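(* Every immersed Taimanov soliton sphere $f\colon\mathbb{CP}^1\to\mathbb{R}^3=\mathrm{Im}\,\mathbb{H}\subset\mathbb{H}\subset\mathbb{HP}^1$ is a soliton sphere.
   Context: Conventions. Quaternionic vector spaces are right $\mathbb{H}$-vector spaces; the dual $V^*$ is a right vector space via $(\alpha\lambda)(x)=\bar\lambda\,\alpha(x)$. For a 1-form $\omega$ on a Riemann surface $M$, $*\omega=\omega\circ J_{TM}$. Quaternionic holomorphic line bundles. A complex quaternionic line bundle is a quaternionic line bundle $L$ over a Riemann surface $M$ with a field $J\in\Gamma(\mathrm{End}(L))$ of quaternionic linear endomorphisms, $J^2=-\mathrm{Id}$. $KL$ and $\bar KL$ denote the bundles of $L$-valued 1-forms $\omega$ with $*\omega=J\omega$, respectively $*\omega=-J\omega$. A quaternionic holomorphic structure is an operator $D\colon\Gamma(L)\to\Gamma(\bar KL)$ with $D(\psi\lambda)=(D\psi)\lambda+(\psi\,d\lambda)''$ for $\psi\in\Gamma(L)$, $\lambda\colon M\to\mathbb{H}$, where $\omega''=\frac12(\omega+J{*}\omega)$. $H^0(L)=\ker D$; a linear system is a finite-dimensional quaternionic subspace $H\subset H^0(L)$. Write $\hat L=\{\psi\in L\mid J\psi=\psi\mathbf{i}\}$, $\deg L:=\deg\hat L$ for compact $M$, and $D=\bar\partial+Q$ with $\bar\partial$ commuting and the Hopf field $Q$ anticommuting with $J$; $W(L)=\frac12\int_M\mathrm{tr}_{\mathbb{R}}(Q\wedge *Q)$. Equality in the Plücker estimate. A holomorphic section $\psi\not\equiv0$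 vanishes to order $k=\mathrm{ord}_p\psi$ at $p$ if $\psi=z^k\varphi+O(k+1)$ for a centered holomorphic coordinate $z$ and a local section $\varphi$ not vanishing at $p$. For an $(n+1)$-dimensional linear system $H$ let $n_0(p)<\dots<n_n(p)$ be the possible vanishing orders at $p$ of nonzero elements of $H$, $\mathrm{ord}_p(H)=\sum_{k=0}^n(n_k(p)-k)$, $|\mathrm{ord}\,H|=\sum_p\mathrm{ord}_p(H)$. Over a compact Riemann surface of genus $g$, with $d=\deg L$, $H$ has equality in the Plücker estimate if $W(L)=4\pi[(n+1)(n(1-g)-d)+|\mathrm{ord}\,H|]$. Soliton spheres. Maps $M\to\mathbb{HP}^1$ are identified with line subbundles $L\subset\mathbb{H}^2$ of the trivial bundle; $\nabla$ is the trivial connection, $\delta=\pi\nabla_{|L}$ with $\pi\colon\mathbb{H}^2\to\mathbb{H}^2/L$ the projection. The affine chart $[\lambda,1]\mapsto\lambda$ identifies $\mathbb{HP}^1\setminus\{[1,0]\}$ with $\mathbb{H}=\mathbb{R}^4$. For a conformal immersion $L\subset\mathbb{H}^2$ there are unique complex structures $J$ on $L$ and on $\mathbb{H}^2/L$ with $*\delta=\delta J=J\delta$. The Möbius invariant holomorphic line bundles are $L^{-1}=(\mathbb{H}^2)^*/L^\perp$ ($L^\perp$ the annihilator of $L$, complex structure dual to that of $L$) and $\mathbb{H}^2/L$, each with the unique quaternionic holomorphic structure for which projections of constant sections of $(\mathbb{H}^2)^*$, respectively $\mathbb{H}^2$, are holomorphic; these projections form the canonical linear systems. A conformal immersion $\mathbb{CP}^1\to\mathbb{HP}^1$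 is a soliton sphere if one of its two Möbius invariant holomorphic line bundles admits a linear system with equality in the Plücker estimate that contains the canonical linear system. Euclidean holomorphic line bundle and potential. For a quaternionic holomorphic line bundle $L$, $KL^{-1}$ carries a unique (paired) holomorphic structure with $d(\alpha,\psi)=0$ for all local holomorphic sections $\alpha$ of $KL^{-1}$, $\psi$ of $L$, where $(\alpha,\psi)=\alpha(\psi)$. For a conformal immersion $f\colon M\to\mathrm{Im}\,\mathbb{H}$ there is, uniquely up to isomorphism, a quaternionic holomorphic line bundle $L$ with $KL^{-1}\cong L$ (a quaternionic spin bundle) and a nowhere vanishing $\psi\in H^0(L)$ with $df=(\psi,\psi)$, where $KL^{-1}$ is identified with $L$; this $L$ is the Euclidean holomorphic line bundle of $f$. With respect to a coordinate $z$ and a complex holomorphic (with respect to $\bar\partial$) local section $\varphi$ of $\hat L$ with $dz=\mathbf{j}(\varphi,\varphi)$, its Hopf field is $Q\varphi=\varphi\,\mathbf{k}\,q\,dz$ with $q=\frac{H|df|}{2|dz|}$ the potential, where $H$ is the (scalar) mean curvature of $f$. Taimanov soliton spheres. A conformal immersion $f\colon\mathbb{CP}^1\to\mathbb{R}^3$ is a Taimanov soliton sphere if the potential $q$ of its Euclidean holomorphic line bundle $L$ is rotationally symmetric, i.e. $q(z)=q(|z|)$, with respect to some affine coordinate $z\colon\mathbb{CP}^1\setminus\{\infty\}\to\mathbb{C}$, and the full linear system $H^0(L)$ has equality in the Plücker estimate. *)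

theory Defs
  imports "HOL-Complex_Analysis.Complex_Analysis"
begin

section \<open>Quaternions\<close>

datatype quat = Quat (qre: real) (qim1: real) (qim2: real) (qim3: real)

lemma quat_eq_iff:
  "x = y \<longleftrightarrow> qre x = qre y \<and> qim1 x = qim1 y \<and> qim2 x = qim2 y \<and> qim3 x = qim3 y"
  by (cases x; cases y) simp

definition qcnj :: "quat \<Rightarrow> quat" where
  "qcnj x = Quat (qre x) (- qim1 x) (- qim2 x) (- qim3 x)"

definition qnormsq :: "quat \<Rightarrow> real" where
  "qnormsq x = (qre x)\<^sup>2 + (qim1 x)\<^sup>2 + (qim2 x)\<^sup>2 + (qim3 x)\<^sup>2"

instantiation quat :: real_vector
begin

definition "0 = Quat 0 0 0 0"
definition "x + y = Quat (qre x + qre y) (qim1 x + qim1 y) (qim2 x + qim2 y) (qim3 x + qim3 y)"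
definition "- x = Quat (- qre x) (- qim1 x) (- qim2 x) (- qim3 x)"
definition "x - y = Quat (qre x - qre y) (qim1 x - qim1 y) (qim2 x - qim2 y) (qim3 x - qim3 y)"
definition "r *\<^sub>R x = Quat (r * qre x) (r * qim1 x) (r * qim2 x) (r * qim3 x)"

instance
  by standard
    (simp_all add: zero_quat_def plus_quat_def uminus_quat_def minus_quat_def scaleR_quat_def
      algebra_simps)

end

lemmas quat_vector_defs =
  zero_quat_def plus_quat_def uminus_quat_def minus_quat_def scaleR_quat_def

instantiation quat :: division_ring
begin

definition "1 = Quat 1 0 0 0"
definition "x * y = Quat
   (qre x * qre y - qim1 x * qim1 y - qim2 x * qim2 y - qim3 x * qim3 y)
   (qre x * qim1 y + qim1 x * qre y + qim2 x * qim3 y - qim3 x * qim2 y)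
   (qre x * qim2 y - qim1 x * qim3 y + qim2 x * qre y + qim3 x * qim1 y)
   (qre x * qim3 y + qim1 x * qim2 y - qim2 x * qim1 y + qim3 x * qre y)"
definition "inverse x = (1 / qnormsq x) *\<^sub>R qcnj x"
definition "x div y = x * inverse y" for x y :: quat

instance
proof
  fix x y z :: quat
  show "x * y * z = x * (y * z)"
    by (simp add: times_quat_def algebra_simps)
  show "(x + y) * z = x * z + y * z" "x * (y + z) = x * y + x * z"
    by (simp_all add: times_quat_def plus_quat_def algebra_simps)
  show "1 * x = x" "x * 1 = x"
    by (simp_all add: times_quat_def one_quat_def)
  show "(0::quat) \<noteq> 1"
    by (simp add: zero_quat_def one_quat_def)
  show "inverse (0::quat) = 0"
    by (simp add: inverse_quat_def qcnj_def quat_vector_defs)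
  show "x div y = x * inverse y"
    by (simp add: divide_quat_def)
  assume "x \<noteq> 0"
  then have nz: "qnormsq x \<noteq> 0"
    by (simp add: quat_eq_iff zero_quat_def qnormsq_def add_nonneg_eq_0_iff)
  have 1: "qcnj x * x = Quat (qnormsq x) 0 0 0" "x * qcnj x = Quat (qnormsq x) 0 0 0"
    by (simp_all add: times_quat_def qcnj_def qnormsq_def power2_eq_square algebra_simps)
  have 2: "(r *\<^sub>R a) * b = r *\<^sub>R (a * b)" "a * (r *\<^sub>R b) = r *\<^sub>R (a * b)" for r and a b :: quat
    by (simp_all add: times_quat_def scaleR_quat_def algebra_simps)
  have 3: "(1 / qnormsq x) *\<^sub>R Quat (qnormsq x) 0 0 0 = 1"
    using nz by (simp add: scaleR_quat_def one_quat_def)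
  show "inverse x * x = 1"
    unfolding inverse_quat_def 2(1) 1(1) by (rule 3)
  show "x * inverse x = 1"
    unfolding inverse_quat_def 2(2) 1(2) by (rule 3)
qed

end

instantiation quat :: real_inner
begin

definition "inner x y = qre x * qre y + qim1 x * qim1 y + qim2 x * qim2 y + qim3 x * qim3 y"
definition "norm x = sqrt (qnormsq x)"
definition "sgn x = x /\<^sub>R norm x" for x :: quat
definition "dist x y = norm (x - y)" for x y :: quat
definition "uniformity = (INF e\<in>{0<..}. principal {(x, y::quat). dist x y < e})"
definition "open U = (\<forall>x\<in>U. eventually (\<lambda>(x', y). x' = x \<longrightarrow> y \<in> U) uniformity)"
  for U :: "quat set"

instance
proof
  fix x y z :: quat and r :: real
  show "inner x y = inner y x"
    by (simp add: inner_quat_def algebra_simps)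
  show "inner (x + y) z = inner x z + inner y z" "inner (r *\<^sub>R x) y = r * inner x y"
    by (simp_all add: inner_quat_def quat_vector_defs algebra_simps)
  show "0 \<le> inner x x"
    by (simp add: inner_quat_def)
  show "inner x x = 0 \<longleftrightarrow> x = 0"
    by (simp add: inner_quat_def zero_quat_def quat_eq_iff add_nonneg_eq_0_iff)
  show "norm x = sqrt (inner x x)"
    by (simp add: norm_quat_def inner_quat_def qnormsq_def power2_eq_square)
qed (rule sgn_quat_def dist_quat_def uniformity_quat_def open_quat_def)+

end

instance quat :: real_normed_div_algebra
proof
  fix x y :: quat and r :: real
  show "r *\<^sub>R x * y = r *\<^sub>R (x * y)" "x * r *\<^sub>R y = r *\<^sub>R (x * y)"
    by (simp_all add: times_quat_def scaleR_quat_def algebra_simps)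
  have "qnormsq (x * y) = qnormsq x * qnormsq y"
    by (simp only: qnormsq_def times_quat_def quat.sel) algebra
  then show "norm (x * y) = norm x * norm y"
    by (simp add: norm_quat_def real_sqrt_mult)
qed

definition qi :: quat where "qi = Quat 0 1 0 0"
definition qj :: quat where "qj = Quat 0 0 1 0"
definition qk :: quat where "qk = Quat 0 0 0 1"

instantiation quat :: euclidean_space
begin

definition "Basis = {1, qi, qj, qk}"

instance
proof
  fix x y :: quat
  show "(Basis :: quat set) \<noteq> {}" "finite (Basis :: quat set)"
    by (simp_all add: Basis_quat_def)
  show "inner x y = (if x = y then 1 else 0)" if "x \<in> Basis" "y \<in> Basis"
  proof -
    have "x \<in> {1, qi, qj, qk}" "y \<in> {1, qi, qj, qk}"
      using that by (simp_all only: Basis_quat_def)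
    then show ?thesis
      by (elim insertE emptyE; hypsubst)
        (simp_all add: inner_quat_def one_quat_def qi_def qj_def qk_def)
  qed
  have "inner x 1 = qre x" "inner x qi = qim1 x" "inner x qj = qim2 x" "inner x qk = qim3 x"
    by (simp_all add: inner_quat_def one_quat_def qi_def qj_def qk_def)
  then show "(\<forall>u\<in>Basis. inner x u = 0) \<longleftrightarrow> x = 0"
    by (simp only: Basis_quat_def ball_simps quat_eq_iff zero_quat_def quat.sel) simp
qed

end

definition qc :: "complex \<Rightarrow> quat" where
  "qc c = Quat (Re c) (Im c) 0 0"


section \<open>Smooth maps\<close>

primrec Ck_on :: "nat \<Rightarrow> 'a::real_normed_vector set \<Rightarrow> ('a \<Rightarrow> 'b::real_normed_vector) \<Rightarrow> bool" where
  "Ck_on 0 S = (\<lambda>f. continuous_on S f)"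
| "Ck_on (Suc k) S = (\<lambda>f. \<exists>f'. (\<forall>x\<in>S. (f has_derivative f' x) (at x)) \<and>
      (\<forall>v. Ck_on k S (\<lambda>x. f' x v)))"

definition smooth_on :: "'a::real_normed_vector set \<Rightarrow> ('a \<Rightarrow> 'b::real_normed_vector) \<Rightarrow> bool" where
  "smooth_on S f \<longleftrightarrow> (\<forall>k. Ck_on k S f)"


section \<open>The Riemann sphere\<close>

datatype cp1 = Fin complex | Infty

text \<open>\<open>par p\<close> is the inverse of the chart used near \<open>p\<close>: the affine coordinate \<open>z\<close> at a finite
  point and \<open>1/z\<close> at infinity. Quantifying over all \<open>p\<close> therefore runs through both charts.
  The coordinate of \<open>p\<close> itself is \<open>pos p\<close>.\<close>

definition par :: "cp1 \<Rightarrow> complex \<Rightarrow> cp1" where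
  "par p w = (case p of Fin _ \<Rightarrow> Fin w | Infty \<Rightarrow> if w = 0 then Infty else Fin (1 / w))"

definition pos :: "cp1 \<Rightarrow> complex" where
  "pos p = (case p of Fin z \<Rightarrow> z | Infty \<Rightarrow> 0)"

text \<open>A tangent vector at \<open>p\<close> is represented by its component in the chart used at \<open>p\<close>, so every
  tangent space is \<open>complex\<close> with complex structure \<open>v \<mapsto> \<i> * v\<close>. \<open>dpar p w v\<close> is the tangent
  vector at \<open>par p w\<close> whose component in the chart \<open>par p\<close> is \<open>v\<close>.\<close>

definition dpar :: "cp1 \<Rightarrow> complex \<Rightarrow> complex \<Rightarrow> complex" where
  "dpar p w v = (case p of Fin _ \<Rightarrow> v | Infty \<Rightarrow> if w = 0 then v else - v / w\<^sup>2)"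

instantiation cp1 :: topological_space
begin

definition "open U \<longleftrightarrow> (\<forall>p. open (par p -` U))" for U :: "cp1 set"

instance
  by standard (auto simp: open_cp1_def vimage_Union)

end

definition csmooth :: "cp1 set \<Rightarrow> (cp1 \<Rightarrow> 'b::real_normed_vector) \<Rightarrow> bool" where
  "csmooth U g \<longleftrightarrow> (\<forall>p. smooth_on (par p -` U) (g \<circ> par p))"

definition cdiff :: "(cp1 \<Rightarrow> 'b::real_normed_vector) \<Rightarrow> cp1 \<Rightarrow> complex \<Rightarrow> 'b" where
  "cdiff g p v = frechet_derivative (g \<circ> par p) (at (pos p)) v"

definition smooth_vector_field :: "cp1 set \<Rightarrow> (cp1 \<Rightarrow> complex) \<Rightarrow> bool" where
  "smooth_vector_field U X \<longleftrightarrow>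
     (\<forall>p. \<exists>Y. smooth_on (par p -` U) Y \<and> (\<forall>w\<in>par p -` U. X (par p w) = dpar p w (Y w)))"

text \<open>The value of the exterior derivative of the 1-form \<open>\<omega>\<close> at \<open>p\<close> on the positively oriented
  basis \<open>1, \<i>\<close>, i.e. \<open>\<partial>\<^sub>x \<omega>\<^sub>y - \<partial>\<^sub>y \<omega>\<^sub>x\<close>; it determines the 2-form at \<open>p\<close>.\<close>

definition ext_deriv :: "(cp1 \<Rightarrow> complex \<Rightarrow> 'b::real_normed_vector) \<Rightarrow> cp1 \<Rightarrow> 'b" where
  "ext_deriv \<omega> p =
     frechet_derivative (\<lambda>w. \<omega> (par p w) (dpar p w \<i>)) (at (pos p)) 1 -
     frechet_derivative (\<lambda>w. \<omega> (par p w) (dpar p w 1)) (at (pos p)) \<i>"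

definition hol_coord :: "cp1 set \<Rightarrow> (cp1 \<Rightarrow> complex) \<Rightarrow> bool" where
  "hol_coord U z \<longleftrightarrow> open U \<and> inj_on z U \<and> (\<forall>p. (z \<circ> par p) holomorphic_on (par p -` U))"

definition affine_coord :: "cp1 \<Rightarrow> (cp1 \<Rightarrow> complex) \<Rightarrow> bool" where
  "affine_coord a z \<longleftrightarrow> hol_coord (- {a}) z \<and> z ` (- {a}) = UNIV"


section \<open>Complex quaternionic line bundles\<close>

text \<open>A bundle is given by its fibres, which are right quaternionic vector spaces, by its local
  smooth sections (a section over \<open>U\<close> is a total function whose values off \<open>U\<close> are irrelevant)
  and by the complex structure \<open>J\<close>.\<close>

record 'v qbundle =
  fib :: "cp1 \<Rightarrow> 'v set"
  zer :: "cp1 \<Rightarrow> 'v"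
  add :: "cp1 \<Rightarrow> 'v \<Rightarrow> 'v \<Rightarrow> 'v"
  scl :: "cp1 \<Rightarrow> 'v \<Rightarrow> quat \<Rightarrow> 'v"
  smooth_sec :: "cp1 set \<Rightarrow> (cp1 \<Rightarrow> 'v) \<Rightarrow> bool"
  Jstr :: "cp1 \<Rightarrow> 'v \<Rightarrow> 'v"

definition right_qspace ::
  "'v set \<Rightarrow> 'v \<Rightarrow> ('v \<Rightarrow> 'v \<Rightarrow> 'v) \<Rightarrow> ('v \<Rightarrow> quat \<Rightarrow> 'v) \<Rightarrow> bool" where
  "right_qspace V z a s \<longleftrightarrow>
     z \<in> V \<and>
     (\<forall>x\<in>V. \<forall>y\<in>V. a x y \<in> V \<and> a x y = a y x) \<and>
     (\<forall>x\<in>V. \<forall>y\<in>V. \<forall>w\<in>V. a (a x y) w = a x (a y w)) \<and>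
     (\<forall>x\<in>V. a x z = x) \<and>
     (\<forall>x\<in>V. \<forall>\<mu>. s x \<mu> \<in> V) \<and>
     (\<forall>x\<in>V. \<forall>\<mu> \<nu>. s x (\<mu> + \<nu>) = a (s x \<mu>) (s x \<nu>)) \<and>
     (\<forall>x\<in>V. \<forall>y\<in>V. \<forall>\<mu>. s (a x y) \<mu> = a (s x \<mu>) (s y \<mu>)) \<and>
     (\<forall>x\<in>V. \<forall>\<mu> \<nu>. s (s x \<mu>) \<nu> = s x (\<mu> * \<nu>)) \<and>
     (\<forall>x\<in>V. s x 1 = x \<and> s x 0 = z)"

definition frame :: "'v qbundle \<Rightarrow> cp1 set \<Rightarrow> (cp1 \<Rightarrow> 'v) \<Rightarrow> bool" where
  "frame E U e \<longleftrightarrow> smooth_sec E U e \<and> (\<forall>p\<in>U. e p \<noteq> zer E p)"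

definition quaternionic_line_bundle :: "'v qbundle \<Rightarrow> bool" where
  "quaternionic_line_bundle E \<longleftrightarrow>
     (\<forall>p. right_qspace (fib E p) (zer E p) (add E p) (scl E p) \<and>
        (\<exists>x\<in>fib E p. x \<noteq> zer E p \<and> fib E p = range (scl E p x))) \<and>
     (\<forall>U s. open U \<and> smooth_sec E U s \<longrightarrow> (\<forall>p\<in>U. s p \<in> fib E p)) \<and>
     (\<forall>U s. open U \<longrightarrow> (smooth_sec E U s \<longleftrightarrow>
        (\<forall>p\<in>U. \<exists>V. open V \<and> p \<in> V \<and> V \<subseteq> U \<and> smooth_sec E V s))) \<and>
     (\<forall>p. \<exists>U e. open U \<and> p \<in> U \<and> frame E U e \<and>
        (\<forall>V s. open V \<and> V \<subseteq> U \<longrightarrow> (smooth_sec E V s \<longleftrightarrow>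
          (\<exists>\<mu>. csmooth V \<mu> \<and> (\<forall>q\<in>V. s q = scl E q (e q) (\<mu> q))))))"

definition complex_qline_bundle :: "'v qbundle \<Rightarrow> bool" where
  "complex_qline_bundle E \<longleftrightarrow> quaternionic_line_bundle E \<and>
     (\<forall>p. \<forall>x\<in>fib E p. Jstr E p x \<in> fib E p \<and> Jstr E p (Jstr E p x) = scl E p x (- 1) \<and>
        (\<forall>y\<in>fib E p. Jstr E p (add E p x y) = add E p (Jstr E p x) (Jstr E p y)) \<and>
        (\<forall>\<mu>. Jstr E p (scl E p x \<mu>) = scl E p (Jstr E p x) \<mu>)) \<and>
     (\<forall>U s. open U \<and> smooth_sec E U s \<longrightarrow> smooth_sec E U (\<lambda>p. Jstr E p (s p)))"

text \<open>Multiplication of a vector by a complex number, acting through \<open>J\<close>.\<close>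

definition Jscl :: "'v qbundle \<Rightarrow> cp1 \<Rightarrow> complex \<Rightarrow> 'v \<Rightarrow> 'v" where
  "Jscl E p c x = add E p (scl E p x (of_real (Re c))) (scl E p (Jstr E p x) (of_real (Im c)))"

text \<open>Smooth sections over \<open>U\<close> of the bundle of \<open>E\<close>-valued 1-forms \<open>\<omega>\<close> with \<open>*\<omega> = - J \<omega>\<close>.\<close>

definition Kbar_form :: "'v qbundle \<Rightarrow> cp1 set \<Rightarrow> (cp1 \<Rightarrow> complex \<Rightarrow> 'v) \<Rightarrow> bool" where
  "Kbar_form E U \<omega> \<longleftrightarrow>
     (\<forall>p\<in>U. \<forall>v. \<omega> p v \<in> fib E p \<and>
        (\<forall>w. \<omega> p (v + w) = add E p (\<omega> p v) (\<omega> p w)) \<and>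
        (\<forall>r. \<omega> p (r *\<^sub>R v) = scl E p (\<omega> p v) (of_real r)) \<and>
        \<omega> p (\<i> * v) = scl E p (Jstr E p (\<omega> p v)) (- 1)) \<and>
     (\<forall>V X. open V \<and> V \<subseteq> U \<and> smooth_vector_field V X \<longrightarrow> smooth_sec E V (\<lambda>p. \<omega> p (X p)))"


section \<open>Quaternionic holomorphic structures\<close>

text \<open>\<open>D\<close> acts on local sections: \<open>D \<psi> p v\<close> is meaningful when \<open>\<psi>\<close> is smooth near \<open>p\<close>, and
  depends on the germ of \<open>\<psi>\<close> at \<open>p\<close> only. The last clause is the Leibniz rule
  \<open>D (\<psi> \<mu>) = (D \<psi>) \<mu> + (\<psi> d\<mu>)''\<close> with \<open>\<omega>'' = (\<omega> + J *\<omega>) / 2\<close>.\<close>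

type_synonym 'v dop = "(cp1 \<Rightarrow> 'v) \<Rightarrow> cp1 \<Rightarrow> complex \<Rightarrow> 'v"

definition hol_line_bundle :: "'v qbundle \<Rightarrow> 'v dop \<Rightarrow> bool" where
  "hol_line_bundle E D \<longleftrightarrow> complex_qline_bundle E \<and>
     (\<forall>U \<psi>. open U \<and> smooth_sec E U \<psi> \<longrightarrow>
        Kbar_form E U (D \<psi>) \<and>
        (\<forall>\<phi>. (\<forall>p\<in>U. \<phi> p = \<psi> p) \<longrightarrow> (\<forall>p\<in>U. D \<phi> p = D \<psi> p)) \<and>
        (\<forall>\<phi>. smooth_sec E U \<phi> \<longrightarrow>
          (\<forall>p\<in>U. \<forall>v. D (\<lambda>q. add E q (\<psi> q) (\<phi> q)) p v = add E p (D \<psi> p v) (D \<phi> p v))) \<and>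
        (\<forall>\<mu>. csmooth U \<mu> \<longrightarrow>
          (\<forall>p\<in>U. \<forall>v. D (\<lambda>q. scl E q (\<psi> q) (\<mu> q)) p v =
             add E p (scl E p (D \<psi> p v) (\<mu> p))
               (scl E p (add E p (scl E p (\<psi> p) (cdiff \<mu> p v))
                                 (Jstr E p (scl E p (\<psi> p) (cdiff \<mu> p (\<i> * v))))) (1 / 2)))))"

definition holomorphic_sec :: "'v qbundle \<Rightarrow> 'v dop \<Rightarrow> cp1 set \<Rightarrow> (cp1 \<Rightarrow> 'v) \<Rightarrow> bool" where
  "holomorphic_sec E D U \<psi> \<longleftrightarrow> smooth_sec E U \<psi> \<and> (\<forall>p\<in>U. \<forall>v. D \<psi> p v = zer E p)"

definition H0 :: "'v qbundle \<Rightarrow> 'v dop \<Rightarrow> (cp1 \<Rightarrow> 'v) set" where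
  "H0 E D = {\<psi>. holomorphic_sec E D UNIV \<psi>}"

text \<open>The decomposition \<open>D = dbar + Q\<close>, applied to a local section: \<open>Q \<psi> = (D \<psi> + J D (J \<psi>)) / 2\<close>
  and \<open>dbar \<psi> = (D \<psi> - J D (J \<psi>)) / 2\<close> are the parts of \<open>D\<close> anticommuting, respectively
  commuting, with \<open>J\<close>.\<close>

definition hopf :: "'v qbundle \<Rightarrow> 'v dop \<Rightarrow> 'v dop" where
  "hopf E D \<psi> p v = scl E p (add E p (D \<psi> p v) (Jstr E p (D (\<lambda>q. Jstr E q (\<psi> q)) p v))) (1 / 2)"

definition dbar :: "'v qbundle \<Rightarrow> 'v dop \<Rightarrow> 'v dop" where
  "dbar E D \<psi> p v = scl E p (add E p (D \<psi> p v)
      (scl E p (Jstr E p (D (\<lambda>q. Jstr E q (\<psi> q)) p v)) (- 1))) (1 / 2)"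

text \<open>\<open>Q\<close> is tensorial; \<open>hopf_at E D p v\<close> is the endomorphism \<open>Q\<^sub>p(v)\<close> of the fibre at \<open>p\<close>.\<close>

definition hopf_at :: "'v qbundle \<Rightarrow> 'v dop \<Rightarrow> cp1 \<Rightarrow> complex \<Rightarrow> 'v \<Rightarrow> 'v" where
  "hopf_at E D p v x = (THE y. \<exists>U \<psi>. open U \<and> p \<in> U \<and> smooth_sec E U \<psi> \<and> \<psi> p = x \<and>
      y = hopf E D \<psi> p v)"

text \<open>The trace of a fibre endomorphism regarded as a real linear map; a nonzero \<open>e\<close> identifies the
  fibre with the quaternions via \<open>\<mu> \<mapsto> e \<mu>\<close>.\<close>

definition real_trace :: "'v qbundle \<Rightarrow> cp1 \<Rightarrow> ('v \<Rightarrow> 'v) \<Rightarrow> real" where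
  "real_trace E p B = (let e = (SOME e. e \<in> fib E p \<and> e \<noteq> zer E p)
     in \<Sum>b\<in>Basis. (THE \<mu>. B (scl E p e b) = scl E p e \<mu>) \<bullet> b)"

text \<open>The real 2-form \<open>tr (Q \<and> *Q)\<close> evaluated on \<open>1, \<i>\<close>, where
  \<open>(Q \<and> *Q)(X, Y) = Q(X) *Q(Y) - Q(Y) *Q(X)\<close> and \<open>*Q(v) = Q(\<i> v)\<close>. The point at infinity is a
  null set, so the integral over the sphere is the integral over the affine chart.\<close>

definition hopf_density :: "'v qbundle \<Rightarrow> 'v dop \<Rightarrow> cp1 \<Rightarrow> real" where
  "hopf_density E D p = real_trace E p (\<lambda>x.
     add E p (hopf_at E D p 1 (hopf_at E D p (\<i> * \<i>) x))
       (scl E p (hopf_at E D p \<i> (hopf_at E D p (\<i> * 1) x)) (- 1)))"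

definition willmore :: "'v qbundle \<Rightarrow> 'v dop \<Rightarrow> real" where
  "willmore E D = 1 / 2 * (LINT z|lborel. hopf_density E D (Fin z))"

text \<open>The degree of the complex line bundle of all \<open>\<psi>\<close> with \<open>J \<psi> = \<psi> \<i>\<close>, as the clutching number
  of frames over the two affine charts: if \<open>s\<^sub>1 = s\<^sub>0 g\<close> with frames \<open>s\<^sub>0\<close> over \<open>z \<noteq> \<infinity>\<close> and \<open>s\<^sub>1\<close>
  over \<open>z \<noteq> 0\<close>, the degree is the winding number of \<open>g\<close> along the unit circle. (The tangent bundle
  has \<open>g(z) = - z\<^sup>2\<close>, hence degree 2.)\<close>

definition hat_frame :: "'v qbundle \<Rightarrow> cp1 set \<Rightarrow> (cp1 \<Rightarrow> 'v) \<Rightarrow> bool" where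
  "hat_frame E U s \<longleftrightarrow> frame E U s \<and> (\<forall>p\<in>U. Jstr E p (s p) = scl E p (s p) qi)"

definition has_degree :: "'v qbundle \<Rightarrow> int \<Rightarrow> bool" where
  "has_degree E d \<longleftrightarrow> (\<exists>s0 s1 g. hat_frame E (- {Infty}) s0 \<and> hat_frame E (- {Fin 0}) s1 \<and>
     (\<forall>z. z \<noteq> 0 \<longrightarrow> s1 (Fin z) = scl E (Fin z) (s0 (Fin z)) (qc (g z))) \<and>
     winding_number (g \<circ> circlepath 0 1) 0 = of_int d)"


section \<open>Linear systems and the Pluecker estimate\<close>

primrec lincomb ::
  "'v qbundle \<Rightarrow> (nat \<Rightarrow> cp1 \<Rightarrow> 'v) \<Rightarrow> (nat \<Rightarrow> quat) \<Rightarrow> nat \<Rightarrow> cp1 \<Rightarrow> 'v" where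
  "lincomb E b c 0 = zer E"
| "lincomb E b c (Suc k) = (\<lambda>p. add E p (lincomb E b c k p) (scl E p (b k p) (c k)))"

text \<open>\<open>linear_system E D n H\<close>: \<open>H\<close> is a linear system of dimension \<open>n + 1\<close>.\<close>

definition linear_system :: "'v qbundle \<Rightarrow> 'v dop \<Rightarrow> nat \<Rightarrow> (cp1 \<Rightarrow> 'v) set \<Rightarrow> bool" where
  "linear_system E D n H \<longleftrightarrow> (\<exists>b. (\<forall>k\<le>n. b k \<in> H0 E D) \<and>
     H = {lincomb E b c (Suc n) |c. True} \<and>
     (\<forall>c. lincomb E b c (Suc n) = zer E \<longrightarrow> (\<forall>k\<le>n. c k = 0)))"

text \<open>\<open>\<psi> = z^k \<phi> + O(k+1)\<close>; the remainder is measured in a local frame \<open>e\<close>.\<close>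

definition vanishes_to_order :: "'v qbundle \<Rightarrow> (cp1 \<Rightarrow> 'v) \<Rightarrow> cp1 \<Rightarrow> nat \<Rightarrow> bool" where
  "vanishes_to_order E \<psi> p k \<longleftrightarrow> (\<exists>U z \<phi> e r C. hol_coord U z \<and> p \<in> U \<and> z p = 0 \<and>
     smooth_sec E U \<phi> \<and> \<phi> p \<noteq> zer E p \<and> frame E U e \<and>
     (\<forall>q\<in>U. \<psi> q = add E q (Jscl E q (z q ^ k) (\<phi> q)) (scl E q (e q) (r q)) \<and>
        norm (r q) \<le> C * norm (z q) ^ Suc k))"

definition vanishing_orders :: "'v qbundle \<Rightarrow> (cp1 \<Rightarrow> 'v) set \<Rightarrow> cp1 \<Rightarrow> nat set" where
  "vanishing_orders E H p = {k. \<exists>\<psi>\<in>H. \<psi> \<noteq> zer E \<and> vanishes_to_order E \<psi> p k}"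

text \<open>\<open>a p 0 < \<dots> < a p n\<close> are the vanishing orders of the \<open>(n+1)\<close>-dimensional system \<open>H\<close> at \<open>p\<close>.
  The points with \<open>ord\<^sub>p(H) \<noteq> 0\<close> are required to be finite in number so that the sum of all
  \<open>ord\<^sub>p(H)\<close> is not a default value. The factor \<open>1 - g\<close> is \<open>1\<close> on the sphere.\<close>

definition Pluecker_equality :: "'v qbundle \<Rightarrow> 'v dop \<Rightarrow> (cp1 \<Rightarrow> 'v) set \<Rightarrow> bool" where
  "Pluecker_equality E D H \<longleftrightarrow> (\<exists>n d a ord. linear_system E D n H \<and> has_degree E d \<and>
     (\<forall>p. strict_mono_on {..n} (a p) \<and> a p ` {..n} = vanishing_orders E H p \<and>
        ord p = (\<Sum>k\<le>n. int (a p k) - int k)) \<and>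
     finite {p. ord p \<noteq> 0} \<and>
     willmore E D = 4 * pi * real_of_int
       ((int n + 1) * (int n * (1 - 0) - d) + (\<Sum>p | ord p \<noteq> 0. ord p)))"


section \<open>Soliton spheres\<close>

text \<open>The right vector space \<open>\<H>\<^sup>2\<close>, and its dual: \<open>(a, b)\<close> is the functional
  \<open>(x, y) \<mapsto> a x + b y\<close>, with right scalar multiplication \<open>(\<alpha> \<mu>)(x) = cnj \<mu> \<alpha>(x)\<close>.\<close>

definition hscl :: "quat \<times> quat \<Rightarrow> quat \<Rightarrow> quat \<times> quat" where
  "hscl x \<mu> = (fst x * \<mu>, snd x * \<mu>)"

definition pairing :: "quat \<times> quat \<Rightarrow> quat \<times> quat \<Rightarrow> quat" where
  "pairing \<alpha> x = fst \<alpha> * fst x + snd \<alpha> * snd x"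

definition dscl :: "quat \<times> quat \<Rightarrow> quat \<Rightarrow> quat \<times> quat" where
  "dscl \<alpha> \<mu> = (qcnj \<mu> * fst \<alpha>, qcnj \<mu> * snd \<alpha>)"

type_synonym hp1_map = "cp1 \<Rightarrow> (quat \<times> quat) set"

definition hline :: "quat \<times> quat \<Rightarrow> (quat \<times> quat) set" where
  "hline x = range (hscl x)"

text \<open>The inclusion of \<open>\<H>\<close> into the quaternionic projective line by \<open>\<mu> \<mapsto> [\<mu>, 1]\<close>.\<close>

definition lift_HP1 :: "(cp1 \<Rightarrow> quat) \<Rightarrow> hp1_map" where
  "lift_HP1 f p = hline (f p, 1)"

definition conformal_at :: "(cp1 \<Rightarrow> quat) \<Rightarrow> cp1 \<Rightarrow> bool" where
  "conformal_at f p \<longleftrightarrow> (\<forall>v. v \<noteq> 0 \<longrightarrow> cdiff f p v \<noteq> 0 \<and>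
     norm (cdiff f p (\<i> * v)) = norm (cdiff f p v) \<and> cdiff f p (\<i> * v) \<bullet> cdiff f p v = 0)"

definition conformal_immersion :: "(cp1 \<Rightarrow> quat) \<Rightarrow> bool" where
  "conformal_immersion f \<longleftrightarrow> csmooth UNIV f \<and> (\<forall>p. conformal_at f p)"

text \<open>Conformality is tested in the affine charts \<open>[\<mu>, 1] \<mapsto> \<mu>\<close> and \<open>[1, \<mu>] \<mapsto> \<mu>\<close>.\<close>

definition conformal_immersion_HP1 :: "hp1_map \<Rightarrow> bool" where
  "conformal_immersion_HP1 L \<longleftrightarrow> (\<forall>p. \<exists>U g. open U \<and> p \<in> U \<and> csmooth U g \<and> conformal_at g p \<and>
     ((\<forall>q\<in>U. L q = hline (g q, 1)) \<or> (\<forall>q\<in>U. L q = hline (1, g q))))"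

definition sub_bundle :: "hp1_map \<Rightarrow> (cp1 \<Rightarrow> quat \<times> quat \<Rightarrow> quat \<times> quat) \<Rightarrow> (quat \<times> quat) qbundle"
  where
  "sub_bundle L J = \<lparr>fib = L, zer = (\<lambda>p. 0), add = (\<lambda>p. (+)), scl = (\<lambda>p. hscl),
     smooth_sec = (\<lambda>U s. csmooth U s \<and> (\<forall>p\<in>U. s p \<in> L p)), Jstr = J\<rparr>"

text \<open>The quotient, with complex structure \<open>J\<close>, of the trivial bundle with fibre \<open>quat \<times> quat\<close> and
  scalar multiplication \<open>m\<close> by the subbundle \<open>S\<close>. Its elements are the cosets of the \<open>S p\<close>.\<close>

definition coset :: "hp1_map \<Rightarrow> cp1 \<Rightarrow> quat \<times> quat \<Rightarrow> (quat \<times> quat) set" where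
  "coset S p x = {x + l |l. l \<in> S p}"

definition quot_bundle ::
  "(quat \<times> quat \<Rightarrow> quat \<Rightarrow> quat \<times> quat) \<Rightarrow> hp1_map \<Rightarrow>
   (cp1 \<Rightarrow> (quat \<times> quat) set \<Rightarrow> (quat \<times> quat) set) \<Rightarrow> ((quat \<times> quat) set) qbundle" where
  "quot_bundle m S J = \<lparr>
     fib = (\<lambda>p. range (coset S p)),
     zer = (\<lambda>p. coset S p 0),
     add = (\<lambda>p A B. {a + b |a b. a \<in> A \<and> b \<in> B}),
     scl = (\<lambda>p A \<mu>. {m a \<mu> + l |a l. a \<in> A \<and> l \<in> S p}),
     smooth_sec = (\<lambda>U s. \<forall>p\<in>U. \<exists>V t. open V \<and> p \<in> V \<and> V \<subseteq> U \<and> csmooth V t \<and>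
        (\<forall>q\<in>V. s q = coset S q (t q))),
     Jstr = J\<rparr>"

text \<open>\<open>JL\<close> on \<open>L\<close> and \<open>JQ\<close> on \<open>\<H>\<^sup>2/L\<close> satisfy \<open>*\<delta> = \<delta> JL = JQ \<delta>\<close>, where \<open>\<delta> \<psi>\<close> is the class
  of \<open>d\<psi>\<close> modulo \<open>L\<close> for sections \<open>\<psi>\<close> of \<open>L\<close>.\<close>

definition conformal_structures ::
  "hp1_map \<Rightarrow> (cp1 \<Rightarrow> quat \<times> quat \<Rightarrow> quat \<times> quat) \<Rightarrow>
   (cp1 \<Rightarrow> (quat \<times> quat) set \<Rightarrow> (quat \<times> quat) set) \<Rightarrow> bool" where
  "conformal_structures L JL JQ \<longleftrightarrow>
     complex_qline_bundle (sub_bundle L JL) \<and>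
     complex_qline_bundle (quot_bundle hscl L JQ) \<and>
     (\<forall>U \<psi>. open U \<and> smooth_sec (sub_bundle L JL) U \<psi> \<longrightarrow> (\<forall>p\<in>U. \<forall>v.
        coset L p (cdiff \<psi> p (\<i> * v)) = coset L p (cdiff (\<lambda>q. JL q (\<psi> q)) p v) \<and>
        coset L p (cdiff \<psi> p (\<i> * v)) = JQ p (coset L p (cdiff \<psi> p v))))"

definition annihilator :: "hp1_map \<Rightarrow> hp1_map" where
  "annihilator L p = {\<alpha>. \<forall>x\<in>L p. pairing \<alpha> x = 0}"

text \<open>\<open>L\<^sup>-\<^sup>1\<close> as \<open>(\<H>\<^sup>2)\<^sup>*/L\<^sup>\<bottom>\<close>, with the dual complex structure \<open>(J \<alpha>)(x) = \<alpha>(J x)\<close>.\<close>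

definition dual_bundle ::
  "hp1_map \<Rightarrow> (cp1 \<Rightarrow> quat \<times> quat \<Rightarrow> quat \<times> quat) \<Rightarrow> ((quat \<times> quat) set) qbundle" where
  "dual_bundle L JL = quot_bundle dscl (annihilator L)
     (\<lambda>p A. {\<beta>. \<exists>\<alpha>\<in>A. \<forall>x\<in>L p. pairing \<beta> x = pairing \<alpha> (JL p x)})"

text \<open>The projections of the constant sections to the quotient by \<open>S\<close>.\<close>

definition canonical_system :: "hp1_map \<Rightarrow> (cp1 \<Rightarrow> (quat \<times> quat) set) set" where
  "canonical_system S = range (\<lambda>x p. coset S p x)"

text \<open>The quotient bundle \<open>E\<close> by \<open>S\<close>, equipped with the holomorphic structure for which the
  canonical system consists of holomorphic sections, admits a linear system as required.\<close>

definition admits_Pluecker_equality :: "hp1_map \<Rightarrow> ((quat \<times> quat) set) qbundle \<Rightarrow> bool" where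
  "admits_Pluecker_equality S E \<longleftrightarrow> (\<exists>D H. hol_line_bundle E D \<and> canonical_system S \<subseteq> H0 E D \<and>
     canonical_system S \<subseteq> H \<and> Pluecker_equality E D H)"

definition soliton_sphere :: "hp1_map \<Rightarrow> bool" where
  "soliton_sphere L \<longleftrightarrow> conformal_immersion_HP1 L \<and> (\<exists>JL JQ. conformal_structures L JL JQ \<and>
     (admits_Pluecker_equality (annihilator L) (dual_bundle L JL) \<or>
      admits_Pluecker_equality L (quot_bundle hscl L JQ)))"


section \<open>Euclidean holomorphic line bundles and Taimanov soliton spheres\<close>

text \<open>Functionals on the fibre at \<open>p\<close>, extended by zero off the fibre.\<close>

definition dual_fib :: "'v qbundle \<Rightarrow> cp1 \<Rightarrow> ('v \<Rightarrow> quat) set" where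
  "dual_fib E p = {\<alpha>. (\<forall>x. x \<notin> fib E p \<longrightarrow> \<alpha> x = 0) \<and>
     (\<forall>x\<in>fib E p. (\<forall>y\<in>fib E p. \<alpha> (add E p x y) = \<alpha> x + \<alpha> y) \<and>
        (\<forall>\<mu>. \<alpha> (scl E p x \<mu>) = \<alpha> x * \<mu>))}"

text \<open>The bundle \<open>K E\<^sup>-\<^sup>1\<close> of 1-forms \<open>\<omega>\<close> with values in the dual bundle and \<open>*\<omega> = J \<omega>\<close>, where
  \<open>(J \<alpha>)(x) = \<alpha>(J x)\<close> on the dual bundle.\<close>

definition K_dual :: "'v qbundle \<Rightarrow> (complex \<Rightarrow> 'v \<Rightarrow> quat) qbundle" where
  "K_dual E = \<lparr>
     fib = (\<lambda>p. {\<omega>. (\<forall>v. \<omega> v \<in> dual_fib E p) \<and>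
        (\<forall>v w x. \<omega> (v + w) x = \<omega> v x + \<omega> w x) \<and> (\<forall>r v x. \<omega> (r *\<^sub>R v) x = r *\<^sub>R \<omega> v x) \<and>
        (\<forall>v. \<forall>x\<in>fib E p. \<omega> (\<i> * v) x = \<omega> v (Jstr E p x))}),
     zer = (\<lambda>p v x. 0),
     add = (\<lambda>p \<omega> \<eta> v x. \<omega> v x + \<eta> v x),
     scl = (\<lambda>p \<omega> \<mu> v x. qcnj \<mu> * \<omega> v x),
     smooth_sec = (\<lambda>U \<alpha>.
        (\<forall>p\<in>U. (\<forall>v. \<alpha> p v \<in> dual_fib E p) \<and>
          (\<forall>v w x. \<alpha> p (v + w) x = \<alpha> p v x + \<alpha> p w x) \<and>
          (\<forall>r v x. \<alpha> p (r *\<^sub>R v) x = r *\<^sub>R \<alpha> p v x) \<and>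
          (\<forall>v. \<forall>x\<in>fib E p. \<alpha> p (\<i> * v) x = \<alpha> p v (Jstr E p x))) \<and>
        (\<forall>V X \<psi>. open V \<and> V \<subseteq> U \<and> smooth_vector_field V X \<and> smooth_sec E V \<psi> \<longrightarrow>
          csmooth V (\<lambda>p. \<alpha> p (X p) (\<psi> p)))),
     Jstr = (\<lambda>p \<omega> v. \<omega> (\<i> * v))\<rparr>"

definition paired_structure ::
  "'v qbundle \<Rightarrow> 'v dop \<Rightarrow> (complex \<Rightarrow> 'v \<Rightarrow> quat) dop \<Rightarrow> bool" where
  "paired_structure E D D' \<longleftrightarrow> hol_line_bundle (K_dual E) D' \<and>
     (\<forall>U \<alpha> \<psi>. open U \<and> holomorphic_sec (K_dual E) D' U \<alpha> \<and> holomorphic_sec E D U \<psi> \<longrightarrow>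
        (\<forall>p\<in>U. ext_deriv (\<lambda>q v. \<alpha> q v (\<psi> q)) p = 0))"

definition hol_bundle_iso ::
  "'v qbundle \<Rightarrow> 'v dop \<Rightarrow> 'w qbundle \<Rightarrow> 'w dop \<Rightarrow> (cp1 \<Rightarrow> 'v \<Rightarrow> 'w) \<Rightarrow> bool" where
  "hol_bundle_iso E D F D' \<Phi> \<longleftrightarrow>
     (\<forall>p. bij_betw (\<Phi> p) (fib E p) (fib F p) \<and>
        (\<forall>x\<in>fib E p. \<Phi> p (Jstr E p x) = Jstr F p (\<Phi> p x) \<and>
          (\<forall>\<mu>. \<Phi> p (scl E p x \<mu>) = scl F p (\<Phi> p x) \<mu>) \<and>
          (\<forall>y\<in>fib E p. \<Phi> p (add E p x y) = add F p (\<Phi> p x) (\<Phi> p y)))) \<and>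
     (\<forall>U s. open U \<and> (\<forall>p\<in>U. s p \<in> fib E p) \<longrightarrow>
        (smooth_sec E U s \<longleftrightarrow> smooth_sec F U (\<lambda>p. \<Phi> p (s p)))) \<and>
     (\<forall>U s. open U \<and> smooth_sec E U s \<longrightarrow>
        (\<forall>p\<in>U. \<forall>v. D' (\<lambda>q. \<Phi> q (s q)) p v = \<Phi> p (D s p v)))"

text \<open>The pairing \<open>(x, y)\<close> of two vectors of \<open>E\<close> at \<open>p\<close> induced by an identification \<open>\<Phi>\<close> of \<open>E\<close>
  with \<open>K E\<^sup>-\<^sup>1\<close>: an \<open>\<H>\<close>-valued form on the tangent space.\<close>

definition spin_pairing ::
  "(cp1 \<Rightarrow> 'v \<Rightarrow> complex \<Rightarrow> 'v \<Rightarrow> quat) \<Rightarrow> cp1 \<Rightarrow> 'v \<Rightarrow> 'v \<Rightarrow> complex \<Rightarrow> quat" where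
  "spin_pairing \<Phi> p x y v = \<Phi> p x v y"

text \<open>\<open>(E, D)\<close> with the identification \<open>\<Phi>\<close> is the Euclidean holomorphic line bundle of \<open>f\<close>.\<close>

definition euclidean_bundle ::
  "(cp1 \<Rightarrow> quat) \<Rightarrow> 'v qbundle \<Rightarrow> 'v dop \<Rightarrow> (cp1 \<Rightarrow> 'v \<Rightarrow> complex \<Rightarrow> 'v \<Rightarrow> quat) \<Rightarrow> bool" where
  "euclidean_bundle f E D \<Phi> \<longleftrightarrow> hol_line_bundle E D \<and>
     (\<exists>D'. paired_structure E D D' \<and> hol_bundle_iso E D (K_dual E) D' \<Phi>) \<and>
     (\<exists>\<psi>\<in>H0 E D. (\<forall>p. \<psi> p \<noteq> zer E p) \<and>
        (\<forall>p v. cdiff f p v = spin_pairing \<Phi> p (\<psi> p) (\<psi> p) v))"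

text \<open>\<open>q\<close> is the potential with respect to the affine coordinate \<open>z\<close> on the complement of \<open>a\<close>:
  \<open>Q \<phi> = \<phi> k q dz\<close> for a section \<open>\<phi>\<close> with \<open>J \<phi> = \<phi> \<i>\<close>, \<open>dbar \<phi> = 0\<close> and \<open>dz = j (\<phi>, \<phi>)\<close>. These
  conditions determine \<open>\<phi>\<close> up to sign, hence \<open>q\<close>; for an immersion with mean curvature \<open>H\<close> one has
  \<open>q = H |df| / (2 |dz|)\<close>.\<close>

definition potential ::
  "'v qbundle \<Rightarrow> 'v dop \<Rightarrow> (cp1 \<Rightarrow> 'v \<Rightarrow> complex \<Rightarrow> 'v \<Rightarrow> quat) \<Rightarrow> cp1 \<Rightarrow> (cp1 \<Rightarrow> complex) \<Rightarrow>
   (complex \<Rightarrow> real) \<Rightarrow> bool" where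
  "potential E D \<Phi> a z q \<longleftrightarrow> affine_coord a z \<and>
     (\<exists>\<phi>. hat_frame E (- {a}) \<phi> \<and> (\<forall>p\<in>- {a}. \<forall>v.
        dbar E D \<phi> p v = zer E p \<and>
        qc (cdiff z p v) = qj * spin_pairing \<Phi> p (\<phi> p) (\<phi> p) v \<and>
        hopf E D \<phi> p v = scl E p (\<phi> p) (qk * of_real (q (z p)) * qc (cdiff z p v))))"

text \<open>\<open>f\<close> takes values in the imaginary quaternions, and \<open>(E, D)\<close> is its Euclidean holomorphic line
  bundle. As that is unique up to isomorphism, the property does not depend on \<open>(E, D)\<close>.\<close>

definition Taimanov_soliton_sphere :: "'v qbundle \<Rightarrow> 'v dop \<Rightarrow> (cp1 \<Rightarrow> quat) \<Rightarrow> bool" where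
  "Taimanov_soliton_sphere E D f \<longleftrightarrow> conformal_immersion f \<and> (\<forall>p. qre (f p) = 0) \<and>
     (\<exists>\<Phi>. euclidean_bundle f E D \<Phi> \<and>
        (\<exists>a z q. potential E D \<Phi> a z q \<and> (\<forall>x. q x = q (of_real (cmod x))))) \<and>
     Pluecker_equality E D (H0 E D)"

end

theory Submission imports Defs begin

text \<open>A nowhere vanishing holomorphic section with \<open>df = (\<psi>, \<psi>)\<close> trivialises the Euclidean bundle: with
  \<open>N = (1 / f\<^sub>x) f\<^sub>y\<close> it becomes the trivial bundle \<open>H\<close> with complex structure \<open>\<phi> \<mapsto> N \<phi>\<close>, and \<open>\<phi>\<close> is
  holomorphic iff \<open>d\<phi> + N *d\<phi> = 0\<close>. In the same way the Moebius invariant bundle dual to \<open>f\<close> becomes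
  the trivial bundle with complex structure \<open>- N\<close>. For holomorphic \<open>\<phi>\<close> the form \<open>df \<phi>\<close> is closed,
  hence exact on the sphere, and its primitives are holomorphic sections of the dual bundle. The
  constants and these primitives, with \<open>\<phi>\<close> ranging over the \<open>(n+1)\<close>-dimensional space of all
  holomorphic sections, form an \<open>(n+2)\<close>-dimensional linear system; it contains \<open>1\<close> and, as the constant
  \<open>1\<close> is holomorphic, also \<open>f\<close>, and so the canonical linear system. Its vanishing orders at a point are
  \<open>0\<close> and the successors of the old ones, so the total order does not change. The degree changes from
  \<open>-1\<close> to \<open>1\<close>, and by Gauss-Bonnet the Willmore energy changes by \<open>- 4 \<pi>\<close>. These changes cancel in the
  Pluecker equality.\<close>

section \<open>Smooth maps\<close>

text \<open>The argument rests on the identities \<open>*df = df N\<close> and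
  \<open>N df = - df N\<close>; the second holds because \<open>f\<close> is imaginary. A
  holomorphic \<phi> satisfies \<open>*d\<phi> = N d\<phi>\<close>, so the wedge product of
  \<open>df\<close> and \<open>d\<phi>\<close>, which up to sign is the differential of
  \<open>df \<phi>\<close>, vanishes: this is the closedness. Moving \<open>N\<close> past
  \<open>df\<close> replaces it by \<open>- N\<close>, which is why primitives are holomorphic for
  the opposite complex structure and why a leading term \<open>w^k\<close> of \<phi> yields a
  leading term \<open>w^(k+1)\<close> of the primitive. The two Willmore integrands are
  \<open>|N N_x - N_y|^2\<close> and \<open>|N N_x + N_y|^2\<close> up to the factor 1/4; they
  differ by a multiple of the inner product of \<open>N N_x\<close> and \<open>N_y\<close>, which is
  minus the Gauss curvature density of \<open>f\<close>. The obstacle is that bundles, quotients and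
  operators are given abstractly, with arbitrary coordinates and frames in the definitions of order
  and degree. A locale of trivialised bundles translates all of this once into statements on
  quaternion-valued functions, and orders are measured with \<open>N\<close> frozen at the point in
  question.\<close>

lemma Ck_on_cong:
  assumes "open S" "\<And>x. x \<in> S \<Longrightarrow> f x = g x" "Ck_on k S f"
  shows "Ck_on k S g"
  using assms
proof (cases k)
  case 0
  with assms show ?thesis
    by (metis Ck_on.simps(1) continuous_on_cong)
next
  case (Suc m)
  with assms(3) obtain f' where f': "\<And>x. x \<in> S \<Longrightarrow> (f has_derivative f' x) (at x)"
      "\<And>v. Ck_on m S (\<lambda>x. f' x v)" by auto
  have "(g has_derivative f' x) (at x)" if "x \<in> S" for x
    using has_derivative_transform_within_open[OF f'(1)[OF that] assms(1) that] assms(2) by blast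
  with f'(2) Suc show ?thesis by auto
qed

lemma Ck_on_SucI:
  assumes "\<And>x. x \<in> S \<Longrightarrow> (f has_derivative f' x) (at x)" "\<And>v. Ck_on k S (\<lambda>x. f' x v)"
  shows "Ck_on (Suc k) S f"
  using assms by auto

text \<open>Derivatives are unique, so the witness hidden in \<open>Ck_on\<close> can be taken to be
  \<open>frechet_derivative\<close>. Local statements can then be patched together without choosing
  derivatives.\<close>

lemma Ck_on_Suc_iff:
  assumes "open S"
  shows "Ck_on (Suc k) S f \<longleftrightarrow> (\<forall>x\<in>S. f differentiable (at x)) \<and>
    (\<forall>v. Ck_on k S (\<lambda>x. frechet_derivative f (at x) v))"
proof
  assume "Ck_on (Suc k) S f"
  then obtain f' where f': "\<And>x. x \<in> S \<Longrightarrow> (f has_derivative f' x) (at x)"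
      "\<And>v. Ck_on k S (\<lambda>x. f' x v)" by auto
  have "frechet_derivative f (at x) = f' x" if "x \<in> S" for x
    using f'(1)[OF that] frechet_derivative_at by metis
  then have "Ck_on k S (\<lambda>x. frechet_derivative f (at x) v)" for v
    by (intro Ck_on_cong[OF assms _ f'(2)[of v]]) simp
  moreover have "\<forall>x\<in>S. f differentiable (at x)"
    using f'(1) differentiableI by blast
  ultimately show "(\<forall>x\<in>S. f differentiable (at x)) \<and>
      (\<forall>v. Ck_on k S (\<lambda>x. frechet_derivative f (at x) v))" by blast
qed (auto intro!: Ck_on_SucI simp: frechet_derivative_works)

lemma Ck_on_Suc_imp:
  assumes "Ck_on (Suc k) S f" shows "Ck_on k S f"
  using assms
proof (induction k arbitrary: f)
  case 0
  then show ?case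
    unfolding Ck_on.simps using has_derivative_continuous continuous_at_imp_continuous_on by blast
next
  case (Suc k)
  from Suc.prems obtain f' where "\<forall>x\<in>S. (f has_derivative f' x) (at x)"
      "\<forall>v. Ck_on (Suc k) S (\<lambda>x. f' x v)" unfolding Ck_on.simps(2)[of "Suc k"] by blast
  with Suc.IH show ?case unfolding Ck_on.simps(2)[of k] by blast
qed

lemma Ck_on_subset:
  assumes "Ck_on k S f" "T \<subseteq> S" shows "Ck_on k T f"
  using assms
proof (induction k arbitrary: f)
  case (Suc k)
  then obtain f' where "\<forall>x\<in>S. (f has_derivative f' x) (at x)"
      "\<forall>v. Ck_on k S (\<lambda>x. f' x v)" by auto
  with Suc.IH Suc.prems(2) show ?case unfolding Ck_on.simps by blast
qed (auto intro: continuous_on_subset)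

lemma Ck_on_local:
  assumes "\<And>x. x \<in> S \<Longrightarrow> \<exists>V. open V \<and> x \<in> V \<and> Ck_on k V f"
  shows "Ck_on k S f"
  using assms
proof (induction k arbitrary: f)
  case 0
  then show ?case
    unfolding Ck_on.simps
    by (meson continuous_at_imp_continuous_on continuous_on_eq_continuous_at)
next
  case (Suc k)
  show ?case
  proof (rule Ck_on_SucI)
    fix x assume "x \<in> S"
    with Suc.prems obtain V where "open V" "x \<in> V" "Ck_on (Suc k) V f" by blast
    then show "(f has_derivative frechet_derivative f (at x)) (at x)"
      using Ck_on_Suc_iff frechet_derivative_works by blast
  next
    fix v
    show "Ck_on k S (\<lambda>x. frechet_derivative f (at x) v)"
    proof (rule Suc.IH)
      fix x assume "x \<in> S"
      with Suc.prems obtain V where "open V" "x \<in> V" "Ck_on (Suc k) V f" by blast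
      then show "\<exists>V. open V \<and> x \<in> V \<and> Ck_on k V (\<lambda>x. frechet_derivative f (at x) v)"
        using Ck_on_Suc_iff by blast
    qed
  qed
qed

lemma Ck_on_const: "Ck_on k S (\<lambda>x. c)"
proof (induction k arbitrary: c)
  case (Suc k)
  show ?case by (rule Ck_on_SucI[where f' = "\<lambda>_ _. 0"]) (use Suc in auto)
qed auto

lemma Ck_on_bounded_linear:
  assumes "bounded_linear L" "Ck_on k S f" shows "Ck_on k S (\<lambda>x. L (f x))"
  using assms(2)
proof (induction k arbitrary: f)
  case 0
  then show ?case
    using bounded_linear.continuous_on[OF assms(1)] by auto
next
  case (Suc k)
  then obtain f' where f': "\<And>x. x \<in> S \<Longrightarrow> (f has_derivative f' x) (at x)"
      "\<And>v. Ck_on k S (\<lambda>x. f' x v)" by auto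
  show ?case
    using f' Suc.IH bounded_linear.has_derivative[OF assms(1)]
    by (intro Ck_on_SucI[where f' = "\<lambda>x v. L (f' x v)"]) blast+
qed

lemma Ck_on_add:
  assumes "Ck_on k S f" "Ck_on k S g" shows "Ck_on k S (\<lambda>x. f x + g x)"
  using assms
proof (induction k arbitrary: f g)
  case (Suc k)
  from Suc.prems(1) obtain f' where f': "\<And>x. x \<in> S \<Longrightarrow> (f has_derivative f' x) (at x)"
      "\<And>v. Ck_on k S (\<lambda>x. f' x v)" by auto
  from Suc.prems(2) obtain g' where g': "\<And>x. x \<in> S \<Longrightarrow> (g has_derivative g' x) (at x)"
      "\<And>v. Ck_on k S (\<lambda>x. g' x v)" by auto
  show ?case
    by (rule Ck_on_SucI[where f' = "\<lambda>x v. f' x v + g' x v"])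
      (use f' g' Suc.IH has_derivative_add in blast)+
qed (auto intro: continuous_on_add)

lemma Ck_on_bilinear:
  assumes "bounded_bilinear B" "Ck_on k S f" "Ck_on k S g"
  shows "Ck_on k S (\<lambda>x. B (f x) (g x))"
  using assms(2,3)
proof (induction k arbitrary: f g)
  case 0
  then show ?case
    using bounded_bilinear.continuous_on[OF assms(1)] by auto
next
  case (Suc k)
  from Suc.prems(1) obtain f' where f': "\<And>x. x \<in> S \<Longrightarrow> (f has_derivative f' x) (at x)"
      "\<And>v. Ck_on k S (\<lambda>x. f' x v)" by auto
  from Suc.prems(2) obtain g' where g': "\<And>x. x \<in> S \<Longrightarrow> (g has_derivative g' x) (at x)"
      "\<And>v. Ck_on k S (\<lambda>x. g' x v)" by auto
  show ?case
  proof (rule Ck_on_SucI[where f' = "\<lambda>x v. B (f x) (g' x v) + B (f' x v) (g x)"])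
    show "Ck_on k S (\<lambda>x. B (f x) (g' x v) + B (f' x v) (g x))" for v
      using Ck_on_add[OF Suc.IH[OF Ck_on_Suc_imp[OF Suc.prems(1)] g'(2)]
          Suc.IH[OF f'(2) Ck_on_Suc_imp[OF Suc.prems(2)]]] .
  qed (use f'(1) g'(1) in \<open>rule bounded_bilinear.FDERIV[OF assms(1)]\<close>)
qed

lemma Ck_on_sum:
  assumes "\<And>i. i \<in> I \<Longrightarrow> Ck_on k S (f i)" shows "Ck_on k S (\<lambda>x. \<Sum>i\<in>I. f i x)"
  using assms by (induction I rule: infinite_finite_induct) (auto intro: Ck_on_const Ck_on_add)

lemma linear_Basis_sum:
  fixes L :: "'a::euclidean_space \<Rightarrow> 'b::real_vector"
  assumes "linear L"
  shows "L x = (\<Sum>b\<in>Basis. (x \<bullet> b) *\<^sub>R L b)"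
proof -
  have "L x = L (\<Sum>b\<in>Basis. (x \<bullet> b) *\<^sub>R b)"
    by (simp only: euclidean_representation)
  then show ?thesis
    by (simp only: linear_sum[OF assms] linear_scale[OF assms] o_def)
qed

text \<open>The chain rule differentiates \<open>g\<close> in the direction \<open>f' x v\<close>,
  which moves with \<open>x\<close>, while the induction hypothesis concerns fixed directions.
  Expanding the direction in an orthonormal basis of the Euclidean space in the middle separates the
  two dependences.\<close>

lemma Ck_on_compose:
  fixes f :: "'a::real_normed_vector \<Rightarrow> 'b::euclidean_space"
  assumes "Ck_on k S f" "Ck_on k T g" "f ` S \<subseteq> T"
  shows "Ck_on k S (\<lambda>x. g (f x))"
  using assms
proof (induction k arbitrary: f g)
  case 0
  then show ?case using continuous_on_compose2 by auto
next
  case (Suc k)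
  from Suc.prems(1) obtain f' where f': "\<And>x. x \<in> S \<Longrightarrow> (f has_derivative f' x) (at x)"
      "\<And>v. Ck_on k S (\<lambda>x. f' x v)" by auto
  from Suc.prems(2) obtain g' where g': "\<And>x. x \<in> T \<Longrightarrow> (g has_derivative g' x) (at x)"
      "\<And>v. Ck_on k T (\<lambda>x. g' x v)" by auto
  have lin: "linear (g' y)" if "y \<in> T" for y
    using g'(1)[OF that] has_derivative_linear by blast
  show ?case
  proof (rule Ck_on_SucI[where f' = "\<lambda>x v. \<Sum>b\<in>Basis. (f' x v \<bullet> b) *\<^sub>R g' (f x) b"])
    fix x assume x: "x \<in> S"
    then have y: "f x \<in> T" using Suc.prems(3) by auto
    have "((\<lambda>x. g (f x)) has_derivative (\<lambda>v. g' (f x) (f' x v))) (at x)"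
      using has_derivative_compose[OF f'(1)[OF x] g'(1)[OF y]] .
    then show "((\<lambda>x. g (f x)) has_derivative
        (\<lambda>v. \<Sum>b\<in>Basis. (f' x v \<bullet> b) *\<^sub>R g' (f x) b)) (at x)"
      by (simp only: linear_Basis_sum[OF lin[OF y], symmetric])
  next
    fix v
    show "Ck_on k S (\<lambda>x. \<Sum>b\<in>Basis. (f' x v \<bullet> b) *\<^sub>R g' (f x) b)"
    proof (intro Ck_on_sum Ck_on_bilinear[OF bounded_bilinear_scaleR])
      fix b :: 'b
      show "Ck_on k S (\<lambda>x. f' x v \<bullet> b)"
        by (intro Ck_on_bounded_linear[OF bounded_linear_inner_left] f')
      show "Ck_on k S (\<lambda>x. g' (f x) b)"
        by (rule Suc.IH[OF Ck_on_Suc_imp[OF Suc.prems(1)] g'(2) Suc.prems(3)])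
    qed
  qed
qed

lemma smooth_on_cong:
  assumes "open S" "\<And>x. x \<in> S \<Longrightarrow> f x = g x" "smooth_on S f"
  shows "smooth_on S g"
  using assms Ck_on_cong unfolding smooth_on_def by blast

lemma smooth_on_subset: "smooth_on S f \<Longrightarrow> T \<subseteq> S \<Longrightarrow> smooth_on T f"
  using Ck_on_subset unfolding smooth_on_def by blast

lemma smooth_on_local:
  assumes "\<And>x. x \<in> S \<Longrightarrow> \<exists>V. open V \<and> x \<in> V \<and> smooth_on V f"
  shows "smooth_on S f"
  using assms Ck_on_local unfolding smooth_on_def by metis

lemma smooth_on_const: "smooth_on S (\<lambda>x. c)"
  unfolding smooth_on_def using Ck_on_const by blast

lemma smooth_on_id: "smooth_on S (\<lambda>x. x)"
  unfolding smooth_on_def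
proof
  show "Ck_on k S (\<lambda>x. x)" for k
  proof (cases k)
    case (Suc m)
    then show ?thesis by (auto intro!: exI[of _ "\<lambda>_ v. v"] Ck_on_const)
  qed auto
qed

lemma smooth_on_bounded_linear:
  "bounded_linear L \<Longrightarrow> smooth_on S f \<Longrightarrow> smooth_on S (\<lambda>x. L (f x))"
  unfolding smooth_on_def using Ck_on_bounded_linear by blast

lemma smooth_on_add: "smooth_on S f \<Longrightarrow> smooth_on S g \<Longrightarrow> smooth_on S (\<lambda>x. f x + g x)"
  unfolding smooth_on_def using Ck_on_add by blast

lemma smooth_on_bilinear:
  "bounded_bilinear B \<Longrightarrow> smooth_on S f \<Longrightarrow> smooth_on S g \<Longrightarrow> smooth_on S (\<lambda>x. B (f x) (g x))"
  unfolding smooth_on_def using Ck_on_bilinear by blast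

lemmas smooth_on_minus = smooth_on_bounded_linear[OF bounded_linear_minus[OF bounded_linear_ident]]
lemmas smooth_on_inner = smooth_on_bilinear[OF bounded_bilinear_inner]
lemmas smooth_on_scaleR = smooth_on_bilinear[OF bounded_bilinear_scaleR]

lemma smooth_on_mult:
  fixes f g :: "_ \<Rightarrow> 'a::real_normed_algebra"
  shows "smooth_on S f \<Longrightarrow> smooth_on S g \<Longrightarrow> smooth_on S (\<lambda>x. f x * g x)"
  by (rule smooth_on_bilinear[OF bounded_bilinear_mult])

lemma smooth_on_diff: "smooth_on S f \<Longrightarrow> smooth_on S g \<Longrightarrow> smooth_on S (\<lambda>x. f x - g x)"
  using smooth_on_add[OF _ smooth_on_minus, of S f g] by simp

lemma smooth_on_sum:
  "(\<And>i. i \<in> I \<Longrightarrow> smooth_on S (f i)) \<Longrightarrow> smooth_on S (\<lambda>x. \<Sum>i\<in>I. f i x)"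
  unfolding smooth_on_def using Ck_on_sum by metis

lemma smooth_on_compose:
  fixes f :: "'a::real_normed_vector \<Rightarrow> 'b::euclidean_space"
  shows "smooth_on S f \<Longrightarrow> smooth_on T g \<Longrightarrow> f ` S \<subseteq> T \<Longrightarrow> smooth_on S (\<lambda>x. g (f x))"
  unfolding smooth_on_def using Ck_on_compose by metis

lemma smooth_on_Pair:
  assumes "smooth_on S f" "smooth_on S g" shows "smooth_on S (\<lambda>x. (f x, g x))"
proof -
  have "bounded_linear (\<lambda>x. (x, 0))" "bounded_linear (\<lambda>x. (0, x))"
    by (auto intro: bounded_linear_Pair bounded_linear_ident bounded_linear_zero)
  from smooth_on_add[OF smooth_on_bounded_linear[OF this(1) assms(1)]
      smooth_on_bounded_linear[OF this(2) assms(2)]]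
  show ?thesis by simp
qed

lemma smooth_on_imp_continuous_on: "smooth_on S f \<Longrightarrow> continuous_on S f"
  unfolding smooth_on_def using Ck_on.simps(1) by metis

lemma smooth_on_differentiable:
  "open S \<Longrightarrow> smooth_on S f \<Longrightarrow> x \<in> S \<Longrightarrow> f differentiable (at x)"
  unfolding smooth_on_def using Ck_on_Suc_iff by blast

lemma smooth_on_has_derivative:
  "open S \<Longrightarrow> smooth_on S f \<Longrightarrow> x \<in> S \<Longrightarrow> (f has_derivative frechet_derivative f (at x)) (at x)"
  using smooth_on_differentiable frechet_derivative_works by blast

lemma smooth_on_derivative:
  "open S \<Longrightarrow> smooth_on S f \<Longrightarrow> smooth_on S (\<lambda>x. frechet_derivative f (at x) v)"
  unfolding smooth_on_def using Ck_on_Suc_iff by blast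

lemma smooth_on_derivative_field:
  fixes f :: "'a::euclidean_space \<Rightarrow> 'b::real_normed_vector"
  assumes "open S" "smooth_on S f" "smooth_on S Y"
  shows "smooth_on S (\<lambda>x. frechet_derivative f (at x) (Y x))"
proof -
  have eq: "frechet_derivative f (at x) (Y x) =
      (\<Sum>b\<in>Basis. (Y x \<bullet> b) *\<^sub>R frechet_derivative f (at x) b)" if "x \<in> S" for x
  proof -
    have "linear (frechet_derivative f (at x))"
      using smooth_on_has_derivative[OF assms(1,2) that] has_derivative_linear by blast
    then show ?thesis by (rule linear_Basis_sum)
  qed
  have sm: "smooth_on S (\<lambda>x. \<Sum>b\<in>Basis. (Y x \<bullet> b) *\<^sub>R frechet_derivative f (at x) b)"
    by (intro smooth_on_sum smooth_on_scaleR smooth_on_inner smooth_on_const assms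
        smooth_on_derivative)
  show ?thesis by (rule smooth_on_cong[OF assms(1) eq[symmetric] sm])
qed

lemma smooth_on_SucI:
  assumes "\<And>x. x \<in> S \<Longrightarrow> (f has_derivative f' x) (at x)" "\<And>v. smooth_on S (\<lambda>x. f' x v)"
  shows "smooth_on S f"
  unfolding smooth_on_def
proof
  show "Ck_on k S f" for k
    by (rule Ck_on_Suc_imp, rule Ck_on_SucI) (use assms in \<open>auto simp: smooth_on_def\<close>)
qed

text \<open>The derivative is again a product of inverses and constants, so each order of
  differentiability follows from the preceding one. The factors keep their order, so quaternions are
  covered.\<close>

lemma smooth_on_inverse_id:
  "smooth_on (- {0}) (inverse :: 'a::real_normed_div_algebra \<Rightarrow> 'a)"
  unfolding smooth_on_def
proof
  show "Ck_on k (- {0}) (inverse :: 'a \<Rightarrow> 'a)" for k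
  proof (induction k)
    case 0
    show ?case by (auto intro!: continuous_on_inverse)
  next
    case (Suc k)
    show ?case
    proof (rule Ck_on_SucI[where f' = "\<lambda>x v. - (inverse x * v * inverse x)"])
      show "(inverse has_derivative (\<lambda>v. - (inverse x * v * inverse x))) (at x)"
        if "x \<in> - {0}" for x :: 'a using has_derivative_inverse' that by auto
      show "Ck_on k (- {0}) (\<lambda>x. - (inverse x * v * inverse x))" for v :: 'a
        by (intro Ck_on_bounded_linear[OF bounded_linear_minus[OF bounded_linear_ident]]
            Ck_on_bilinear[OF bounded_bilinear_mult] Suc Ck_on_const)
    qed
  qed
qed

lemma smooth_on_inverse:
  fixes f :: "_ \<Rightarrow> 'a::{real_normed_div_algebra, euclidean_space}"
  assumes "smooth_on S f" "\<And>x. x \<in> S \<Longrightarrow> f x \<noteq> 0"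
  shows "smooth_on S (\<lambda>x. inverse (f x))"
  by (rule smooth_on_compose[OF assms(1) smooth_on_inverse_id]) (use assms in auto)

lemma smooth_on_ln:
  fixes f :: "'b::real_normed_vector \<Rightarrow> real"
  assumes "smooth_on S f" "\<And>x. x \<in> S \<Longrightarrow> f x > 0"
  shows "smooth_on S (\<lambda>x. ln (f x))"
proof -
  have "smooth_on {0<..} (ln :: real \<Rightarrow> real)"
  proof (rule smooth_on_SucI[where f' = "\<lambda>x v. inverse x * v"])
    show "(ln has_derivative (\<lambda>v. inverse x * v)) (at x)" if "x \<in> {0<..}" for x :: real
      using DERIV_ln[of x] that by (simp add: has_field_derivative_def)
    show "smooth_on {0<..} (\<lambda>x::real. inverse x * v)" for v :: real
      by (intro smooth_on_mult smooth_on_inverse smooth_on_id smooth_on_const) auto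
  qed
  then show ?thesis by (rule smooth_on_compose[OF assms(1)]) (use assms(2) in auto)
qed

section \<open>The charts of the sphere\<close>

lemma par_Fin [simp]: "par (Fin z) = Fin"
  by (auto simp: par_def)

lemma par_Infty: "par Infty w = (if w = 0 then Infty else Fin (1 / w))"
  by (simp add: par_def)

lemma par_pos [simp]: "par p (pos p) = p"
  by (cases p) (auto simp: par_def pos_def)

lemma pos_simps [simp]: "pos (Fin z) = z" "pos Infty = 0"
  by (auto simp: pos_def)

lemma par_cases: "par p = Fin \<or> par p = par Infty"
  by (cases p) auto

lemma open_cp1_iff: "open U \<longleftrightarrow> open (Fin -` U) \<and> open (par Infty -` U)"
  unfolding open_cp1_def using par_cases par_Fin by metis

lemma open_par_vimage: "open U \<Longrightarrow> open (par p -` U)"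
  by (simp add: open_cp1_def)

lemma open_Compl_Infty: "open (- {Infty})"
proof -
  have "Fin -` (- {Infty}) = UNIV" "par Infty -` (- {Infty}) = - {0}"
    by (auto simp: par_Infty split: if_splits)
  then show ?thesis by (simp only: open_cp1_iff) (simp add: open_Compl)
qed

lemma open_Compl_Fin_0: "open (- {Fin 0})"
proof -
  have "Fin -` (- {Fin 0}) = - {0}" "par Infty -` (- {Fin 0}) = UNIV"
    by (auto simp: par_Infty split: if_splits)
  then show ?thesis by (simp only: open_cp1_iff) (simp add: open_Compl)
qed

lemma inj_par: "inj (par p)"
  by (cases p) (auto simp: inj_on_def par_Infty split: if_splits)

text \<open>The chart image of a Euclidean open set is open, because the transition map is a
  homeomorphism.\<close>

lemma open_par_image:
  assumes "open W" shows "open (par p ` W)"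
proof -
  have tr: "open {w. w \<noteq> 0 \<and> 1 / w \<in> W}"
  proof -
    have "continuous_on (- {0}) (\<lambda>w::complex. 1 / w)"
      by (intro continuous_intros) auto
    from continuous_open_preimage[OF this _ assms] have "open (- {0} \<inter> (\<lambda>w. 1 / w) -` W)"
      by (simp add: open_Compl)
    moreover have "- {0} \<inter> (\<lambda>w. 1 / w) -` W = {w. w \<noteq> 0 \<and> 1 / w \<in> W}" by auto
    ultimately show ?thesis by simp
  qed
  show ?thesis
  proof (cases p)
    case (Fin z)
    have "Fin -` (Fin ` W) = W" "par Infty -` (Fin ` W) = {w. w \<noteq> 0 \<and> 1 / w \<in> W}"
      by (auto simp: par_Infty split: if_splits)
    with assms tr Fin show ?thesis by (simp only: open_cp1_iff par_Fin)
  next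
    case Infty
    have "Fin -` (par Infty ` W) = {w. w \<noteq> 0 \<and> 1 / w \<in> W}"
    proof -
      have "Fin z \<in> par Infty ` W \<longleftrightarrow> z \<noteq> 0 \<and> 1 / z \<in> W" for z
      proof
        assume "Fin z \<in> par Infty ` W"
        then show "z \<noteq> 0 \<and> 1 / z \<in> W" by (auto simp: par_Infty split: if_splits)
      next
        assume "z \<noteq> 0 \<and> 1 / z \<in> W"
        then have "Fin z = par Infty (1 / z)" "1 / z \<in> W" by (auto simp: par_Infty)
        then show "Fin z \<in> par Infty ` W" by blast
      qed
      then show ?thesis by auto
    qed
    moreover have "par Infty -` (par Infty ` W) = W"
      using inj_par[of Infty] by (simp add: inj_vimage_image_eq)
    ultimately show ?thesis using assms tr Infty by (simp only: open_cp1_iff)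
  qed
qed

section \<open>Smooth functions on the sphere and their differentials\<close>

lemma csmooth_iff: "csmooth U g \<longleftrightarrow> smooth_on (Fin -` U) (g \<circ> Fin) \<and>
    smooth_on (par Infty -` U) (g \<circ> par Infty)"
  unfolding csmooth_def using par_cases par_Fin by metis

lemma csmooth_par: "csmooth U g \<Longrightarrow> smooth_on (par p -` U) (g \<circ> par p)"
  by (simp add: csmooth_def)

lemma csmooth_par_UNIV: "csmooth UNIV g \<Longrightarrow> smooth_on UNIV (g \<circ> par p)"
  using csmooth_par[of UNIV g p] by simp

lemma csmooth_cong:
  assumes "open U" "\<And>p. p \<in> U \<Longrightarrow> f p = g p" "csmooth U f" shows "csmooth U g"
  unfolding csmooth_def
proof
  fix p
  show "smooth_on (par p -` U) (g \<circ> par p)"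
    by (rule smooth_on_cong[OF open_par_vimage[OF assms(1)] _ csmooth_par[OF assms(3)]])
      (use assms(2) in auto)
qed

lemma csmooth_subset: "csmooth U g \<Longrightarrow> V \<subseteq> U \<Longrightarrow> csmooth V g"
  unfolding csmooth_def by (meson smooth_on_subset vimage_mono)

lemma csmooth_local:
  assumes "\<And>p. p \<in> U \<Longrightarrow> \<exists>V. open V \<and> p \<in> V \<and> csmooth V g"
  shows "csmooth U g"
  unfolding csmooth_def
proof
  fix p
  show "smooth_on (par p -` U) (g \<circ> par p)"
  proof (rule smooth_on_local)
    fix w assume "w \<in> par p -` U"
    then obtain V where "open V" "par p w \<in> V" "csmooth V g" using assms by auto
    then show "\<exists>V. open V \<and> w \<in> V \<and> smooth_on V (g \<circ> par p)"
      using csmooth_par open_par_vimage by (intro exI[of _ "par p -` V"]) auto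
  qed
qed

lemma csmooth_const: "csmooth U (\<lambda>p. c)"
  unfolding csmooth_def o_def using smooth_on_const by blast

lemma csmooth_bounded_linear:
  "bounded_linear L \<Longrightarrow> csmooth U g \<Longrightarrow> csmooth U (\<lambda>p. L (g p))"
  unfolding csmooth_def o_def using smooth_on_bounded_linear by blast

lemma csmooth_bilinear:
  "bounded_bilinear B \<Longrightarrow> csmooth U f \<Longrightarrow> csmooth U g \<Longrightarrow> csmooth U (\<lambda>p. B (f p) (g p))"
  unfolding csmooth_def o_def using smooth_on_bilinear by blast

lemma csmooth_add: "csmooth U f \<Longrightarrow> csmooth U g \<Longrightarrow> csmooth U (\<lambda>p. f p + g p)"
  unfolding csmooth_def o_def using smooth_on_add by blast

lemma csmooth_diff: "csmooth U f \<Longrightarrow> csmooth U g \<Longrightarrow> csmooth U (\<lambda>p. f p - g p)"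
  unfolding csmooth_def o_def using smooth_on_diff by blast

lemma csmooth_minus: "csmooth U f \<Longrightarrow> csmooth U (\<lambda>p. - f p)"
  unfolding csmooth_def o_def using smooth_on_minus by blast

lemma csmooth_mult:
  fixes f g :: "_ \<Rightarrow> 'a::real_normed_algebra"
  shows "csmooth U f \<Longrightarrow> csmooth U g \<Longrightarrow> csmooth U (\<lambda>p. f p * g p)"
  unfolding csmooth_def o_def using smooth_on_mult by blast

lemma csmooth_scaleR: "csmooth U f \<Longrightarrow> csmooth U g \<Longrightarrow> csmooth U (\<lambda>p. f p *\<^sub>R g p)"
  by (rule csmooth_bilinear[OF bounded_bilinear_scaleR])

lemma csmooth_Pair: "csmooth U f \<Longrightarrow> csmooth U g \<Longrightarrow> csmooth U (\<lambda>p. (f p, g p))"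
  unfolding csmooth_def o_def using smooth_on_Pair by blast

lemma csmooth_fst: "csmooth U f \<Longrightarrow> csmooth U (\<lambda>p. fst (f p))"
  by (rule csmooth_bounded_linear[OF bounded_linear_fst])

lemma csmooth_snd: "csmooth U f \<Longrightarrow> csmooth U (\<lambda>p. snd (f p))"
  by (rule csmooth_bounded_linear[OF bounded_linear_snd])

lemma csmooth_inverse:
  fixes f :: "_ \<Rightarrow> 'a::{real_normed_div_algebra, euclidean_space}"
  assumes "csmooth U f" "\<And>p. p \<in> U \<Longrightarrow> f p \<noteq> 0"
  shows "csmooth U (\<lambda>p. inverse (f p))"
  using assms smooth_on_inverse unfolding csmooth_def o_def by (metis vimageE)

lemma csmooth_sum:
  "(\<And>i. i \<in> I \<Longrightarrow> csmooth U (f i)) \<Longrightarrow> csmooth U (\<lambda>p. \<Sum>i\<in>I. f i p)"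
  by (induction I rule: infinite_finite_induct) (auto intro: csmooth_const csmooth_add)

lemma csmooth_has_derivative:
  assumes "open U" "csmooth U g" "par p w \<in> U"
  shows "((g \<circ> par p) has_derivative frechet_derivative (g \<circ> par p) (at w)) (at w)"
  by (rule smooth_on_has_derivative[OF open_par_vimage[OF assms(1)] csmooth_par[OF assms(2)]])
    (use assms(3) in auto)

lemma csmooth_has_cdiff:
  assumes "open U" "csmooth U g" "p \<in> U"
  shows "((g \<circ> par p) has_derivative cdiff g p) (at (pos p))"
proof -
  have "cdiff g p = frechet_derivative (g \<circ> par p) (at (pos p))"
    by (rule ext) (simp add: cdiff_def)
  then show ?thesis using csmooth_has_derivative[OF assms(1,2), of p "pos p"] assms(3) by simp
qed

lemma cdiff_eqI: "((g \<circ> par p) has_derivative d) (at (pos p)) \<Longrightarrow> cdiff g p = d"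
  unfolding cdiff_def using frechet_derivative_at[of "g \<circ> par p" d "pos p"] by simp

lemma cdiff_linear: "open U \<Longrightarrow> csmooth U g \<Longrightarrow> p \<in> U \<Longrightarrow> linear (cdiff g p)"
  using csmooth_has_cdiff has_derivative_linear by blast

lemma cdiff_cong:
  assumes "open U" "csmooth U f" "\<And>q. q \<in> U \<Longrightarrow> f q = g q" "p \<in> U"
  shows "cdiff g p = cdiff f p"
proof (rule cdiff_eqI)
  show "((g \<circ> par p) has_derivative cdiff f p) (at (pos p))"
    by (rule has_derivative_transform_within_open[OF csmooth_has_cdiff[OF assms(1,2,4)]
          open_par_vimage[OF assms(1)]]) (use assms in auto)
qed

lemma cdiff_const [simp]: "cdiff (\<lambda>p. c) q = (\<lambda>v. 0)"
  by (rule cdiff_eqI) (simp add: o_def)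

lemma cdiff_bounded_linear:
  assumes "bounded_linear L" "open U" "csmooth U g" "p \<in> U"
  shows "cdiff (\<lambda>q. L (g q)) p v = L (cdiff g p v)"
proof -
  have "cdiff (\<lambda>q. L (g q)) p = (\<lambda>v. L (cdiff g p v))"
    using bounded_linear.has_derivative[OF assms(1) csmooth_has_cdiff[OF assms(2-)]]
    by (intro cdiff_eqI) (simp add: o_def)
  then show ?thesis by simp
qed

lemma cdiff_add:
  assumes "open U" "csmooth U f" "csmooth U g" "p \<in> U"
  shows "cdiff (\<lambda>q. f q + g q) p v = cdiff f p v + cdiff g p v"
proof -
  have "cdiff (\<lambda>q. f q + g q) p = (\<lambda>v. cdiff f p v + cdiff g p v)"
    using has_derivative_add[OF csmooth_has_cdiff[OF assms(1,2,4)] csmooth_has_cdiff[OF assms(1,3,4)]]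
    by (intro cdiff_eqI) (simp add: o_def)
  then show ?thesis by simp
qed

lemma cdiff_bilinear:
  assumes "bounded_bilinear B" "open U" "csmooth U f" "csmooth U g" "p \<in> U"
  shows "cdiff (\<lambda>q. B (f q) (g q)) p v = B (f p) (cdiff g p v) + B (cdiff f p v) (g p)"
proof -
  have "cdiff (\<lambda>q. B (f q) (g q)) p = (\<lambda>v. B (f p) (cdiff g p v) + B (cdiff f p v) (g p))"
    using bounded_bilinear.FDERIV[OF assms(1) csmooth_has_cdiff[OF assms(2,3,5)]
        csmooth_has_cdiff[OF assms(2,4,5)]]
    by (intro cdiff_eqI) (simp add: o_def)
  then show ?thesis by simp
qed

lemmas cdiff_mult = cdiff_bilinear[OF bounded_bilinear_mult]

text \<open>\<open>cdiff\<close> always works in the chart belonging to the point, which is the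
  affine one at every point except infinity. For a finite point seen in the chart at infinity, the
  chain rule for \<open>w \<mapsto> 1 / w\<close> produces exactly the factor built into
  \<open>dpar\<close>.\<close>

lemma cdiff_par:
  assumes "open U" "csmooth U g" "par q w \<in> U"
  shows "cdiff g (par q w) (dpar q w v) = frechet_derivative (g \<circ> par q) (at w) v"
proof (cases "q = Infty \<and> w \<noteq> 0")
  case False
  then have "par (par q w) = par q" "pos (par q w) = w" "dpar q w v = v"
    by (cases q; auto simp: par_Infty dpar_def)+
  then show ?thesis by (simp add: cdiff_def)
next
  case True
  then have q: "q = Infty" and w: "w \<noteq> 0" by auto
  then have U: "Fin (1 / w) \<in> U" using assms(3) by (simp add: par_Infty)
  have d: "((g \<circ> Fin) has_derivative cdiff g (Fin (1 / w))) (at (1 / w))"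
    using csmooth_has_cdiff[OF assms(1,2) U] by simp
  have i: "((\<lambda>x. 1 / x) has_derivative (\<lambda>v. - v / w\<^sup>2)) (at w)"
    using w by (auto intro!: derivative_eq_intros simp: field_simps power2_eq_square)
  have "((\<lambda>x. (g \<circ> Fin) (1 / x)) has_derivative (\<lambda>v. cdiff g (Fin (1 / w)) (- v / w\<^sup>2))) (at w)"
    by (rule has_derivative_compose[OF i d])
  then have "((g \<circ> par Infty) has_derivative (\<lambda>v. cdiff g (Fin (1 / w)) (- v / w\<^sup>2))) (at w)"
    by (rule has_derivative_transform_within_open[where s = "- {0}"])
      (use w in \<open>auto simp: par_Infty open_Compl\<close>)
  from frechet_derivative_at[OF this] q w show ?thesis by (simp add: par_Infty dpar_def fun_eq_iff)
qed

lemma csmooth_cdiff_field: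
  assumes "open U" "csmooth U g" "smooth_vector_field U X"
  shows "csmooth U (\<lambda>p. cdiff g p (X p))"
  unfolding csmooth_def
proof
  fix p
  obtain Y where Y: "smooth_on (par p -` U) Y" "\<And>w. w \<in> par p -` U \<Longrightarrow> X (par p w) = dpar p w (Y w)"
    using assms(3) unfolding smooth_vector_field_def by metis
  show "smooth_on (par p -` U) ((\<lambda>p. cdiff g p (X p)) \<circ> par p)"
  proof (rule smooth_on_cong[OF open_par_vimage[OF assms(1)]])
    show "smooth_on (par p -` U) (\<lambda>w. frechet_derivative (g \<circ> par p) (at w) (Y w))"
      by (rule smooth_on_derivative_field[OF open_par_vimage[OF assms(1)] csmooth_par[OF assms(2)] Y(1)])
    show "frechet_derivative (g \<circ> par p) (at w) (Y w) = ((\<lambda>p. cdiff g p (X p)) \<circ> par p) w"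
      if "w \<in> par p -` U" for w
      using cdiff_par[OF assms(1,2)] that Y(2)[OF that] by simp
  qed
qed

lemma smooth_vector_field_mult_i:
  assumes "smooth_vector_field U X" shows "smooth_vector_field U (\<lambda>p. \<i> * X p)"
  unfolding smooth_vector_field_def
proof
  fix p
  obtain Y where Y: "smooth_on (par p -` U) Y" "\<forall>w\<in>par p -` U. X (par p w) = dpar p w (Y w)"
    using assms unfolding smooth_vector_field_def by metis
  have "dpar p w (\<i> * v) = \<i> * dpar p w v" for w v
    by (auto simp: dpar_def split: cp1.splits)
  with Y show "\<exists>Y. smooth_on (par p -` U) Y \<and> (\<forall>w\<in>par p -` U. \<i> * X (par p w) = dpar p w (Y w))"
    by (intro exI[of _ "\<lambda>w. \<i> * Y w"]) (auto intro: smooth_on_mult smooth_on_const)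
qed

lemma dpar_mult: "dpar p w (c * v) = c * dpar p w v"
  by (auto simp: dpar_def split: cp1.splits)

text \<open>The differential vanishes throughout both charts, each of which is connected; both
  contain \<open>Fin 1\<close>, so the two constants coincide.\<close>

lemma csmooth_constant:
  fixes g :: "cp1 \<Rightarrow> 'b::real_normed_vector"
  assumes "csmooth UNIV g" "\<And>p v. cdiff g p v = 0"
  shows "g p = g q"
proof -
  have z: "((g \<circ> par r) has_derivative (\<lambda>v. 0)) (at w)" for r w
  proof -
    have "frechet_derivative (g \<circ> par r) (at w) = (\<lambda>v. 0)"
      using cdiff_par[OF open_UNIV assms(1), of r w] assms(2) by auto
    then show ?thesis using csmooth_has_derivative[OF open_UNIV assms(1), of r w] by simp
  qed
  have c: "(g \<circ> par r) w = (g \<circ> par r) w'" for r w w'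
    by (rule has_derivative_zero_unique_connected[OF open_UNIV connected_UNIV z]) auto
  have "g p = g (Fin 1)" for p
  proof (cases p)
    case (Fin z)
    then show ?thesis using c[of "Fin 0" z 1] by simp
  next
    case Infty
    then show ?thesis using c[of Infty 0 1] by (simp add: par_Infty)
  qed
  then show ?thesis by metis
qed

section \<open>Trivialised quaternionic line bundles\<close>

lemma qcnj_simps:
  "qcnj (x + y) = qcnj x + qcnj y" "qcnj (x - y) = qcnj x - qcnj y" "qcnj (- x) = - qcnj x"
  "qcnj (x * y) = qcnj y * qcnj x" "qcnj (r *\<^sub>R x) = r *\<^sub>R qcnj x" "qcnj (qcnj x) = x"
  "qcnj 0 = 0" "qcnj 1 = 1"
  by (simp_all add: qcnj_def quat_vector_defs times_quat_def one_quat_def algebra_simps)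

lemma norm_qcnj [simp]: "norm (qcnj x) = norm x"
  by (simp add: norm_quat_def qnormsq_def qcnj_def)

lemma bounded_linear_qcnj: "bounded_linear qcnj"
  by (rule bounded_linear_intro[where K = 1]) (simp_all add: qcnj_simps)

lemmas csmooth_qcnj = csmooth_bounded_linear[OF bounded_linear_qcnj]

lemma of_real_quat: "of_real r = Quat r 0 0 0"
  by (simp add: of_real_def scaleR_quat_def one_quat_def)

lemma quat_half: "x * (1 / 2) = (1 / 2) *\<^sub>R (x::quat)"
  by (metis mult_scaleR_right mult.right_neutral of_real_1 of_real_def of_real_divide of_real_numeral)

text \<open>Multiplication by the complex number \<open>z\<close> with respect to the complex structure \<open>n\<close>.\<close>

definition cx :: "quat \<Rightarrow> complex \<Rightarrow> quat" where
  "cx n z = of_real (Re z) + n * of_real (Im z)"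

lemma cx_alt: "cx n z = Re z *\<^sub>R 1 + Im z *\<^sub>R n"
  by (simp add: cx_def of_real_def)

text \<open>The common interface to the Euclidean bundle, the line subbundle and the two quotient
  bundles of \<open>f\<close>. The map \<theta> identifies each fibre with the quaternions so that
  right scalars stay right multiplication; being quaternionic linear, \<open>J\<close> is then left
  multiplication by a function \<open>N\<close> with square -1. Bundle axioms, orders, degree and
  energy can all be read off in this coordinate.\<close>

locale trivialized_bundle =
  fixes E :: "'v qbundle" and \<theta> :: "cp1 \<Rightarrow> 'v \<Rightarrow> quat" and N :: "cp1 \<Rightarrow> quat"
  assumes bij: "bij_betw (\<theta> p) (fib E p) UNIV"
    and zer_in: "zer E p \<in> fib E p" and zer_eq: "\<theta> p (zer E p) = 0"
    and add_in: "x \<in> fib E p \<Longrightarrow> y \<in> fib E p \<Longrightarrow> add E p x y \<in> fib E p"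
    and add_eq: "x \<in> fib E p \<Longrightarrow> y \<in> fib E p \<Longrightarrow> \<theta> p (add E p x y) = \<theta> p x + \<theta> p y"
    and scl_in: "x \<in> fib E p \<Longrightarrow> scl E p x \<mu> \<in> fib E p"
    and scl_eq: "x \<in> fib E p \<Longrightarrow> \<theta> p (scl E p x \<mu>) = \<theta> p x * \<mu>"
    and J_in: "x \<in> fib E p \<Longrightarrow> Jstr E p x \<in> fib E p"
    and J_eq: "x \<in> fib E p \<Longrightarrow> \<theta> p (Jstr E p x) = N p * \<theta> p x"
    and N_sq: "N p * N p = - 1" and N_smooth: "csmooth UNIV N"
    and smooth_iff: "open U \<Longrightarrow> smooth_sec E U s \<longleftrightarrow>
      (\<forall>p\<in>U. s p \<in> fib E p) \<and> csmooth U (\<lambda>p. \<theta> p (s p))"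
begin

definition unt :: "cp1 \<Rightarrow> quat \<Rightarrow> 'v" where "unt p = inv_into (fib E p) (\<theta> p)"

lemma unt_in [simp]: "unt p \<mu> \<in> fib E p"
  using bij[of p] inv_into_into[of \<mu> "\<theta> p" "fib E p"] by (auto simp: unt_def bij_betw_def)

lemma unt_eq [simp]: "\<theta> p (unt p \<mu>) = \<mu>"
  using bij[of p] f_inv_into_f[of \<mu> "\<theta> p" "fib E p"] by (auto simp: unt_def bij_betw_def)

lemma eqI: "x \<in> fib E p \<Longrightarrow> y \<in> fib E p \<Longrightarrow> \<theta> p x = \<theta> p y \<Longrightarrow> x = y"
  using bij[of p] by (auto simp: bij_betw_def dest: inj_onD)

lemma eq_iff: "x \<in> fib E p \<Longrightarrow> y \<in> fib E p \<Longrightarrow> x = y \<longleftrightarrow> \<theta> p x = \<theta> p y"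
  using eqI by blast

lemma eq_zer_iff: "x \<in> fib E p \<Longrightarrow> x = zer E p \<longleftrightarrow> \<theta> p x = 0"
  using eq_iff[OF _ zer_in] zer_eq by simp

lemma unt_theta: "x \<in> fib E p \<Longrightarrow> unt p (\<theta> p x) = x"
  by (rule eqI) auto

lemmas ins = zer_in add_in scl_in J_in unt_in
lemmas eqs = zer_eq add_eq scl_eq J_eq unt_eq

lemma N_smooth_on: "csmooth U N"
  using csmooth_subset[OF N_smooth] by simp

lemma right_qspace_fib: "right_qspace (fib E p) (zer E p) (add E p) (scl E p)"
  unfolding right_qspace_def
  by (intro conjI ballI allI) (auto intro!: ins eqI simp: ins eqs algebra_simps)

lemma line_fib: "\<exists>x\<in>fib E p. x \<noteq> zer E p \<and> fib E p = range (scl E p x)"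
proof (intro bexI conjI)
  show "unt p 1 \<noteq> zer E p" using eq_zer_iff[of "unt p 1" p] by simp
  show "fib E p = range (scl E p (unt p 1))"
  proof
    show "range (scl E p (unt p 1)) \<subseteq> fib E p" by (auto intro: ins)
    show "fib E p \<subseteq> range (scl E p (unt p 1))"
    proof
      fix x assume x: "x \<in> fib E p"
      then have "x = scl E p (unt p 1) (\<theta> p x)" by (auto intro!: eqI ins simp: eqs)
      then show "x \<in> range (scl E p (unt p 1))" by blast
    qed
  qed
qed simp

lemma unt_smooth: "open U \<Longrightarrow> csmooth U l \<Longrightarrow> smooth_sec E U (\<lambda>p. unt p (l p))"
  by (simp add: smooth_iff)

lemma local_frame: "\<exists>U e. open U \<and> p \<in> U \<and> frame E U e \<and>
    (\<forall>V s. open V \<and> V \<subseteq> U \<longrightarrow> (smooth_sec E V s \<longleftrightarrow>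
      (\<exists>\<mu>. csmooth V \<mu> \<and> (\<forall>q\<in>V. s q = scl E q (e q) (\<mu> q)))))"
proof (intro exI conjI allI impI)
  show "frame E UNIV (\<lambda>p. unt p 1)"
    unfolding frame_def using eq_zer_iff[of "unt q 1" q for q]
    by (auto intro!: unt_smooth csmooth_const)
  fix V s assume "open (V :: cp1 set) \<and> V \<subseteq> UNIV"
  then have V: "open V" by simp
  show "smooth_sec E V s \<longleftrightarrow> (\<exists>\<mu>. csmooth V \<mu> \<and> (\<forall>q\<in>V. s q = scl E q (unt q 1) (\<mu> q)))"
  proof
    assume "smooth_sec E V s"
    then show "\<exists>\<mu>. csmooth V \<mu> \<and> (\<forall>q\<in>V. s q = scl E q (unt q 1) (\<mu> q))"
      using V by (intro exI[of _ "\<lambda>p. \<theta> p (s p)"]) (auto simp: smooth_iff eqs intro!: eqI ins)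
  next
    assume "\<exists>\<mu>. csmooth V \<mu> \<and> (\<forall>q\<in>V. s q = scl E q (unt q 1) (\<mu> q))"
    then obtain \<mu> where \<mu>: "csmooth V \<mu>" "\<And>q. q \<in> V \<Longrightarrow> s q = scl E q (unt q 1) (\<mu> q)" by blast
    have "csmooth V (\<lambda>p. \<theta> p (s p))"
      by (rule csmooth_cong[OF V _ \<mu>(1)]) (simp add: \<mu>(2) eqs)
    then show "smooth_sec E V s" using V \<mu>(2) by (auto simp: smooth_iff ins)
  qed
qed auto

lemma quaternionic: "quaternionic_line_bundle E"
  unfolding quaternionic_line_bundle_def
proof (intro conjI allI impI)
  fix U :: "cp1 set" and s assume U: "open U"
  show "smooth_sec E U s \<longleftrightarrow> (\<forall>p\<in>U. \<exists>V. open V \<and> p \<in> V \<and> V \<subseteq> U \<and> smooth_sec E V s)"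
  proof
    assume *: "\<forall>p\<in>U. \<exists>V. open V \<and> p \<in> V \<and> V \<subseteq> U \<and> smooth_sec E V s"
    have loc: "\<exists>V. open V \<and> p \<in> V \<and> (\<forall>q\<in>V. s q \<in> fib E q) \<and> csmooth V (\<lambda>p. \<theta> p (s p))"
      if "p \<in> U" for p
    proof -
      from * that obtain V where V: "open V" "p \<in> V" "smooth_sec E V s" by blast
      with smooth_iff[OF V(1), of s] show ?thesis by blast
    qed
    from loc have "\<forall>p\<in>U. s p \<in> fib E p" by blast
    moreover have "csmooth U (\<lambda>p. \<theta> p (s p))"
      by (rule csmooth_local) (use loc in blast)
    ultimately show "smooth_sec E U s" using smooth_iff[OF U, of s] by blast
  qed (use U in blast)
qed (use right_qspace_fib line_fib smooth_iff local_frame in auto)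

lemma complex_qline: "complex_qline_bundle E"
  unfolding complex_qline_bundle_def
proof (intro conjI allI impI ballI quaternionic)
  fix p x assume x: "x \<in> fib E p"
  show "Jstr E p (Jstr E p x) = scl E p x (- 1)"
    by (rule eqI[where p = p]) (use x N_sq[of p] in \<open>simp_all add: ins eqs mult.assoc[symmetric]\<close>)
next
  fix U s assume *: "open U \<and> smooth_sec E U s"
  then have "csmooth U (\<lambda>p. N p * \<theta> p (s p))"
    using smooth_iff by (intro csmooth_mult N_smooth_on) auto
  then have "csmooth U (\<lambda>p. \<theta> p (Jstr E p (s p)))"
    by (rule csmooth_cong[rotated -1]) (use * smooth_iff in \<open>auto simp: eqs\<close>)
  then show "smooth_sec E U (\<lambda>p. Jstr E p (s p))" using * by (auto simp: smooth_iff ins)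
qed (auto intro!: eqI ins simp: ins eqs algebra_simps)

lemma Jscl_in: "x \<in> fib E p \<Longrightarrow> Jscl E p c x \<in> fib E p"
  by (simp add: Jscl_def ins)

lemma Jscl_eq: "x \<in> fib E p \<Longrightarrow> \<theta> p (Jscl E p c x) = cx (N p) c * \<theta> p x"
proof -
  assume "x \<in> fib E p"
  then have "\<theta> p (Jscl E p c x) = \<theta> p x * of_real (Re c) + N p * \<theta> p x * of_real (Im c)"
    by (simp add: Jscl_def ins eqs)
  then show ?thesis by (simp add: cx_def of_real_def algebra_simps)
qed

lemma lincomb_in: "(\<And>j. j < k \<Longrightarrow> b j p \<in> fib E p) \<Longrightarrow> lincomb E b c k p \<in> fib E p"
  by (induction k) (auto simp: ins)

lemma lincomb_eq: "(\<And>j. j < k \<Longrightarrow> b j p \<in> fib E p) \<Longrightarrow>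
    \<theta> p (lincomb E b c k p) = (\<Sum>j<k. \<theta> p (b j p) * c j)"
  by (induction k) (auto simp: ins eqs lincomb_in)

end

text \<open>For the trivial bundle with complex structure \<open>N\<close>: the kernel of \<open>\<phi> \<mapsto> (d\<phi> + N *d\<phi>) / 2\<close>.\<close>

definition nhol :: "(cp1 \<Rightarrow> quat) \<Rightarrow> (cp1 \<Rightarrow> quat) \<Rightarrow> bool" where
  "nhol N l \<longleftrightarrow> csmooth UNIV l \<and> (\<forall>p v. cdiff l p v + N p * cdiff l p (\<i> * v) = 0)"

definition qspan :: "(nat \<Rightarrow> cp1 \<Rightarrow> quat) \<Rightarrow> nat \<Rightarrow> (cp1 \<Rightarrow> quat) set" where
  "qspan b n = {\<lambda>p. \<Sum>j\<le>n. b j p * c j |c. True}"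

definition qindep :: "(nat \<Rightarrow> cp1 \<Rightarrow> quat) \<Rightarrow> nat \<Rightarrow> bool" where
  "qindep b n \<longleftrightarrow> (\<forall>c. (\<forall>p. (\<Sum>j\<le>n. b j p * c j) = 0) \<longrightarrow> (\<forall>k\<le>n. c k = 0))"

text \<open>Once the section with coordinate 1 is holomorphic, the Leibniz rule leaves no freedom:
  on a section with coordinate \<mu>, \<open>D\<close> must be half of
  \<open>d\<mu> + N *d\<mu>\<close>. The formula is required over every open set because
  \<open>D\<close> acts on local sections.\<close>

locale trivialized_hol = trivialized_bundle E \<theta> N for E :: "'v qbundle" and \<theta> N +
  fixes D :: "'v dop"
  assumes D_in: "open U \<Longrightarrow> smooth_sec E U s \<Longrightarrow> p \<in> U \<Longrightarrow> D s p v \<in> fib E p"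
    and D_eq: "open U \<Longrightarrow> smooth_sec E U s \<Longrightarrow> p \<in> U \<Longrightarrow> \<theta> p (D s p v) =
      (1 / 2) *\<^sub>R (cdiff (\<lambda>q. \<theta> q (s q)) p v + N p * cdiff (\<lambda>q. \<theta> q (s q)) p (\<i> * v))"
begin

lemma Kbar_form_D:
  assumes U: "open U" and s: "smooth_sec E U s" shows "Kbar_form E U (D s)"
  unfolding Kbar_form_def
proof (intro conjI ballI allI impI)
  have l: "csmooth U (\<lambda>q. \<theta> q (s q))" using U s smooth_iff by blast
  {
    fix p v assume p: "p \<in> U"
    note lin = cdiff_linear[OF U l p]
    note in' = D_in[OF U s p] note eq' = D_eq[OF U s p]
    show "D s p v \<in> fib E p" by (rule in')
    show "D s p (v + w) = add E p (D s p v) (D s p w)" for w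
      by (rule eqI[where p = p]) (use lin in \<open>simp_all add: ins in' eqs eq' linear_add algebra_simps\<close>)
    show "D s p (r *\<^sub>R v) = scl E p (D s p v) (of_real r)" for r
      by (rule eqI[where p = p]) (use lin in \<open>simp_all add: ins in' eqs eq' linear_scale of_real_def algebra_simps\<close>)
    show "D s p (\<i> * v) = scl E p (Jstr E p (D s p v)) (- 1)"
    proof (rule eqI[where p = p])
      have "N p * (N p * x) = - x" for x using N_sq[of p] by (simp add: mult.assoc[symmetric])
      moreover have "cdiff (\<lambda>q. \<theta> q (s q)) p (\<i> * (\<i> * v)) = - cdiff (\<lambda>q. \<theta> q (s q)) p v"
        using lin by (simp add: linear_neg flip: mult.assoc)
      ultimately show "\<theta> p (D s p (\<i> * v)) = \<theta> p (scl E p (Jstr E p (D s p v)) (- 1))"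
        by (simp add: ins in' eqs eq' algebra_simps)
    qed (simp_all add: ins in')
  }
  fix V X assume V: "open V \<and> V \<subseteq> U \<and> smooth_vector_field V X"
  then have lV: "csmooth V (\<lambda>q. \<theta> q (s q))" using csmooth_subset[OF l] by blast
  have "csmooth V (\<lambda>p. (1 / 2) *\<^sub>R (cdiff (\<lambda>q. \<theta> q (s q)) p (X p) +
      N p * cdiff (\<lambda>q. \<theta> q (s q)) p (\<i> * X p)))"
    using V lV smooth_vector_field_mult_i
    by (intro csmooth_scaleR csmooth_const csmooth_add csmooth_mult N_smooth_on csmooth_cdiff_field) auto
  then have "csmooth V (\<lambda>p. \<theta> p (D s p (X p)))"
    by (rule csmooth_cong[rotated -1]) (use V in \<open>auto simp: D_eq[OF U s]\<close>)
  then show "smooth_sec E V (\<lambda>p. D s p (X p))"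
    using V by (auto simp: smooth_iff intro: D_in[OF U s])
qed

lemma hol_line: "hol_line_bundle E D"
  unfolding hol_line_bundle_def
proof (intro conjI allI impI ballI complex_qline)
  fix U s assume *: "open U \<and> smooth_sec E U s"
  then have U: "open U" and s: "smooth_sec E U s" by auto
  have l: "csmooth U (\<lambda>q. \<theta> q (s q))" using U s smooth_iff by blast
  show "Kbar_form E U (D s)" by (rule Kbar_form_D[OF U s])
  have s_in: "q \<in> U \<Longrightarrow> s q \<in> fib E q" for q using U s smooth_iff by blast
  fix p
  show "D t p = D s p" if t: "\<forall>p\<in>U. t p = s p" and p: "p \<in> U" for t
  proof
    have lt: "csmooth U (\<lambda>q. \<theta> q (t q))"
      by (rule csmooth_cong[OF U _ l]) (simp add: t)
    then have st: "smooth_sec E U t" using U s_in t smooth_iff by auto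
    have "cdiff (\<lambda>q. \<theta> q (t q)) p = cdiff (\<lambda>q. \<theta> q (s q)) p"
      by (rule cdiff_cong[OF U l _ p]) (simp add: t)
    then show "D t p v = D s p v" for v
      by (intro eqI[where p = p]) (simp_all add: D_in[OF U st p] D_in[OF U s p] D_eq[OF U st p] D_eq[OF U s p])
  qed
  show "D (\<lambda>q. add E q (s q) (t q)) p v = add E p (D s p v) (D t p v)"
    if t: "smooth_sec E U t" and p: "p \<in> U" for t v
  proof -
    have lt: "csmooth U (\<lambda>q. \<theta> q (t q))" using U t smooth_iff by blast
    have t_in: "q \<in> U \<Longrightarrow> t q \<in> fib E q" for q using U t smooth_iff by blast
    have la: "csmooth U (\<lambda>q. \<theta> q (s q) + \<theta> q (t q))" by (rule csmooth_add[OF l lt])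
    have "csmooth U (\<lambda>q. \<theta> q (add E q (s q) (t q)))"
      by (rule csmooth_cong[OF U _ la]) (simp add: eqs s_in t_in)
    then have sa: "smooth_sec E U (\<lambda>q. add E q (s q) (t q))"
      using U s_in t_in by (simp add: smooth_iff ins)
    have "cdiff (\<lambda>q. \<theta> q (add E q (s q) (t q))) p = cdiff (\<lambda>q. \<theta> q (s q) + \<theta> q (t q)) p"
      by (rule cdiff_cong[OF U la _ p]) (simp add: eqs s_in t_in)
    then show ?thesis
      by (intro eqI[where p = p]) (simp_all add: ins eqs D_in[OF U sa p] D_in[OF U s p] D_in[OF U t p]
          D_eq[OF U sa p] D_eq[OF U s p] D_eq[OF U t p] cdiff_add[OF U l lt p] algebra_simps)
  qed
  show "D (\<lambda>q. scl E q (s q) (\<mu> q)) p v = add E p (scl E p (D s p v) (\<mu> p))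
      (scl E p (add E p (scl E p (s p) (cdiff \<mu> p v))
                        (Jstr E p (scl E p (s p) (cdiff \<mu> p (\<i> * v))))) (1 / 2))"
    if \<mu>: "csmooth U \<mu>" and p: "p \<in> U" for \<mu> v
  proof -
    have la: "csmooth U (\<lambda>q. \<theta> q (s q) * \<mu> q)" by (rule csmooth_mult[OF l \<mu>])
    have "csmooth U (\<lambda>q. \<theta> q (scl E q (s q) (\<mu> q)))"
      by (rule csmooth_cong[OF U _ la]) (simp add: eqs s_in)
    then have sa: "smooth_sec E U (\<lambda>q. scl E q (s q) (\<mu> q))"
      using U s_in by (simp add: smooth_iff ins)
    have "cdiff (\<lambda>q. \<theta> q (scl E q (s q) (\<mu> q))) p = cdiff (\<lambda>q. \<theta> q (s q) * \<mu> q) p"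
      by (rule cdiff_cong[OF U la _ p]) (simp add: eqs s_in)
    then have "\<theta> p (D (\<lambda>q. scl E q (s q) (\<mu> q)) p v) = (1 / 2) *\<^sub>R
        (\<theta> p (s p) * cdiff \<mu> p v + cdiff (\<lambda>q. \<theta> q (s q)) p v * \<mu> p +
         N p * (\<theta> p (s p) * cdiff \<mu> p (\<i> * v) + cdiff (\<lambda>q. \<theta> q (s q)) p (\<i> * v) * \<mu> p))"
      by (simp add: D_eq[OF U sa p] cdiff_mult[OF U l \<mu> p])
    also have "\<dots> = (1 / 2) *\<^sub>R (cdiff (\<lambda>q. \<theta> q (s q)) p v + N p * cdiff (\<lambda>q. \<theta> q (s q)) p (\<i> * v)) * \<mu> p +
        (1 / 2) *\<^sub>R (\<theta> p (s p) * cdiff \<mu> p v + N p * (\<theta> p (s p) * cdiff \<mu> p (\<i> * v)))"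
      by (simp only: distrib_left distrib_right scaleR_right_distrib mult_scaleR_left mult.assoc add_ac)
    finally show ?thesis
      by (intro eqI[where p = p]) (simp_all only: ins eqs D_in[OF U sa p] D_in[OF U s p] s_in[OF p]
          quat_half D_eq[OF U s p])
  qed
qed

lemma H0_iff: "s \<in> H0 E D \<longleftrightarrow> (\<forall>p. s p \<in> fib E p) \<and> nhol N (\<lambda>p. \<theta> p (s p))"
proof (cases "smooth_sec E UNIV s")
  case True
  then have "s \<in> H0 E D \<longleftrightarrow> (\<forall>p v. \<theta> p (D s p v) = 0)"
    using D_in[OF open_UNIV True] by (auto simp: H0_def holomorphic_sec_def eq_zer_iff)
  with True show ?thesis
    by (auto simp: D_eq[OF open_UNIV True] nhol_def smooth_iff)
next
  case False
  then show ?thesis by (auto simp: H0_def holomorphic_sec_def smooth_iff nhol_def)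
qed

text \<open>A section is determined by the coordinates of its values, so belonging to
  \<open>H\<close> becomes a condition on a quaternion-valued function, and fibrewise combinations
  become finite sums.\<close>

lemma linear_systemD:
  assumes "linear_system E D n H"
  obtains b where "\<And>k. k \<le> n \<Longrightarrow> nhol N (b k)" "qindep b n"
    "H = {s. (\<forall>p. s p \<in> fib E p) \<and> (\<lambda>p. \<theta> p (s p)) \<in> qspan b n}"
proof -
  from assms obtain b where b: "\<And>k. k \<le> n \<Longrightarrow> b k \<in> H0 E D"
    and H: "H = {lincomb E b c (Suc n) |c. True}"
    and ind: "\<And>c. lincomb E b c (Suc n) = zer E \<Longrightarrow> \<forall>k\<le>n. c k = 0"
    unfolding linear_system_def by metis
  let ?b = "\<lambda>k p. \<theta> p (b k p)"
  have bin: "j < Suc n \<Longrightarrow> b j p \<in> fib E p" for j p using b H0_iff by (simp add: less_Suc_eq_le)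
  have eq: "\<theta> p (lincomb E b c (Suc n) p) = (\<Sum>j\<le>n. ?b j p * c j)" for c p
    using lincomb_eq[of "Suc n" b p c] bin by (simp add: lessThan_Suc_atMost del: lincomb.simps)
  have inn: "lincomb E b c (Suc n) p \<in> fib E p" for c p
    by (rule lincomb_in) (use bin in auto)
  have "H = {s. (\<forall>p. s p \<in> fib E p) \<and> (\<lambda>p. \<theta> p (s p)) \<in> qspan ?b n}"
  proof (intro set_eqI iffI)
    fix s assume "s \<in> H"
    then show "s \<in> {s. (\<forall>p. s p \<in> fib E p) \<and> (\<lambda>p. \<theta> p (s p)) \<in> qspan ?b n}"
      using eq inn by (auto simp: H qspan_def simp del: lincomb.simps)
  next
    fix s assume "s \<in> {s. (\<forall>p. s p \<in> fib E p) \<and> (\<lambda>p. \<theta> p (s p)) \<in> qspan ?b n}"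
    then obtain c where s: "\<And>p. s p \<in> fib E p" and c: "\<And>p. \<theta> p (s p) = (\<Sum>j\<le>n. ?b j p * c j)"
      by (auto simp: qspan_def dest: fun_cong)
    have "s = lincomb E b c (Suc n)"
      by (intro ext eqI[OF s inn]) (simp add: c eq del: lincomb.simps)
    then show "s \<in> H" unfolding H by blast
  qed
  moreover have "qindep ?b n"
    unfolding qindep_def
  proof (intro allI impI)
    fix c k assume 0: "\<forall>p. (\<Sum>j\<le>n. ?b j p * c j) = 0" and k: "k \<le> n"
    have "lincomb E b c (Suc n) = zer E"
      by (intro ext eqI[OF inn zer_in]) (simp add: eq zer_eq 0 del: lincomb.simps)
    with ind k show "c k = 0" by blast
  qed
  moreover have "\<And>k. k \<le> n \<Longrightarrow> nhol N (?b k)" using b H0_iff by blast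
  ultimately show ?thesis using that[of ?b] by blast
qed

lemma linear_systemI:
  assumes b: "\<And>k. k \<le> n \<Longrightarrow> nhol N (b k)" and ind: "qindep b n"
  shows "linear_system E D n {s. (\<forall>p. s p \<in> fib E p) \<and> (\<lambda>p. \<theta> p (s p)) \<in> qspan b n}"
proof -
  let ?b = "\<lambda>k p. unt p (b k p)"
  have eq: "\<theta> p (lincomb E ?b c (Suc n) p) = (\<Sum>j\<le>n. b j p * c j)" for c p
    using lincomb_eq[of "Suc n" ?b p c] by (simp add: lessThan_Suc_atMost del: lincomb.simps)
  have inn: "lincomb E ?b c (Suc n) p \<in> fib E p" for c p
    by (rule lincomb_in) auto
  show ?thesis
    unfolding linear_system_def
  proof (intro exI[of _ ?b] conjI allI impI)
    show "?b k \<in> H0 E D" if "k \<le> n" for k using b[OF that] by (simp add: H0_iff)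
    show "{s. (\<forall>p. s p \<in> fib E p) \<and> (\<lambda>p. \<theta> p (s p)) \<in> qspan b n} =
        {lincomb E ?b c (Suc n) |c. True}"
    proof (intro set_eqI iffI)
      fix s assume "s \<in> {lincomb E ?b c (Suc n) |c. True}"
      then show "s \<in> {s. (\<forall>p. s p \<in> fib E p) \<and> (\<lambda>p. \<theta> p (s p)) \<in> qspan b n}"
        using eq inn by (auto simp: qspan_def simp del: lincomb.simps)
    next
      fix s assume "s \<in> {s. (\<forall>p. s p \<in> fib E p) \<and> (\<lambda>p. \<theta> p (s p)) \<in> qspan b n}"
      then obtain c where s: "\<And>p. s p \<in> fib E p" and c: "\<And>p. \<theta> p (s p) = (\<Sum>j\<le>n. b j p * c j)"
        by (auto simp: qspan_def dest: fun_cong)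
      have "s = lincomb E ?b c (Suc n)"
        by (intro ext eqI[OF s inn]) (simp add: c eq del: lincomb.simps)
      then show "s \<in> {lincomb E ?b c (Suc n) |c. True}" by blast
    qed
    fix c k assume 0: "lincomb E ?b c (Suc n) = zer E" and k: "k \<le> n"
    have "(\<Sum>j\<le>n. b j p * c j) = 0" for p
      using eq[of p c] by (simp only: 0 zer_eq)
    with ind k show "c k = 0" unfolding qindep_def by blast
  qed
qed

end

section \<open>Vanishing orders\<close>

definition Od :: "nat \<Rightarrow> (complex \<Rightarrow> 'b::real_normed_vector) \<Rightarrow> bool" where
  "Od k f \<longleftrightarrow> (\<exists>C r. 0 < r \<and> (\<forall>w. norm w < r \<longrightarrow> norm (f w) \<le> C * norm w ^ k))"

text \<open>Normalising to \<open>0 \<le> C\<close> and \<open>r \<le> 1\<close> lets estimates be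
  multiplied and higher powers of the norm be bounded by lower ones.\<close>

lemma OdE:
  assumes "Od k f"
  obtains C r where "0 \<le> C" "0 < r" "r \<le> 1" "\<And>w. norm w < r \<Longrightarrow> norm (f w) \<le> C * norm w ^ k"
proof -
  from assms obtain C r where *: "0 < r" "\<And>w. norm w < r \<Longrightarrow> norm (f w) \<le> C * norm w ^ k"
    unfolding Od_def by blast
  have "norm (f w) \<le> \<bar>C\<bar> * norm w ^ k" if "norm w < min r 1" for w
  proof -
    have "C * norm w ^ k \<le> \<bar>C\<bar> * norm w ^ k" by (intro mult_right_mono) auto
    then show ?thesis using *(2)[of w] that by linarith
  qed
  with *(1) show ?thesis using that[of "\<bar>C\<bar>" "min r 1"] by auto
qed

lemma Od_cong:
  assumes "Od k f" "0 < r" "\<And>w. norm w < r \<Longrightarrow> f w = g w" shows "Od k g"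
proof -
  from assms(1) obtain C r' where *: "0 < r'" "\<And>w. norm w < r' \<Longrightarrow> norm (f w) \<le> C * norm w ^ k"
    unfolding Od_def by blast
  have "norm (g w) \<le> C * norm w ^ k" if "norm w < min r r'" for w
    using *(2)[of w] assms(3)[of w] that by simp
  moreover have "0 < min r r'" using assms(2) *(1) by simp
  ultimately show ?thesis unfolding Od_def by blast
qed

lemma Od_mono:
  assumes "Od k f" "m \<le> k" shows "Od m f"
proof -
  from OdE[OF assms(1)] obtain C r where *: "0 \<le> C" "0 < r" "r \<le> 1"
    "\<And>w. norm w < r \<Longrightarrow> norm (f w) \<le> C * norm w ^ k" by metis
  have "norm (f w) \<le> C * norm w ^ m" if "norm w < r" for w
  proof -
    have "norm w ^ k \<le> norm w ^ m" using that *(3) assms(2) by (intro power_decreasing) auto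
    then have "C * norm w ^ k \<le> C * norm w ^ m" using *(1) by (rule mult_left_mono)
    then show ?thesis using *(4)[OF that] by linarith
  qed
  with *(2) show ?thesis unfolding Od_def by blast
qed

lemma Od_add:
  assumes "Od k f" "Od k g" shows "Od k (\<lambda>w. f w + g w)"
proof -
  from OdE[OF assms(1)] obtain C r where 1: "0 < r"
    "\<And>w. norm w < r \<Longrightarrow> norm (f w) \<le> C * norm w ^ k" by metis
  from OdE[OF assms(2)] obtain C' r' where 2: "0 < r'"
    "\<And>w. norm w < r' \<Longrightarrow> norm (g w) \<le> C' * norm w ^ k" by metis
  have "norm (f w + g w) \<le> (C + C') * norm w ^ k" if "norm w < min r r'" for w
    using 1(2)[of w] 2(2)[of w] that norm_triangle_ineq[of "f w" "g w"] by (simp add: distrib_right)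
  moreover have "0 < min r r'" using 1(1) 2(1) by simp
  ultimately show ?thesis unfolding Od_def by blast
qed

lemma Od_bounded_linear:
  assumes "bounded_linear L" "Od k f" shows "Od k (\<lambda>w. L (f w))"
proof -
  from OdE[OF assms(2)] obtain C r where 1: "0 < r"
    "\<And>w. norm w < r \<Longrightarrow> norm (f w) \<le> C * norm w ^ k" by metis
  obtain K where K: "0 \<le> K" "\<And>x. norm (L x) \<le> norm x * K"
    using bounded_linear.nonneg_bounded[OF assms(1)] by blast
  have "norm (L (f w)) \<le> (C * K) * norm w ^ k" if "norm w < r" for w
  proof -
    have "norm (f w) * K \<le> (C * norm w ^ k) * K" by (rule mult_right_mono[OF 1(2)[OF that] K(1)])
    then show ?thesis using K(2)[of "f w"] by (simp add: algebra_simps)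
  qed
  with 1(1) show ?thesis unfolding Od_def by blast
qed

lemma Od_diff: "Od k f \<Longrightarrow> Od k g \<Longrightarrow> Od k (\<lambda>w. f w - g w)"
  using Od_add[of k f "\<lambda>w. - g w"] Od_bounded_linear[OF bounded_linear_minus[OF bounded_linear_ident], of k g]
  by simp

lemma Od_bilinear:
  assumes "bounded_bilinear B" "Od k f" "Od m g" shows "Od (k + m) (\<lambda>w. B (f w) (g w))"
proof -
  from OdE[OF assms(2)] obtain C r where 1: "0 \<le> C" "0 < r"
    "\<And>w. norm w < r \<Longrightarrow> norm (f w) \<le> C * norm w ^ k" by metis
  from OdE[OF assms(3)] obtain C' r' where 2: "0 \<le> C'" "0 < r'"
    "\<And>w. norm w < r' \<Longrightarrow> norm (g w) \<le> C' * norm w ^ m" by metis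
  obtain K where K: "0 \<le> K" "\<And>x y. norm (B x y) \<le> norm x * norm y * K"
    using bounded_bilinear.nonneg_bounded[OF assms(1)] by blast
  have "norm (B (f w) (g w)) \<le> (C * C' * K) * norm w ^ (k + m)" if "norm w < min r r'" for w
  proof -
    have "norm (f w) * norm (g w) \<le> (C * norm w ^ k) * (C' * norm w ^ m)"
      using 1 2(3)[of w] that by (intro mult_mono) auto
    then have "norm (f w) * norm (g w) * K \<le> (C * norm w ^ k) * (C' * norm w ^ m) * K"
      using K(1) by (rule mult_right_mono)
    then show ?thesis using K(2)[of "f w" "g w"] by (simp add: algebra_simps power_add)
  qed
  moreover have "0 < min r r'" using 1(2) 2(2) by simp
  ultimately show ?thesis unfolding Od_def by blast
qed

lemma Od_mult:
  fixes f g :: "complex \<Rightarrow> 'a::real_normed_algebra"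
  shows "Od k f \<Longrightarrow> Od m g \<Longrightarrow> Od (k + m) (\<lambda>w. f w * g w)"
  by (rule Od_bilinear[OF bounded_bilinear_mult])

lemma Od_const: "Od 0 (\<lambda>w. c)"
  unfolding Od_def by (intro exI[of _ "norm c"] exI[of _ 1]) auto

lemma Od_zero: "Od k (\<lambda>w. 0)"
  unfolding Od_def by (intro exI[of _ 0] exI[of _ 1]) auto

lemma Od_power: "Od k (\<lambda>w. w ^ k)"
  unfolding Od_def by (intro exI[of _ 1]) (auto simp: norm_power)

lemma Od_differentiable:
  assumes "(f has_derivative f') (at 0)" shows "Od 1 (\<lambda>w. f w - f 0)"
proof -
  obtain K where K: "\<And>x. norm (f' x) \<le> norm x * K"
    using bounded_linear.bounded[OF has_derivative_bounded_linear[OF assms]] by blast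
  from assms[unfolded has_derivative_at_alt] obtain d where d: "0 < d"
    "\<And>y. norm y < d \<Longrightarrow> norm (f y - f 0 - f' y) \<le> 1 * norm y"
    by (metis diff_zero zero_less_one)
  have "norm (f w - f 0) \<le> (1 + K) * norm w ^ 1" if "norm w < d" for w
    using d(2)[OF that] K[of w] norm_triangle_ineq[of "f w - f 0 - f' w" "f' w"]
    by (simp add: algebra_simps)
  with d(1) show ?thesis unfolding Od_def by blast
qed

lemma Od_differentiable_0:
  assumes "(f has_derivative f') (at 0)" shows "Od 0 f"
  using Od_add[OF Od_mono[OF Od_differentiable[OF assms], of 0] Od_const[of "f 0"]] by simp

lemma has_derivative_shift:
  fixes g :: "'a::real_normed_vector \<Rightarrow> 'b::real_normed_vector"
  assumes "(g has_derivative g') (at (a + w))"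
  shows "((\<lambda>x. g (a + x)) has_derivative g') (at w)"
proof -
  have "((\<lambda>x. a + x) has_derivative (\<lambda>v. v)) (at w)" by (auto intro!: derivative_eq_intros)
  from has_derivative_compose[OF this assms] show ?thesis by simp
qed

lemma csmooth_has_derivative_shift:
  assumes "open U" "csmooth U l" "p \<in> U"
  shows "((\<lambda>w. l (par p (pos p + w))) has_derivative cdiff l p) (at 0)"
  using has_derivative_shift[of "l \<circ> par p" "cdiff l p" "pos p" 0] csmooth_has_cdiff[OF assms] by simp

section \<open>Complex scalars acting through a square root of -1, and leading terms\<close>

lemma bounded_linear_cx: "bounded_linear (cx n)"
proof -
  have "bounded_linear (\<lambda>z. Re z *\<^sub>R 1 + Im z *\<^sub>R n)"
    by (intro bounded_linear_add bounded_linear_compose[OF bounded_linear_scaleR_left]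
        bounded_linear_Re bounded_linear_Im)
  then show ?thesis by (simp add: cx_alt[abs_def])
qed

lemma cx_simps: "cx n (a + b) = cx n a + cx n b" "cx n (a - b) = cx n a - cx n b" "cx n 1 = 1"
  "cx n 0 = 0" "cx n \<i> = n" "cx n (- a) = - cx n a" "cx n (r *\<^sub>R a) = r *\<^sub>R cx n a"
  by (simp_all add: cx_alt algebra_simps)

lemma cx_mult:
  assumes "n * n = - 1" shows "cx n (a * b) = cx n a * cx n b"
proof -
  have "Im a *\<^sub>R (Im b *\<^sub>R (n * n)) = - (Im a * Im b) *\<^sub>R 1" by (simp add: assms)
  then show ?thesis by (simp add: cx_alt algebra_simps)
qed

lemma cx_nonzero:
  assumes "n * n = - 1" "a \<noteq> 0" shows "cx n a \<noteq> 0"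
  using cx_mult[OF assms(1), of a "1 / a"] assms(2) by (auto simp: cx_simps)

lemma Od_cx: "Od k f \<Longrightarrow> Od k (\<lambda>w. cx n (f w))"
  by (rule Od_bounded_linear[OF bounded_linear_cx])

text \<open>Replacing the complex structure at a nearby point by its value at the centre gains one
  order, since \<open>M w - n\<close> is itself of first order. Hence orders can be read off with a
  constant complex structure.\<close>

lemma cx_change:
  assumes "Od 1 (\<lambda>w. M w - n)" "Od k f" shows "Od (k + 1) (\<lambda>w. cx (M w) (f w) - cx n (f w))"
proof -
  have "Od k (\<lambda>w. complex_of_real (Im (f w)))"
    using Od_bounded_linear[OF bounded_linear_Im assms(2)]
    by (rule Od_bounded_linear[OF bounded_linear_of_real])
  then have "Od (k + 1) (\<lambda>w. Im (f w) *\<^sub>R (M w - n))"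
    using Od_bilinear[OF bounded_bilinear_scaleR Od_bounded_linear[OF bounded_linear_Im assms(2)] assms(1)]
    by blast
  then show ?thesis by (simp add: cx_alt algebra_simps)
qed

text \<open>Vanishing to order \<open>k\<close> with the complex structure frozen at its value \<open>n\<close> at the point.\<close>

definition order_at :: "quat \<Rightarrow> (complex \<Rightarrow> quat) \<Rightarrow> nat \<Rightarrow> bool" where
  "order_at n h k \<longleftrightarrow> (\<exists>c. c \<noteq> 0 \<and> Od (k + 1) (\<lambda>w. h w - cx n (w ^ k) * c))"

lemma order_at_imp_Od:
  assumes "order_at n h k" shows "Od k h"
proof -
  from assms obtain c where c: "Od (k + 1) (\<lambda>w. h w - cx n (w ^ k) * c)" unfolding order_at_def by blast
  have "Od (k + 0) (\<lambda>w. cx n (w ^ k) * c)"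
    by (rule Od_mult[OF Od_cx[OF Od_power] Od_const])
  from Od_add[OF Od_mono[OF c, of k] this[unfolded add_0_right]] show ?thesis by simp
qed

text \<open>Multiplication by \<open>(1 / w) ^ k\<close> turns the assumption into
  \<open>norm c \<le> K * C * norm w\<close> for all small nonzero \<open>w\<close>. This is what
  makes leading terms, and with them orders, unique.\<close>

lemma cx_power_not_small:
  assumes n: "n * n = - 1" and "Od (k + 1) (\<lambda>w. cx n (w ^ k) * c)" shows "c = 0"
proof (rule ccontr)
  assume "c \<noteq> 0"
  from OdE[OF assms(2)] obtain C r where 1: "0 \<le> C" "0 < r"
    "\<And>w. norm w < r \<Longrightarrow> norm (cx n (w ^ k) * c) \<le> C * norm w ^ (k + 1)" by metis
  obtain K where K: "0 \<le> K" "\<And>x. norm (cx n x) \<le> norm x * K"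
    using bounded_linear.nonneg_bounded[OF bounded_linear_cx] by blast
  have *: "norm c \<le> K * C * norm w" if w: "w \<noteq> 0" "norm w < r" for w :: complex
  proof -
    have "c = cx n ((1 / w) ^ k * w ^ k) * c"
      using w by (simp add: power_mult_distrib[symmetric] cx_simps)
    also have "\<dots> = cx n ((1 / w) ^ k) * (cx n (w ^ k) * c)" by (simp add: cx_mult[OF n] mult.assoc)
    finally have "norm c = norm (cx n ((1 / w) ^ k)) * norm (cx n (w ^ k) * c)"
      by (metis norm_mult)
    also have "\<dots> \<le> (norm ((1 / w) ^ k) * K) * (C * norm w ^ (k + 1))"
      by (intro mult_mono K 1 w mult_nonneg_nonneg) (use K in auto)
    also have "\<dots> = K * C * norm w * (norm ((1 / w) ^ k * w ^ k))"
      by (simp add: norm_mult norm_power algebra_simps)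
    also have "\<dots> = K * C * norm w" using w by (simp add: power_mult_distrib[symmetric])
    finally show ?thesis .
  qed
  \<comment> \<open>Small enough that \<open>(K * C + 1) * t\<close> is at most half of
    \<open>norm c\<close>; the summand 1 keeps the denominator positive when
    \<open>K * C = 0\<close>.\<close>
  define t where "t = min (r / 2) (norm c / (2 * (K * C + 1)))"
  have KC: "0 \<le> K * C" using K(1) 1(1) by simp
  have t: "0 < t" "t < r" using 1(2) \<open>c \<noteq> 0\<close> KC by (auto simp: t_def)
  have "norm c \<le> K * C * t" using *[of "of_real t"] t by simp
  also have "\<dots> \<le> (K * C + 1) * t" using t by (simp add: distrib_right)
  also have "\<dots> \<le> (K * C + 1) * (norm c / (2 * (K * C + 1)))"
    by (rule mult_left_mono) (use KC in \<open>auto simp: t_def\<close>)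
  also have "\<dots> = norm c / 2"
  proof -
    have "K * C + 1 \<noteq> 0" using KC by linarith
    from mult_divide_mult_cancel_left[OF this, of "norm c" 2] show ?thesis
      by (simp only: times_divide_eq_right mult.commute[of 2])
  qed
  finally show False using \<open>c \<noteq> 0\<close> by simp
qed

lemma order_at_not_Od:
  assumes "n * n = - 1" "order_at n h k" shows "\<not> Od (k + 1) h"
proof
  assume h: "Od (k + 1) h"
  from assms(2) obtain c where c: "c \<noteq> 0" "Od (k + 1) (\<lambda>w. h w - cx n (w ^ k) * c)"
    unfolding order_at_def by blast
  from Od_diff[OF h c(2)] have "Od (k + 1) (\<lambda>w. cx n (w ^ k) * c)" by simp
  with cx_power_not_small[OF assms(1)] c(1) show False by blast
qed

lemma order_at_unique:
  assumes "n * n = - 1" "order_at n h k" "order_at n h m" shows "k = m"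
proof -
  have "\<not> k < m" if "order_at n h k" "order_at n h m" for k m
    using order_at_not_Od[OF assms(1) that(1)] Od_mono[OF order_at_imp_Od[OF that(2)], of "k + 1"] by auto
  then show ?thesis using assms(2,3) by (metis linorder_neqE_nat)
qed

text \<open>An injective holomorphic map has nonzero derivative, which is \<alpha>. The difference
  quotient, extended by \<alpha> at 0, is again holomorphic and so differs from \<alpha> by a term
  of first order; multiplied by \<open>w\<close> this is the quadratic error.\<close>

lemma hol_coord_expansion:
  assumes "hol_coord U z" "p \<in> U" "z p = 0"
  obtains \<alpha> where "\<alpha> \<noteq> 0" "Od 2 (\<lambda>w. z (par p (pos p + w)) - \<alpha> * w)"
proof -
  define W where "W = {w. par p (pos p + w) \<in> U}"
  have U: "open U" "inj_on z U" "(z \<circ> par p) holomorphic_on (par p -` U)"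
    using assms(1) by (auto simp: hol_coord_def)
  have W: "W = (\<lambda>w. pos p + w) -` (par p -` U)" by (auto simp: W_def)
  have "open W" unfolding W by (intro open_vimage open_par_vimage U continuous_intros)
  have "0 \<in> W" using assms(2) by (simp add: W_def)
  define \<zeta> where "\<zeta> = (\<lambda>w. z (par p (pos p + w)))"
  have hol: "\<zeta> holomorphic_on W"
  proof -
    have "((z \<circ> par p) \<circ> (\<lambda>w. pos p + w)) holomorphic_on W"
      by (rule holomorphic_on_compose_gen[OF _ U(3)]) (auto intro!: holomorphic_intros simp: W_def)
    then show ?thesis by (simp add: \<zeta>_def o_def)
  qed
  have inj: "inj_on \<zeta> W"
  proof (rule inj_onI)
    fix x y assume "x \<in> W" "y \<in> W" "\<zeta> x = \<zeta> y"
    then have "par p (pos p + x) = par p (pos p + y)"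
      using inj_onD[OF U(2)] by (auto simp: W_def \<zeta>_def)
    then show "x = y" using injD[OF inj_par] by fastforce
  qed
  define \<alpha> where "\<alpha> = deriv \<zeta> 0"
  have "\<alpha> \<noteq> 0" unfolding \<alpha>_def
    by (rule holomorphic_injective_imp_regular[OF hol \<open>open W\<close> inj \<open>0 \<in> W\<close>])
  define \<eta> where "\<eta> = (\<lambda>w. if w = 0 then \<alpha> else (\<zeta> w - \<zeta> 0) / (w - 0))"
  have "\<eta> holomorphic_on W"
    unfolding \<eta>_def \<alpha>_def
    by (rule pole_lemma[OF hol]) (use \<open>0 \<in> W\<close> \<open>open W\<close> in \<open>simp add: interior_open\<close>)
  then obtain d where "(\<eta> has_field_derivative d) (at 0)"
    using \<open>0 \<in> W\<close> \<open>open W\<close> by (metis at_within_open holomorphic_on_def field_differentiable_def)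
  then have "Od 1 (\<lambda>w. \<eta> w - \<eta> 0)"
    unfolding has_field_derivative_def by (rule Od_differentiable)
  from Od_mult[OF Od_power[of 1] this] have "Od 2 (\<lambda>w. w * (\<eta> w - \<eta> 0))" by (simp add: numeral_2_eq_2)
  moreover have "w * (\<eta> w - \<eta> 0) = z (par p (pos p + w)) - \<alpha> * w" for w
    using assms(3) by (auto simp: \<eta>_def \<zeta>_def field_simps)
  ultimately show ?thesis using that \<open>\<alpha> \<noteq> 0\<close> by simp
qed

lemma Od_power_expansion:
  fixes \<zeta> :: "complex \<Rightarrow> complex"
  assumes "Od 2 (\<lambda>w. \<zeta> w - \<alpha> * w)"
  shows "Od k (\<lambda>w. \<zeta> w ^ k)" "Od (k + 1) (\<lambda>w. \<zeta> w ^ k - \<alpha> ^ k * w ^ k)"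
proof -
  have aw: "Od 1 (\<lambda>w. \<alpha> * w)" using Od_mult[OF Od_const[of \<alpha>] Od_power[of 1]] by simp
  have z1: "Od 1 \<zeta>" using Od_add[OF Od_mono[OF assms, of 1] aw] by simp
  show p: "Od k (\<lambda>w. \<zeta> w ^ k)" for k
  proof (induction k)
    case 0
    show ?case using Od_const[of 1] by simp
  next
    case (Suc k)
    show ?case using Od_mult[OF z1 Suc] by simp
  qed
  show "Od (k + 1) (\<lambda>w. \<zeta> w ^ k - \<alpha> ^ k * w ^ k)"
  proof (induction k)
    case 0
    show ?case using Od_zero by simp
  next
    case (Suc k)
    have "Od (k + 2) (\<lambda>w. \<zeta> w ^ k * (\<zeta> w - \<alpha> * w) + (\<zeta> w ^ k - \<alpha> ^ k * w ^ k) * (\<alpha> * w))"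
      using Od_mult[OF p[of k] assms] Od_mult[OF Suc aw] by (intro Od_add) (simp_all add: numeral_2_eq_2)
    moreover have "\<zeta> w ^ k * (\<zeta> w - \<alpha> * w) + (\<zeta> w ^ k - \<alpha> ^ k * w ^ k) * (\<alpha> * w) =
        \<zeta> w ^ Suc k - \<alpha> ^ Suc k * w ^ Suc k" for w by (simp add: algebra_simps)
    ultimately show ?case by simp
  qed
qed

text \<open>A left inverse of \<open>par p\<close>. The one point that the chart misses is sent to
  0, for the chart at infinity by way of \<open>1 / 0 = 0\<close>.\<close>

definition chart_at :: "cp1 \<Rightarrow> cp1 \<Rightarrow> complex" where
  "chart_at p q = (case p of Fin _ \<Rightarrow> (case q of Fin z \<Rightarrow> z | Infty \<Rightarrow> 0)
     | Infty \<Rightarrow> (case q of Fin z \<Rightarrow> 1 / z | Infty \<Rightarrow> 0))"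

lemma chart_at_par [simp]: "chart_at p (par p w) = w"
  by (cases p) (auto simp: chart_at_def par_Infty)

lemma hol_coord_chart:
  assumes "0 < r"
  shows "hol_coord (par p ` ball (pos p) r) (\<lambda>q. chart_at p q - pos p)"
  unfolding hol_coord_def
proof (intro conjI allI)
  let ?U = "par p ` ball (pos p) r"
  show "open ?U" by (rule open_par_image) simp
  show "inj_on (\<lambda>q. chart_at p q - pos p) ?U" by (auto simp: inj_on_def)
  fix p'
  show "((\<lambda>q. chart_at p q - pos p) \<circ> par p') holomorphic_on (par p' -` ?U)"
  proof (cases "par p' = par p")
    case True
    then have "(\<lambda>q. chart_at p q - pos p) \<circ> par p' = (\<lambda>w. w - pos p)" by (auto simp: fun_eq_iff)
    then show ?thesis by (simp only:) (intro holomorphic_intros)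
  next
    case False
    \<comment> \<open>When the two charts differ, the preimage omits 0, because the centre of either
      chart is the point missed by the other.\<close>
    have nz: "w \<noteq> 0" if "w \<in> par p' -` ?U" for w
      using that False by (cases p; cases p') (auto simp: par_Infty split: if_splits)
    have hol: "(\<lambda>w. 1 / w - pos p) holomorphic_on (par p' -` ?U)"
      by (intro holomorphic_intros) (use nz in auto)
    have "chart_at p (par p' w) = 1 / w" if "w \<noteq> 0" for w
      using False that by (cases p; cases p') (simp_all add: chart_at_def par_Infty)
    with nz show ?thesis by (intro holomorphic_transform[OF hol]) simp
  qed
qed

context trivialized_bundle
begin

lemma N_Od: "Od 1 (\<lambda>w. N (par p (pos p + w)) - N p)"
  using Od_differentiable[OF csmooth_has_derivative_shift[OF open_UNIV N_smooth UNIV_I, of p]] by simp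

text \<open>The definition of order allows any coordinate, any \<phi> and any frame for the
  remainder. In the chart at \<open>p\<close> the coordinate is \<open>\<alpha> * w\<close> to first
  order, which makes \<open>cx (N p) (\<alpha> ^ k) * \<theta> p (\<phi> p)\<close> the leading
  coefficient. The errors from the variation of \<open>N\<close> and \<phi>, from the coordinate and
  from the remainder all have order \<open>k + 1\<close>.\<close>

lemma vanishesD:
  assumes "vanishes_to_order E s p k" "\<And>q. s q \<in> fib E q"
  shows "order_at (N p) (\<lambda>w. \<theta> (par p (pos p + w)) (s (par p (pos p + w)))) k"
proof -
  from assms(1) obtain U z \<phi> e r C where z: "hol_coord U z" "p \<in> U" "z p = 0"
    and \<phi>: "smooth_sec E U \<phi>" "\<phi> p \<noteq> zer E p" and e: "frame E U e"
    and eq: "\<And>q. q \<in> U \<Longrightarrow> s q = add E q (Jscl E q (z q ^ k) (\<phi> q)) (scl E q (e q) (r q))"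
    and r: "\<And>q. q \<in> U \<Longrightarrow> norm (r q) \<le> C * norm (z q) ^ Suc k"
    unfolding vanishes_to_order_def by metis
  have U: "open U" using z(1) by (simp add: hol_coord_def)
  obtain \<alpha> where \<alpha>: "\<alpha> \<noteq> 0" "Od 2 (\<lambda>w. z (par p (pos p + w)) - \<alpha> * w)"
    using hol_coord_expansion[OF z] by blast
  let ?P = "\<lambda>w. par p (pos p + w)"
  note zk = Od_power_expansion[OF \<alpha>(2)]
  have \<phi>': "csmooth U (\<lambda>q. \<theta> q (\<phi> q))" "\<And>q. q \<in> U \<Longrightarrow> \<phi> q \<in> fib E q"
    using \<phi>(1) U smooth_iff by blast+
  have e': "csmooth U (\<lambda>q. \<theta> q (e q))" "\<And>q. q \<in> U \<Longrightarrow> e q \<in> fib E q"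
    using e U smooth_iff unfolding frame_def by blast+
  let ?c = "cx (N p) (\<alpha> ^ k) * \<theta> p (\<phi> p)"
  have "?c \<noteq> 0"
    using cx_nonzero[OF N_sq, of "\<alpha> ^ k"] \<alpha>(1) eq_zer_iff[OF \<phi>'(2)[OF z(2)]] \<phi>(2) by simp
  obtain \<rho> where \<rho>: "0 < \<rho>" "\<And>w. norm w < \<rho> \<Longrightarrow> ?P w \<in> U"
  proof -
    have "open (par p -` U)" "pos p \<in> par p -` U" using open_par_vimage[OF U] z(2) by auto
    then obtain \<rho> where "0 < \<rho>" "ball (pos p) \<rho> \<subseteq> par p -` U" using openE by blast
    then show ?thesis using that[of \<rho>] by (auto simp: subset_iff dist_norm)
  qed
  \<comment> \<open>The remainder \<open>r\<close> is controlled on \<open>U\<close> only, so it is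
    cut off by 0 outside the radius \<rho>; this does not affect the germ at 0.\<close>
  have R: "Od (k + 1) (\<lambda>w. \<theta> (?P w) (e (?P w)) * (if norm w < \<rho> then r (?P w) else 0))"
  proof -
    have "Od (k + 1) (\<lambda>w. if norm w < \<rho> then r (?P w) else 0)"
    proof -
      from OdE[OF zk(1)[of "Suc k"]] obtain C' r' where 1: "0 \<le> C'" "0 < r'"
        "\<And>w. norm w < r' \<Longrightarrow> norm (z (?P w) ^ Suc k) \<le> C' * norm w ^ Suc k" by metis
      have "norm (if norm w < \<rho> then r (?P w) else 0) \<le> (\<bar>C\<bar> * C') * norm w ^ (k + 1)" if "norm w < r'" for w
      proof (cases "norm w < \<rho>")
        case True
        have "norm (r (?P w)) \<le> C * norm (z (?P w)) ^ Suc k" by (rule r[OF \<rho>(2)[OF True]])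
        also have "\<dots> \<le> \<bar>C\<bar> * norm (z (?P w) ^ Suc k)"
          unfolding norm_power by (intro mult_right_mono) auto
        also have "\<dots> \<le> \<bar>C\<bar> * (C' * norm w ^ Suc k)"
          by (intro mult_left_mono 1(3) that) auto
        finally show ?thesis using True by (simp add: mult.assoc)
      qed (use 1(1) in simp)
      with 1(2) show ?thesis unfolding Od_def by blast
    qed
    from Od_mult[OF Od_differentiable_0[OF csmooth_has_derivative_shift[OF U e'(1) z(2)]] this]
    show ?thesis by simp
  qed
  have "Od (k + 1) (\<lambda>w. (cx (N (?P w)) (z (?P w) ^ k) - cx (N p) (z (?P w) ^ k)) * \<theta> (?P w) (\<phi> (?P w))
      + cx (N p) (z (?P w) ^ k) * (\<theta> (?P w) (\<phi> (?P w)) - \<theta> p (\<phi> p))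
      + cx (N p) (z (?P w) ^ k - \<alpha> ^ k * w ^ k) * \<theta> p (\<phi> p)
      + \<theta> (?P w) (e (?P w)) * (if norm w < \<rho> then r (?P w) else 0))" (is "Od _ ?F")
  proof (intro Od_add R)
    note d = csmooth_has_derivative_shift[OF U \<phi>'(1) z(2)]
    show "Od (k + 1) (\<lambda>w. (cx (N (?P w)) (z (?P w) ^ k) - cx (N p) (z (?P w) ^ k)) * \<theta> (?P w) (\<phi> (?P w)))"
      using Od_mult[OF cx_change[OF N_Od zk(1)] Od_differentiable_0[OF d]] by simp
    show "Od (k + 1) (\<lambda>w. cx (N p) (z (?P w) ^ k) * (\<theta> (?P w) (\<phi> (?P w)) - \<theta> p (\<phi> p)))"
      using Od_mult[OF Od_cx[OF zk(1)] Od_differentiable[OF d]] by simp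
    show "Od (k + 1) (\<lambda>w. cx (N p) (z (?P w) ^ k - \<alpha> ^ k * w ^ k) * \<theta> p (\<phi> p))"
      using Od_mult[OF Od_cx[OF zk(2)] Od_const] by simp
  qed
  then have "Od (k + 1) (\<lambda>w. \<theta> (?P w) (s (?P w)) - cx (N p) (w ^ k) * ?c)"
  proof (rule Od_cong[OF _ \<rho>(1)])
    fix w :: complex assume w: "norm w < \<rho>"
    have "cx (N p) (w ^ k) * ?c = cx (N p) (\<alpha> ^ k * w ^ k) * \<theta> p (\<phi> p)"
      by (simp add: cx_mult[OF N_sq, symmetric] mult.assoc[symmetric]) (simp add: mult.commute)
    moreover have "\<theta> (?P w) (s (?P w)) = cx (N (?P w)) (z (?P w) ^ k) * \<theta> (?P w) (\<phi> (?P w)) +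
        \<theta> (?P w) (e (?P w)) * r (?P w)"
      using eq[OF \<rho>(2)[OF w]] \<phi>'(2)[OF \<rho>(2)[OF w]] e'(2)[OF \<rho>(2)[OF w]]
      by (simp add: eqs ins Jscl_in Jscl_eq)
    ultimately show "?F w = \<theta> (?P w) (s (?P w)) - cx (N p) (w ^ k) * ?c"
      using w by (simp add: cx_simps algebra_simps)
  qed
  with \<open>?c \<noteq> 0\<close> show ?thesis unfolding order_at_def by blast
qed

text \<open>The standard chart, the section with constant coordinate \<open>c\<close> and the frame
  with coordinate 1 serve as witnesses; the remainder is simply the difference. The complex
  structure has to be unfrozen first, at the cost of an error of order \<open>k + 1\<close>.\<close>

lemma vanishesI:
  assumes "order_at (N p) (\<lambda>w. \<theta> (par p (pos p + w)) (s (par p (pos p + w)))) k"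
    and s: "\<And>q. s q \<in> fib E q"
  shows "vanishes_to_order E s p k"
proof -
  let ?P = "\<lambda>w. par p (pos p + w)"
  from assms(1) obtain c where c: "c \<noteq> 0"
    "Od (k + 1) (\<lambda>w. \<theta> (?P w) (s (?P w)) - cx (N p) (w ^ k) * c)" unfolding order_at_def by blast
  have "Od (k + 1) (\<lambda>w. (cx (N (?P w)) (w ^ k) - cx (N p) (w ^ k)) * c)"
    using Od_mult[OF cx_change[OF N_Od Od_power] Od_const] by simp
  from Od_diff[OF c(2) this] have
    "Od (k + 1) (\<lambda>w. \<theta> (?P w) (s (?P w)) - cx (N (?P w)) (w ^ k) * c)"
    by (simp add: algebra_simps)
  then obtain C r where Cr: "0 < r"
    "\<And>w. norm w < r \<Longrightarrow> norm (\<theta> (?P w) (s (?P w)) - cx (N (?P w)) (w ^ k) * c) \<le> C * norm w ^ (k + 1)"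
    unfolding Od_def by blast
  let ?z = "\<lambda>q. chart_at p q - pos p" and ?U = "par p ` ball (pos p) r"
  have U: "open ?U" by (rule open_par_image) simp
  have p: "p \<in> ?U" "?z p = 0"
    using Cr(1) chart_at_par[of p "pos p"] by (auto intro!: image_eqI[of _ _ "pos p"])
  show ?thesis
    unfolding vanishes_to_order_def
  proof (intro exI conjI ballI)
    show "hol_coord ?U ?z" by (rule hol_coord_chart[OF Cr(1)])
    show "p \<in> ?U" "?z p = 0" by (rule p)+
    show "smooth_sec E ?U (\<lambda>q. unt q c)" by (rule unt_smooth[OF U csmooth_const])
    show "unt p c \<noteq> zer E p" using eq_zer_iff[of "unt p c" p] c(1) by simp
    show "frame E ?U (\<lambda>q. unt q 1)"
      unfolding frame_def using eq_zer_iff[of "unt q 1" q for q]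
      by (auto intro!: unt_smooth[OF U] csmooth_const)
    fix q assume "q \<in> ?U"
    then obtain w where w: "q = ?P w" "norm w < r"
      by (auto simp: dist_norm norm_minus_commute) (metis add_diff_cancel_left' diff_add_cancel add.commute)
    show "s q = add E q (Jscl E q (?z q ^ k) (unt q c))
        (scl E q (unt q 1) (\<theta> q (s q) - cx (N q) (?z q ^ k) * c))"
      by (rule eqI[where p = q]) (simp_all add: s ins eqs Jscl_in Jscl_eq)
    show "norm (\<theta> q (s q) - cx (N q) (?z q ^ k) * c) \<le> C * norm (?z q) ^ Suc k"
      using Cr(2)[OF w(2)] by (simp add: w(1))
  qed
qed

lemma vanishing_orders_eq:
  assumes "\<And>s q. s \<in> H \<Longrightarrow> s q \<in> fib E q"
  shows "vanishing_orders E H p = {k. \<exists>s\<in>H. (\<exists>q. \<theta> q (s q) \<noteq> 0) \<and>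
    order_at (N p) (\<lambda>w. \<theta> (par p (pos p + w)) (s (par p (pos p + w)))) k}"
proof -
  have "s \<noteq> zer E \<longleftrightarrow> (\<exists>q. \<theta> q (s q) \<noteq> 0)" if "s \<in> H" for s
    using assms[OF that] eq_zer_iff by (auto simp: fun_eq_iff)
  then show ?thesis
    unfolding vanishing_orders_def using vanishesD vanishesI assms by (metis (no_types, lifting))
qed

end

section \<open>Degree and Willmore energy\<close>

lemma quat_square_minus_one:
  assumes "n * n = (- 1 :: quat)" shows "qre n = 0" "norm n = 1"
proof -
  have c: "(qre n)\<^sup>2 - (qim1 n)\<^sup>2 - (qim2 n)\<^sup>2 - (qim3 n)\<^sup>2 = - 1"
    "qre n * qim1 n = 0" "qre n * qim2 n = 0" "qre n * qim3 n = 0"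
    using assms by (auto simp: quat_eq_iff times_quat_def one_quat_def uminus_quat_def power2_eq_square)
  show "qre n = 0"
  proof (rule ccontr)
    assume "qre n \<noteq> 0"
    with c have "(qre n)\<^sup>2 = - 1" by simp
    then show False by (metis zero_le_power2 neg_0_le_iff_le not_one_le_zero)
  qed
  with c show "norm n = 1" by (simp add: norm_quat_def qnormsq_def)
qed

lemma quat_anticommute:
  assumes "n * n = (- 1 :: quat)" "n * a + a * n = 0" shows "qre a = 0" "n \<bullet> a = 0"
proof -
  note re = quat_square_minus_one(1)[OF assms(1)]
  have c: "qre a * qim1 n = 0" "qre a * qim2 n = 0" "qre a * qim3 n = 0"
    and d: "qim1 n * qim1 a + qim2 n * qim2 a + qim3 n * qim3 a = 0"
    using assms(2) re
    by (simp_all add: quat_eq_iff times_quat_def plus_quat_def zero_quat_def algebra_simps)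
  show "qre a = 0"
  proof (rule ccontr)
    assume "qre a \<noteq> 0"
    with c have "n = 0" using re by (simp add: quat_eq_iff zero_quat_def)
    with assms(1) show False by simp
  qed
  with d show "n \<bullet> a = 0" by (simp add: inner_quat_def)
qed

lemma quat_imaginary_square: "qre x = 0 \<Longrightarrow> x * x = - of_real ((norm x)\<^sup>2)"
  by (simp add: quat_eq_iff times_quat_def of_real_quat uminus_quat_def norm_quat_def qnormsq_def
      power2_eq_square)

lemma qre_simps: "qre (x + y) = qre x + qre y" "qre (x - y) = qre x - qre y" "qre (- x) = - qre x"
  "qre (r *\<^sub>R x) = r * qre x" "qre 0 = 0"
  by (simp_all add: quat_vector_defs)

lemma quat_re_mult: "qre (x * y) = qcnj x \<bullet> y"
  by (simp add: times_quat_def inner_quat_def qcnj_def)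

lemma quat_cnj_imaginary: "qre x = 0 \<Longrightarrow> qcnj x = - x"
  by (simp add: qcnj_def uminus_quat_def)

lemma DIM_quat: "DIM(quat) = 4"
  by (simp add: Basis_quat_def one_quat_def qi_def qj_def qk_def)

text \<open>Willmore energy and degree of the trivial bundle with complex structure \<open>N\<close>.\<close>

definition willm :: "(cp1 \<Rightarrow> quat) \<Rightarrow> real" where
  "willm N = 1 / 4 * (LINT z|lborel. (norm (N (Fin z) * cdiff N (Fin z) 1 - cdiff N (Fin z) \<i>))\<^sup>2)"

definition has_deg :: "(cp1 \<Rightarrow> quat) \<Rightarrow> int \<Rightarrow> bool" where
  "has_deg N d \<longleftrightarrow> (\<exists>l0 l1 g.
     csmooth (- {Infty}) l0 \<and> (\<forall>p\<in>- {Infty}. l0 p \<noteq> 0 \<and> N p * l0 p = l0 p * qi) \<and>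
     csmooth (- {Fin 0}) l1 \<and> (\<forall>p\<in>- {Fin 0}. l1 p \<noteq> 0 \<and> N p * l1 p = l1 p * qi) \<and>
     (\<forall>z. z \<noteq> 0 \<longrightarrow> l1 (Fin z) = l0 (Fin z) * qc (g z)) \<and>
     winding_number (g \<circ> circlepath 0 1) 0 = of_int d)"

lemma anticommute_cdiff:
  assumes "\<And>p. N p * N p = (- 1 :: quat)" "csmooth UNIV N"
  shows "N p * cdiff N p v + cdiff N p v * N p = 0"
  using cdiff_mult[OF open_UNIV assms(2,2) UNIV_I, of p v] assms(1) by simp

context trivialized_bundle
begin

lemma hat_frame_iff:
  assumes "open U"
  shows "hat_frame E U s \<longleftrightarrow> (\<forall>p\<in>U. s p \<in> fib E p) \<and> csmooth U (\<lambda>p. \<theta> p (s p)) \<and>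
    (\<forall>p\<in>U. \<theta> p (s p) \<noteq> 0 \<and> N p * \<theta> p (s p) = \<theta> p (s p) * qi)"
proof (cases "smooth_sec E U s")
  case True
  then have s: "p \<in> U \<Longrightarrow> s p \<in> fib E p" for p using assms smooth_iff by blast
  have "Jstr E p (s p) = scl E p (s p) qi \<longleftrightarrow> N p * \<theta> p (s p) = \<theta> p (s p) * qi"
    "s p \<noteq> zer E p \<longleftrightarrow> \<theta> p (s p) \<noteq> 0" if "p \<in> U" for p
    using s[OF that] by (simp_all add: eq_iff[of _ p] ins eqs)
  with True s show ?thesis
    unfolding hat_frame_def frame_def using smooth_iff[OF assms] by auto
next
  case False
  then show ?thesis unfolding hat_frame_def frame_def using smooth_iff[OF assms] by blast
qed

lemma has_degree_iff: "has_degree E d \<longleftrightarrow> has_deg N d"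
proof
  assume "has_degree E d"
  then obtain s0 s1 g where *: "hat_frame E (- {Infty}) s0" "hat_frame E (- {Fin 0}) s1"
    "\<And>z. z \<noteq> 0 \<Longrightarrow> s1 (Fin z) = scl E (Fin z) (s0 (Fin z)) (qc (g z))"
    "winding_number (g \<circ> circlepath 0 1) 0 = of_int d"
    unfolding has_degree_def by blast
  note h0 = *(1)[unfolded hat_frame_iff[OF open_Compl_Infty]]
  note h1 = *(2)[unfolded hat_frame_iff[OF open_Compl_Fin_0]]
  show "has_deg N d"
    unfolding has_deg_def
    by (rule exI[of _ "\<lambda>p. \<theta> p (s0 p)"], rule exI[of _ "\<lambda>p. \<theta> p (s1 p)"], rule exI[of _ g])
      (use h0 h1 *(3,4) in \<open>auto simp: eqs\<close>)
next
  assume "has_deg N d"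
  then obtain l0 l1 g where *: "csmooth (- {Infty}) l0"
    "\<forall>p\<in>- {Infty}. l0 p \<noteq> 0 \<and> N p * l0 p = l0 p * qi"
    "csmooth (- {Fin 0}) l1" "\<forall>p\<in>- {Fin 0}. l1 p \<noteq> 0 \<and> N p * l1 p = l1 p * qi"
    "\<And>z. z \<noteq> 0 \<Longrightarrow> l1 (Fin z) = l0 (Fin z) * qc (g z)"
    "winding_number (g \<circ> circlepath 0 1) 0 = of_int d"
    unfolding has_deg_def by blast
  have "unt (Fin z) (l1 (Fin z)) = scl E (Fin z) (unt (Fin z) (l0 (Fin z))) (qc (g z))" if "z \<noteq> 0" for z
    by (rule eqI[where p = "Fin z"]) (simp_all add: ins eqs *(5)[OF that])
  then show "has_degree E d"
    unfolding has_degree_def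
    using *(1-4,6)
    by (intro exI[of _ "\<lambda>p. unt p (l0 p)"] exI[of _ "\<lambda>p. unt p (l1 p)"] exI[of _ g])
      (simp add: hat_frame_iff open_Compl_Infty open_Compl_Fin_0)
qed

end

section \<open>The Hopf field and its energy density in a trivialisation\<close>

context trivialized_hol
begin

text \<open>In the trivialisation \<open>Q(v)\<close> is left multiplication by this quaternion; it
  involves \<open>N\<close> and its differential only.\<close>

definition hq :: "cp1 \<Rightarrow> complex \<Rightarrow> quat" where
  "hq p v = (1 / 4) *\<^sub>R (N p * cdiff N p v - cdiff N p (\<i> * v))"

text \<open>In \<open>D + J D J\<close> the derivatives of the section cancel because
  \<open>N N = - 1\<close>; what survives is the derivative of \<open>N\<close> from the product
  rule.\<close>

lemma hopf_eq:
  assumes U: "open U" and s: "smooth_sec E U s" and p: "p \<in> U"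
  shows "hopf E D s p v \<in> fib E p" "\<theta> p (hopf E D s p v) = hq p v * \<theta> p (s p)"
proof -
  let ?l = "\<lambda>q. \<theta> q (s q)"
  have l: "csmooth U ?l" and s_in: "q \<in> U \<Longrightarrow> s q \<in> fib E q" for q using U s smooth_iff by blast+
  have la: "csmooth U (\<lambda>q. N q * ?l q)" by (intro csmooth_mult N_smooth_on l)
  have "csmooth U (\<lambda>q. \<theta> q (Jstr E q (s q)))"
    by (rule csmooth_cong[OF U _ la]) (simp add: eqs s_in)
  then have sa: "smooth_sec E U (\<lambda>q. Jstr E q (s q))" using U s_in by (simp add: smooth_iff ins)
  have c: "cdiff (\<lambda>q. \<theta> q (Jstr E q (s q))) p = cdiff (\<lambda>q. N q * ?l q) p"
    by (rule cdiff_cong[OF U la _ p]) (simp add: eqs s_in)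
  have m: "cdiff (\<lambda>q. N q * ?l q) p w = N p * cdiff ?l p w + cdiff N p w * ?l p" for w
    by (rule cdiff_mult[OF U N_smooth_on l p])
  have NN: "N p * (N p * x) = - x" for x using N_sq[of p] by (simp add: mult.assoc[symmetric])
  show "hopf E D s p v \<in> fib E p"
    by (simp add: hopf_def ins D_in[OF U s p] D_in[OF U sa p])
  have "\<theta> p (hopf E D s p v) =
      (1 / 2) *\<^sub>R ((1 / 2) *\<^sub>R (cdiff ?l p v + N p * cdiff ?l p (\<i> * v)) +
        N p * ((1 / 2) *\<^sub>R ((N p * cdiff ?l p v + cdiff N p v * ?l p) +
          N p * (N p * cdiff ?l p (\<i> * v) + cdiff N p (\<i> * v) * ?l p))))"
    by (simp only: hopf_def ins eqs D_in[OF U s p] D_in[OF U sa p] D_eq[OF U s p] D_eq[OF U sa p]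
        c m quat_half)
  also have "\<dots> = (1 / 2) *\<^sub>R ((1 / 2) *\<^sub>R ((N p * cdiff N p v - cdiff N p (\<i> * v)) * ?l p))"
    by (simp add: distrib_left distrib_right left_diff_distrib right_diff_distrib NN mult.assoc
        scaleR_right_distrib scaleR_right_diff_distrib)
  finally show "\<theta> p (hopf E D s p v) = hq p v * \<theta> p (s p)"
    by (simp add: hq_def)
qed

lemma hopf_at_eq:
  assumes x: "x \<in> fib E p"
  shows "hopf_at E D p v x \<in> fib E p \<and> \<theta> p (hopf_at E D p v x) = hq p v * \<theta> p x"
proof -
  let ?y = "unt p (hq p v * \<theta> p x)"
  have "hopf_at E D p v x = ?y"
    unfolding hopf_at_def
  proof (rule the_equality)
    let ?s = "\<lambda>q. unt q (\<theta> p x)"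
    have s: "smooth_sec E UNIV ?s" by (rule unt_smooth[OF open_UNIV csmooth_const])
    have "?s p = x" using x by (rule unt_theta)
    moreover have "?y = hopf E D ?s p v"
      by (rule eqI[where p = p]) (simp_all add: hopf_eq[OF open_UNIV s UNIV_I])
    ultimately show "\<exists>U s. open U \<and> p \<in> U \<and> smooth_sec E U s \<and> s p = x \<and> ?y = hopf E D s p v"
      using s by (intro exI[of _ UNIV] exI[of _ ?s]) auto
  next
    fix y assume "\<exists>U s. open U \<and> p \<in> U \<and> smooth_sec E U s \<and> s p = x \<and> y = hopf E D s p v"
    then obtain U s where *: "open U" "p \<in> U" "smooth_sec E U s" "s p = x" "y = hopf E D s p v" by blast
    show "y = ?y"
      using *(4,5) by (intro eqI[where p = p]) (simp_all add: hopf_eq[OF *(1,3,2)])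
  qed
  then show ?thesis by simp
qed

lemma real_trace_scalar:
  assumes B: "\<And>x. x \<in> fib E p \<Longrightarrow> B x \<in> fib E p \<and> \<theta> p (B x) = of_real t * \<theta> p x"
  shows "real_trace E p B = 4 * t"
proof -
  define e where "e = (SOME e. e \<in> fib E p \<and> e \<noteq> zer E p)"
  have "unt p 1 \<in> fib E p \<and> unt p 1 \<noteq> zer E p" using eq_zer_iff[of "unt p 1" p] by simp
  then have e: "e \<in> fib E p" "\<theta> p e \<noteq> 0"
    unfolding e_def using someI_ex[of "\<lambda>e. e \<in> fib E p \<and> e \<noteq> zer E p"] eq_zer_iff by blast+
  have "(THE \<mu>. B (scl E p e b) = scl E p e \<mu>) = t *\<^sub>R b" for b
  proof (rule the_equality)
    have *: "B (scl E p e b) = scl E p e \<mu> \<longleftrightarrow> t *\<^sub>R (\<theta> p e * b) = \<theta> p e * \<mu>" for \<mu>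
      using e B[of "scl E p e b"] by (simp add: eq_iff[of _ p] ins eqs of_real_def)
    show "B (scl E p e b) = scl E p e (t *\<^sub>R b)" unfolding * by simp
    fix \<mu> assume "B (scl E p e b) = scl E p e \<mu>"
    then have "\<theta> p e * (t *\<^sub>R b) = \<theta> p e * \<mu>" unfolding * by (simp only: mult_scaleR_right)
    with e(2) show "\<mu> = t *\<^sub>R b" by (metis mult_left_cancel)
  qed
  then have "real_trace E p B = (\<Sum>b\<in>(Basis::quat set). t)"
    unfolding real_trace_def e_def[symmetric] Let_def by (intro sum.cong) simp_all
  then show ?thesis by (simp add: DIM_quat)
qed

text \<open>Since \<open>dN\<close> anticommutes with \<open>N\<close>, both \<open>Q(1)\<close> and
  \<open>Q(i) = - N Q(1)\<close> are imaginary, and they have the same norm. Hence \<open>Q\<close>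
  wedge \<open>*Q\<close> is the real scalar \<open>2 |Q(1)|^2\<close>, whose trace is
  \<open>8 |Q(1)|^2\<close>; the factor 1/16 coming from \<open>hq\<close> leaves 1/2.\<close>

lemma hopf_density_eq:
  "hopf_density E D p = 1 / 2 * (norm (N p * cdiff N p 1 - cdiff N p \<i>))\<^sup>2"
proof -
  let ?a = "cdiff N p 1" and ?b = "cdiff N p \<i>"
  have lin: "linear (cdiff N p)" by (rule cdiff_linear[OF open_UNIV N_smooth UNIV_I])
  have ac: "N p * cdiff N p v + cdiff N p v * N p = 0" for v
    by (rule anticommute_cdiff[OF N_sq N_smooth])
  note im = quat_anticommute[OF N_sq ac]
  have NN: "N p * (N p * x) = - x" for x using N_sq[of p] by (simp add: mult.assoc[symmetric])
  have m1: "cdiff N p (- 1) = - ?a" using lin by (rule linear_neg)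
  define Q where "Q = (1 / 4) *\<^sub>R (N p * ?a - ?b)"
  have q1: "hq p 1 = Q" by (simp add: hq_def Q_def)
  have qm: "hq p (- 1) = - Q"
    using linear_neg[OF lin, of 1] linear_neg[OF lin, of \<i>]
    by (simp add: hq_def Q_def scaleR_minus_right[symmetric] del: scaleR_minus_right)
  have qi: "hq p \<i> = - (N p * Q)" by (simp add: hq_def Q_def NN m1 right_diff_distrib algebra_simps)
  have reN: "qcnj (N p) = - N p" by (rule quat_cnj_imaginary[OF quat_square_minus_one(1)[OF N_sq]])
  have re: "qre (N p * ?a - ?b) = 0" "qre (N p * (N p * ?a - ?b)) = 0"
    using im by (simp_all add: qre_simps quat_re_mult reN right_diff_distrib NN)
  have reQ: "qre Q = 0" "qre (N p * Q) = 0"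
    using re by (simp_all add: Q_def qre_simps)
  have nQ: "norm (N p * Q) = norm Q" using quat_square_minus_one(2)[OF N_sq] by (simp add: norm_mult)
  have "hopf_density E D p = 4 * (2 * (norm Q)\<^sup>2)"
    unfolding hopf_density_def
  proof (rule real_trace_scalar, intro conjI)
    fix x assume x: "x \<in> fib E p"
    let ?y = "add E p (hopf_at E D p 1 (hopf_at E D p (\<i> * \<i>) x))
      (scl E p (hopf_at E D p \<i> (hopf_at E D p (\<i> * 1) x)) (- 1))"
    show "?y \<in> fib E p" using x by (simp add: ins hopf_at_eq)
    have "\<theta> p ?y = - (Q * Q + (N p * Q) * (N p * Q)) * \<theta> p x"
      using x by (simp add: ins eqs hopf_at_eq q1 qm qi algebra_simps)
    also have "Q * Q + (N p * Q) * (N p * Q) = - of_real (2 * (norm Q)\<^sup>2)"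
      unfolding quat_imaginary_square[OF reQ(1)] quat_imaginary_square[OF reQ(2)] nQ by (simp only: of_real_mult of_real_numeral) (simp add: mult_2)
    finally show "\<theta> p ?y = of_real (2 * (norm Q)\<^sup>2) * \<theta> p x" by simp
  qed
  then show ?thesis by (simp add: Q_def power_mult_distrib power2_eq_square)
qed

lemma willmore_eq: "willmore E D = willm N"
  unfolding willmore_def willm_def hopf_density_eq by simp

end

section \<open>Trivialisation by a nowhere vanishing section\<close>

definition coord :: "'v qbundle \<Rightarrow> (cp1 \<Rightarrow> 'v) \<Rightarrow> cp1 \<Rightarrow> 'v \<Rightarrow> quat" where
  "coord E \<psi> p x = (THE \<mu>. x = scl E p (\<psi> p) \<mu>)"

text \<open>A nonzero difference of scalars is invertible, so if it annihilated \<open>x\<close>,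
  then \<open>x\<close> itself would be zero.\<close>

lemma right_qspace_cancel:
  assumes V: "right_qspace V z a s" and x: "x \<in> V" "x \<noteq> z" and eq: "s x \<mu> = s x \<nu>"
  shows "\<mu> = \<nu>"
proof (rule ccontr)
  assume "\<mu> \<noteq> \<nu>"
  have add: "s x (\<mu> + \<nu>) = a (s x \<mu>) (s x \<nu>)" and mul: "s (s x \<mu>) \<nu> = s x (\<mu> * \<nu>)"
    and one: "s x 1 = x" and zero: "s x 0 = z" for \<mu> \<nu>
    using V x(1) unfolding right_qspace_def by blast+
  have "s x (\<mu> - \<nu>) = a (s x \<nu>) (s x (- \<nu>))" using add[of \<mu> "- \<nu>"] eq by simp
  then have "s x (\<mu> - \<nu>) = z" using add[of \<nu> "- \<nu>"] zero by simp
  then have "s x ((\<mu> - \<nu>) * inverse (\<mu> - \<nu>)) = s x (0 * inverse (\<mu> - \<nu>))"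
    using mul[symmetric] zero by metis
  with \<open>\<mu> \<noteq> \<nu>\<close> one zero x(2) show False by simp
qed

text \<open>Every vector is \<open>\<psi> \<mu>\<close> for a unique \<mu>, its coordinate. As
  \<open>J\<close> is quaternionic linear, \<open>J \<psi> = \<psi> N\<close> makes it left
  multiplication by \<open>N\<close>; as \<open>D \<psi> = 0\<close>, the Leibniz rule reduces
  \<open>D\<close> to its second summand.\<close>

lemma trivialization:
  fixes E :: "'v qbundle" and D :: "'v dop"
  assumes hol: "hol_line_bundle E D" and \<psi>: "\<psi> \<in> H0 E D" "\<And>p. \<psi> p \<noteq> zer E p"
    and J: "\<And>p. Jstr E p (\<psi> p) = scl E p (\<psi> p) (N p)"
    and N: "\<And>p. N p * N p = - 1" "csmooth UNIV N"
    and restr: "\<And>U V s. open U \<Longrightarrow> smooth_sec E U s \<Longrightarrow> open V \<Longrightarrow> V \<subseteq> U \<Longrightarrow> smooth_sec E V s"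
  shows "trivialized_hol E (coord E \<psi>) N D"
    and "\<And>p. coord E \<psi> p (\<psi> p) = 1"
proof -
  note cq = hol[unfolded hol_line_bundle_def, THEN conjunct1]
  note lb = cq[unfolded complex_qline_bundle_def, THEN conjunct1]
  note lbs = lb[unfolded quaternionic_line_bundle_def]
  note lb1 = lbs[THEN conjunct1, THEN spec]
  note lb2 = lbs[THEN conjunct2, THEN conjunct1, THEN spec, THEN spec]
  note lb3 = lbs[THEN conjunct2, THEN conjunct2, THEN conjunct1, THEN spec, THEN spec]
  note loc = lbs[THEN conjunct2, THEN conjunct2, THEN conjunct2, THEN spec]
  have rq: "right_qspace (fib E p) (zer E p) (add E p) (scl E p)"
    and rng: "\<exists>x\<in>fib E p. x \<noteq> zer E p \<and> fib E p = range (scl E p x)" for p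
    using lb1[of p] by simp_all
  have sec_in: "open U \<Longrightarrow> smooth_sec E U s \<Longrightarrow> p \<in> U \<Longrightarrow> s p \<in> fib E p" for U s p
    using lb2[of U s] by simp
  have sec_local: "open U \<Longrightarrow> smooth_sec E U s \<longleftrightarrow>
      (\<forall>p\<in>U. \<exists>V. open V \<and> p \<in> V \<and> V \<subseteq> U \<and> smooth_sec E V s)" for U s
    using lb3[of U s] by (rule mp)
  have \<psi>_sm: "smooth_sec E UNIV \<psi>" and D\<psi>: "D \<psi> p v = zer E p" for p v
    using \<psi>(1) by (auto simp: H0_def holomorphic_sec_def)
  have \<psi>_in: "\<psi> p \<in> fib E p" for p using sec_in[OF open_UNIV \<psi>_sm] by simp
  have add_in: "x \<in> fib E p \<Longrightarrow> y \<in> fib E p \<Longrightarrow> add E p x y \<in> fib E p" for p x y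
    using rq[of p] by (simp add: right_qspace_def)
  have scl_in: "x \<in> fib E p \<Longrightarrow> scl E p x \<mu> \<in> fib E p" for p x \<mu>
    using rq[of p] by (simp add: right_qspace_def)
  have scl_add: "x \<in> fib E p \<Longrightarrow> scl E p x (\<mu> + \<nu>) = add E p (scl E p x \<mu>) (scl E p x \<nu>)" for p x \<mu> \<nu>
    using rq[of p] by (simp add: right_qspace_def)
  have scl_mul: "x \<in> fib E p \<Longrightarrow> scl E p (scl E p x \<mu>) \<nu> = scl E p x (\<mu> * \<nu>)" for p x \<mu> \<nu>
    using rq[of p] by (simp add: right_qspace_def)
  have scl_01: "x \<in> fib E p \<Longrightarrow> scl E p x 1 = x" "x \<in> fib E p \<Longrightarrow> scl E p x 0 = zer E p" for p x
    using rq[of p] by (simp_all add: right_qspace_def)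
  have zer_in: "zer E p \<in> fib E p" for p using rq[of p] by (simp add: right_qspace_def)
  have cancel: "x \<in> fib E p \<Longrightarrow> x \<noteq> zer E p \<Longrightarrow> scl E p x \<mu> = scl E p x \<nu> \<Longrightarrow> \<mu> = \<nu>" for p x \<mu> \<nu>
    by (rule right_qspace_cancel[OF rq])
  have gen: "fib E p = range (scl E p x)" if x: "x \<in> fib E p" "x \<noteq> zer E p" for p x
  proof -
    obtain e where e: "e \<in> fib E p" "fib E p = range (scl E p e)" using rng by blast
    with x obtain \<mu> where \<mu>: "x = scl E p e \<mu>" by blast
    have "\<mu> \<noteq> 0" using x(2) \<mu> scl_01(2)[OF e(1)] by auto
    then have "scl E p e \<nu> = scl E p x (inverse \<mu> * \<nu>)" for \<nu>
      using scl_mul[OF e(1)] \<mu> by (simp add: mult.assoc[symmetric])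
    then have "fib E p \<subseteq> range (scl E p x)" unfolding e(2) by auto
    with scl_in[OF x(1)] show ?thesis by blast
  qed
  let ?\<theta> = "coord E \<psi>"
  have \<theta>_scl: "?\<theta> p (scl E p (\<psi> p) \<mu>) = \<mu>" for p \<mu>
    unfolding coord_def by (rule the_equality) (auto dest: cancel[OF \<psi>_in \<psi>(2)])
  have rep: "x = scl E p (\<psi> p) (?\<theta> p x)" if "x \<in> fib E p" for p x
    using that gen[OF \<psi>_in \<psi>(2)] \<theta>_scl by auto
  show "?\<theta> p (\<psi> p) = 1" for p using \<theta>_scl[of p 1] scl_01(1)[OF \<psi>_in] by simp
  \<comment> \<open>Compared with a local frame \<open>e\<close>, the section \<psi> is
    \<open>e \<mu>\<close> with \<mu> smooth and nowhere zero. This lets \<psi> replace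
    \<open>e\<close> as the frame in which smoothness is tested.\<close>
  have near: "\<exists>V e \<mu>. open V \<and> p \<in> V \<and> V \<subseteq> U \<and> csmooth V \<mu> \<and> (\<forall>q\<in>V. e q \<in> fib E q \<and> e q \<noteq> zer E q \<and>
      \<mu> q \<noteq> 0 \<and> \<psi> q = scl E q (e q) (\<mu> q)) \<and>
      (\<forall>s. smooth_sec E V s \<longleftrightarrow> (\<exists>\<nu>. csmooth V \<nu> \<and> (\<forall>q\<in>V. s q = scl E q (e q) (\<nu> q))))"
    if U: "open U" "p \<in> U" for U p
  proof -
    obtain W e where W: "open W" "p \<in> W" "frame E W e" and
      W4: "\<forall>V s. open V \<and> V \<subseteq> W \<longrightarrow> (smooth_sec E V s \<longleftrightarrow>
        (\<exists>\<mu>. csmooth V \<mu> \<and> (\<forall>q\<in>V. s q = scl E q (e q) (\<mu> q))))"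
      using loc[of p] by (elim exE conjE) (rule that)
    have e: "e q \<in> fib E q" "e q \<noteq> zer E q" if "q \<in> W" for q
      using W(1,3) that sec_in unfolding frame_def by blast+
    have V: "open (W \<inter> U)" "W \<inter> U \<subseteq> W" using W(1) U(1) by auto
    have "smooth_sec E (W \<inter> U) \<psi>" by (rule restr[OF open_UNIV \<psi>_sm V(1)]) simp
    then obtain \<mu> where \<mu>: "csmooth (W \<inter> U) \<mu>" "\<And>q. q \<in> W \<inter> U \<Longrightarrow> \<psi> q = scl E q (e q) (\<mu> q)"
      using W4[THEN spec, THEN spec, of "W \<inter> U" \<psi>] V by auto
    have "\<mu> q \<noteq> 0" if "q \<in> W \<inter> U" for q
      using \<mu>(2)[OF that] \<psi>(2)[of q] scl_01(2)[OF e(1), of q] that by auto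
    with W(2) W4[THEN spec, of "W \<inter> U"] V \<mu> e U(2) show ?thesis
      by (intro exI[of _ "W \<inter> U"] exI[of _ e] exI[of _ \<mu>]) simp
  qed
  have smooth: "smooth_sec E U s \<longleftrightarrow> (\<forall>p\<in>U. s p \<in> fib E p) \<and> csmooth U (\<lambda>p. ?\<theta> p (s p))"
    if U: "open U" for U s
  proof
    assume s: "smooth_sec E U s"
    have "csmooth U (\<lambda>p. ?\<theta> p (s p))"
    proof (rule csmooth_local)
      fix p assume "p \<in> U"
      from near[OF U this] obtain V e \<mu> where V: "open V" "p \<in> V" "V \<subseteq> U" "csmooth V \<mu>"
        and Ve: "\<forall>q\<in>V. e q \<in> fib E q \<and> e q \<noteq> zer E q \<and> \<mu> q \<noteq> 0 \<and> \<psi> q = scl E q (e q) (\<mu> q)"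
        and Vs: "\<forall>s. smooth_sec E V s \<longleftrightarrow> (\<exists>\<nu>. csmooth V \<nu> \<and> (\<forall>q\<in>V. s q = scl E q (e q) (\<nu> q)))"
        by (elim exE conjE) (rule that)
      obtain \<nu> where \<nu>: "csmooth V \<nu>" "\<And>q. q \<in> V \<Longrightarrow> s q = scl E q (e q) (\<nu> q)"
        using Vs[THEN spec, of s] restr[OF U s V(1,3)] by auto
      have sm: "csmooth V (\<lambda>q. inverse (\<mu> q) * \<nu> q)"
        using Ve by (intro csmooth_mult csmooth_inverse V(4) \<nu>(1)) simp
      have "csmooth V (\<lambda>p. ?\<theta> p (s p))"
      proof (rule csmooth_cong[OF V(1) _ sm])
        fix q assume q: "q \<in> V"
        then have "s q = scl E q (\<psi> q) (inverse (\<mu> q) * \<nu> q)"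
          using bspec[OF Ve q] \<nu>(2)[OF q] scl_mul[of "e q" q "\<mu> q"] by (simp add: mult.assoc[symmetric])
        then show "inverse (\<mu> q) * \<nu> q = ?\<theta> q (s q)" using \<theta>_scl by simp
      qed
      with V(1,2) show "\<exists>V. open V \<and> p \<in> V \<and> csmooth V (\<lambda>p. ?\<theta> p (s p))" by blast
    qed
    with sec_in[OF U s] show "(\<forall>p\<in>U. s p \<in> fib E p) \<and> csmooth U (\<lambda>p. ?\<theta> p (s p))" by blast
  next
    assume s: "(\<forall>p\<in>U. s p \<in> fib E p) \<and> csmooth U (\<lambda>p. ?\<theta> p (s p))"
    show "smooth_sec E U s"
      unfolding sec_local[OF U]
    proof
      fix p assume "p \<in> U"
      from near[OF U this] obtain V e \<mu> where V: "open V" "p \<in> V" "V \<subseteq> U" "csmooth V \<mu>"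
        and Ve: "\<forall>q\<in>V. e q \<in> fib E q \<and> e q \<noteq> zer E q \<and> \<mu> q \<noteq> 0 \<and> \<psi> q = scl E q (e q) (\<mu> q)"
        and Vs: "\<forall>s. smooth_sec E V s \<longleftrightarrow> (\<exists>\<nu>. csmooth V \<nu> \<and> (\<forall>q\<in>V. s q = scl E q (e q) (\<nu> q)))"
        by (elim exE conjE) (rule that)
      have "csmooth V (\<lambda>q. \<mu> q * ?\<theta> q (s q))"
        using s by (intro csmooth_mult V(4) csmooth_subset[OF _ V(3)]) blast
      moreover have "s q = scl E q (e q) (\<mu> q * ?\<theta> q (s q))" if q: "q \<in> V" for q
      proof -
        have "s q = scl E q (\<psi> q) (?\<theta> q (s q))" using rep s q V(3) by blast
        then show ?thesis using bspec[OF Ve q] scl_mul[of "e q" q] by simp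
      qed
      ultimately have "smooth_sec E V s" using Vs[THEN spec, of s] by auto
      with V(1-3) show "\<exists>V. open V \<and> p \<in> V \<and> V \<subseteq> U \<and> smooth_sec E V s" by blast
    qed
  qed
  have Jp: "Jstr E p x \<in> fib E p" "Jstr E p (scl E p x \<mu>) = scl E p (Jstr E p x) \<mu>" if "x \<in> fib E p" for p x \<mu>
    using cq[unfolded complex_qline_bundle_def, THEN conjunct2, THEN conjunct1, THEN spec, of p] that by simp_all
  have Jx: "Jstr E p x = scl E p (\<psi> p) (N p * ?\<theta> p x)" if "x \<in> fib E p" for p x
    using Jp(2)[OF \<psi>_in, of p "?\<theta> p x"] J scl_mul[OF \<psi>_in] rep[OF that] by simp
  have add_scl: "add E p (scl E p (\<psi> p) \<mu>) (scl E p (\<psi> p) \<nu>) = scl E p (\<psi> p) (\<mu> + \<nu>)" for p \<mu> \<nu>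
    using scl_add[OF \<psi>_in] by simp
  have tb: "trivialized_bundle E ?\<theta> N"
  proof
    fix p x y \<mu>
    show "bij_betw (?\<theta> p) (fib E p) UNIV"
      by (rule bij_betwI[where g = "scl E p (\<psi> p)"]) (use scl_in[OF \<psi>_in] \<theta>_scl rep in auto)
    show "zer E p \<in> fib E p" by (rule zer_in)
    show "?\<theta> p (zer E p) = 0" using \<theta>_scl[of p 0] scl_01(2)[OF \<psi>_in] by simp
    show "N p * N p = - 1" by (rule N(1))
    assume x: "x \<in> fib E p"
    show "scl E p x \<mu> \<in> fib E p" by (rule scl_in[OF x])
    show "?\<theta> p (scl E p x \<mu>) = ?\<theta> p x * \<mu>"
      using rep[OF x] scl_mul[OF \<psi>_in] \<theta>_scl by metis
    show "Jstr E p x \<in> fib E p" by (rule Jp(1)[OF x])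
    show "?\<theta> p (Jstr E p x) = N p * ?\<theta> p x" using Jx[OF x] \<theta>_scl by simp
    assume y: "y \<in> fib E p"
    show "add E p x y \<in> fib E p" by (rule add_in[OF x y])
    show "?\<theta> p (add E p x y) = ?\<theta> p x + ?\<theta> p y"
      using rep[OF x] rep[OF y] add_scl \<theta>_scl by metis
  qed (use N(2) smooth in auto)
  then interpret T: trivialized_bundle E ?\<theta> N .
  show "trivialized_hol E ?\<theta> N D"
  proof
    fix U s p v assume U: "open U" and s: "smooth_sec E U s" and p: "p \<in> U"
    let ?l = "\<lambda>q. ?\<theta> q (s q)"
    have l: "csmooth U ?l" using smooth[OF U] s by blast
    have \<psi>U: "smooth_sec E U \<psi>" by (rule restr[OF open_UNIV \<psi>_sm U]) simp
    note hl = hol[unfolded hol_line_bundle_def, THEN conjunct2, THEN spec, THEN spec, THEN mp, OF conjI]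
    note DU1 = hl[OF U s, THEN conjunct2, THEN conjunct1, THEN spec, THEN mp]
    note DU2 = hl[OF U \<psi>U, THEN conjunct2, THEN conjunct2, THEN conjunct2, THEN spec, THEN mp,
        THEN bspec, THEN spec]
    have "D (\<lambda>q. scl E q (\<psi> q) (?l q)) p = D s p"
    proof -
      have "\<forall>q\<in>U. scl E q (\<psi> q) (?l q) = s q" using rep sec_in[OF U s] by simp
      from DU1[OF this] p show ?thesis by (rule bspec)
    qed
    with DU2[OF l p, of v] have eq: "D s p v = add E p (scl E p (zer E p) (?l p))
               (scl E p (add E p (scl E p (\<psi> p) (cdiff ?l p v))
                                 (Jstr E p (scl E p (\<psi> p) (cdiff ?l p (\<i> * v))))) (1 / 2))"
      by (simp only: D\<psi>)
    show "D s p v \<in> fib E p" unfolding eq by (simp add: T.ins \<psi>_in)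
    show "?\<theta> p (D s p v) = (1 / 2) *\<^sub>R (cdiff ?l p v + N p * cdiff ?l p (\<i> * v))"
      unfolding eq by (simp only: T.ins T.eqs \<psi>_in \<theta>_scl quat_half mult_zero_left add_0_left)
  qed
qed

section \<open>Conformal immersions into the imaginary quaternions\<close>

lemma quat_imaginary_mult_commute:
  assumes "qre a = 0" "qre b = 0" "a \<bullet> b = 0" shows "a * b = - (b * a)"
  using assms by (simp add: quat_eq_iff times_quat_def uminus_quat_def inner_quat_def algebra_simps)

lemma quat_imaginary_inverse: "qre a = 0 \<Longrightarrow> inverse a = - (1 / (norm a)\<^sup>2) *\<^sub>R a"
  by (simp add: inverse_quat_def quat_cnj_imaginary norm_quat_def qnormsq_def)

lemma linear_complex:
  fixes L :: "complex \<Rightarrow> 'b::real_vector"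
  assumes "linear L" shows "L v = Re v *\<^sub>R L 1 + Im v *\<^sub>R L \<i>"
  using linear_Basis_sum[OF assms, of v] by (simp add: Basis_complex_def)

locale imaginary_conformal_immersion =
  fixes f :: "cp1 \<Rightarrow> quat"
  assumes f_smooth: "csmooth UNIV f" and f_conformal: "conformal_at f p" and f_im: "qre (f p) = 0"
begin

text \<open>The right normal of \<open>f\<close>, characterised by
  \<open>*df = df N\<close>.\<close>

definition N :: "cp1 \<Rightarrow> quat" where "N p = inverse (cdiff f p 1) * cdiff f p \<i>"

lemma f_linear: "linear (cdiff f p)"
  by (rule cdiff_linear[OF open_UNIV f_smooth UNIV_I])

lemma bounded_linear_qre: "bounded_linear qre"
  by (rule bounded_linear_intro[where K = 1])
    (simp_all add: qre_simps norm_quat_def qnormsq_def real_le_rsqrt)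

lemma cdiff_f_im: "qre (cdiff f p v) = 0"
  using cdiff_bounded_linear[OF bounded_linear_qre open_UNIV f_smooth UNIV_I, of p v] f_im by simp

lemma cdiff_f_nonzero: "v \<noteq> 0 \<Longrightarrow> cdiff f p v \<noteq> 0"
  using f_conformal[of p] by (simp add: conformal_at_def)

lemma cdiff_f_norm: "norm (cdiff f p \<i>) = norm (cdiff f p 1)"
  and cdiff_f_orth: "cdiff f p 1 \<bullet> cdiff f p \<i> = 0"
  using f_conformal[of p, unfolded conformal_at_def, THEN spec, of 1] by (simp_all add: inner_commute)

lemma cdiff_f_N: "cdiff f p \<i> = cdiff f p 1 * N p"
  using cdiff_f_nonzero[of 1 p] by (simp add: N_def mult.assoc[symmetric])

text \<open>Orthogonal imaginary quaternions anticommute, and the inverse of an imaginary quaternion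
  is a real multiple of it.\<close>

lemma cdiff_f_inverse: "inverse (cdiff f p 1) * cdiff f p \<i> = - (cdiff f p \<i> * inverse (cdiff f p 1))"
  using quat_imaginary_mult_commute[OF cdiff_f_im cdiff_f_im cdiff_f_orth]
  by (simp add: quat_imaginary_inverse[OF cdiff_f_im])

text \<open>Orthogonality of \<open>f_x\<close> and \<open>f_y\<close> allows the factors to be
  reordered, and equality of their norms makes their squares equal; so both halves of conformality
  enter.\<close>

lemma N_sq: "N p * N p = - 1"
proof -
  let ?a = "cdiff f p 1" and ?b = "cdiff f p \<i>"
  have "N p * N p = - (?b * (inverse ?a * (inverse ?a * ?b)))"
    unfolding N_def by (subst (1) cdiff_f_inverse) (simp add: mult.assoc)
  also have "\<dots> = ?b * (inverse ?a * (?b * inverse ?a))"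
    by (subst cdiff_f_inverse) simp
  also have "\<dots> = ?b * ((inverse ?a * ?b) * inverse ?a)" by (simp add: mult.assoc)
  also have "\<dots> = - ((?b * ?b) * (inverse ?a * inverse ?a))"
    by (subst cdiff_f_inverse) (simp add: mult.assoc)
  also have "inverse ?a * inverse ?a = inverse (?a * ?a)"
    using cdiff_f_nonzero[of 1 p] by (simp add: nonzero_inverse_mult_distrib)
  also have "?b * ?b = ?a * ?a"
    by (simp only: quat_imaginary_square[OF cdiff_f_im] cdiff_f_norm)
  also have "- ((?a * ?a) * inverse (?a * ?a)) = - 1" using cdiff_f_nonzero[of 1 p] by simp
  finally show ?thesis .
qed

lemma N_N: "N p * (N p * x) = - x" "x * N p * N p = - x"
  using N_sq[of p] by (simp_all add: mult.assoc[symmetric]) (simp add: mult.assoc)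

lemma cdiff_f_cx: "cdiff f p v = cdiff f p 1 * cx (N p) v"
proof -
  have "cdiff f p v = Re v *\<^sub>R cdiff f p 1 + Im v *\<^sub>R cdiff f p \<i>"
    by (rule linear_complex[OF f_linear])
  then show ?thesis by (simp add: cdiff_f_N cx_alt algebra_simps)
qed

lemma cdiff_f_i: "cdiff f p (\<i> * v) = cdiff f p v * N p"
  using cx_mult[OF N_sq, of p v \<i>] cdiff_f_cx[of p v] cdiff_f_cx[of p "\<i> * v"]
  by (simp add: cx_simps mult.commute mult.assoc)

text \<open>Geometrically, \<open>N\<close> is a unit normal of the surface, and normal and tangent
  vectors anticommute as orthogonal imaginary quaternions.\<close>

lemma N_cdiff_f: "N p * cdiff f p v = - (cdiff f p v * N p)"
proof -
  have a: "N p * cdiff f p 1 = - (cdiff f p 1 * N p)"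
  proof -
    have "N p * cdiff f p 1 = - (cdiff f p \<i> * (inverse (cdiff f p 1) * cdiff f p 1))"
      unfolding N_def cdiff_f_inverse by (simp add: mult.assoc)
    then show ?thesis using cdiff_f_nonzero[of 1 p] by (simp add: cdiff_f_N)
  qed
  have c: "cx (N p) v * N p = N p * cx (N p) v" by (simp add: cx_alt algebra_simps)
  have "N p * cdiff f p v = - (cdiff f p 1 * (N p * cx (N p) v))"
    using a by (simp add: cdiff_f_cx[of p v] mult.assoc[symmetric])
  then show ?thesis by (simp add: cdiff_f_cx[of p v] c mult.assoc)
qed

lemma N_re: "qre (N p) = 0" and N_norm: "norm (N p) = 1" and N_cnj: "qcnj (N p) = - N p"
  using quat_square_minus_one[OF N_sq] quat_cnj_imaginary by auto

lemma frechet_f: "frechet_derivative (f \<circ> par q) (at w) v = cdiff f (par q w) (dpar q w v)"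
  using cdiff_par[OF open_UNIV f_smooth, of q w v] by simp

lemma frechet_f_i: "frechet_derivative (f \<circ> par q) (at w) (\<i> * v) =
    frechet_derivative (f \<circ> par q) (at w) v * N (par q w)"
  by (simp add: frechet_f dpar_mult cdiff_f_i)

lemma frechet_f_nonzero: "frechet_derivative (f \<circ> par q) (at w) 1 \<noteq> 0"
proof -
  have "dpar q w 1 \<noteq> 0" by (auto simp: dpar_def split: cp1.splits)
  then show ?thesis by (simp add: frechet_f cdiff_f_nonzero)
qed

lemma N_par: "N (par q w) =
    inverse (frechet_derivative (f \<circ> par q) (at w) 1) * frechet_derivative (f \<circ> par q) (at w) \<i>"
  using frechet_f_i[of q w 1] frechet_f_nonzero[of q w] by (simp add: mult.assoc[symmetric])

lemma N_smooth: "csmooth UNIV N"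
  unfolding csmooth_def
proof
  fix q
  have "smooth_on UNIV (\<lambda>w. inverse (frechet_derivative (f \<circ> par q) (at w) 1) *
      frechet_derivative (f \<circ> par q) (at w) \<i>)"
    using csmooth_par_UNIV[OF f_smooth, of q] frechet_f_nonzero
    by (intro smooth_on_mult smooth_on_inverse smooth_on_derivative open_UNIV)
  then show "smooth_on (par q -` UNIV) (N \<circ> par q)"
    by (simp add: o_def N_par[abs_def])
qed

lemma conformal_HP1: "conformal_immersion_HP1 (lift_HP1 f)"
  unfolding conformal_immersion_HP1_def
proof
  fix p
  show "\<exists>U g. open U \<and> p \<in> U \<and> csmooth U g \<and> conformal_at g p \<and>
     ((\<forall>q\<in>U. lift_HP1 f q = hline (g q, 1)) \<or> (\<forall>q\<in>U. lift_HP1 f q = hline (1, g q)))"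
    using f_smooth f_conformal
    by (intro exI[of _ UNIV] exI[of _ f]) (auto simp: lift_HP1_def)
qed

end

lemma (in trivialized_bundle) ex_trivialized_hol: "\<exists>D. trivialized_hol E \<theta> N D"
proof
  show "trivialized_hol E \<theta> N (\<lambda>s p v. unt p ((1 / 2) *\<^sub>R
      (cdiff (\<lambda>q. \<theta> q (s q)) p v + N p * cdiff (\<lambda>q. \<theta> q (s q)) p (\<i> * v))))"
    by unfold_locales simp_all
qed

section \<open>Quotients of the trivial bundle of rank two\<close>

definition rep_val :: "(cp1 \<Rightarrow> quat \<times> quat \<Rightarrow> quat) \<Rightarrow> cp1 \<Rightarrow> (quat \<times> quat) set \<Rightarrow> quat" where
  "rep_val \<kappa> p A = \<kappa> p (SOME a. a \<in> A)"

text \<open>Each \<open>\<kappa> p\<close> is a linear functional with kernel \<open>S p\<close> and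
  \<sigma> is a smooth right inverse, so a coset is determined by the value of \<kappa> on any
  representative. The locale serves the quotient by \<open>L\<close> with \<open>hscl\<close> and
  the quotient by the annihilator with the conjugated multiplication \<open>dscl\<close>.\<close>

locale quotient_coordinate =
  fixes m :: "quat \<times> quat \<Rightarrow> quat \<Rightarrow> quat \<times> quat" and S :: hp1_map
    and \<kappa> :: "cp1 \<Rightarrow> quat \<times> quat \<Rightarrow> quat" and \<sigma> :: "quat \<Rightarrow> quat \<times> quat"
  assumes k_add: "\<kappa> p (x + y) = \<kappa> p x + \<kappa> p y" and k_scl: "\<kappa> p (m x \<mu>) = \<kappa> p x * \<mu>"
    and ker: "S p = {x. \<kappa> p x = 0}" and k_sec: "\<kappa> p (\<sigma> \<mu>) = \<mu>"
    and k_smooth: "csmooth U t \<Longrightarrow> csmooth U (\<lambda>p. \<kappa> p (t p))"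
    and s_smooth: "csmooth U l \<Longrightarrow> csmooth U (\<lambda>p. \<sigma> (l p))"
begin

lemma k_diff: "\<kappa> p (x - y) = \<kappa> p x - \<kappa> p y"
  using k_add[of p "x - y" y] by simp

lemma coset_eq: "coset S p x = {y. \<kappa> p y = \<kappa> p x}"
proof (intro set_eqI iffI)
  fix y assume "y \<in> {y. \<kappa> p y = \<kappa> p x}"
  then have "y - x \<in> S p" by (simp add: ker k_diff)
  moreover have "y = x + (y - x)" by simp
  ultimately show "y \<in> coset S p x" unfolding coset_def by blast
qed (auto simp: coset_def ker k_add)

lemma rep_val_coset [simp]: "rep_val \<kappa> p (coset S p x) = \<kappa> p x"
proof -
  have "(SOME a. a \<in> coset S p x) \<in> coset S p x"
    by (rule someI[of _ x]) (simp add: coset_eq)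
  then show ?thesis by (simp add: rep_val_def coset_eq)
qed

lemma coset_eqI: "\<kappa> p x = \<kappa> p y \<Longrightarrow> coset S p x = coset S p y"
  by (simp add: coset_eq)

lemma trivialized_quot:
  assumes J: "\<And>p x. J p (coset S p x) = coset S p (\<sigma> (N p * \<kappa> p x))"
    and N: "\<And>p. N p * N p = - 1" "csmooth UNIV N"
  shows "trivialized_bundle (quot_bundle m S J) (rep_val \<kappa>) N"
proof
  have k0: "\<kappa> p 0 = 0" for p using k_add[of p 0 0] by simp
  fix p x y \<mu> U s
  show "bij_betw (rep_val \<kappa> p) (fib (quot_bundle m S J) p) UNIV"
    by (rule bij_betwI[where g = "\<lambda>\<mu>. coset S p (\<sigma> \<mu>)"])
      (auto simp: quot_bundle_def k_sec intro!: coset_eqI)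
  show "zer (quot_bundle m S J) p \<in> fib (quot_bundle m S J) p"
    "rep_val \<kappa> p (zer (quot_bundle m S J) p) = 0"
    by (simp_all add: quot_bundle_def k0)
  show "N p * N p = - 1" "csmooth UNIV N" by (rule N)+
  assume "x \<in> fib (quot_bundle m S J) p"
  then obtain a where a: "x = coset S p a" by (auto simp: quot_bundle_def)
  have "{m b \<mu> + l |b l. b \<in> coset S p a \<and> l \<in> S p} = coset S p (m a \<mu>)"
  proof (intro set_eqI iffI)
    fix c assume "c \<in> coset S p (m a \<mu>)"
    then have "c = m a \<mu> + (c - m a \<mu>)" "a \<in> coset S p a" "c - m a \<mu> \<in> S p"
      by (auto simp: coset_eq ker k_diff)
    then show "c \<in> {m b \<mu> + l |b l. b \<in> coset S p a \<and> l \<in> S p}" by blast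
  qed (auto simp: coset_eq ker k_add k_scl)
  then show "scl (quot_bundle m S J) p x \<mu> \<in> fib (quot_bundle m S J) p"
    "rep_val \<kappa> p (scl (quot_bundle m S J) p x \<mu>) = rep_val \<kappa> p x * \<mu>"
    by (simp_all add: quot_bundle_def a k_scl)
  show "Jstr (quot_bundle m S J) p x \<in> fib (quot_bundle m S J) p"
    "rep_val \<kappa> p (Jstr (quot_bundle m S J) p x) = N p * rep_val \<kappa> p x"
    by (simp_all add: quot_bundle_def a J k_sec)
  assume "y \<in> fib (quot_bundle m S J) p"
  then obtain b where b: "y = coset S p b" by (auto simp: quot_bundle_def)
  have "{c + d |c d. c \<in> coset S p a \<and> d \<in> coset S p b} = coset S p (a + b)"
  proof (intro set_eqI iffI)
    fix c assume "c \<in> coset S p (a + b)"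
    then have "c = a + (c - a)" "a \<in> coset S p a" "c - a \<in> coset S p b"
      by (auto simp: coset_eq k_diff k_add)
    then show "c \<in> {c + d |c d. c \<in> coset S p a \<and> d \<in> coset S p b}" by blast
  next
    fix c assume "c \<in> {c + d |c d. c \<in> coset S p a \<and> d \<in> coset S p b}"
    then obtain d d' where "c = d + d'" "d \<in> coset S p a" "d' \<in> coset S p b" by blast
    then show "c \<in> coset S p (a + b)" by (simp add: coset_eq k_add)
  qed
  then show "add (quot_bundle m S J) p x y \<in> fib (quot_bundle m S J) p"
    "rep_val \<kappa> p (add (quot_bundle m S J) p x y) = rep_val \<kappa> p x + rep_val \<kappa> p y"
    by (simp_all add: quot_bundle_def a b k_add)
next
  fix U :: "cp1 set" and s assume U: "open U"
  have sec: "smooth_sec (quot_bundle m S J) U s \<longleftrightarrow> (\<forall>p\<in>U. \<exists>V t. open V \<and> p \<in> V \<and> V \<subseteq> U \<and>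
      csmooth V t \<and> (\<forall>q\<in>V. s q = coset S q (t q)))" by (simp add: quot_bundle_def)
  have fb: "fib (quot_bundle m S J) p = range (coset S p)" for p by (simp add: quot_bundle_def)
  show "smooth_sec (quot_bundle m S J) U s \<longleftrightarrow>
      (\<forall>p\<in>U. s p \<in> fib (quot_bundle m S J) p) \<and> csmooth U (\<lambda>p. rep_val \<kappa> p (s p))"
  proof
    assume "smooth_sec (quot_bundle m S J) U s"
    note * = this[unfolded sec]
    have "csmooth U (\<lambda>p. rep_val \<kappa> p (s p))"
    proof (rule csmooth_local)
      fix p assume "p \<in> U"
      from bspec[OF * this] obtain V t where V: "open V" "p \<in> V" "csmooth V t"
        and st: "\<forall>q\<in>V. s q = coset S q (t q)" by (elim exE conjE) (rule that)
      have "csmooth V (\<lambda>p. rep_val \<kappa> p (s p))"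
        by (rule csmooth_cong[OF V(1) _ k_smooth[OF V(3)]]) (simp add: st)
      with V show "\<exists>V. open V \<and> p \<in> V \<and> csmooth V (\<lambda>p. rep_val \<kappa> p (s p))" by blast
    qed
    moreover have "s p \<in> fib (quot_bundle m S J) p" if "p \<in> U" for p
    proof -
      from bspec[OF * that] obtain V t where "p \<in> V" "\<forall>q\<in>V. s q = coset S q (t q)"
        by (elim exE conjE) (rule that)
      then show ?thesis unfolding fb by simp
    qed
    ultimately show "(\<forall>p\<in>U. s p \<in> fib (quot_bundle m S J) p) \<and> csmooth U (\<lambda>p. rep_val \<kappa> p (s p))"
      by blast
  next
    assume *: "(\<forall>p\<in>U. s p \<in> fib (quot_bundle m S J) p) \<and> csmooth U (\<lambda>p. rep_val \<kappa> p (s p))"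
    then have t: "csmooth U (\<lambda>p. \<sigma> (rep_val \<kappa> p (s p)))" using s_smooth by blast
    have "s q = coset S q (\<sigma> (rep_val \<kappa> q (s q)))" if "q \<in> U" for q
    proof -
      from * that obtain a where "s q = coset S q a" unfolding fb by blast
      then show ?thesis by (simp, intro coset_eqI) (simp add: k_sec)
    qed
    with U t show "smooth_sec (quot_bundle m S J) U s"
      unfolding sec by (intro ballI exI[of _ U] exI[of _ "\<lambda>p. \<sigma> (rep_val \<kappa> p (s p))"]) simp
  qed
qed

end

section \<open>The conformal structures and Moebius invariant bundles of \<open>f\<close>\<close>

context imaginary_conformal_immersion
begin

abbreviation L :: hp1_map where "L \<equiv> lift_HP1 f"

definition JL :: "cp1 \<Rightarrow> quat \<times> quat \<Rightarrow> quat \<times> quat" where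
  "JL p x = (f p * (N p * snd x), N p * snd x)"

definition kQ :: "cp1 \<Rightarrow> quat \<times> quat \<Rightarrow> quat" where "kQ p x = fst x - f p * snd x"

text \<open>The sign comes from \<open>N df = - df N\<close>: the condition
  \<open>*\<delta> = JQ \<delta>\<close> asks for an action on \<open>df\<close> from the left that
  equals multiplication by \<open>N\<close> from the right.\<close>

definition JQ :: "cp1 \<Rightarrow> (quat \<times> quat) set \<Rightarrow> (quat \<times> quat) set" where
  "JQ p A = coset L p (- N p * rep_val kQ p A, 0)"

text \<open>The value of the functional on the spanning vector \<open>(f p, 1)\<close> of
  \<open>L p\<close>, conjugated so that left multiplication by \<open>qcnj \<mu>\<close> in
  \<open>dscl\<close> becomes right multiplication by \<mu>.\<close>

definition kD :: "cp1 \<Rightarrow> quat \<times> quat \<Rightarrow> quat" where "kD p x = qcnj (fst x * f p + snd x)"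

lemma L_iff: "x \<in> L p \<longleftrightarrow> fst x = f p * snd x"
  by (cases x) (auto simp: lift_HP1_def hline_def hscl_def image_iff)

lemma f_smooth_on: "csmooth U f" using csmooth_subset[OF f_smooth] by simp

lemma minus_N: "(- N p) * (- N p) = - 1" "csmooth UNIV (\<lambda>p. - N p)"
  using N_sq N_smooth csmooth_minus by auto

lemma trivialized_sub: "trivialized_bundle (sub_bundle L JL) (\<lambda>p. snd) N"
proof
  fix p x y \<mu> and U :: "cp1 set" and s
  show "bij_betw snd (fib (sub_bundle L JL) p) UNIV"
    by (rule bij_betwI[where g = "\<lambda>\<mu>. (f p * \<mu>, \<mu>)"]) (auto simp: sub_bundle_def L_iff)
  show "N p * N p = - 1" "csmooth UNIV N" by (rule N_sq N_smooth)+
  have "csmooth U (\<lambda>p. snd (s p)) \<Longrightarrow> open U \<Longrightarrow> \<forall>p\<in>U. s p \<in> L p \<Longrightarrow> csmooth U s"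
    by (rule csmooth_cong[of _ "\<lambda>p. (f p * snd (s p), snd (s p))"])
      (auto simp: L_iff prod_eq_iff intro!: csmooth_Pair csmooth_mult f_smooth_on)
  then show "open U \<Longrightarrow> smooth_sec (sub_bundle L JL) U s \<longleftrightarrow>
      (\<forall>p\<in>U. s p \<in> fib (sub_bundle L JL) p) \<and> csmooth U (\<lambda>p. snd (s p))"
    using csmooth_snd[of U s] by (auto simp: sub_bundle_def)
qed (auto simp: sub_bundle_def L_iff hscl_def JL_def algebra_simps)

sublocale Q: quotient_coordinate hscl L kQ "\<lambda>\<mu>. (\<mu>, 0)"
  by unfold_locales (auto simp: kQ_def hscl_def L_iff algebra_simps
      intro!: csmooth_diff csmooth_mult csmooth_fst csmooth_snd f_smooth_on csmooth_Pair csmooth_const)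

lemma trivialized_Q: "trivialized_bundle (quot_bundle hscl L JQ) (rep_val kQ) (\<lambda>p. - N p)"
  by (rule Q.trivialized_quot[OF _ minus_N]) (simp add: JQ_def)

lemma conformal_structures: "conformal_structures L JL JQ"
  unfolding conformal_structures_def
proof (intro conjI allI impI ballI)
  interpret T: trivialized_bundle "sub_bundle L JL" "\<lambda>p. snd" N by (rule trivialized_sub)
  interpret TQ: trivialized_bundle "quot_bundle hscl L JQ" "rep_val kQ" "\<lambda>p. - N p" by (rule trivialized_Q)
  show cq: "complex_qline_bundle (sub_bundle L JL)" by (rule T.complex_qline)
  show "complex_qline_bundle (quot_bundle hscl L JQ)" by (rule TQ.complex_qline)
  \<comment> \<open>In these coordinates \<delta> sends a section of \<open>L\<close> to
    \<open>df\<close> times its second component, since the derivatives of that component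
    cancel.\<close>
  have key: "kQ p (cdiff s p v) = cdiff f p v * snd (s p)"
    if U: "open U" and s: "smooth_sec (sub_bundle L JL) U s" and p: "p \<in> U" for U s p v
  proof -
    have sm: "csmooth U s" and L: "\<And>q. q \<in> U \<Longrightarrow> s q \<in> L q" using s by (auto simp: sub_bundle_def)
    note l = csmooth_snd[OF sm]
    have m: "csmooth U (\<lambda>q. f q * snd (s q))" by (rule csmooth_mult[OF f_smooth_on l])
    have "cdiff (\<lambda>q. fst (s q)) p = cdiff (\<lambda>q. f q * snd (s q)) p"
      by (rule cdiff_cong[OF U m _ p]) (use L in \<open>auto simp: L_iff\<close>)
    then show ?thesis
      using cdiff_bounded_linear[OF bounded_linear_fst U sm p, of v]
        cdiff_bounded_linear[OF bounded_linear_snd U sm p, of v] cdiff_mult[OF U f_smooth_on l p, of v]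
      by (simp add: kQ_def) (metis add_diff_cancel_left')
  qed
  fix U s p v
  assume "open U \<and> smooth_sec (sub_bundle L JL) U s" and p: "p \<in> U"
  then have U: "open U" and s: "smooth_sec (sub_bundle L JL) U s" by auto
  have Js: "smooth_sec (sub_bundle L JL) U (\<lambda>q. JL q (s q))"
  proof -
    have "smooth_sec (sub_bundle L JL) U (\<lambda>q. Jstr (sub_bundle L JL) q (s q))"
      using cq U s unfolding complex_qline_bundle_def by blast
    then show ?thesis by (simp add: sub_bundle_def)
  qed
  show "coset L p (cdiff s p (\<i> * v)) = coset L p (cdiff (\<lambda>q. JL q (s q)) p v)"
    by (rule Q.coset_eqI) (simp only: key[OF U s p] key[OF U Js p] cdiff_f_i, simp add: JL_def mult.assoc)
  show "coset L p (cdiff s p (\<i> * v)) = JQ p (coset L p (cdiff s p v))"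
    unfolding JQ_def
    by (rule Q.coset_eqI) (simp add: key[OF U s p] cdiff_f_i mult.assoc[symmetric] N_cdiff_f,
        simp add: kQ_def)
qed

lemma annihilator_iff: "x \<in> annihilator L p \<longleftrightarrow> kD p x = 0"
proof -
  have "x \<in> annihilator L p \<longleftrightarrow> (\<forall>\<mu>. (fst x * f p + snd x) * \<mu> = 0)"
    by (auto simp: annihilator_def lift_HP1_def hline_def hscl_def pairing_def algebra_simps)
  also have "\<dots> \<longleftrightarrow> fst x * f p + snd x = 0" by (auto dest: spec[of _ 1])
  also have "\<dots> \<longleftrightarrow> kD p x = 0" unfolding kD_def by (metis qcnj_simps(6,7))
  finally show ?thesis .
qed

sublocale Du: quotient_coordinate dscl "annihilator L" kD "\<lambda>\<mu>. (0, qcnj \<mu>)"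
proof unfold_locales
  fix p x y \<mu>
  show "kD p (x + y) = kD p x + kD p y" by (simp add: kD_def qcnj_simps algebra_simps)
  show "kD p (dscl x \<mu>) = kD p x * \<mu>" by (simp add: kD_def dscl_def qcnj_simps algebra_simps)
  show "annihilator L p = {x. kD p x = 0}" using annihilator_iff by auto
  show "kD p (0, qcnj \<mu>) = \<mu>" by (simp add: kD_def qcnj_simps)
next
  fix U and t :: "cp1 \<Rightarrow> quat \<times> quat" assume "csmooth U t"
  then show "csmooth U (\<lambda>p. kD p (t p))" unfolding kD_def
    by (intro csmooth_qcnj csmooth_add csmooth_mult csmooth_fst csmooth_snd f_smooth_on)
next
  fix U and l :: "cp1 \<Rightarrow> quat" assume "csmooth U l"
  then show "csmooth U (\<lambda>p. (0 :: quat, qcnj (l p)))"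
    by (intro csmooth_Pair csmooth_const csmooth_qcnj)
qed

text \<open>Composing a functional with \<open>J\<close> multiplies its value on
  \<open>(f p, 1)\<close> by \<open>N p\<close> from the right. Conjugation makes this left
  multiplication by \<open>qcnj (N p)\<close>, which is \<open>- N p\<close>.\<close>

lemma trivialized_dual: "trivialized_bundle (dual_bundle L JL) (rep_val kD) (\<lambda>p. - N p)"
  unfolding dual_bundle_def
proof (rule Du.trivialized_quot[OF _ minus_N])
  fix p x
  let ?v = "\<lambda>a. fst a * f p + snd a"
  have pv: "pairing b (f p * \<mu>, \<mu>) = ?v b * \<mu>" for b \<mu> by (simp add: pairing_def algebra_simps)
  have "(\<forall>y\<in>L p. pairing b y = pairing a (JL p y)) \<longleftrightarrow> ?v b = ?v a * N p" for a b
  proof -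
    have "L p = range (\<lambda>\<mu>. (f p * \<mu>, \<mu>))" by (simp add: lift_HP1_def hline_def hscl_def)
    then have "(\<forall>y\<in>L p. pairing b y = pairing a (JL p y)) \<longleftrightarrow> (\<forall>\<mu>. ?v b * \<mu> = ?v a * (N p * \<mu>))"
      by (simp add: JL_def pv)
    also have "\<dots> \<longleftrightarrow> ?v b = ?v a * N p" by (auto simp: mult.assoc[symmetric] dest: spec[of _ 1])
    finally show ?thesis .
  qed
  moreover have "?v b = ?v a * N p \<longleftrightarrow> kD p b = - N p * kD p a" for a b
  proof -
    have "kD p b = - N p * kD p a \<longleftrightarrow> qcnj (kD p b) = qcnj (- N p * kD p a)" by (metis qcnj_simps(6))
    then show ?thesis by (simp add: kD_def qcnj_simps N_cnj)
  qed
  ultimately have *: "(\<forall>y\<in>L p. pairing b y = pairing a (JL p y)) \<longleftrightarrow> kD p b = - N p * kD p a" for a b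
    by blast
  have "{b. \<exists>a\<in>coset (annihilator L) p x. \<forall>y\<in>L p. pairing b y = pairing a (JL p y)} =
      {b. \<exists>a. kD p a = kD p x \<and> kD p b = - N p * kD p a}"
    unfolding * Du.coset_eq by blast
  also have "\<dots> = coset (annihilator L) p (0, qcnj (- N p * kD p x))"
    unfolding Du.coset_eq Du.k_sec by (intro set_eqI iffI) (auto simp del: split_paired_Ex)
  finally show "{b. \<exists>a\<in>coset (annihilator L) p x. \<forall>y\<in>L p. pairing b y = pairing a (JL p y)} =
      coset (annihilator L) p (0, qcnj (- N p * kD p x))" .
qed

text \<open>For imaginary \<open>f\<close> the conjugation in \<open>kD\<close> only reverses the
  sign of \<open>f\<close>, so left coefficients become right coefficients and no conjugate of
  \<open>f\<close> remains.\<close>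

lemma canonical_system_values:
  assumes "s \<in> canonical_system (annihilator L)"
  obtains c d where "\<And>p. s p \<in> fib (dual_bundle L JL) p" "\<And>p. rep_val kD p (s p) = f p * c + d"
proof -
  from assms obtain x where x: "s = (\<lambda>p. coset (annihilator L) p x)" by (auto simp: canonical_system_def)
  have "qcnj (f p) = - f p" for p by (rule quat_cnj_imaginary[OF f_im])
  then have "rep_val kD p (s p) = f p * (- qcnj (fst x)) + qcnj (snd x)" for p
    by (simp add: x) (simp add: kD_def qcnj_simps)
  moreover have "s p \<in> fib (dual_bundle L JL) p" for p
    by (simp add: x dual_bundle_def quot_bundle_def)
  ultimately show ?thesis using that by blast
qed

lemma euclidean_trivialization:
  assumes "euclidean_bundle f E D \<Phi>"
  obtains \<theta> \<psi> where "trivialized_hol E \<theta> N D" "\<psi> \<in> H0 E D" "\<And>p. \<theta> p (\<psi> p) = 1"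
proof -
  from assms obtain D' \<psi> where hol: "hol_line_bundle E D"
    and iso: "hol_bundle_iso E D (K_dual E) D' \<Phi>"
    and \<psi>: "\<psi> \<in> H0 E D" "\<And>p. \<psi> p \<noteq> zer E p"
    and df: "\<And>p v. cdiff f p v = \<Phi> p (\<psi> p) v (\<psi> p)"
    unfolding euclidean_bundle_def spin_pairing_def by blast
  note cq = hol[unfolded hol_line_bundle_def, THEN conjunct1]
  note lb = cq[unfolded complex_qline_bundle_def, THEN conjunct1]
  note lbs = lb[unfolded quaternionic_line_bundle_def]
  note lb1 = lbs[THEN conjunct1, THEN spec]
  note lb2 = lbs[THEN conjunct2, THEN conjunct1, THEN spec, THEN spec]
  have sec_in: "open U \<Longrightarrow> smooth_sec E U s \<Longrightarrow> p \<in> U \<Longrightarrow> s p \<in> fib E p" for U s p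
    using lb2[of U s] by simp
  have iso_smooth: "open U \<Longrightarrow> \<forall>p\<in>U. s p \<in> fib E p \<Longrightarrow>
      smooth_sec E U s \<longleftrightarrow> smooth_sec (K_dual E) U (\<lambda>p. \<Phi> p (s p))" for U s
    using iso[unfolded hol_bundle_iso_def, THEN conjunct2, THEN conjunct1, THEN spec, THEN spec, of U s] by simp
  have iso_bij: "bij_betw (\<Phi> p) (fib E p) (fib (K_dual E) p)" for p
    using iso[unfolded hol_bundle_iso_def, THEN conjunct1, THEN spec, of p] by simp
  text \<open>The axioms of a bundle do not say that smooth sections restrict to smooth sections over
    smaller sets, but those of \<open>K_dual E\<close> do.\<close>
  have restr: "smooth_sec E V s"
    if U: "open U" and s: "smooth_sec E U s" and V: "open V" "V \<subseteq> U" for U V s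
  proof -
    have "smooth_sec (K_dual E) U (\<lambda>p. \<Phi> p (s p))"
      using iso_smooth[OF U, of s] s sec_in[OF U s] by blast
    then have "smooth_sec (K_dual E) V (\<lambda>p. \<Phi> p (s p))"
      using V by (auto simp: K_dual_def subset_iff)
    then show ?thesis using iso_smooth[OF V(1), of s] sec_in[OF U s] V(2) by blast
  qed
  have \<psi>_in: "\<psi> p \<in> fib E p" for p
    using \<psi>(1) sec_in[OF open_UNIV, of \<psi>] by (auto simp: H0_def holomorphic_sec_def)
  \<comment> \<open>The form \<open>(\<psi>, \<psi>)\<close> takes values in the bundle of type
    \<open>K\<close>, hence \<open>df(i) = (\<psi>, J \<psi>)(1)\<close>. Writing
    \<open>J \<psi>\<close> as \<psi> times a scalar, the right side is \<open>df(1)\<close> times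
    that scalar, which therefore is \<open>N p\<close>.\<close>
  have J: "Jstr E p (\<psi> p) = scl E p (\<psi> p) (N p)" for p
  proof -
    have Jp: "Jstr E p (\<psi> p) \<in> fib E p"
      using cq[unfolded complex_qline_bundle_def, THEN conjunct2, THEN conjunct1, THEN spec, of p] \<psi>_in by simp
    obtain x where x: "x \<in> fib E p" "fib E p = range (scl E p x)" using lb1[of p] by blast
    have mul: "scl E p (scl E p x \<mu>) \<nu> = scl E p x (\<mu> * \<nu>)" for \<mu> \<nu>
      using lb1[of p, THEN conjunct1] x(1) by (simp add: right_qspace_def)
    obtain \<alpha> where \<alpha>: "\<psi> p = scl E p x \<alpha>" using \<psi>_in x(2) by blast
    have "\<alpha> \<noteq> 0"
      using \<psi>(2)[of p] \<alpha> lb1[of p, THEN conjunct1] x(1) by (auto simp: right_qspace_def)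
    obtain \<beta> where "Jstr E p (\<psi> p) = scl E p x \<beta>" using Jp x(2) by blast
    then have S: "Jstr E p (\<psi> p) = scl E p (\<psi> p) (inverse \<alpha> * \<beta>)"
      using \<open>\<alpha> \<noteq> 0\<close> by (simp add: \<alpha> mul mult.assoc[symmetric])
    have K: "\<Phi> p (\<psi> p) \<in> fib (K_dual E) p" using bij_betwE[OF iso_bij] \<psi>_in by blast
    have "cdiff f p \<i> = \<Phi> p (\<psi> p) 1 (Jstr E p (\<psi> p))"
    proof -
      have "\<forall>v. \<forall>x\<in>fib E p. \<Phi> p (\<psi> p) (\<i> * v) x = \<Phi> p (\<psi> p) v (Jstr E p x)"
        using K by (simp add: K_dual_def)
      from this[THEN spec, THEN bspec, OF \<psi>_in, of 1] df[of p \<i>] show ?thesis by simp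
    qed
    also have "\<dots> = \<Phi> p (\<psi> p) 1 (\<psi> p) * (inverse \<alpha> * \<beta>)"
      using K \<psi>_in[of p] unfolding S by (simp add: K_dual_def dual_fib_def)
    finally have "inverse \<alpha> * \<beta> = N p"
      using cdiff_f_nonzero[of 1 p] df[of p 1] by (simp add: N_def mult.assoc[symmetric])
    with S show ?thesis by simp
  qed
  have "trivialized_hol E (coord E \<psi>) N D" "\<And>p. coord E \<psi> p (\<psi> p) = 1"
    by (rule trivialization[OF hol \<psi> J N_sq N_smooth]; rule restr; assumption)+
  then show ?thesis by (rule that[OF _ \<psi>(1)])
qed

end

section \<open>Primitives of closed forms\<close>

lemma has_vector_derivative_line:
  assumes "(f has_derivative f') (at (a + t *\<^sub>R u))"
  shows "((\<lambda>s. f (a + s *\<^sub>R u)) has_vector_derivative f' u) (at t within S)"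
proof -
  have "((\<lambda>s. a + s *\<^sub>R u) has_derivative (\<lambda>s. s *\<^sub>R u)) (at t within S)"
    by (auto intro!: derivative_eq_intros)
  from has_derivative_compose[OF this assms]
  show ?thesis
    using has_derivative_linear[OF assms] by (simp add: has_vector_derivative_def linear_scale)
qed

text \<open>Integrating the derivative in direction \<open>u\<close> along a segment, and
  differentiating the result under the integral in direction \<open>v\<close>, expresses the
  increment of the \<open>v\<close>-derivative along \<open>u\<close> as the integral of a mixed
  derivative. Differentiating at the initial point, with one-sided derivatives on
  \<open>[0, 1]\<close>, gives the symmetry.\<close>

lemma second_derivative_symmetric:
  fixes F :: "'a::real_normed_vector \<Rightarrow> 'b::banach"
  assumes F: "smooth_on UNIV F"
  shows "frechet_derivative (\<lambda>x. frechet_derivative F (at x) u) (at z) v =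
    frechet_derivative (\<lambda>x. frechet_derivative F (at x) v) (at z) u"
proof -
  let ?D = "\<lambda>v x. frechet_derivative F (at x) v"
  let ?D2 = "\<lambda>u v x. frechet_derivative (?D u) (at x) v"
  have sm: "smooth_on UNIV (?D v)" "smooth_on UNIV (?D2 u v)" for u v
    by (intro smooth_on_derivative open_UNIV F)+
  have d: "(F has_derivative frechet_derivative F (at x)) (at x)"
    "(?D v has_derivative frechet_derivative (?D v) (at x)) (at x)" for v x
    by (intro smooth_on_has_derivative[OF open_UNIV] F sm(1) UNIV_I)+
  have cont: "continuous_on UNIV (?D v)" "continuous_on UNIV (?D2 u v)" for u v
    using sm smooth_on_imp_continuous_on by blast+
  let ?p = "\<lambda>s y. z + s *\<^sub>R u + y *\<^sub>R v"
  have ftc: "((\<lambda>s. ?D u (?p s y)) has_integral (F (?p x y) - F (?p 0 y))) {0..x}" if "0 \<le> x" for x y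
  proof (rule fundamental_theorem_of_calculus[OF that])
    fix s assume "s \<in> {0..x}"
    have "((\<lambda>s. F ((z + y *\<^sub>R v) + s *\<^sub>R u)) has_vector_derivative ?D u ((z + y *\<^sub>R v) + s *\<^sub>R u)) (at s within {0..x})"
      by (rule has_vector_derivative_line[OF d(1)])
    then show "((\<lambda>s. F (?p s y)) has_vector_derivative ?D u (?p s y)) (at s within {0..x})"
      by (simp add: algebra_simps)
  qed
  have int: "?D v (?p x 0) - ?D v z = integral {0..x} (\<lambda>s. ?D2 u v (?p s 0))" if x: "0 \<le> x" for x
  proof -
    have "((\<lambda>y. integral (cbox 0 x) (\<lambda>s. ?D u (?p s y))) has_vector_derivative
        integral (cbox 0 x) (\<lambda>s. ?D2 u v (?p s 0))) (at 0 within UNIV)"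
    proof (rule leibniz_rule_vector_derivative)
      show "((\<lambda>y. ?D u (?p s y)) has_vector_derivative ?D2 u v (?p s y)) (at y within UNIV)" for s y
        by (rule has_vector_derivative_line[OF d(2)])
      show "(\<lambda>s. ?D u (?p s y)) integrable_on cbox 0 x" for y
        using ftc[OF x, of y] by (auto simp: integrable_on_def)
      show "continuous_on (UNIV \<times> cbox 0 x) (\<lambda>(y, s). ?D2 u v (?p s y))"
        unfolding split_beta
        by (intro continuous_on_compose2[OF cont(2)] continuous_intros) auto
    qed auto
    then have d1: "((\<lambda>y. F (?p x y) - F (?p 0 y)) has_vector_derivative
        integral {0..x} (\<lambda>s. ?D2 u v (?p s 0))) (at 0)"
      by (simp only: box_real integral_unique[OF ftc[OF x]])
    have d2: "((\<lambda>y. F (?p x y) - F (?p 0 y)) has_vector_derivative ?D v (?p x 0) - ?D v z) (at 0)"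
      using has_vector_derivative_diff[OF
          has_vector_derivative_line[of F _ "z + x *\<^sub>R u" 0 v UNIV, OF d(1)]
          has_vector_derivative_line[of F _ z 0 v UNIV, OF d(1)]] by simp
    show ?thesis by (rule vector_derivative_unique_at[OF d2 d1])
  qed
  have "((\<lambda>x. ?D v z + integral {0..x} (\<lambda>s. ?D2 u v (?p s 0))) has_vector_derivative ?D2 u v (?p 0 0))
      (at 0 within {0..1})"
  proof -
    have "continuous_on {0..1} (\<lambda>s. ?D2 u v (?p s 0))"
      by (intro continuous_on_compose2[OF cont(2)] continuous_intros) auto
    from integral_has_vector_derivative[OF this, of 0]
    show ?thesis by (auto intro!: derivative_eq_intros)
  qed
  then have i: "((\<lambda>x. ?D v z + integral {0..x} (\<lambda>s. ?D2 u v (?p s 0))) has_vector_derivative ?D2 u v z)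
      (at 0 within {0..1})" by simp
  have d1: "((\<lambda>x. ?D v (z + x *\<^sub>R u)) has_vector_derivative ?D2 u v z) (at 0 within {0..1})"
  proof (rule has_vector_derivative_transform[OF _ _ i])
    show "?D v (z + x *\<^sub>R u) = ?D v z + integral {0..x} (\<lambda>s. ?D2 u v (?p s 0))" if "x \<in> {0..1}" for x
      using int[of x] that by (simp add: algebra_simps)
  qed simp
  have d2: "((\<lambda>x. ?D v (z + x *\<^sub>R u)) has_vector_derivative ?D2 v u z) (at 0 within {0..1})"
    using has_vector_derivative_line[of "?D v" _ z 0 u, OF d(2)] by simp
  show ?thesis
    by (rule vector_derivative_unique_within_closed_interval[of 0 1 0, OF _ _ d1[folded box_real] d2[folded box_real]])
      auto
qed

text \<open>The primitive is the integral of the form along the segment from 0 to \<open>z\<close>.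
  By closedness, the derivative of the integrand in direction \<open>v\<close> equals the
  \<open>t\<close>-derivative of \<open>t\<close> times the form at \<open>t z\<close> applied to
  \<open>v\<close>, so it integrates to the form at \<open>z\<close>.\<close>

lemma poincare:
  fixes P Q :: "complex \<Rightarrow> 'b::euclidean_space"
  assumes P: "smooth_on UNIV P" and Q: "smooth_on UNIV Q"
    and closed: "\<And>w. frechet_derivative P (at w) \<i> = frechet_derivative Q (at w) 1"
  obtains G where "\<And>z. (G has_derivative (\<lambda>v. Re v *\<^sub>R P z + Im v *\<^sub>R Q z)) (at z)"
proof -
  let ?DP = "\<lambda>v w. frechet_derivative P (at w) v" and ?DQ = "\<lambda>v w. frechet_derivative Q (at w) v"
  have dP: "(P has_derivative frechet_derivative P (at w)) (at w)" for w
    by (rule smooth_on_has_derivative[OF open_UNIV P UNIV_I])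
  have dQ: "(Q has_derivative frechet_derivative Q (at w)) (at w)" for w
    by (rule smooth_on_has_derivative[OF open_UNIV Q UNIV_I])
  have lP: "?DP v w = Re v *\<^sub>R ?DP 1 w + Im v *\<^sub>R ?DP \<i> w" for v w
    by (rule linear_complex[OF has_derivative_linear[OF dP]])
  have lQ: "?DQ v w = Re v *\<^sub>R ?DQ 1 w + Im v *\<^sub>R ?DQ \<i> w" for v w
    by (rule linear_complex[OF has_derivative_linear[OF dQ]])
  have c: "continuous_on UNIV P" "continuous_on UNIV Q" "continuous_on UNIV (?DP v)" "continuous_on UNIV (?DQ v)" for v
    by (intro smooth_on_imp_continuous_on smooth_on_derivative P Q open_UNIV)+
  define A where "A z t = P (t *\<^sub>R z) + Re z *\<^sub>R (t *\<^sub>R ?DP 1 (t *\<^sub>R z)) + Im z *\<^sub>R (t *\<^sub>R ?DQ 1 (t *\<^sub>R z))" for z t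
  define B where "B z t = Q (t *\<^sub>R z) + Re z *\<^sub>R (t *\<^sub>R ?DP \<i> (t *\<^sub>R z)) + Im z *\<^sub>R (t *\<^sub>R ?DQ \<i> (t *\<^sub>R z))" for z t
  define F where "F z t = Re z *\<^sub>R P (t *\<^sub>R z) + Im z *\<^sub>R Q (t *\<^sub>R z)" for z t
  \<comment> \<open>The derivative of \<open>F\<close> in \<open>z\<close> as a bounded linear
    function, the type in which it can be integrated when differentiating under the integral;
    \<open>A\<close> and \<open>B\<close> are its values on 1 and i.\<close>
  define fx where "fx z t = (blinfun_scaleR_left (A z t) o\<^sub>L Blinfun Re) +
    (blinfun_scaleR_left (B z t) o\<^sub>L Blinfun Im)"
    for z t
  have fx: "blinfun_apply (fx z t) v = Re v *\<^sub>R A z t + Im v *\<^sub>R B z t" for z t v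
    by (simp add: fx_def blinfun.add_left bounded_linear_Blinfun_apply bounded_linear_Re bounded_linear_Im)
  have scal: "((\<lambda>z. t *\<^sub>R z) has_derivative (\<lambda>v. t *\<^sub>R v)) (at z)" for t :: real and z :: complex
    by (auto intro!: derivative_eq_intros)
  have dF: "((\<lambda>z. F z t) has_derivative blinfun_apply (fx z t)) (at z)" for z t
  proof -
    have "((\<lambda>z. F z t) has_derivative (\<lambda>v. (Re z *\<^sub>R ?DP (t *\<^sub>R v) (t *\<^sub>R z) + Re v *\<^sub>R P (t *\<^sub>R z)) +
        (Im z *\<^sub>R ?DQ (t *\<^sub>R v) (t *\<^sub>R z) + Im v *\<^sub>R Q (t *\<^sub>R z)))) (at z)"
      unfolding F_def
      by (intro has_derivative_add has_derivative_scaleR has_derivative_compose[OF scal dP]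
          has_derivative_compose[OF scal dQ] has_derivative_Re has_derivative_Im has_derivative_ident)
    moreover have "(\<lambda>v. (Re z *\<^sub>R ?DP (t *\<^sub>R v) (t *\<^sub>R z) + Re v *\<^sub>R P (t *\<^sub>R z)) +
        (Im z *\<^sub>R ?DQ (t *\<^sub>R v) (t *\<^sub>R z) + Im v *\<^sub>R Q (t *\<^sub>R z))) = blinfun_apply (fx z t)"
    proof
      fix v
      have e: "?DP (t *\<^sub>R v) w = t *\<^sub>R (Re v *\<^sub>R ?DP 1 w + Im v *\<^sub>R ?DP \<i> w)"
        "?DQ (t *\<^sub>R v) w = t *\<^sub>R (Re v *\<^sub>R ?DQ 1 w + Im v *\<^sub>R ?DQ \<i> w)" for w
        using lP[where v = v and w = w] lQ[where v = v and w = w] linear_scale[OF has_derivative_linear[OF dP]]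
          linear_scale[OF has_derivative_linear[OF dQ]] by simp_all
      show "Re z *\<^sub>R ?DP (t *\<^sub>R v) (t *\<^sub>R z) + Re v *\<^sub>R P (t *\<^sub>R z) +
        (Im z *\<^sub>R ?DQ (t *\<^sub>R v) (t *\<^sub>R z) + Im v *\<^sub>R Q (t *\<^sub>R z)) = blinfun_apply (fx z t) v"
        unfolding fx A_def B_def e by (simp add: algebra_simps)
    qed
    ultimately show ?thesis by simp
  qed
  have cA: "continuous_on UNIV (\<lambda>(z, t). A z t)" "continuous_on UNIV (\<lambda>(z, t). B z t)"
    unfolding A_def B_def split_beta
    by (intro continuous_intros continuous_on_compose2[OF c(1)] continuous_on_compose2[OF c(2)]
        continuous_on_compose2[OF c(3)] continuous_on_compose2[OF c(4)]; simp)+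
  have cfx: "continuous_on UNIV (\<lambda>(z, t). fx z t)"
    using cA unfolding fx_def split_beta
    by (intro continuous_on_add bounded_bilinear.continuous_on[OF bounded_bilinear_blinfun_compose]
        bounded_linear.continuous_on[OF bounded_linear_blinfun_scaleR_left] continuous_on_const) simp_all
  have ct: "continuous_on {0..1} (\<lambda>t. fx z t)" for z
  proof -
    have "continuous_on {0..1} (\<lambda>t. (\<lambda>(z, t). fx z t) (z, t))"
      by (rule continuous_on_compose2[OF cfx]) (auto intro!: continuous_intros)
    then show ?thesis by simp
  qed
  show ?thesis
  proof (rule that)
    fix z
    have "((\<lambda>z. integral (cbox 0 1) (F z)) has_derivative integral (cbox 0 1) (fx z)) (at z within UNIV)"
    proof (rule leibniz_rule)
      show "((\<lambda>x. F x t) has_derivative blinfun_apply (fx x t)) (at x within UNIV)" for x t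
        by (rule dF)
      show "F x integrable_on cbox 0 1" for x
        unfolding F_def
        by (intro integrable_continuous continuous_intros continuous_on_compose2[OF c(1)]
            continuous_on_compose2[OF c(2)]) auto
      show "continuous_on (UNIV \<times> cbox 0 1) (\<lambda>(x, t). fx x t)"
        by (rule continuous_on_subset[OF cfx]) simp
    qed auto
    moreover have "blinfun_apply (integral (cbox 0 1) (fx z)) v = Re v *\<^sub>R P z + Im v *\<^sub>R Q z" for v
    proof -
      have "blinfun_apply (integral (cbox 0 1) (fx z)) v = integral (cbox 0 1) (\<lambda>t. fx z t v)"
        by (rule blinfun_apply_integral) (use ct[of z] integrable_continuous_real in simp)
      also have "\<dots> = Re v *\<^sub>R P z + Im v *\<^sub>R Q z"
      proof (rule integral_unique)
        have "((\<lambda>t. fx z t v) has_integral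
            1 *\<^sub>R (Re v *\<^sub>R P (1 *\<^sub>R z) + Im v *\<^sub>R Q (1 *\<^sub>R z)) - 0 *\<^sub>R (Re v *\<^sub>R P (0 *\<^sub>R z) + Im v *\<^sub>R Q (0 *\<^sub>R z))) {0..1}"
        proof (rule fundamental_theorem_of_calculus)
          fix t :: real
          have lP': "((\<lambda>t. P (t *\<^sub>R z)) has_vector_derivative ?DP z (t *\<^sub>R z)) (at t within {0..1})"
            using has_vector_derivative_line[of P _ 0 t z, OF dP] by simp
          have lQ': "((\<lambda>t. Q (t *\<^sub>R z)) has_vector_derivative ?DQ z (t *\<^sub>R z)) (at t within {0..1})"
            using has_vector_derivative_line[of Q _ 0 t z, OF dQ] by simp
          have "((\<lambda>t. t *\<^sub>R (Re v *\<^sub>R P (t *\<^sub>R z) + Im v *\<^sub>R Q (t *\<^sub>R z))) has_vector_derivative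
              t *\<^sub>R (Re v *\<^sub>R ?DP z (t *\<^sub>R z) + Im v *\<^sub>R ?DQ z (t *\<^sub>R z)) +
              1 *\<^sub>R (Re v *\<^sub>R P (t *\<^sub>R z) + Im v *\<^sub>R Q (t *\<^sub>R z))) (at t within {0..1})"
            by (intro has_vector_derivative_scaleR DERIV_ident has_vector_derivative_add
                bounded_linear.has_vector_derivative[OF bounded_linear_scaleR_right] lP' lQ')
          moreover have "t *\<^sub>R (Re v *\<^sub>R ?DP z (t *\<^sub>R z) + Im v *\<^sub>R ?DQ z (t *\<^sub>R z)) +
              1 *\<^sub>R (Re v *\<^sub>R P (t *\<^sub>R z) + Im v *\<^sub>R Q (t *\<^sub>R z)) = blinfun_apply (fx z t) v"
            unfolding fx A_def B_def lP[where v = z] lQ[where v = z] closed by (simp add: algebra_simps)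
          ultimately show "((\<lambda>t. t *\<^sub>R (Re v *\<^sub>R P (t *\<^sub>R z) + Im v *\<^sub>R Q (t *\<^sub>R z))) has_vector_derivative
              blinfun_apply (fx z t) v) (at t within {0..1})" by simp
        qed simp
        then show "((\<lambda>t. fx z t v) has_integral (Re v *\<^sub>R P z + Im v *\<^sub>R Q z)) (cbox 0 1)" by simp
      qed
      finally show ?thesis .
    qed
    ultimately show "((\<lambda>z. integral (cbox 0 1) (F z)) has_derivative (\<lambda>v. Re v *\<^sub>R P z + Im v *\<^sub>R Q z)) (at z)"
      by (elim has_derivative_eq_rhs) (rule ext)
  qed
qed

context imaginary_conformal_immersion
begin

lemma nhol_i: "nhol N \<phi> \<Longrightarrow> cdiff \<phi> p (\<i> * v) = N p * cdiff \<phi> p v"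
proof -
  assume "nhol N \<phi>"
  then have "N p * (cdiff \<phi> p v + N p * cdiff \<phi> p (\<i> * v)) = 0" by (simp add: nhol_def)
  then show ?thesis by (simp add: distrib_left N_N)
qed

lemma chart_primitive:
  assumes \<phi>: "nhol N \<phi>"
  obtains G where "smooth_on UNIV G"
    "\<And>w. (G has_derivative (\<lambda>v. cdiff f (par q w) (dpar q w v) * \<phi> (par q w))) (at w)"
proof -
  define F where "F = f \<circ> par q"
  define h where "h = \<phi> \<circ> par q"
  have smF: "smooth_on UNIV F" unfolding F_def by (rule csmooth_par_UNIV[OF f_smooth])
  have sm\<phi>: "csmooth UNIV \<phi>" using \<phi> by (simp add: nhol_def)
  have smh: "smooth_on UNIV h" unfolding h_def by (rule csmooth_par_UNIV[OF sm\<phi>])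
  let ?F = "\<lambda>v w. frechet_derivative F (at w) v"
  have smF': "smooth_on UNIV (?F v)" for v by (rule smooth_on_derivative[OF open_UNIV smF])
  have dh: "(h has_derivative frechet_derivative h (at w)) (at w)" for w
    by (rule smooth_on_has_derivative[OF open_UNIV smh UNIV_I])
  have dF: "(?F v has_derivative frechet_derivative (?F v) (at w)) (at w)" for v w
    by (rule smooth_on_has_derivative[OF open_UNIV smF' UNIV_I])
  have D: "frechet_derivative (\<lambda>w. ?F u w * h w) (at w) v =
      ?F u w * frechet_derivative h (at w) v + frechet_derivative (?F u) (at w) v * h w" for u v w
    using frechet_derivative_at[OF has_derivative_mult[OF dF dh], of w u] by (simp add: fun_eq_iff)
  have hi: "frechet_derivative h (at w) \<i> = N (par q w) * frechet_derivative h (at w) 1" for w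
    using cdiff_par[OF open_UNIV sm\<phi>, of q w \<i>] cdiff_par[OF open_UNIV sm\<phi>, of q w 1] nhol_i[OF \<phi>, of "par q w" "dpar q w 1"]
      dpar_mult[of q w \<i> 1] unfolding h_def by simp
  have Fi: "?F \<i> w = ?F 1 w * N (par q w)" for w
    using frechet_f_i[of q w 1] unfolding F_def by simp
  \<comment> \<open>Second derivatives of \<open>F\<close> are symmetric, and the remaining terms
    agree because \<open>F_x h_y = F_x N h_x = F_y h_x\<close>.\<close>
  have closed: "frechet_derivative (\<lambda>w. ?F 1 w * h w) (at w) \<i> = frechet_derivative (\<lambda>w. ?F \<i> w * h w) (at w) 1"
    for w
    unfolding D hi second_derivative_symmetric[OF smF, of 1 w \<i>] Fi[of w] by (simp only: mult.assoc)
  have smP: "smooth_on UNIV (\<lambda>w. ?F v w * h w)" for v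
    by (intro smooth_on_mult smF' smh)
  obtain G where G: "\<And>w. (G has_derivative (\<lambda>v. Re v *\<^sub>R (?F 1 w * h w) + Im v *\<^sub>R (?F \<i> w * h w))) (at w)"
    using poincare[OF smP smP closed] by blast
  have "(\<lambda>v. Re v *\<^sub>R (?F 1 w * h w) + Im v *\<^sub>R (?F \<i> w * h w)) =
      (\<lambda>v. cdiff f (par q w) (dpar q w v) * \<phi> (par q w))" for w
  proof
    fix v
    have "?F v w = Re v *\<^sub>R ?F 1 w + Im v *\<^sub>R ?F \<i> w"
      by (rule linear_complex[OF has_derivative_linear[OF smooth_on_has_derivative[OF open_UNIV smF UNIV_I]]])
    then show "Re v *\<^sub>R (?F 1 w * h w) + Im v *\<^sub>R (?F \<i> w * h w) =
        cdiff f (par q w) (dpar q w v) * \<phi> (par q w)"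
      using frechet_f[of q w v] by (simp add: F_def h_def algebra_simps)
  qed
  with G have "(G has_derivative (\<lambda>v. cdiff f (par q w) (dpar q w v) * \<phi> (par q w))) (at w)" for w
    by metis
  moreover have "smooth_on UNIV G"
    by (rule smooth_on_SucI[OF G]) (intro smooth_on_add smooth_on_bounded_linear[OF bounded_linear_scaleR_right] smP)
  ultimately show ?thesis using that by blast
qed

text \<open>The primitives on the two charts differ by a constant on the overlap, because the
  punctured plane is connected. No period can arise, as each primitive is already defined on a whole
  chart.\<close>

lemma primitive:
  assumes \<phi>: "nhol N \<phi>"
  obtains G where "csmooth UNIV G" "\<And>p v. cdiff G p v = cdiff f p v * \<phi> p"
proof -
  obtain G0 where G0: "smooth_on UNIV G0"
    "\<And>w. (G0 has_derivative (\<lambda>v. cdiff f (Fin w) v * \<phi> (Fin w))) (at w)"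
    using chart_primitive[OF \<phi>, of "Fin 0"] by (auto simp: dpar_def)
  obtain G1 where G1: "smooth_on UNIV G1"
    "\<And>w. (G1 has_derivative (\<lambda>v. cdiff f (par Infty w) (dpar Infty w v) * \<phi> (par Infty w))) (at w)"
    using chart_primitive[OF \<phi>, of Infty] by blast
  have "((\<lambda>w. G0 (1 / w) - G1 w) has_derivative (\<lambda>v. 0)) (at w)" if w: "w \<in> - {0}" for w
  proof -
    have i: "((\<lambda>x. 1 / x) has_derivative (\<lambda>v. - v / w\<^sup>2)) (at w)"
      using w by (auto intro!: derivative_eq_intros simp: field_simps power2_eq_square)
    have "((\<lambda>w. G0 (1 / w) - G1 w) has_derivative (\<lambda>v. cdiff f (Fin (1 / w)) (- v / w\<^sup>2) * \<phi> (Fin (1 / w)) -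
        cdiff f (par Infty w) (dpar Infty w v) * \<phi> (par Infty w))) (at w)"
      by (intro has_derivative_diff G1(2) has_derivative_compose[OF i G0(2)])
    then show ?thesis using w by (simp add: par_Infty dpar_def)
  qed
  then have "G0 (1 / w) - G1 w = G0 (1 / 1) - G1 1" if "w \<noteq> 0" for w
    using that
    by (intro has_derivative_zero_unique_connected[of "- {0}" "\<lambda>w. G0 (1 / w) - G1 w"])
      (auto simp: open_Compl connected_punctured_universe)
  then obtain c where c: "\<And>w. w \<noteq> 0 \<Longrightarrow> G0 (1 / w) = G1 w + c"
    by (metis diff_add_cancel add.commute)
  define G where "G p = (case p of Fin z \<Rightarrow> G0 z | Infty \<Rightarrow> G1 0 + c)" for p
  have GF: "G \<circ> Fin = G0" by (auto simp: G_def)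
  have GI: "G \<circ> par Infty = (\<lambda>w. G1 w + c)"
    using c by (auto simp: G_def par_Infty fun_eq_iff)
  have "csmooth UNIV G"
    unfolding csmooth_iff GF GI using G0(1) G1(1) by (simp add: smooth_on_add smooth_on_const)
  moreover have "cdiff G p v = cdiff f p v * \<phi> p" for p v
  proof (cases p)
    case (Fin z)
    have "cdiff G p = (\<lambda>v. cdiff f p v * \<phi> p)"
      by (rule cdiff_eqI) (use G0(2)[of z] Fin in \<open>simp add: GF\<close>)
    then show ?thesis by simp
  next
    case Infty
    have "cdiff G p = (\<lambda>v. cdiff f p v * \<phi> p)"
      by (rule cdiff_eqI) (use has_derivative_add_const[OF G1(2)[of 0], of c] Infty in
          \<open>simp add: GI par_Infty dpar_def\<close>)
    then show ?thesis by simp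
  qed
  ultimately show ?thesis using that by blast
qed

text \<open>\<open>*dG = df N \<phi> = - N df \<phi>\<close>, so \<open>dG\<close> has the type that
  belongs to \<open>- N\<close>.\<close>

lemma primitive_nhol:
  assumes G: "csmooth UNIV G" "\<And>p v. cdiff G p v = cdiff f p v * \<phi> p"
  shows "nhol (\<lambda>p. - N p) G"
  unfolding nhol_def
proof (intro conjI allI G(1))
  show "cdiff G p v + - N p * cdiff G p (\<i> * v) = 0" for p v
    using N_cdiff_f[of p "\<i> * v"] by (simp add: G(2) cdiff_f_i mult.assoc[symmetric] N_N)
qed

end

section \<open>Vanishing orders of primitives\<close>

text \<open>Gaussian elimination over a division ring. The unknowns stand to the right of the
  coefficients, so equations may be multiplied from the left.\<close>

lemma homogeneous_solution:
  fixes A :: "nat \<Rightarrow> 'i \<Rightarrow> 'a::division_ring"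
  assumes "finite I" "m < card I"
  shows "\<exists>c. (\<exists>i\<in>I. c i \<noteq> 0) \<and> (\<forall>k<m. (\<Sum>i\<in>I. A k i * c i) = 0)"
  using assms
proof (induction m arbitrary: A I)
  case 0
  then have "I \<noteq> {}" by auto
  then show ?case by (intro exI[of _ "\<lambda>_. 1"]) auto
next
  case (Suc m)
  show ?case
  proof (cases "\<forall>i\<in>I. A m i = 0")
    case True
    from Suc.IH[of I A] Suc.prems obtain c where
      c: "\<exists>i\<in>I. c i \<noteq> 0" "\<forall>k<m. (\<Sum>i\<in>I. A k i * c i) = 0" by auto
    have "(\<Sum>i\<in>I. A k i * c i) = 0" if "k < Suc m" for k
      using that c(2) True by (cases "k = m") auto
    with c(1) show ?thesis by blast
  next
    case False
    then obtain i0 where i0: "i0 \<in> I" "A m i0 \<noteq> 0" by blast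
    let ?I = "I - {i0}"
    \<comment> \<open>Row \<open>m\<close> eliminates the unknown \<open>i0\<close> from the other
      rows; \<open>d\<close> below recovers that unknown from row \<open>m\<close>.\<close>
    define A' where "A' k i = A k i - A k i0 * inverse (A m i0) * A m i" for k i
    have "m < card ?I" using Suc.prems i0 by (simp add: card_Diff_singleton)
    from Suc.IH[OF _ this, of A'] Suc.prems(1) obtain c where
      c: "\<exists>i\<in>?I. c i \<noteq> 0" "\<And>k. k < m \<Longrightarrow> (\<Sum>i\<in>?I. A' k i * c i) = 0" by auto
    define d where "d = c(i0 := - (inverse (A m i0) * (\<Sum>i\<in>?I. A m i * c i)))"
    have sum_d: "(\<Sum>i\<in>I. A k i * d i) = A k i0 * d i0 + (\<Sum>i\<in>?I. A k i * c i)" for k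
    proof -
      have "(\<Sum>i\<in>I. A k i * d i) = A k i0 * d i0 + (\<Sum>i\<in>?I. A k i * d i)"
        by (rule sum.remove[OF Suc.prems(1) i0(1)])
      also have "(\<Sum>i\<in>?I. A k i * d i) = (\<Sum>i\<in>?I. A k i * c i)"
        by (rule sum.cong) (auto simp: d_def)
      finally show ?thesis .
    qed
    have "(\<Sum>i\<in>I. A k i * d i) = 0" if "k < Suc m" for k
    proof (cases "k = m")
      case True
      then show ?thesis using i0(2) unfolding sum_d by (simp add: d_def mult.assoc[symmetric])
    next
      case False
      then have "(\<Sum>i\<in>?I. A k i * c i) - A k i0 * (inverse (A m i0) * (\<Sum>i\<in>?I. A m i * c i)) = 0"
        using c(2)[of k] that
        by (simp add: A'_def left_diff_distrib sum_subtractf sum_distrib_left mult.assoc)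
      then show ?thesis unfolding sum_d by (simp add: d_def)
    qed
    moreover have "\<exists>i\<in>I. d i \<noteq> 0" using c(1) by (auto simp: d_def)
    ultimately show ?thesis by blast
  qed
qed

lemma Od_sum: "(\<And>i. i \<in> I \<Longrightarrow> Od k (f i)) \<Longrightarrow> Od k (\<lambda>w. \<Sum>i\<in>I. f i w)"
  by (induction I rule: infinite_finite_induct) (auto intro: Od_zero Od_add)

lemma Od_norm: "Od k f \<Longrightarrow> Od k (\<lambda>w. norm (f w))"
  by (simp add: Od_def)

text \<open>The orders are distinct, so the term of least index with nonzero coefficient cannot be
  cancelled by the others. The coefficients multiply from the right and do not interfere with the
  complex powers on the left.\<close>

lemma order_at_sum:
  fixes m :: nat
  assumes n: "n * n = - 1" and h: "\<And>j. j \<le> m \<Longrightarrow> order_at n (h j) (\<alpha> j)"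
    and \<alpha>: "strict_mono_on {..m} \<alpha>" and c: "\<exists>j\<le>m. c j \<noteq> 0"
  shows "\<exists>j\<le>m. order_at n (\<lambda>w. \<Sum>j\<le>m. h j w * c j) (\<alpha> j)"
proof -
  define j where "j = (LEAST j. j \<le> m \<and> c j \<noteq> 0)"
  have j: "j \<le> m" "c j \<noteq> 0" using LeastI_ex[of "\<lambda>j. j \<le> m \<and> c j \<noteq> 0"] c by (auto simp: j_def)
  have least: "c i = 0" if "i < j" for i
    using not_less_Least[of i "\<lambda>j. j \<le> m \<and> c j \<noteq> 0"] that j(1) by (auto simp: j_def)
  obtain d where d: "d \<noteq> 0" "Od (\<alpha> j + 1) (\<lambda>w. h j w - cx n (w ^ \<alpha> j) * d)"
    using h[OF j(1)] unfolding order_at_def by blast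
  have "Od (\<alpha> j + 1) (\<lambda>w. h i w * c i)" if i: "i \<in> {..m} - {j}" for i
  proof (cases "i < j")
    case True
    then show ?thesis using least Od_zero by simp
  next
    case False
    with i have "\<alpha> j < \<alpha> i" using strict_mono_onD[OF \<alpha>, of j i] j(1) by auto
    then have "Od (\<alpha> j + 1) (h i)" using Od_mono[OF order_at_imp_Od[OF h[of i]]] i by auto
    from Od_mult[OF this Od_const] show ?thesis by simp
  qed
  then have "Od (\<alpha> j + 1) (\<lambda>w. \<Sum>i\<in>{..m} - {j}. h i w * c i)" by (rule Od_sum)
  moreover have "Od (\<alpha> j + 1) (\<lambda>w. (h j w - cx n (w ^ \<alpha> j) * d) * c j)"
    using Od_mult[OF d(2) Od_const] by simp
  ultimately have "Od (\<alpha> j + 1) (\<lambda>w. (h j w - cx n (w ^ \<alpha> j) * d) * c j + (\<Sum>i\<in>{..m} - {j}. h i w * c i))"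
    by (rule Od_add[rotated])
  moreover have "(h j w - cx n (w ^ \<alpha> j) * d) * c j + (\<Sum>i\<in>{..m} - {j}. h i w * c i) =
      (\<Sum>i\<le>m. h i w * c i) - cx n (w ^ \<alpha> j) * (d * c j)" for w
    using sum.remove[of "{..m}" j "\<lambda>i. h i w * c i"] j(1) by (simp add: algebra_simps)
  ultimately have "order_at n (\<lambda>w. \<Sum>j\<le>m. h j w * c j) (\<alpha> j)"
    unfolding order_at_def using d(1) j(2) by (intro exI[of _ "d * c j"]) simp
  with j(1) show ?thesis by blast
qed

abbreviation shifted :: "(cp1 \<Rightarrow> quat) \<Rightarrow> cp1 \<Rightarrow> complex \<Rightarrow> quat" where
  "shifted l p \<equiv> \<lambda>w. l (par p (pos p + w))"

lemma order_at_zero: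
  assumes "n * n = - 1" shows "\<not> order_at n (\<lambda>w. 0) k"
  using order_at_not_Od[OF assms] Od_zero by blast

lemma order_at_nonzero:
  assumes "n * n = - 1" "order_at n (shifted l p) k" shows "\<exists>q. l q \<noteq> 0"
proof (rule ccontr)
  assume "\<nexists>q. l q \<noteq> 0"
  then have "shifted l p = (\<lambda>w. 0)" by auto
  with assms(2) order_at_zero[OF assms(1)] show False by simp
qed

text \<open>Elements with distinct orders are independent, so the \<open>\<phi> j\<close> form a
  basis of the span. This is extracted from a nontrivial relation between them and \<psi>: its
  coefficient at \<psi> cannot vanish, as otherwise \<open>order_at_sum\<close> would assign an
  order to the zero function.\<close>

lemma order_in_span:
  assumes n: "n * n = - 1" and \<phi>: "\<And>j. j \<le> m \<Longrightarrow> \<phi> j \<in> qspan b m"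
    and ord: "\<And>j. j \<le> m \<Longrightarrow> order_at n (shifted (\<phi> j) p) (\<alpha> j)"
    and \<alpha>: "strict_mono_on {..m} \<alpha>" and \<psi>: "\<psi> \<in> qspan b m" "\<psi> q \<noteq> 0"
  shows "\<exists>j\<le>m. order_at n (shifted \<psi> p) (\<alpha> j)"
proof -
  have "\<exists>B. \<phi> j = (\<lambda>p. \<Sum>k\<le>m. b k p * B k)" if "j \<le> m" for j
    using \<phi>[OF that] by (auto simp: qspan_def)
  then obtain B where B: "\<And>j. j \<le> m \<Longrightarrow> \<phi> j = (\<lambda>p. \<Sum>k\<le>m. b k p * B j k)" by metis
  obtain d where d: "\<psi> = (\<lambda>p. \<Sum>k\<le>m. b k p * d k)" using \<psi>(1) by (auto simp: qspan_def)
  \<comment> \<open>Columns up to \<open>m\<close> hold the coefficients of the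
    \<open>\<phi> j\<close>, column \<open>Suc m\<close> those of \<psi>: there are
    \<open>m + 1\<close> equations in \<open>m + 2\<close> unknowns.\<close>
  define A where "A k j = (if j \<le> m then B j k else d k)" for k j
  have "Suc m < card {..Suc m}" by simp
  from homogeneous_solution[OF _ this, of A] obtain c where
    c: "\<exists>i\<le>Suc m. c i \<noteq> 0" "\<And>k. k \<le> m \<Longrightarrow> (\<Sum>i\<le>Suc m. A k i * c i) = 0"
    by (auto simp: less_Suc_eq_le)
  have rel: "(\<Sum>j\<le>m. \<phi> j p * c j) + \<psi> p * c (Suc m) = 0" for p
  proof -
    have "(\<Sum>j\<le>m. \<phi> j p * c j) + \<psi> p * c (Suc m) = (\<Sum>j\<le>Suc m. (\<Sum>k\<le>m. b k p * A k j) * c j)"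
      by (simp add: A_def d B)
    also have "\<dots> = (\<Sum>j\<le>Suc m. \<Sum>k\<le>m. b k p * (A k j * c j))"
      by (simp only: sum_distrib_right mult.assoc)
    also have "\<dots> = (\<Sum>k\<le>m. b k p * (\<Sum>j\<le>Suc m. A k j * c j))"
      by (subst sum.swap) (simp only: sum_distrib_left)
    finally show ?thesis using c(2) by simp
  qed
  show ?thesis
  proof (cases "c (Suc m) = 0")
    case True
    with c(1) have "\<exists>j\<le>m. c j \<noteq> 0" by (auto simp: le_Suc_eq)
    from order_at_sum[OF n ord \<alpha> this] obtain j where
      "order_at n (\<lambda>w. \<Sum>j\<le>m. shifted (\<phi> j) p w * c j) (\<alpha> j)" by blast
    moreover have "(\<lambda>w. \<Sum>j\<le>m. shifted (\<phi> j) p w * c j) = (\<lambda>w. 0)"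
      using rel True by simp
    ultimately show ?thesis using order_at_zero[OF n] by simp
  next
    case False
    let ?e = "\<lambda>j. c j * - inverse (c (Suc m))"
    have eq: "\<psi> p = (\<Sum>j\<le>m. \<phi> j p * ?e j)" for p
    proof -
      have "\<psi> p * c (Suc m) = - (\<Sum>j\<le>m. \<phi> j p * c j)"
        using rel[of p] by (simp add: eq_neg_iff_add_eq_0 add.commute)
      then have "\<psi> p * c (Suc m) * inverse (c (Suc m)) = - (\<Sum>j\<le>m. \<phi> j p * c j) * inverse (c (Suc m))"
        by simp
      then show ?thesis using False by (simp add: mult.assoc sum_distrib_right sum_negf)
    qed
    have "\<exists>j\<le>m. ?e j \<noteq> 0"
    proof (rule ccontr)
      assume "\<not> (\<exists>j\<le>m. ?e j \<noteq> 0)"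
      then have e0: "?e j = 0" if "j \<le> m" for j using that by blast
      have "\<psi> q = (\<Sum>j\<le>m. \<phi> j q * 0)" unfolding eq[of q] by (intro sum.cong refl) (simp only: e0 atMost_iff)
      then have "\<psi> q = 0" by simp
      with \<psi>(2) show False by simp
    qed
    from order_at_sum[OF n ord \<alpha> this] show ?thesis by (simp only: eq[symmetric])
  qed
qed

text \<open>The mean value inequality on the disc of radius \<open>norm w\<close> bounds
  \<open>H w\<close> by the supremum of the derivative times \<open>norm w\<close>, which is the
  extra order.\<close>

lemma Od_integrate:
  assumes r: "0 < r" and H: "\<And>w. norm w < r \<Longrightarrow> (H has_derivative H' w) (at w)" and H0: "H 0 = 0"
    and B: "\<And>w v. norm w < r \<Longrightarrow> norm (H' w v) \<le> B w * norm v" and O: "Od m B"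
  shows "Od (m + 1) H"
proof -
  from OdE[OF O] obtain C s where s: "0 < s" "0 \<le> C" "\<And>w. norm w < s \<Longrightarrow> norm (B w) \<le> C * norm w ^ m"
    by metis
  have "norm (H w) \<le> C * norm w ^ (m + 1)" if w: "norm w < min r s" for w
  proof -
    have "norm (H w - H 0) \<le> (C * norm w ^ m) * norm (w - 0)"
    proof (rule differentiable_bound[of "cball 0 (norm w)" H H'])
      fix x :: complex assume x: "x \<in> cball 0 (norm w)"
      then have x': "norm x \<le> norm w" "norm x < r" "norm x < s" using w by auto
      show "(H has_derivative H' x) (at x within cball 0 (norm w))"
        by (rule has_derivative_at_withinI[OF H[OF x'(2)]])
      have "B x \<le> C * norm w ^ m"
      proof -
        have "B x \<le> norm (B x)" by simp
        also have "\<dots> \<le> C * norm x ^ m" by (rule s(3)[OF x'(3)])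
        also have "\<dots> \<le> C * norm w ^ m" using x'(1) s(2) by (intro mult_left_mono power_mono) auto
        finally show ?thesis .
      qed
      then have "norm (H' x v) \<le> (C * norm w ^ m) * norm v" for v
        using B[OF x'(2), of v] mult_right_mono[of "B x" "C * norm w ^ m" "norm v"] by simp
      then show "onorm (H' x) \<le> C * norm w ^ m"
        by (rule onorm_bound[rotated]) (use s(2) in auto)
    qed auto
    then show ?thesis by (simp add: H0 mult_ac)
  qed
  moreover have "0 < min r s" using r s(1) by simp
  ultimately show ?thesis unfolding Od_def by blast
qed

context imaginary_conformal_immersion
begin

lemma cdiff_f_cx_swap: "cdiff f p 1 * cx (N p) z = cx (- N p) z * cdiff f p 1"
  by (simp add: cx_alt distrib_left left_diff_distrib N_cdiff_f)

text \<open>Integrating \<open>f_x w^k c dw\<close> gives the leading term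
  \<open>f_x w^(k+1) c / (k+1)\<close>, and \<open>cdiff_f_cx_swap\<close> moves the complex power
  to the left at the price of replacing \<open>N\<close> by \<open>- N\<close>. What remains has a
  derivative of order \<open>k + 1\<close> and is handled by \<open>Od_integrate\<close>.\<close>

lemma order_primitive:
  assumes \<phi>: "csmooth UNIV \<phi>" and G: "csmooth UNIV G" "\<And>p v. cdiff G p v = cdiff f p v * \<phi> p"
    and G0: "G p = 0" and ord: "order_at (N p) (shifted \<phi> p) k"
  shows "order_at (- N p) (shifted G p) (k + 1)"
proof -
  let ?P = "\<lambda>w. par p (pos p + w)"
  let ?n = "N p" and ?a = "cdiff f p 1"
  from ord obtain c where c: "c \<noteq> 0" and R: "Od (k + 1) (\<lambda>w. \<phi> (?P w) - cx ?n (w ^ k) * c)"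
    unfolding order_at_def by blast
  define T where "T w v = frechet_derivative (f \<circ> par p) (at (pos p + w)) v" for w v
  have T0: "T 0 v = cdiff f p v" for v unfolding T_def cdiff_def by simp
  have lin: "T w v = Re v *\<^sub>R T w 1 + Im v *\<^sub>R T w \<i>" for w v
    unfolding T_def
    by (rule linear_complex[OF has_derivative_linear[OF csmooth_has_derivative[OF open_UNIV f_smooth UNIV_I]]])
  have dT: "Od 1 (\<lambda>w. T w v - T 0 v)" for v
  proof -
    have "((\<lambda>x. frechet_derivative (f \<circ> par p) (at x) v) has_derivative
        frechet_derivative (\<lambda>x. frechet_derivative (f \<circ> par p) (at x) v) (at (pos p + 0))) (at (pos p + 0))"
      by (rule smooth_on_has_derivative[OF open_UNIV smooth_on_derivative[OF open_UNIV csmooth_par_UNIV[OF f_smooth]] UNIV_I])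
    from Od_differentiable[OF has_derivative_shift[OF this]] show ?thesis by (simp add: T_def)
  qed
  let ?H = "\<lambda>w. G (?P w) - (1 / real (k + 1)) *\<^sub>R (?a * cx ?n (w ^ (k + 1)) * c)"
  let ?H' = "\<lambda>w v. T w v * \<phi> (?P w) - ?a * cx ?n (v * w ^ k) * c"
  \<comment> \<open>The first summand accounts for replacing \<open>df\<close> by its value at
    \<open>p\<close>, the second for replacing \<phi> by its leading term.\<close>
  define B where "B w = (norm (T w 1 - T 0 1) + norm (T w \<i> - T 0 \<i>)) * norm (\<phi> (?P w)) +
    (norm (T 0 1) + norm (T 0 \<i>)) * norm (\<phi> (?P w) - cx ?n (w ^ k) * c)" for w
  have "Od (k + 1 + 1) ?H"
  proof (rule Od_integrate[where H' = ?H' and B = B and r = 1])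
    fix w :: complex
    show "(?H has_derivative ?H' w) (at w)"
    proof -
      have "((\<lambda>w. (G \<circ> par p) (pos p + w)) has_derivative frechet_derivative (G \<circ> par p) (at (pos p + w))) (at w)"
        by (rule has_derivative_shift[OF csmooth_has_derivative[OF open_UNIV G(1) UNIV_I]])
      moreover have "frechet_derivative (G \<circ> par p) (at (pos p + w)) = (\<lambda>v. T w v * \<phi> (?P w))"
        using cdiff_par[OF open_UNIV G(1), of p "pos p + w"] frechet_f[of p "pos p + w"]
        by (auto simp: T_def G(2))
      ultimately have 1: "((\<lambda>w. G (?P w)) has_derivative (\<lambda>v. T w v * \<phi> (?P w))) (at w)" by simp
      have "((\<lambda>w. w ^ (k + 1)) has_derivative (\<lambda>v. (of_nat (k + 1) * w ^ k) * v)) (at w)"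
        using DERIV_power[OF DERIV_ident, where x = w and s = UNIV and n = "k + 1"] by (simp add: has_field_derivative_def)
      then have "((\<lambda>w. (1 / real (k + 1)) *\<^sub>R (?a * cx ?n (w ^ (k + 1)) * c)) has_derivative
          (\<lambda>v. (1 / real (k + 1)) *\<^sub>R (?a * cx ?n ((of_nat (k + 1) * w ^ k) * v) * c))) (at w)"
        by (intro bounded_linear.has_derivative[OF bounded_linear_scaleR_right]
            bounded_linear.has_derivative[OF bounded_linear_mult_left]
            bounded_linear.has_derivative[OF bounded_linear_mult_right]
            bounded_linear.has_derivative[OF bounded_linear_cx])
      moreover have "(1 / real (k + 1)) *\<^sub>R (?a * cx ?n ((of_nat (k + 1) * w ^ k) * v) * c) =
          ?a * cx ?n (v * w ^ k) * c" for v
      proof -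
        have "(of_nat (k + 1) * w ^ k) * v = real (k + 1) *\<^sub>R (v * w ^ k)"
          by (simp add: scaleR_conv_of_real algebra_simps)
        then show ?thesis by (simp only: cx_simps mult_scaleR_left mult_scaleR_right scaleR_scaleR) simp
      qed
      ultimately show ?thesis using has_derivative_diff[OF 1] by simp
    qed
    show "norm (?H' w v) \<le> B w * norm v" for v
    proof -
      have key: "norm (T' v) \<le> (norm (T' 1) + norm (T' \<i>)) * norm v"
        if "T' v = Re v *\<^sub>R T' 1 + Im v *\<^sub>R T' \<i>" for T' :: "complex \<Rightarrow> quat"
      proof -
        have "norm (T' v) \<le> \<bar>Re v\<bar> * norm (T' 1) + \<bar>Im v\<bar> * norm (T' \<i>)"
          using norm_triangle_ineq[of "Re v *\<^sub>R T' 1" "Im v *\<^sub>R T' \<i>"] by (simp add: that)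
        also have "\<dots> \<le> norm v * norm (T' 1) + norm v * norm (T' \<i>)"
          by (intro add_mono mult_right_mono abs_Re_le_cmod abs_Im_le_cmod) auto
        finally show ?thesis by (simp add: algebra_simps)
      qed
      have k1: "norm (T w v - T 0 v) \<le> (norm (T w 1 - T 0 1) + norm (T w \<i> - T 0 \<i>)) * norm v"
        by (rule key) (simp add: lin[of w v] lin[of 0 v] algebra_simps)
      have k2: "norm (T 0 v) \<le> (norm (T 0 1) + norm (T 0 \<i>)) * norm v"
        by (rule key[OF lin])
      have "T 0 v * cx ?n (w ^ k) = ?a * cx ?n (v * w ^ k)"
        by (simp add: T0 cdiff_f_cx[of p v] cx_mult[OF N_sq] mult.assoc)
      then have "T 0 v * (cx ?n (w ^ k) * c) = ?a * (cx ?n (v * w ^ k) * c)"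
        by (metis mult.assoc)
      then have "?H' w v = (T w v - T 0 v) * \<phi> (?P w) + T 0 v * (\<phi> (?P w) - cx ?n (w ^ k) * c)"
        by (simp add: algebra_simps)
      then have "norm (?H' w v) \<le> norm (T w v - T 0 v) * norm (\<phi> (?P w)) +
          norm (T 0 v) * norm (\<phi> (?P w) - cx ?n (w ^ k) * c)"
        by (metis norm_mult norm_triangle_ineq)
      also have "\<dots> \<le> (norm (T w 1 - T 0 1) + norm (T w \<i> - T 0 \<i>)) * norm v * norm (\<phi> (?P w)) +
          (norm (T 0 1) + norm (T 0 \<i>)) * norm v * norm (\<phi> (?P w) - cx ?n (w ^ k) * c)"
        by (intro add_mono mult_right_mono k1 k2 norm_ge_zero)
      finally show ?thesis by (simp add: B_def algebra_simps)
    qed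
    show "?H 0 = 0" using G0 by (simp add: cx_simps)
  next
    show "Od (k + 1) B"
      unfolding B_def
    proof (rule Od_add)
      show "Od (k + 1) (\<lambda>w. (norm (T w 1 - T 0 1) + norm (T w \<i> - T 0 \<i>)) * norm (\<phi> (?P w)))"
        using Od_mult[OF Od_add[OF Od_norm[OF dT] Od_norm[OF dT]] Od_norm[OF order_at_imp_Od[OF ord]]]
        by simp
      show "Od (k + 1) (\<lambda>w. (norm (T 0 1) + norm (T 0 \<i>)) * norm (\<phi> (?P w) - cx ?n (w ^ k) * c))"
        using Od_mult[OF Od_const Od_norm[OF R]] by simp
    qed
  qed simp
  moreover have "(1 / real (k + 1)) *\<^sub>R (?a * cx ?n (w ^ (k + 1)) * c) =
      cx (- ?n) (w ^ (k + 1)) * ((1 / real (k + 1)) *\<^sub>R (?a * c))" for w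
    by (simp only: cdiff_f_cx_swap mult_scaleR_right mult.assoc)
  ultimately have "Od (k + 1 + 1) (\<lambda>w. G (?P w) - cx (- ?n) (w ^ (k + 1)) * ((1 / real (k + 1)) *\<^sub>R (?a * c)))"
    by simp
  moreover have "(1 / real (k + 1)) *\<^sub>R (?a * c) \<noteq> 0" using c cdiff_f_nonzero[of 1 p] by simp
  ultimately show ?thesis unfolding order_at_def by blast
qed

lemma cdiff_sum:
  assumes "\<And>k. k \<le> n \<Longrightarrow> csmooth UNIV (b k)"
  shows "cdiff (\<lambda>p. \<Sum>j\<le>(n::nat). b j p * (c j :: quat)) p v = (\<Sum>j\<le>n. cdiff (b j) p v * c j)"
  using assms
proof (induction n)
  case 0
  then show ?case using cdiff_mult[OF open_UNIV _ csmooth_const UNIV_I, of "b 0"] by simp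
next
  case (Suc n)
  have s: "csmooth UNIV (\<lambda>p. \<Sum>j\<le>n. b j p * c j)"
    using Suc.prems by (intro csmooth_sum csmooth_mult csmooth_const) simp
  have b: "csmooth UNIV (\<lambda>p. b (Suc n) p * c (Suc n))"
    using Suc.prems by (intro csmooth_mult csmooth_const) simp
  show ?case
    using Suc.IH Suc.prems cdiff_add[OF open_UNIV s b UNIV_I, of p v]
      cdiff_mult[OF open_UNIV Suc.prems[of "Suc n"] csmooth_const UNIV_I, of "c (Suc n)" p v] by simp
qed

text \<open>The sections of the dual bundle are the constants and the primitives of \<open>df \<phi>\<close> for
  holomorphic \<open>\<phi>\<close>.\<close>

definition prims :: "(nat \<Rightarrow> cp1 \<Rightarrow> quat) \<Rightarrow> nat \<Rightarrow> cp1 \<Rightarrow> quat" where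
  "prims G k = (case k of 0 \<Rightarrow> (\<lambda>p. 1) | Suc j \<Rightarrow> G j)"

lemma prims_sum: "(\<Sum>k\<le>Suc n. prims G k p * c k) = c 0 + (\<Sum>k\<le>n. G k p * c (Suc k))"
  by (simp only: sum.atMost_Suc_shift) (simp add: prims_def)

context
  fixes b G :: "nat \<Rightarrow> cp1 \<Rightarrow> quat" and n :: nat
  assumes b: "\<And>k. k \<le> n \<Longrightarrow> nhol N (b k)"
    and G: "\<And>k. k \<le> n \<Longrightarrow> csmooth UNIV (G k)"
    "\<And>k p v. k \<le> n \<Longrightarrow> cdiff (G k) p v = cdiff f p v * b k p"
begin

lemma b_smooth: "k \<le> n \<Longrightarrow> csmooth UNIV (b k)"
  using b by (simp add: nhol_def)

lemma cdiff_prims: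
  "cdiff (\<lambda>p. \<Sum>k\<le>Suc n. prims G k p * c k) p v = cdiff f p v * (\<Sum>k\<le>n. b k p * c (Suc k))"
proof -
  have s: "csmooth UNIV (\<lambda>p. \<Sum>k\<le>n. G k p * c (Suc k))"
    using G(1) by (intro csmooth_sum csmooth_mult csmooth_const) simp
  show ?thesis
    using cdiff_add[OF open_UNIV csmooth_const s UNIV_I, of "c 0" p v] cdiff_sum[where n = n and b = G and c = "\<lambda>k. c (Suc k)" and p = p and v = v, OF G(1)] G(2)
    unfolding prims_sum by (simp add: sum_distrib_left mult.assoc)
qed

lemma prims_nhol: "k \<le> Suc n \<Longrightarrow> nhol (\<lambda>p. - N p) (prims G k)"
proof (cases k)
  case 0
  then show ?thesis by (simp add: prims_def nhol_def csmooth_const)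
next
  case (Suc j)
  moreover assume "k \<le> Suc n"
  ultimately have "nhol (\<lambda>p. - N p) (G j)"
    by (intro primitive_nhol[of "G j" "b j"]) (simp_all add: G)
  with Suc show ?thesis by (simp add: prims_def)
qed

text \<open>Differentiating a relation removes the constant and, \<open>df\<close> being invertible,
  leaves a relation between the \<open>b k\<close>.\<close>

lemma qindep_prims:
  assumes ind: "qindep b n" shows "qindep (prims G) (Suc n)"
  unfolding qindep_def
proof (intro allI impI)
  fix c k assume 0: "\<forall>p. (\<Sum>j\<le>Suc n. prims G j p * c j) = 0" and k: "k \<le> Suc n"
  have "(\<Sum>k\<le>n. b k p * c (Suc k)) = 0" for p
  proof -
    have "cdiff (\<lambda>p. \<Sum>j\<le>Suc n. prims G j p * c j) p 1 = 0" using 0 by (simp only: cdiff_const)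
    then show ?thesis unfolding cdiff_prims using cdiff_f_nonzero[of 1 p] by simp
  qed
  then have c: "\<forall>k\<le>n. c (Suc k) = 0"
    using ind[unfolded qindep_def, THEN spec, of "\<lambda>k. c (Suc k)"] by simp
  moreover have "c 0 = 0"
    using 0[THEN spec, of Infty] c unfolding prims_sum by simp
  ultimately show "c k = 0" using k by (cases k) auto
qed

text \<open>An element with nonzero value at \<open>p\<close> has order 0. Any other nonzero element
  is a primitive, vanishing at \<open>p\<close>, of \<open>df \<phi>\<close> with \<phi> not
  identically zero, and its order exceeds that of \<phi> by one.\<close>

lemma orders_prims:
  assumes a: "strict_mono_on {..n} a"
    and V: "a ` {..n} = {k. \<exists>l\<in>qspan b n. order_at (N p) (shifted l p) k}"
  shows "{k. \<exists>l\<in>qspan (prims G) (Suc n). (\<exists>q. l q \<noteq> 0) \<and> order_at (- N p) (shifted l p) k} =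
    insert 0 (Suc ` a ` {..n})"
proof -
  have mN: "(- N p) * (- N p) = - 1" by (rule minus_N(1))
  have mem: "(\<lambda>p. \<Sum>k\<le>Suc n. prims G k p * c k) \<in> qspan (prims G) (Suc n)" for c
    unfolding qspan_def by blast
  have smp: "csmooth UNIV (\<lambda>p. \<Sum>k\<le>Suc n. prims G k p * c k)" for c
    using prims_nhol by (intro csmooth_sum csmooth_mult csmooth_const) (simp add: nhol_def)
  have smb: "csmooth UNIV (\<lambda>p. \<Sum>k\<le>n. b k p * c k)" for c
    using b_smooth by (intro csmooth_sum csmooth_mult csmooth_const) simp
  have zero: "order_at (- N p) (shifted l p) 0" if "csmooth UNIV l" "l p \<noteq> 0" for l
    using Od_differentiable[OF csmooth_has_derivative_shift[OF open_UNIV that(1) UNIV_I, of p]] that(2)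
    unfolding order_at_def by (intro exI[of _ "l p"]) (simp add: cx_simps)
  show ?thesis
  proof (intro set_eqI iffI)
    fix k assume "k \<in> insert 0 (Suc ` a ` {..n})"
    then consider "k = 0" | j where "k = Suc j" "j \<in> a ` {..n}" by blast
    then show "k \<in> {k. \<exists>l\<in>qspan (prims G) (Suc n). (\<exists>q. l q \<noteq> 0) \<and> order_at (- N p) (shifted l p) k}"
    proof cases
      case 1
      let ?c = "\<lambda>k::nat. if k = 0 then 1 else 0 :: quat"
      have eq: "(\<lambda>p. \<Sum>k\<le>Suc n. prims G k p * ?c k) = (\<lambda>p. 1)" unfolding prims_sum by simp
      have "order_at (- N p) (shifted (\<lambda>p. 1) p) 0" by (rule zero[OF csmooth_const]) simp
      with 1 mem[of ?c, unfolded eq] show ?thesis by (intro CollectI bexI[of _ "\<lambda>p. 1"]) auto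
    next
      case 2
      then obtain c where o: "order_at (N p) (shifted (\<lambda>p. \<Sum>k\<le>n. b k p * c k) p) j"
        unfolding V by (auto simp: qspan_def)
      \<comment> \<open>The coefficient of the constant section is chosen so that the primitive
        vanishes at \<open>p\<close>.\<close>
      let ?c = "\<lambda>i. case i of 0 \<Rightarrow> - (\<Sum>k\<le>n. G k p * c k) | Suc k \<Rightarrow> c k"
      let ?l = "\<lambda>p. \<Sum>k\<le>Suc n. prims G k p * ?c k"
      have l: "order_at (- N p) (shifted ?l p) (j + 1)"
      proof (rule order_primitive[OF smb smp _ _ o])
        show "cdiff ?l p v = cdiff f p v * (\<Sum>k\<le>n. b k p * c k)" for p v unfolding cdiff_prims by simp
        show "?l p = 0" unfolding prims_sum by simp
      qed
      have nz: "\<exists>q. ?l q \<noteq> 0" by (rule order_at_nonzero[OF mN l])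
      show ?thesis
        by (rule CollectI, rule bexI[OF _ mem[of ?c]], rule conjI[OF nz]) (use l 2(1) in \<open>simp del: sum.atMost_Suc\<close>)
    qed
  next
    fix k assume "k \<in> {k. \<exists>l\<in>qspan (prims G) (Suc n). (\<exists>q. l q \<noteq> 0) \<and> order_at (- N p) (shifted l p) k}"
    then obtain c where nz: "\<exists>q. (\<Sum>k\<le>Suc n. prims G k q * c k) \<noteq> 0"
      and o: "order_at (- N p) (shifted (\<lambda>p. \<Sum>k\<le>Suc n. prims G k p * c k) p) k"
      by (auto simp: qspan_def)
    let ?l = "\<lambda>p. \<Sum>k\<le>Suc n. prims G k p * c k"
    show "k \<in> insert 0 (Suc ` a ` {..n})"
    proof (cases "?l p = 0")
      case False
      from order_at_unique[OF mN o zero[OF smp False]] show ?thesis by simp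
    next
      case True
      let ?\<phi> = "\<lambda>p. \<Sum>k\<le>n. b k p * c (Suc k)"
      \<comment> \<open>Otherwise the element would be constant and, vanishing at \<open>p\<close>,
        identically zero.\<close>
      have "\<exists>q. ?\<phi> q \<noteq> 0"
      proof (rule ccontr)
        assume "\<nexists>q. ?\<phi> q \<noteq> 0"
        then have "cdiff ?l q v = 0" for q v unfolding cdiff_prims by simp
        from csmooth_constant[OF smp this] True nz show False by metis
      qed
      then obtain q where q: "?\<phi> q \<noteq> 0" by blast
      have "\<exists>l. l \<in> qspan b n \<and> order_at (N p) (shifted l p) (a j)" if "j \<le> n" for j
        using V that by blast
      then obtain \<phi> where \<phi>: "\<And>j. j \<le> n \<Longrightarrow> \<phi> j \<in> qspan b n"
        "\<And>j. j \<le> n \<Longrightarrow> order_at (N p) (shifted (\<phi> j) p) (a j)" by metis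
      have "?\<phi> \<in> qspan b n"
        unfolding qspan_def by (intro CollectI exI[of _ "\<lambda>k. c (Suc k)"]) simp
      from order_in_span[OF N_sq \<phi> a this q] obtain j where j: "j \<le> n"
        "order_at (N p) (shifted ?\<phi> p) (a j)" by blast
      have "order_at (- N p) (shifted ?l p) (a j + 1)"
        by (rule order_primitive[OF smb smp cdiff_prims True j(2)])
      from order_at_unique[OF mN o this] j(1) show ?thesis by auto
    qed
  qed
qed

end

end

section \<open>The degree of the Euclidean bundle\<close>

text \<open>A real linear left inverse of \<open>qc\<close>; the components along \<open>qj\<close>
  and \<open>qk\<close> are discarded.\<close>

definition q2c :: "quat \<Rightarrow> complex" where "q2c x = Complex (qre x) (qim1 x)"

lemma qc_simps: "qc (a * b) = qc a * qc b" "qc 1 = 1" "qcnj (qc a) = qc (cnj a)"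
  "qc a * qj = qj * qc (cnj a)" "q2c (qc a) = a" "qc 0 = 0"
  by (simp_all add: qc_def times_quat_def one_quat_def zero_quat_def qcnj_def qj_def q2c_def complex_eq_iff)

lemma qc_inject [simp]: "qc a = qc b \<longleftrightarrow> a = b"
  using qc_simps(5) by metis

lemma qj_nonzero: "qj \<noteq> 0"
  by (simp add: qj_def zero_quat_def)

lemma bounded_linear_q2c: "bounded_linear q2c"
proof (rule bounded_linear_intro[where K = 1])
  show "norm (q2c x) \<le> norm x * 1" for x
    by (simp add: q2c_def cmod_def norm_quat_def qnormsq_def)
qed (simp_all add: q2c_def complex_eq_iff quat_vector_defs)

lemma quat_anticommute_qi:
  assumes "qi * x = - (x * qi)" shows "x = qj * qc (q2c (- qj * x))"
  using assms by (simp add: quat_eq_iff qi_def qj_def qc_def q2c_def times_quat_def uminus_quat_def)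

lemma cx_mult_frame: "n * l = l * qi \<Longrightarrow> cx n v * l = l * qc v"
proof -
  assume "n * l = l * qi"
  then have "cx n v * l = l * (Re v *\<^sub>R 1 + Im v *\<^sub>R qi)" by (simp add: cx_alt algebra_simps)
  also have "Re v *\<^sub>R 1 + Im v *\<^sub>R qi = qc v"
    by (simp add: qc_def quat_vector_defs one_quat_def qi_def)
  finally show ?thesis .
qed

text \<open>All values are integral multiples of \<open>2 pi i\<close>, so distinct values are at
  least \<open>2 pi\<close> apart, and a continuous function on an interval can attain only one of
  them.\<close>

lemma exp_one_constant:
  fixes u :: "real \<Rightarrow> complex"
  assumes "continuous_on {0..1} u" "\<And>t. t \<in> {0..1} \<Longrightarrow> exp (u t) = 1"
  shows "u 1 = u 0"
proof -
  have "u constant_on {0..1}"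
  proof (rule continuous_discrete_range_constant[OF connected_Icc assms(1)])
    fix x :: real assume x: "x \<in> {0..1}"
    have "2 * pi \<le> norm (u y - u x)" if y: "y \<in> {0..1}" and ne: "u y \<noteq> u x" for y
    proof -
      have "exp (u y - u x) = 1" using assms(2)[OF x] assms(2)[OF y] by (simp add: exp_diff)
      then obtain n :: int where n: "Re (u y - u x) = 0" "Im (u y - u x) = of_int (2 * n) * pi"
        unfolding exp_eq_1 by blast
      have "n \<noteq> 0" using n ne by (auto simp: complex_eq_iff)
      then have "1 \<le> \<bar>real_of_int n\<bar>" by linarith
      then have "2 * pi \<le> \<bar>Im (u y - u x)\<bar>" using n(2) by (simp add: abs_mult)
      also have "\<dots> \<le> norm (u y - u x)" by (rule abs_Im_le_cmod)
      finally show ?thesis .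
    qed
    then show "\<exists>e>0. \<forall>y. y \<in> {0..1} \<and> u y \<noteq> u x \<longrightarrow> e \<le> norm (u y - u x)"
      by (intro exI[of _ "2 * pi"]) simp
  qed
  then show ?thesis by (auto simp: constant_on_def)
qed

lemma Fin_continuous:
  assumes "csmooth (- {Infty}) l" shows "continuous_on UNIV (\<lambda>z. l (Fin z))"
proof -
  have "Fin -` (- {Infty}) = UNIV" by auto
  then show ?thesis
    using smooth_on_imp_continuous_on[OF csmooth_par[OF assms, of "Fin 0"]] by (simp add: o_def)
qed

lemma par_Infty_continuous:
  assumes "csmooth (- {Fin 0}) l" shows "continuous_on UNIV (\<lambda>w. l (par Infty w))"
proof -
  have "par Infty -` (- {Fin 0}) = UNIV" by (auto simp: par_Infty)
  then show ?thesis
    using smooth_on_imp_continuous_on[OF csmooth_par[OF assms, of Infty]] by (simp add: o_def)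
qed

lemma Fin_continuous_nonzero:
  assumes "csmooth (- {Fin 0}) l" shows "continuous_on (- {0}) (\<lambda>z. l (Fin z))"
proof -
  have "Fin -` (- {Fin 0}) = - {0}" by auto
  then show ?thesis
    using smooth_on_imp_continuous_on[OF csmooth_par[OF assms, of "Fin 0"]] by (simp add: o_def)
qed

text \<open>The definition of the degree mentions no continuity of \<open>g\<close>; it is recovered
  from the frames, as \<open>g\<close> is the complex part of \<open>inverse l0 * l1\<close>.
  Winding numbers can then be computed by continuous logarithms.\<close>

lemma transition_path:
  assumes l0: "csmooth (- {Infty}) l0" "\<And>p. p \<noteq> Infty \<Longrightarrow> l0 p \<noteq> 0"
    and l1: "csmooth (- {Fin 0}) l1" "\<And>p. p \<noteq> Fin 0 \<Longrightarrow> l1 p \<noteq> 0"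
    and g: "\<And>z. z \<noteq> 0 \<Longrightarrow> l1 (Fin z) = l0 (Fin z) * qc (g z)"
  shows "path (g \<circ> circlepath 0 1)" "0 \<notin> path_image (g \<circ> circlepath 0 1)"
proof -
  have geq: "g z = q2c (inverse (l0 (Fin z)) * l1 (Fin z))" if "z \<noteq> 0" for z
    using g[OF that] l0(2)[of "Fin z"] by (simp add: mult.assoc[symmetric] qc_simps)
  have "continuous_on (- {0}) (\<lambda>z. q2c (inverse (l0 (Fin z)) * l1 (Fin z)))"
    using l0(2)
    by (intro bounded_linear.continuous_on[OF bounded_linear_q2c] continuous_on_mult continuous_on_inverse
        Fin_continuous_nonzero[OF l1(1)] continuous_on_subset[OF Fin_continuous[OF l0(1)]]) auto
  then have cg: "continuous_on (- {0}) g"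
    by (rule continuous_on_eq) (use geq in simp)
  have nz: "circlepath 0 1 t \<noteq> 0" for t by (simp add: circlepath exp_not_eq_zero)
  have "path_image (circlepath 0 1) \<subseteq> - {0 :: complex}"
    using nz by (auto simp: path_image_def)
  then show "path (g \<circ> circlepath 0 1)"
    by (intro path_continuous_image path_circlepath continuous_on_subset[OF cg])
  have "g z \<noteq> 0" if "z \<noteq> 0" for z using g[OF that] l1(2)[of "Fin z"] that by (auto simp: qc_simps)
  then show "0 \<notin> path_image (g \<circ> circlepath 0 1)"
    using nz by (auto simp: path_image_def)
qed

text \<open>If \<open>N l = l i\<close>, then \<open>l j\<close> is a frame of the same kind for
  \<open>- N\<close>, because \<open>i\<close> and \<open>j\<close> anticommute. Since
  \<open>g j = j cnj g\<close>, the transition function is conjugated, which negates its winding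
  number.\<close>

lemma has_deg_uminus:
  assumes "has_deg N d" shows "has_deg (\<lambda>p. - N p) (- d)"
proof -
  from assms obtain l0 l1 g where l0: "csmooth (- {Infty}) l0"
    and f0: "\<forall>p\<in>- {Infty}. l0 p \<noteq> 0 \<and> N p * l0 p = l0 p * qi"
    and l1: "csmooth (- {Fin 0}) l1" and f1: "\<forall>p\<in>- {Fin 0}. l1 p \<noteq> 0 \<and> N p * l1 p = l1 p * qi"
    and g: "\<And>z. z \<noteq> 0 \<Longrightarrow> l1 (Fin z) = l0 (Fin z) * qc (g z)"
    and w: "winding_number (g \<circ> circlepath 0 1) 0 = of_int d"
    unfolding has_deg_def by blast
  have pg: "path (g \<circ> circlepath 0 1)" "0 \<notin> path_image (g \<circ> circlepath 0 1)"
    using transition_path[OF l0 _ l1 _ g] f0 f1 by auto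
  have ij: "qi * qj = - (qj * qi)" by (simp add: qi_def qj_def times_quat_def uminus_quat_def)
  have fr: "- n * (l * qj) = (l * qj) * qi" if "n * l = l * qi" for n l
  proof -
    have "- n * (l * qj) = - ((n * l) * qj)" by (simp add: mult.assoc)
    also have "\<dots> = - (l * (qi * qj))" by (simp add: that mult.assoc)
    also have "\<dots> = (l * qj) * qi" by (simp add: ij mult.assoc)
    finally show ?thesis .
  qed
  obtain q where q: "path q" "pathfinish q - pathstart q = 2 * of_real pi * \<i> * of_int d"
    "\<And>t. t \<in> {0..1} \<Longrightarrow> (g \<circ> circlepath 0 1) t = exp (q t)"
    using winding_number_as_continuous_log[OF pg] w by auto
  have pq: "path (cnj \<circ> q)" by (intro path_continuous_image q(1) continuous_intros)
  have "winding_number ((cnj \<circ> g) \<circ> circlepath 0 1) 0 = winding_number (exp \<circ> (cnj \<circ> q)) 0"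
    by (rule winding_number_cong) (use q(3) in \<open>simp add: exp_cnj\<close>)
  also have "\<dots> = cnj (pathfinish q - pathstart q) / (2 * of_real pi * \<i>)"
    unfolding winding_number_compose_exp[OF pq] by (simp add: pathfinish_def pathstart_def)
  also have "\<dots> = of_int (- d)" unfolding q(2) by simp
  finally have "winding_number ((cnj \<circ> g) \<circ> circlepath 0 1) 0 = of_int (- d)" .
  moreover have "l1 (Fin z) * qj = (l0 (Fin z) * qj) * qc ((cnj \<circ> g) z)" if "z \<noteq> 0" for z
    using g[OF that] by (simp add: mult.assoc qc_simps)
  ultimately show ?thesis
    unfolding has_deg_def
    using f0 f1 fr
    by (intro exI[of _ "\<lambda>p. l0 p * qj"] exI[of _ "\<lambda>p. l1 p * qj"] exI[of _ "cnj \<circ> g"])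
      (auto intro!: csmooth_mult csmooth_const l0 l1 simp: qj_nonzero)
qed

context imaginary_conformal_immersion
begin

text \<open>By \<open>N df = - df N\<close> the quaternion \<open>qcnj l * df * l\<close>
  anticommutes with \<open>i\<close>, and the quaternions doing so are \<open>j\<close> times the
  complex numbers.\<close>

lemma frame_form:
  assumes l: "N p * l = l * qi" "l \<noteq> 0" and v: "v \<noteq> 0"
  shows "qcnj l * cdiff f p v * l = qj * qc (q2c (- qj * (qcnj l * cdiff f p v * l)))"
    and "q2c (- qj * (qcnj l * cdiff f p v * l)) \<noteq> 0"
proof -
  let ?x = "qcnj l * cdiff f p v * l"
  have "qcnj (N p * l) = qcnj (l * qi)" using l by simp
  then have i: "qi * qcnj l = qcnj l * N p"
    using quat_cnj_imaginary[of qi] by (simp add: qcnj_simps N_cnj qi_def)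
  have "qi * ?x = qcnj l * (N p * cdiff f p v) * l" by (simp add: i mult.assoc[symmetric])
  also have "\<dots> = - (qcnj l * cdiff f p v * (N p * l))" by (simp add: N_cdiff_f mult.assoc)
  also have "\<dots> = - (?x * qi)" by (simp add: l mult.assoc)
  finally show eq: "?x = qj * qc (q2c (- qj * ?x))" by (rule quat_anticommute_qi)
  have "qcnj l \<noteq> 0" using l(2) by (metis qcnj_simps(6,7))
  then have "?x \<noteq> 0" using l(2) cdiff_f_nonzero[OF v] by simp
  then show "q2c (- qj * ?x) \<noteq> 0" using eq qc_simps(6) by auto
qed

text \<open>For frames \<open>l\<close> with \<open>N l = l i\<close> the form \<open>cnj l df l\<close> is \<open>j\<close> times a complex-valued
  \<open>(1, 0)\<close>-form without zeros, so the square of the bundle of such frames is \<open>K\<close>.\<close>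

lemma has_deg_N:
  assumes "has_deg N d" shows "d = - 1"
proof -
  from assms obtain l0 l1 g where l0: "csmooth (- {Infty}) l0"
    and f0: "\<forall>p\<in>- {Infty}. l0 p \<noteq> 0 \<and> N p * l0 p = l0 p * qi"
    and l1: "csmooth (- {Fin 0}) l1" and f1: "\<forall>p\<in>- {Fin 0}. l1 p \<noteq> 0 \<and> N p * l1 p = l1 p * qi"
    and g: "\<And>z. z \<noteq> 0 \<Longrightarrow> l1 (Fin z) = l0 (Fin z) * qc (g z)"
    and w: "winding_number (g \<circ> circlepath 0 1) 0 = of_int d"
    unfolding has_deg_def by blast
  have pg: "path (g \<circ> circlepath 0 1)" "0 \<notin> path_image (g \<circ> circlepath 0 1)"
    using transition_path[OF l0 _ l1 _ g] f0 f1 by auto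
  define e0 where "e0 z = q2c (- qj * (qcnj (l0 (Fin z)) * cdiff f (Fin z) 1 * l0 (Fin z)))" for z
  define e1 where "e1 w = q2c (- qj * (qcnj (l1 (par Infty w)) * cdiff f (par Infty w) (dpar Infty w 1) * l1 (par Infty w)))" for w
  have d1: "dpar Infty w 1 \<noteq> 0" for w by (simp add: dpar_def)
  have p1: "par Infty w \<noteq> Fin 0" for w by (simp add: par_Infty)
  have F0: "qcnj (l0 (Fin z)) * cdiff f (Fin z) 1 * l0 (Fin z) = qj * qc (e0 z)" and n0: "e0 z \<noteq> 0" for z
    unfolding e0_def using frame_form[of "Fin z" "l0 (Fin z)" 1] f0 by auto
  have F1: "qcnj (l1 (par Infty w)) * cdiff f (par Infty w) (dpar Infty w 1) * l1 (par Infty w) = qj * qc (e1 w)"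
    and n1: "e1 w \<noteq> 0" for w
    unfolding e1_def using frame_form[of "par Infty w" "l1 (par Infty w)" "dpar Infty w 1"] f1 d1[of w] p1[of w] by auto
  have cdf: "continuous_on UNIV (\<lambda>w. cdiff f (par q w) (dpar q w 1))" for q
    using smooth_on_imp_continuous_on[OF smooth_on_derivative[OF open_UNIV csmooth_par_UNIV[OF f_smooth]], of q 1]
    by (simp add: frechet_f)
  have c0: "continuous_on UNIV e0"
    using cdf[of "Fin 0"] unfolding e0_def
    by (intro bounded_linear.continuous_on[OF bounded_linear_q2c] continuous_on_mult continuous_on_const
        bounded_linear.continuous_on[OF bounded_linear_qcnj] Fin_continuous[OF l0]) (simp add: dpar_def)
  have c1: "continuous_on UNIV e1"
    using cdf[of Infty] unfolding e1_def
    by (intro bounded_linear.continuous_on[OF bounded_linear_q2c] continuous_on_mult continuous_on_const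
        bounded_linear.continuous_on[OF bounded_linear_qcnj] par_Infty_continuous[OF l1])
  \<comment> \<open>The coordinate vectors of the two charts differ by the factor
    \<open>- z^2\<close>. Moving \<open>cnj g\<close> past \<open>j\<close> turns it into
    \<open>g\<close>, so \<open>g\<close> enters quadratically.\<close>
  have rel: "e1 (1 / z) = - (g z)\<^sup>2 * z\<^sup>2 * e0 z" if z: "z \<noteq> 0" for z
  proof -
    have P: "par Infty (1 / z) = Fin z" "dpar Infty (1 / z) 1 = - z\<^sup>2"
      using z by (auto simp: par_Infty dpar_def power_divide)
    let ?l = "l0 (Fin z)"
    have "qj * qc (e1 (1 / z)) = qcnj (?l * qc (g z)) * cdiff f (Fin z) (- z\<^sup>2) * (?l * qc (g z))"
      using F1[of "1 / z"] unfolding P g[OF z] by simp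
    also have "\<dots> = qc (cnj (g z)) * (qcnj ?l * cdiff f (Fin z) 1 * (cx (N (Fin z)) (- z\<^sup>2) * ?l)) * qc (g z)"
      by (simp add: qcnj_simps qc_simps cdiff_f_cx[of _ "- z\<^sup>2"] mult.assoc)
    also have "cx (N (Fin z)) (- z\<^sup>2) * ?l = ?l * qc (- z\<^sup>2)"
      by (rule cx_mult_frame) (use f0 in auto)
    also have "qc (cnj (g z)) * (qcnj ?l * cdiff f (Fin z) 1 * (?l * qc (- z\<^sup>2))) * qc (g z) =
        qc (cnj (g z)) * (qj * qc (e0 z)) * qc (- z\<^sup>2) * qc (g z)"
      by (simp add: F0[symmetric] mult.assoc)
    also have "\<dots> = (qc (cnj (g z)) * qj) * qc (e0 z) * qc (- z\<^sup>2) * qc (g z)"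
      by (simp only: mult.assoc)
    also have "\<dots> = qj * qc (g z * e0 z * (- z\<^sup>2) * g z)"
      by (simp only: qc_simps(4) complex_cnj_cnj qc_simps(1) mult.assoc)
    finally have "e1 (1 / z) = g z * e0 z * (- z\<^sup>2) * g z" using qj_nonzero by simp
    then show ?thesis by (simp add: power2_eq_square)
  qed
  \<comment> \<open>\<open>e0\<close> and \<open>e1\<close> have no zeros on contractible planes, so
    they possess logarithms there and contribute no winding.\<close>
  obtain L0 where L0: "continuous_on UNIV L0" "\<And>z. e0 z = exp (L0 z)"
    using continuous_logarithm_on_contractible[OF c0 contractible_UNIV] n0 by auto
  obtain L1 where L1: "continuous_on UNIV L1" "\<And>z. e1 z = exp (L1 z)"
    using continuous_logarithm_on_contractible[OF c1 contractible_UNIV] n1 by auto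
  obtain q where q: "path q" "pathfinish q - pathstart q = 2 * of_real pi * \<i> * of_int d"
    "\<And>t. t \<in> {0..1} \<Longrightarrow> (g \<circ> circlepath 0 1) t = exp (q t)"
    using winding_number_as_continuous_log[OF pg] w by auto
  let ?\<gamma> = "circlepath 0 1"
  have \<gamma>: "?\<gamma> t = exp (2 * of_real pi * \<i> * of_real t)" for t by (simp add: circlepath)
  have \<gamma>0: "?\<gamma> t \<noteq> 0" for t by (simp add: \<gamma>)
  have c\<gamma>: "continuous_on {0..1} ?\<gamma>" using path_circlepath[of 0 1] by (simp add: path_def)
  \<comment> \<open>A logarithm along the unit circle of the quotient of the two sides of
    \<open>rel\<close>; the summand \<open>pi i\<close> represents the minus sign. Comparing the two
    ends of the circle yields \<open>2 (2 pi i d) + 4 pi i = 0\<close>.\<close>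
  define u where "u t = 2 * q t + 4 * of_real pi * \<i> * of_real t + of_real pi * \<i> + L0 (?\<gamma> t) - L1 (1 / ?\<gamma> t)" for t
  have "u 1 = u 0"
  proof (rule exp_one_constant)
    show "continuous_on {0..1} u"
      unfolding u_def using q(1) \<gamma>0
      by (intro continuous_intros continuous_on_compose2[OF L0(1)] continuous_on_compose2[OF L1(1)] c\<gamma>)
        (auto simp: path_def)
    fix t :: real assume t: "t \<in> {0..1}"
    have "exp (2 * q t) = (g (?\<gamma> t))\<^sup>2" using q(3)[OF t] by (simp add: exp_double)
    moreover have "exp (4 * of_real pi * \<i> * of_real t) = (?\<gamma> t)\<^sup>2"
      using exp_double[of "2 * of_real pi * \<i> * of_real t"] by (simp add: \<gamma> mult.assoc)
    ultimately have "exp (u t) * e1 (1 / ?\<gamma> t) = - (g (?\<gamma> t))\<^sup>2 * (?\<gamma> t)\<^sup>2 * e0 (?\<gamma> t)"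
      by (simp add: u_def exp_add exp_diff L0(2) L1(2))
    then show "exp (u t) = 1" using rel[OF \<gamma>0, of t] n1[of "1 / ?\<gamma> t"] by simp
  qed
  moreover have "?\<gamma> 1 = ?\<gamma> 0" by (simp add: \<gamma>)
  ultimately have "2 * (q 1 - q 0) + 4 * of_real pi * \<i> = 0"
    unfolding u_def by (simp add: algebra_simps)
  then have "2 * (2 * of_real pi * \<i> * of_int d) + 4 * of_real pi * \<i> = 0"
    unfolding q(2)[symmetric] by (simp only: pathfinish_def pathstart_def)
  then have "(4 * of_real pi * \<i>) * (of_int d + 1 :: complex) = 0" by (simp add: algebra_simps)
  then have "of_int (d + 1) = (0 :: complex)" by simp
  then show ?thesis unfolding of_int_eq_0_iff by simp
qed

end

section \<open>The Gauss-Bonnet theorem\<close>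

lemma quat_inner_mult_left: "(x * y) \<bullet> (x * z) = (norm x)\<^sup>2 * (y \<bullet> z)" for x :: quat
  by (simp add: inner_quat_def times_quat_def norm_quat_def qnormsq_def) algebra

text \<open>The vectors \<open>a\<close>, \<open>a n\<close> and \<open>n\<close> are orthogonal.
  The part of \<open>X\<close> orthogonal to all three anticommutes with each of them; but
  anticommuting with \<open>a\<close> and with \<open>n\<close>, it commutes with
  \<open>a n\<close>, so it is zero.\<close>

lemma quat_orthogonal_expansion:
  assumes n: "n * n = (- 1 :: quat)" and a: "a \<noteq> 0" "qre a = 0" "n * a = - (a * n)" and X: "qre X = 0"
  shows "X = ((X \<bullet> a) / (norm a)\<^sup>2) *\<^sub>R a + ((X \<bullet> (a * n)) / (norm a)\<^sup>2) *\<^sub>R (a * n) + (X \<bullet> n) *\<^sub>R n"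
proof -
  let ?b = "a * n"
  define Z where "Z = X - ((X \<bullet> a) / (norm a)\<^sup>2) *\<^sub>R a - ((X \<bullet> ?b) / (norm a)\<^sup>2) *\<^sub>R ?b - (X \<bullet> n) *\<^sub>R n"
  note n' = quat_square_minus_one[OF n]
  have an: "n \<bullet> a = 0" by (rule quat_anticommute(2)[OF n]) (simp add: a(3))
  have anc: "n \<bullet> ?b = 0"
    by (rule quat_anticommute(2)[OF n]) (simp add: mult.assoc[symmetric] a(3))
  have bre: "qre ?b = 0"
    by (rule quat_anticommute(1)[OF n]) (simp add: mult.assoc[symmetric] a(3))
  have "a \<bullet> ?b = (norm a)\<^sup>2 * (1 \<bullet> n)" using quat_inner_mult_left[of a 1 n] by simp
  then have ab: "a \<bullet> ?b = 0" using n'(1) by (simp add: inner_quat_def one_quat_def)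
  have sq: "a \<bullet> a = (norm a)\<^sup>2" "?b \<bullet> ?b = (norm a)\<^sup>2" "n \<bullet> n = 1" "(norm a)\<^sup>2 \<noteq> 0"
    using n'(2) a(1) by (simp_all add: power2_norm_eq_inner[symmetric] norm_mult)
  have "Z \<bullet> a = 0" "Z \<bullet> ?b = 0" "Z \<bullet> n = 0"
    using sq an anc ab inner_commute[of n a] inner_commute[of n ?b] inner_commute[of a ?b]
    by (simp_all add: Z_def inner_diff_left)
  moreover have Zre: "qre Z = 0" by (simp add: Z_def qre_simps X a n'(1) bre)
  ultimately have c: "Z * a = - (a * Z)" "Z * ?b = - (?b * Z)" "Z * n = - (n * Z)"
    using quat_imaginary_mult_commute[of Z] a(2) bre n'(1) by auto
  have "Z * ?b = ?b * Z"
  proof -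
    have "Z * (a * n) = - (a * (Z * n))" using c(1) by (simp add: mult.assoc[symmetric])
    then show ?thesis using c(3) by (simp add: mult.assoc)
  qed
  with c(2) have "?b * Z = - (?b * Z)" by simp
  then have "?b * Z + ?b * Z = 0" by (simp only: eq_neg_iff_add_eq_0)
  then have "2 *\<^sub>R (?b * Z) = 0" by (simp only: scaleR_2)
  then have "Z = 0" using a(1) n by auto
  then show ?thesis by (simp add: Z_def algebra_simps)
qed

text \<open>The Gauss equation of a conformal surface: \<open>a\<close> and \<open>a n\<close> stand
  for \<open>f_x\<close> and \<open>f_y\<close>, and \<open>A\<close>, \<open>B\<close>,
  \<open>C\<close> for \<open>f_xx\<close>, \<open>f_xy\<close>, \<open>f_yy\<close>. The left side
  is minus the Gauss curvature times the area density, expressed by the determinant of the second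
  fundamental form; on the right the tangential parts are removed from
  \<open>B \<bullet> B - A \<bullet> C\<close>.\<close>

lemma gauss_pointwise:
  assumes n: "n * n = (- 1 :: quat)" and a: "a \<noteq> 0" "qre a = 0" "n * a = - (a * n)"
    and im: "qre A = 0" "qre B = 0" "qre C = 0"
    and rel: "A \<bullet> a = s" "B \<bullet> (a * n) = s" "C \<bullet> a = - s" "B \<bullet> a = t" "C \<bullet> (a * n) = t" "A \<bullet> (a * n) = - t"
    and d: "B = A * n + a * nx" "C = B * n + a * ny"
  shows "(n * nx) \<bullet> ny = (B \<bullet> B - A \<bullet> C) / (norm a)\<^sup>2 - 2 * (s\<^sup>2 + t\<^sup>2) / ((norm a)\<^sup>2)\<^sup>2"
proof -
  let ?b = "a * n" and ?r = "(norm a)\<^sup>2"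
  note n' = quat_square_minus_one[OF n]
  have an: "n \<bullet> a = 0" by (rule quat_anticommute(2)[OF n]) (simp add: a(3))
  have anc: "n \<bullet> ?b = 0"
    by (rule quat_anticommute(2)[OF n]) (simp add: mult.assoc[symmetric] a(3))
  have "a \<bullet> ?b = ?r * (1 \<bullet> n)" using quat_inner_mult_left[of a 1 n] by simp
  then have ab: "a \<bullet> ?b = 0" using n'(1) by (simp add: inner_quat_def one_quat_def)
  have sq: "a \<bullet> a = ?r" "?b \<bullet> ?b = ?r" "n \<bullet> n = 1" "?r \<noteq> 0"
    using n'(2) a(1) by (simp_all add: power2_norm_eq_inner[symmetric] norm_mult)
  \<comment> \<open>\<alpha>, \<beta>, \<gamma> are the coefficients of the second fundamental form;
    \<open>S\<close> and \<open>T\<close> are the Christoffel symbols, which by \<open>rel\<close>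
    determine all tangential components.\<close>
  define \<alpha> \<beta> \<gamma> S T where "\<alpha> = A \<bullet> n" and "\<beta> = B \<bullet> n" and "\<gamma> = C \<bullet> n" and "S = s / ?r" and "T = t / ?r"
  note ex = quat_orthogonal_expansion[OF n a]
  have A: "A = S *\<^sub>R a - T *\<^sub>R ?b + \<alpha> *\<^sub>R n" using ex[OF im(1)] by (simp add: rel \<alpha>_def S_def T_def)
  have B: "B = T *\<^sub>R a + S *\<^sub>R ?b + \<beta> *\<^sub>R n" using ex[OF im(2)] by (simp add: rel \<beta>_def S_def T_def)
  have C: "C = - S *\<^sub>R a + T *\<^sub>R ?b + \<gamma> *\<^sub>R n" using ex[OF im(3)] by (simp add: rel \<gamma>_def S_def T_def)
  have bn: "?b * n = - a" by (simp add: mult.assoc n)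
  have x: "a * nx = \<alpha> *\<^sub>R 1 + \<beta> *\<^sub>R n"
  proof -
    have "a * nx = B - A * n" using d(1) by simp
    also have "A * n = S *\<^sub>R ?b + T *\<^sub>R a - \<alpha> *\<^sub>R 1"
      unfolding A by (simp add: distrib_right left_diff_distrib bn n)
    finally show ?thesis unfolding B by simp
  qed
  have y: "a * ny = \<beta> *\<^sub>R 1 + \<gamma> *\<^sub>R n"
  proof -
    have "a * ny = C - B * n" using d(2) by simp
    also have "B * n = T *\<^sub>R ?b - S *\<^sub>R a - \<beta> *\<^sub>R 1"
      unfolding B by (simp add: distrib_right bn n)
    finally show ?thesis unfolding C by simp
  qed
  have n1: "n \<bullet> 1 = 0" "1 \<bullet> n = 0" "(1::quat) \<bullet> 1 = 1"
    using n'(1) by (simp_all add: inner_quat_def one_quat_def)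
  have "?r * ((n * nx) \<bullet> ny) = (a * (n * nx)) \<bullet> (a * ny)" by (simp add: quat_inner_mult_left)
  also have "a * (n * nx) = - (n * (a * nx))" by (simp add: mult.assoc[symmetric] a(3))
  also have "- (n * (a * nx)) = \<beta> *\<^sub>R 1 - \<alpha> *\<^sub>R n" unfolding x by (simp add: distrib_left n)
  also have "\<dots> \<bullet> (a * ny) = \<beta>\<^sup>2 - \<alpha> * \<gamma>"
    unfolding y using sq n1 by (simp add: inner_simps power2_eq_square)
  finally have 1: "?r * ((n * nx) \<bullet> ny) = \<beta>\<^sup>2 - \<alpha> * \<gamma>" .
  have "B \<bullet> B = ?r * (S\<^sup>2 + T\<^sup>2) + \<beta>\<^sup>2"
    unfolding B using sq an anc ab inner_commute[of n a] inner_commute[of n ?b] inner_commute[of a ?b]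
    by (simp add: inner_simps power2_eq_square algebra_simps)
  moreover have "A \<bullet> C = - ?r * (S\<^sup>2 + T\<^sup>2) + \<alpha> * \<gamma>"
    unfolding A C using sq an anc ab inner_commute[of n a] inner_commute[of n ?b] inner_commute[of a ?b]
    by (simp add: inner_simps power2_eq_square algebra_simps)
  ultimately have "B \<bullet> B - A \<bullet> C = 2 * ?r * (S\<^sup>2 + T\<^sup>2) + ?r * ((n * nx) \<bullet> ny)" using 1 by (simp add: algebra_simps)
  moreover have "2 * (s\<^sup>2 + t\<^sup>2) / ?r\<^sup>2 = 2 * (S\<^sup>2 + T\<^sup>2)"
    by (simp add: S_def T_def power_divide add_divide_distrib)
  ultimately show ?thesis using sq(4) by (simp add: add_divide_distrib)
qed

lemma norm_cx: "n * n = - 1 \<Longrightarrow> norm (cx n v) = norm v"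
proof -
  assume n: "n * n = - 1"
  have "qre n = 0" "(norm n)\<^sup>2 = 1" using quat_square_minus_one[OF n] by auto
  then have "(norm (cx n v))\<^sup>2 = (Re v)\<^sup>2 + (Im v)\<^sup>2"
    by (simp add: cx_alt norm_quat_def qnormsq_def quat_vector_defs one_quat_def power_mult_distrib
        flip: distrib_left)
  then show ?thesis by (metis cmod_def norm_ge_zero real_sqrt_abs abs_of_nonneg)
qed

context imaginary_conformal_immersion
begin

text \<open>The logarithm of the conformal factor of \<open>f\<close> relative to the round metric. Its Laplacian is the
  difference of the curvature forms of the round metric and of the metric of \<open>f\<close>, and the integral of a
  Laplacian over the sphere vanishes.\<close>

definition hlog :: "cp1 \<Rightarrow> real" where
  "hlog p = 1 / 2 * ln ((norm (cdiff f p 1))\<^sup>2) + ln (1 + (norm (pos p))\<^sup>2)"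

lemma norm_cdiff_f: "norm (cdiff f p v) = norm (cdiff f p 1) * norm v"
  by (simp add: cdiff_f_cx[of p v] norm_mult norm_cx[OF N_sq])

text \<open>In the coordinate at infinity \<open>|f_x|\<close> acquires the factor
  \<open>1 / |w|^2\<close>, and this compensates the denominator of
  \<open>1 + 1 / |w|^2 = (1 + |w|^2) / |w|^2\<close>. The expression therefore has the same form in
  both charts, so \<open>hlog\<close> extends smoothly over infinity.\<close>

lemma hlog_par: "hlog (par q w) = 1 / 2 * ln ((norm (cdiff f (par q w) (dpar q w 1)))\<^sup>2) + ln (1 + (norm w)\<^sup>2)"
proof (cases "q = Infty \<and> w \<noteq> 0")
  case False
  then have "pos (par q w) = w" "dpar q w 1 = 1" by (cases q; auto simp: par_Infty dpar_def)+
  then show ?thesis by (simp add: hlog_def)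
next
  case True
  then have q: "q = Infty" and w: "w \<noteq> 0" by auto
  let ?r = "norm (cdiff f (Fin (1 / w)) 1)"
  have r: "?r > 0" using cdiff_f_nonzero[of 1 "Fin (1 / w)"] by simp
  have "norm (cdiff f (par q w) (dpar q w 1)) = ?r * (1 / (norm w)\<^sup>2)"
    using w unfolding q by (subst norm_cdiff_f) (simp add: par_Infty dpar_def norm_divide norm_power)
  then have "1 / 2 * ln ((norm (cdiff f (par q w) (dpar q w 1)))\<^sup>2) = ln ?r - 2 * ln (norm w)"
    using r w by (simp add: ln_realpow ln_mult ln_div power_mult_distrib[symmetric])
  moreover have "hlog (par q w) = ln ?r + ln (1 + 1 / (norm w)\<^sup>2)"
    using r w by (simp add: q hlog_def par_Infty ln_realpow norm_divide power_divide)
  moreover have "ln (1 + 1 / (norm w)\<^sup>2) = ln (1 + (norm w)\<^sup>2) - 2 * ln (norm w)"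
  proof -
    have "1 + 1 / (norm w)\<^sup>2 = (1 + (norm w)\<^sup>2) / (norm w)\<^sup>2" using w by (simp add: field_simps)
    moreover have "0 < 1 + (norm w)\<^sup>2" by (simp add: add_pos_nonneg)
    ultimately show ?thesis using w by (simp add: ln_div ln_realpow)
  qed
  ultimately show ?thesis by simp
qed

lemma smooth_cdiff_f: "smooth_on UNIV (\<lambda>w. cdiff f (par q w) (dpar q w v))"
  using smooth_on_derivative[OF open_UNIV csmooth_par_UNIV[OF f_smooth], of q v] by (simp add: frechet_f)

text \<open>Norms enter only through their squares, which are inner products and hence
  smooth.\<close>

lemma hlog_smooth: "csmooth UNIV hlog"
  unfolding csmooth_def
proof
  fix q
  have "dpar q w 1 \<noteq> 0" for w by (auto simp: dpar_def split: cp1.splits)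
  then have p: "0 < (norm (cdiff f (par q w) (dpar q w 1)))\<^sup>2" "0 < 1 + (norm w)\<^sup>2" for w
    using cdiff_f_nonzero by (simp_all add: add_pos_nonneg)
  have "smooth_on UNIV (\<lambda>w. 1 / 2 * ln ((norm (cdiff f (par q w) (dpar q w 1)))\<^sup>2) + ln (1 + (norm w)\<^sup>2))"
    unfolding power2_norm_eq_inner
    by (intro smooth_on_add smooth_on_mult smooth_on_const smooth_on_ln smooth_on_inner smooth_cdiff_f smooth_on_id)
      (use p in \<open>simp_all add: power2_norm_eq_inner[symmetric]\<close>)
  then show "smooth_on (par q -` UNIV) (hlog \<circ> par q)" by (simp add: o_def hlog_par)
qed

definition fx :: "complex \<Rightarrow> quat" where "fx z = cdiff f (Fin z) 1"
definition fy :: "complex \<Rightarrow> quat" where "fy z = cdiff f (Fin z) \<i>"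

lemma fx_fy_smooth: "smooth_on UNIV fx" "smooth_on UNIV fy"
  using smooth_cdiff_f[of "Fin 0" 1] smooth_cdiff_f[of "Fin 0" \<i>]
  by (simp_all add: fx_def[abs_def] fy_def[abs_def] dpar_def)

lemma N_Fin_smooth: "smooth_on UNIV (\<lambda>z. N (Fin z))"
  using csmooth_par_UNIV[OF N_smooth, of "Fin 0"] by (simp add: o_def)

text \<open>The Laplacian of \<open>ln |f_x|\<close> is minus the curvature density, which
  \<open>gauss_pointwise\<close> identifies with the inner product on the right; that of
  \<open>ln (1 + |z|^2)\<close> is the area density of the unit sphere.\<close>

lemma hlog_laplacian:
  "frechet_derivative (\<lambda>z. cdiff hlog (Fin z) 1) (at z) 1 + frechet_derivative (\<lambda>z. cdiff hlog (Fin z) \<i>) (at z) \<i> =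
    (N (Fin z) * cdiff N (Fin z) 1) \<bullet> cdiff N (Fin z) \<i> + 4 / (1 + (norm z)\<^sup>2)\<^sup>2"
proof -
  let ?Dx = "\<lambda>z v. frechet_derivative fx (at z) v" and ?Dy = "\<lambda>z v. frechet_derivative fy (at z) v"
  let ?n = "\<lambda>z. N (Fin z)"
  have dx: "(fx has_derivative ?Dx z) (at z)" and dy: "(fy has_derivative ?Dy z) (at z)" for z
    using fx_fy_smooth by (auto intro: smooth_on_has_derivative[OF open_UNIV])
  have dn: "(?n has_derivative cdiff N (Fin z)) (at z)" for z
    using csmooth_has_cdiff[OF open_UNIV N_smooth UNIV_I, of "Fin z"] by (simp add: o_def)
  define A B C where "A z = ?Dx z 1" and "B z = ?Dx z \<i>" and "C z = ?Dy z \<i>" for z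
  have "f \<circ> Fin = f \<circ> par (Fin 0)" by simp
  have fxD: "fx = (\<lambda>z. frechet_derivative (f \<circ> Fin) (at z) 1)" "fy = (\<lambda>z. frechet_derivative (f \<circ> Fin) (at z) \<i>)"
    using frechet_f[of "Fin 0"] by (simp_all add: fx_def fy_def dpar_def fun_eq_iff)
  have smF: "smooth_on UNIV (f \<circ> Fin)" using csmooth_par_UNIV[OF f_smooth, of "Fin 0"] by simp
  have B': "?Dy z 1 = B z" for z
    unfolding B_def fxD by (rule second_derivative_symmetric[OF smF])
  have smABC: "smooth_on UNIV A" "smooth_on UNIV B"
    unfolding A_def[abs_def] B_def[abs_def] by (intro smooth_on_derivative open_UNIV fx_fy_smooth)+
  have dA: "(A has_derivative frechet_derivative A (at z)) (at z)" and dB: "(B has_derivative frechet_derivative B (at z)) (at z)" for z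
    using smABC by (auto intro: smooth_on_has_derivative[OF open_UNIV])
  have AB: "frechet_derivative A (at z) \<i> = frechet_derivative B (at z) 1" for z
    unfolding A_def[abs_def] B_def[abs_def] by (rule second_derivative_symmetric[OF fx_fy_smooth(1)])
  have im: "qre (fx z) = 0" "qre (fy z) = 0" for z unfolding fx_def fy_def by (rule cdiff_f_im)+
  have imD: "qre (?Dx z v) = 0" "qre (?Dy z v) = 0" for z v
  proof -
    have "((\<lambda>z. qre (fx z)) has_derivative (\<lambda>v. qre (?Dx z v))) (at z)"
      by (rule bounded_linear.has_derivative[OF bounded_linear_qre dx])
    moreover have "((\<lambda>z. qre (fx z)) has_derivative (\<lambda>v. 0)) (at z)" by (simp add: im)
    ultimately have "(\<lambda>v. qre (?Dx z v)) = (\<lambda>v. 0)" by (rule has_derivative_unique)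
    then show "qre (?Dx z v) = 0" by (rule fun_cong)
    have "((\<lambda>z. qre (fy z)) has_derivative (\<lambda>v. qre (?Dy z v))) (at z)"
      by (rule bounded_linear.has_derivative[OF bounded_linear_qre dy])
    moreover have "((\<lambda>z. qre (fy z)) has_derivative (\<lambda>v. 0)) (at z)" by (simp add: im)
    ultimately have "(\<lambda>v. qre (?Dy z v)) = (\<lambda>v. 0)" by (rule has_derivative_unique)
    then show "qre (?Dy z v) = 0" by (rule fun_cong)
  qed
  have orth: "fx z \<bullet> fy z = 0" and eqn: "fx z \<bullet> fx z = fy z \<bullet> fy z" and nz: "fx z \<noteq> 0" for z
    using cdiff_f_orth[of "Fin z"] cdiff_f_norm[of "Fin z"] cdiff_f_nonzero[of 1 "Fin z"]
    by (simp_all add: fx_def fy_def power2_norm_eq_inner[symmetric])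
  have o1: "fx z \<bullet> ?Dy z v + ?Dx z v \<bullet> fy z = 0" for z v
  proof -
    have "((\<lambda>z. fx z \<bullet> fy z) has_derivative (\<lambda>v. fx z \<bullet> ?Dy z v + ?Dx z v \<bullet> fy z)) (at z)"
      by (rule has_derivative_inner[OF dx dy])
    moreover have "((\<lambda>z. fx z \<bullet> fy z) has_derivative (\<lambda>v. 0)) (at z)" by (simp add: orth)
    ultimately have "(\<lambda>v. fx z \<bullet> ?Dy z v + ?Dx z v \<bullet> fy z) = (\<lambda>v. 0)" by (rule has_derivative_unique)
    then show ?thesis by (rule fun_cong)
  qed
  have e1: "?Dx z v \<bullet> fx z = ?Dy z v \<bullet> fy z" for z v
  proof -
    have "((\<lambda>z. fx z \<bullet> fx z) has_derivative (\<lambda>v. fx z \<bullet> ?Dx z v + ?Dx z v \<bullet> fx z)) (at z)"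
      by (rule has_derivative_inner[OF dx dx])
    moreover have "((\<lambda>z. fx z \<bullet> fx z) has_derivative (\<lambda>v. fy z \<bullet> ?Dy z v + ?Dy z v \<bullet> fy z)) (at z)"
      unfolding eqn by (rule has_derivative_inner[OF dy dy])
    ultimately have "(\<lambda>v. fx z \<bullet> ?Dx z v + ?Dx z v \<bullet> fx z) = (\<lambda>v. fy z \<bullet> ?Dy z v + ?Dy z v \<bullet> fy z)"
      by (rule has_derivative_unique)
    from fun_cong[OF this, of v] show ?thesis by (simp add: inner_commute)
  qed
  have fyn: "fy z = fx z * ?n z" for z unfolding fx_def fy_def by (rule cdiff_f_N)
  \<comment> \<open>These relations come from differentiating \<open>|f_x| = |f_y|\<close> and
    \<open>f_x \<bullet> f_y = 0\<close> in both coordinate directions.\<close>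
  have rel: "B z \<bullet> fy z = A z \<bullet> fx z" "C z \<bullet> fx z = - (A z \<bullet> fx z)" "C z \<bullet> fy z = B z \<bullet> fx z"
    "A z \<bullet> fy z = - (B z \<bullet> fx z)" for z
  proof -
    show 1: "B z \<bullet> fy z = A z \<bullet> fx z" using e1[of z 1] by (simp add: A_def B')
    show "C z \<bullet> fy z = B z \<bullet> fx z" using e1[of z \<i>] by (simp add: B_def C_def)
    show "C z \<bullet> fx z = - (A z \<bullet> fx z)" using o1[of z \<i>] 1 by (simp add: B_def C_def inner_commute)
    show "A z \<bullet> fy z = - (B z \<bullet> fx z)" using o1[of z 1] by (simp add: A_def B' inner_commute)
  qed
  have d: "B z = A z * ?n z + fx z * cdiff N (Fin z) 1" "C z = B z * ?n z + fx z * cdiff N (Fin z) \<i>" for z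
  proof -
    have "((\<lambda>z. fx z * ?n z) has_derivative (\<lambda>v. fx z * cdiff N (Fin z) v + ?Dx z v * ?n z)) (at z)"
      by (rule has_derivative_mult[OF dx dn])
    then have "(fy has_derivative (\<lambda>v. fx z * cdiff N (Fin z) v + ?Dx z v * ?n z)) (at z)"
      by (simp add: fyn[symmetric])
    then have "?Dy z = (\<lambda>v. fx z * cdiff N (Fin z) v + ?Dx z v * ?n z)"
      by (rule has_derivative_unique[OF dy])
    then show "B z = A z * ?n z + fx z * cdiff N (Fin z) 1" "C z = B z * ?n z + fx z * cdiff N (Fin z) \<i>"
      using B'[of z] by (simp_all add: A_def B_def C_def add.commute)
  qed
  define \<rho> where "\<rho> z = fx z \<bullet> fx z" for z
  have \<rho>: "\<rho> z > 0" "\<rho> z = (norm (fx z))\<^sup>2" for z using nz[of z] by (simp_all add: \<rho>_def power2_norm_eq_inner)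
  have d\<rho>: "(\<rho> has_derivative (\<lambda>v. 2 * (?Dx z v \<bullet> fx z))) (at z)" for z
    unfolding \<rho>_def[abs_def] by (rule has_derivative_eq_rhs[OF has_derivative_inner[OF dx dx]]) (simp add: inner_commute)
  have dr: "((\<lambda>z::complex. 1 + z \<bullet> z) has_derivative (\<lambda>v. 2 * (z \<bullet> v))) (at z)" for z
    by (auto intro!: derivative_eq_intros simp: inner_commute)
  have rp: "1 + z \<bullet> z > 0" for z :: complex by (simp add: add_pos_nonneg)
  have hF: "hlog \<circ> Fin = (\<lambda>z. 1 / 2 * ln (\<rho> z) + ln (1 + z \<bullet> z))"
    by (auto simp: hlog_def \<rho>(2) fx_def power2_norm_eq_inner)
  have dh: "cdiff hlog (Fin z) v = (?Dx z v \<bullet> fx z) / \<rho> z + 2 * (z \<bullet> v) / (1 + z \<bullet> z)" for z v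
  proof -
    have "((\<lambda>z. 1 / 2 * ln (\<rho> z) + ln (1 + z \<bullet> z)) has_derivative
        (\<lambda>v. 1 / 2 * (2 * (?Dx z v \<bullet> fx z) * inverse (\<rho> z)) + 2 * (z \<bullet> v) * inverse (1 + z \<bullet> z))) (at z)"
      by (intro has_derivative_add has_derivative_mult_right has_derivative_ln d\<rho> dr \<rho>(1) rp)
    then have "cdiff hlog (Fin z) = (\<lambda>v. 1 / 2 * (2 * (?Dx z v \<bullet> fx z) * inverse (\<rho> z)) + 2 * (z \<bullet> v) * inverse (1 + z \<bullet> z))"
      by (intro cdiff_eqI) (simp add: hF)
    from fun_cong[OF this, of v] show ?thesis unfolding divide_inverse by simp
  qed
  \<comment> \<open>Expressed by \<open>B \<bullet> fy\<close> and \<open>- A \<bullet> fy\<close>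
    instead of \<open>A \<bullet> fx\<close> and \<open>B \<bullet> fx\<close>, the first
    derivatives of \<open>hlog\<close> lead to the third derivatives \<open>B_x\<close> and
    \<open>A_y\<close> of \<open>f\<close> only; these agree and cancel in the Laplacian.\<close>
  have hx: "(\<lambda>z. cdiff hlog (Fin z) 1) = (\<lambda>z. (B z \<bullet> fy z) / \<rho> z + 2 * Re z / (1 + z \<bullet> z))"
    unfolding dh rel(1) by (simp add: A_def inner_complex_def)
  have hy: "(\<lambda>z. cdiff hlog (Fin z) \<i>) = (\<lambda>z. - (A z \<bullet> fy z) / \<rho> z + 2 * Im z / (1 + z \<bullet> z))"
    unfolding dh rel(4) by (simp add: B_def inner_complex_def)
  have q: "((\<lambda>z. g z / k z) has_derivative (\<lambda>v. g' v / k z - g z * k' v / (k z)\<^sup>2)) (at z)"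
    if "(g has_derivative g') (at z)" "(k has_derivative k') (at z)" "k z \<noteq> 0"
    for g k :: "complex \<Rightarrow> real" and g' k' z
    using has_derivative_divide[OF that]
    by (rule has_derivative_eq_rhs) (use that(3) in \<open>simp add: fun_eq_iff field_simps power2_eq_square\<close>)
  have "((\<lambda>z. (B z \<bullet> fy z) / \<rho> z + 2 * Re z / (1 + z \<bullet> z)) has_derivative (\<lambda>v.
      ((B z \<bullet> ?Dy z v + frechet_derivative B (at z) v \<bullet> fy z) / \<rho> z - (B z \<bullet> fy z) * (2 * (?Dx z v \<bullet> fx z)) / (\<rho> z)\<^sup>2) +
      (2 * Re v / (1 + z \<bullet> z) - 2 * Re z * (2 * (z \<bullet> v)) / (1 + z \<bullet> z)\<^sup>2))) (at z)"
    using \<rho>(1)[of z] rp[of z]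
    by (intro has_derivative_add q has_derivative_inner dB dy d\<rho> dr has_derivative_mult_right
        has_derivative_Re has_derivative_ident) auto
  then have X: "frechet_derivative (\<lambda>z. cdiff hlog (Fin z) 1) (at z) 1 =
      (B z \<bullet> B z + frechet_derivative B (at z) 1 \<bullet> fy z) / \<rho> z - (B z \<bullet> fy z) * (2 * (A z \<bullet> fx z)) / (\<rho> z)\<^sup>2 +
      (2 / (1 + z \<bullet> z) - 4 * (Re z)\<^sup>2 / (1 + z \<bullet> z)\<^sup>2)"
    unfolding hx by (subst frechet_derivative_at[symmetric]) (assumption, simp add: B' A_def inner_complex_def power2_eq_square)
  have "((\<lambda>z. - (A z \<bullet> fy z) / \<rho> z + 2 * Im z / (1 + z \<bullet> z)) has_derivative (\<lambda>v.
      (- (A z \<bullet> ?Dy z v + frechet_derivative A (at z) v \<bullet> fy z) / \<rho> z - - (A z \<bullet> fy z) * (2 * (?Dx z v \<bullet> fx z)) / (\<rho> z)\<^sup>2) +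
      (2 * Im v / (1 + z \<bullet> z) - 2 * Im z * (2 * (z \<bullet> v)) / (1 + z \<bullet> z)\<^sup>2))) (at z)"
    using \<rho>(1)[of z] rp[of z]
    by (intro has_derivative_add q has_derivative_minus has_derivative_inner dA dy d\<rho> dr has_derivative_mult_right
        has_derivative_Im has_derivative_ident) auto
  then have Y: "frechet_derivative (\<lambda>z. cdiff hlog (Fin z) \<i>) (at z) \<i> =
      - (A z \<bullet> C z + frechet_derivative A (at z) \<i> \<bullet> fy z) / \<rho> z + (A z \<bullet> fy z) * (2 * (B z \<bullet> fx z)) / (\<rho> z)\<^sup>2 +
      (2 / (1 + z \<bullet> z) - 4 * (Im z)\<^sup>2 / (1 + z \<bullet> z)\<^sup>2)"
    unfolding hy by (subst frechet_derivative_at[symmetric]) (assumption, simp add: B_def C_def inner_complex_def power2_eq_square)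
  let ?s = "A z \<bullet> fx z" and ?t = "B z \<bullet> fx z"
  have g: "(?n z * cdiff N (Fin z) 1) \<bullet> cdiff N (Fin z) \<i> =
      (B z \<bullet> B z - A z \<bullet> C z) / \<rho> z - 2 * (?s\<^sup>2 + ?t\<^sup>2) / (\<rho> z)\<^sup>2"
    unfolding \<rho>(2)
  proof (rule gauss_pointwise[OF N_sq nz im(1) _ _ _ _ _ _ _ _ _ _ d])
    show "?n z * fx z = - (fx z * ?n z)" unfolding fx_def by (rule N_cdiff_f)
    show "qre (A z) = 0" "qre (B z) = 0" "qre (C z) = 0" by (simp_all add: A_def B_def C_def imD)
  qed (simp_all add: fyn[symmetric] rel)
  have zz: "z \<bullet> z = (Re z)\<^sup>2 + (Im z)\<^sup>2" "(norm z)\<^sup>2 = z \<bullet> z"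
    by (simp_all add: inner_complex_def power2_eq_square[of "Re z"] power2_eq_square[of "Im z"] power2_norm_eq_inner)
  have sph: "2 / (1 + z \<bullet> z) - 4 * (Re z)\<^sup>2 / (1 + z \<bullet> z)\<^sup>2 + (2 / (1 + z \<bullet> z) - 4 * (Im z)\<^sup>2 / (1 + z \<bullet> z)\<^sup>2) =
      4 / (1 + (norm z)\<^sup>2)\<^sup>2"
  proof -
    have gen: "2 / r - 4 * x\<^sup>2 / r\<^sup>2 + (2 / r - 4 * y\<^sup>2 / r\<^sup>2) = 4 / r\<^sup>2"
      if "r \<noteq> 0" "r = 1 + (x\<^sup>2 + y\<^sup>2)" for r x y :: real
    proof -
      have "2 / r = 2 * r / r\<^sup>2" using that(1) by (simp add: power2_eq_square)
      then have "2 / r - 4 * x\<^sup>2 / r\<^sup>2 + (2 / r - 4 * y\<^sup>2 / r\<^sup>2) =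
          (2 * r - 4 * x\<^sup>2 + (2 * r - 4 * y\<^sup>2)) / r\<^sup>2"
        by (simp only: diff_divide_distrib add_divide_distrib)
      also have "2 * r - 4 * x\<^sup>2 + (2 * r - 4 * y\<^sup>2) = 4" using that(2) by simp
      finally show ?thesis .
    qed
    show ?thesis unfolding zz(2) using rp[of z] by (intro gen) (simp_all add: zz(1))
  qed
  have alg: "(b1 + b2) / r - s * (2 * s) / r2 + x + (- (a1 + b2) / r + - t * (2 * t) / r2 + y) =
      (b1 - a1) / r - 2 * (s\<^sup>2 + t\<^sup>2) / r2 + (x + y)" for b1 b2 r s r2 x a1 t y :: real
    by (simp add: add_divide_distrib diff_divide_distrib power2_eq_square distrib_left mult.left_commute)
  show ?thesis
    unfolding X Y g AB rel(1) rel(4) sph[symmetric] by (rule alg)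
qed

end

section \<open>Integrals over lines and over the plane\<close>

lemma FTC_line_nonneg:
  fixes F f :: "real \<Rightarrow> real"
  assumes F: "\<And>x. (F has_real_derivative f x) (at x)" and f: "\<And>x. isCont f x" "\<And>x. 0 \<le> f x"
    and A: "(F \<longlongrightarrow> A) at_bot" and B: "(F \<longlongrightarrow> B) at_top"
  shows "integrable lborel f" "(LINT x|lborel. f x) = B - A"
proof -
  have U: "einterval (- \<infinity>) \<infinity> = UNIV" by (auto simp: einterval_def)
  have "set_integrable lborel (einterval (- \<infinity>) \<infinity>) f" "(LBINT x=-\<infinity>..\<infinity>. f x) = B - A"
    using assms by (intro interval_integral_FTC_nonneg; simp add: ereal_tendsto_simps1)+
  then show "integrable lborel f" "(LINT x|lborel. f x) = B - A"
    by (simp_all add: U set_integrable_def interval_lebesgue_integral_def set_lebesgue_integral_def)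
qed

lemma FTC_line_zero:
  fixes F f :: "real \<Rightarrow> real"
  assumes F: "\<And>x. (F has_real_derivative f x) (at x)" and f: "\<And>x. isCont f x" "integrable lborel f"
    and A: "(F \<longlongrightarrow> 0) at_bot" and B: "(F \<longlongrightarrow> 0) at_top"
  shows "(LINT x|lborel. f x) = 0"
proof -
  have U: "einterval (- \<infinity>) \<infinity> = UNIV" by (auto simp: einterval_def)
  have "(LBINT x=-\<infinity>..\<infinity>. f x) = 0 - 0"
    using assms by (intro interval_integral_FTC_integrable[where F = F])
      (simp_all add: ereal_tendsto_simps1 U set_integrable_def has_real_derivative_iff_has_vector_derivative)
  then show ?thesis
    by (simp add: U interval_lebesgue_integral_def set_lebesgue_integral_def)
qed

lemma tendsto_x_over_sqrt:
  assumes "s > 0"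
  shows "((\<lambda>x. x / sqrt (s + x\<^sup>2)) \<longlongrightarrow> 1) at_top" "((\<lambda>x. x / sqrt (s + x\<^sup>2)) \<longlongrightarrow> - 1) at_bot"
proof -
  have "((\<lambda>x::real. s / x\<^sup>2) \<longlongrightarrow> 0) at_top"
    by (intro tendsto_divide_0[OF tendsto_const] filterlim_at_top_imp_at_infinity filterlim_pow_at_top
        filterlim_ident) auto
  then have "((\<lambda>x. 1 / sqrt (s / x\<^sup>2 + 1)) \<longlongrightarrow> 1 / sqrt (0 + 1)) at_top"
    by (intro tendsto_intros) auto
  then have "((\<lambda>x. 1 / sqrt (s / x\<^sup>2 + 1)) \<longlongrightarrow> 1) at_top" by simp
  moreover have "1 / sqrt (s / x\<^sup>2 + 1) = x / sqrt (s + x\<^sup>2)" if "x > 0" for x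
  proof -
    have "s / x\<^sup>2 + 1 = (s + x\<^sup>2) / x\<^sup>2" using that by (simp add: field_simps)
    then show ?thesis using that by (simp add: real_sqrt_divide)
  qed
  then have "eventually (\<lambda>x. 1 / sqrt (s / x\<^sup>2 + 1) = x / sqrt (s + x\<^sup>2)) at_top"
    by (rule eventually_mono[OF eventually_gt_at_top[of 0]])
  ultimately show 1: "((\<lambda>x. x / sqrt (s + x\<^sup>2)) \<longlongrightarrow> 1) at_top"
    by (rule Lim_transform_eventually)
  show "((\<lambda>x. x / sqrt (s + x\<^sup>2)) \<longlongrightarrow> - 1) at_bot"
    unfolding filterlim_at_bot_mirror using tendsto_minus[OF 1] by simp
qed

text \<open>The antiderivative \<open>x / (s * sqrt (s + x^2))\<close> has the limits
  \<open>1 / s\<close> and \<open>- 1 / s\<close>. The integral occurs twice: as the inner integral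
  for \<open>decay\<close> and as the outer one for the area of the sphere.\<close>

lemma line_integral_32:
  assumes s: "s > 0"
  shows "integrable lborel (\<lambda>x. 1 / ((s + x\<^sup>2) * sqrt (s + x\<^sup>2)))"
    "(LINT x|lborel. 1 / ((s + x\<^sup>2) * sqrt (s + x\<^sup>2))) = 2 / s"
proof -
  let ?F = "\<lambda>x. (1 / s) * (x / sqrt (s + x\<^sup>2))"
  have pos: "s + x\<^sup>2 > 0" for x using s by (simp add: add_pos_nonneg)
  have d: "(?F has_real_derivative 1 / ((s + x\<^sup>2) * sqrt (s + x\<^sup>2))) (at x)" for x
  proof -
    have "((\<lambda>x. sqrt (s + x\<^sup>2)) has_real_derivative (2 * x) * (inverse (sqrt (s + x\<^sup>2)) / 2)) (at x)"
      using pos[of x] by (auto intro!: derivative_eq_intros)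
    then have "(?F has_real_derivative (1 / s) * ((1 * sqrt (s + x\<^sup>2) - x * ((2 * x) * (inverse (sqrt (s + x\<^sup>2)) / 2))) /
        (sqrt (s + x\<^sup>2) * sqrt (s + x\<^sup>2)))) (at x)"
      using pos[of x] by (intro DERIV_cmult DERIV_divide DERIV_ident) auto
    moreover have "(1 / s) * ((1 * sqrt (s + x\<^sup>2) - x * ((2 * x) * (inverse (sqrt (s + x\<^sup>2)) / 2))) /
        (sqrt (s + x\<^sup>2) * sqrt (s + x\<^sup>2))) = 1 / ((s + x\<^sup>2) * sqrt (s + x\<^sup>2))"
    proof -
      define r where "r = sqrt (s + x\<^sup>2)"
      have r: "r > 0" "r * r = s + x\<^sup>2" using pos[of x] by (auto simp: r_def)
      have "r - x * ((2 * x) * (inverse r / 2)) = (r * r - x\<^sup>2) / r"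
        using r(1) by (simp add: field_simps power2_eq_square)
      then have "r - x * ((2 * x) * (inverse r / 2)) = s / r" using r(2) by simp
      then show ?thesis using s r by (simp add: r_def[symmetric])
    qed
    ultimately show ?thesis by simp
  qed
  have c: "isCont (\<lambda>x. 1 / ((s + x\<^sup>2) * sqrt (s + x\<^sup>2))) x" for x
    using pos[of x] by (intro continuous_intros) auto
  have p: "0 \<le> 1 / ((s + x\<^sup>2) * sqrt (s + x\<^sup>2))" for x using pos[of x] by simp
  have l: "(?F \<longlongrightarrow> (1 / s) * (- 1)) at_bot" "(?F \<longlongrightarrow> (1 / s) * 1) at_top"
    by (intro tendsto_mult tendsto_const tendsto_x_over_sqrt s)+
  show "integrable lborel (\<lambda>x. 1 / ((s + x\<^sup>2) * sqrt (s + x\<^sup>2)))"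
    by (rule FTC_line_nonneg(1)[OF d c p l])
  show "(LINT x|lborel. 1 / ((s + x\<^sup>2) * sqrt (s + x\<^sup>2))) = 2 / s"
    using FTC_line_nonneg(2)[OF d c p l] by simp
qed

text \<open>Only the arctangent in the antiderivative contributes, increasing by pi in total; the
  rational summand tends to 0 at both ends.\<close>

lemma line_integral_sphere:
  assumes s: "s > 0"
  shows "(LINT x|lborel. 4 / (s + x\<^sup>2)\<^sup>2) = 2 * pi * (1 / (s * sqrt s))"
proof -
  let ?F = "\<lambda>x. (2 / s) * (x / (s + x\<^sup>2)) + (2 / (s * sqrt s)) * arctan (x / sqrt s)"
  have pos: "s + x\<^sup>2 > 0" for x using s by (simp add: add_pos_nonneg)
  have d: "(?F has_real_derivative 4 / (s + x\<^sup>2)\<^sup>2) (at x)" for x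
  proof -
    define t where "t = s + x\<^sup>2"
    have t: "t > 0" using pos by (simp add: t_def)
    have 1: "((\<lambda>x. s + x\<^sup>2) has_real_derivative 2 * x) (at x)"
      by (auto intro!: derivative_eq_intros)
    have 2: "((\<lambda>x. x / sqrt s) has_real_derivative 1 / sqrt s) (at x)"
      by (rule DERIV_cdivide[OF DERIV_ident])
    have "(?F has_real_derivative (2 / s) * ((1 * (s + x\<^sup>2) - x * (2 * x)) / ((s + x\<^sup>2) * (s + x\<^sup>2))) +
        (2 / (s * sqrt s)) * (inverse (1 + (x / sqrt s)\<^sup>2) * (1 / sqrt s))) (at x)"
      using pos[of x] by (intro DERIV_add DERIV_cmult DERIV_divide DERIV_ident 1
          DERIV_chain'[OF 2 DERIV_arctan]) auto
    moreover have "(2 / (s * sqrt s)) * (inverse (1 + (x / sqrt s)\<^sup>2) * (1 / sqrt s)) = 2 / (s * t)"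
    proof -
      have "1 + (x / sqrt s)\<^sup>2 = t / s" using s by (simp add: t_def field_simps power_divide)
      then have "(2 / (s * sqrt s)) * (inverse (1 + (x / sqrt s)\<^sup>2) * (1 / sqrt s)) = 2 / (s * (sqrt s * sqrt s)) * (s / t)"
        by simp
      then show ?thesis using s by simp
    qed
    moreover have "(2 / s) * ((1 * t - x * (2 * x)) / (t * t)) + 2 / (s * t) = 4 / t\<^sup>2"
    proof -
      have "2 / (s * t) = (2 / s) * (t / (t * t))" using t by simp
      then have "(2 / s) * ((1 * t - x * (2 * x)) / (t * t)) + 2 / (s * t) =
          (2 / s) * ((1 * t - x * (2 * x)) / (t * t) + t / (t * t))" by (simp only: distrib_left)
      also have "(1 * t - x * (2 * x)) / (t * t) + t / (t * t) = (2 * s) / (t * t)"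
        unfolding add_divide_distrib[symmetric] by (simp add: t_def power2_eq_square)
      finally show ?thesis using s by (simp add: power2_eq_square)
    qed
    ultimately show ?thesis by (simp add: t_def)
  qed
  have c: "isCont (\<lambda>x. 4 / (s + x\<^sup>2)\<^sup>2) x" for x
    using pos[of x] by (intro continuous_intros) auto
  have p: "0 \<le> 4 / (s + x\<^sup>2)\<^sup>2" for x by simp
  have z1: "((\<lambda>x. x / (s + x\<^sup>2)) \<longlongrightarrow> 0) at_top"
  proof -
    have sq: "filterlim (\<lambda>x. sqrt (s + x\<^sup>2)) at_top at_top"
      by (intro filterlim_compose[OF sqrt_at_top] filterlim_tendsto_add_at_top[OF tendsto_const]
          filterlim_pow_at_top filterlim_ident) auto
    have "((\<lambda>x. (x / sqrt (s + x\<^sup>2)) * inverse (sqrt (s + x\<^sup>2))) \<longlongrightarrow> 1 * 0) at_top"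
      by (intro tendsto_mult tendsto_x_over_sqrt s filterlim_compose[OF tendsto_inverse_0]
          filterlim_at_top_imp_at_infinity sq)
    moreover have "(x / sqrt (s + x\<^sup>2)) * inverse (sqrt (s + x\<^sup>2)) = x / (s + x\<^sup>2)" for x
      using pos[of x] by (simp add: divide_inverse mult.assoc flip: inverse_mult_distrib)
    ultimately show ?thesis by simp
  qed
  have z2: "((\<lambda>x. x / (s + x\<^sup>2)) \<longlongrightarrow> 0) at_bot"
    unfolding filterlim_at_bot_mirror using tendsto_minus[OF z1] by simp
  have sq: "sqrt s > 0" using s by simp
  have ft: "filterlim (\<lambda>x. x / sqrt s) at_top at_top"
    unfolding divide_inverse mult.commute[of _ "inverse (sqrt s)"]
    by (rule filterlim_tendsto_pos_mult_at_top[OF tendsto_const _ filterlim_ident]) (use sq in simp)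
  have a1: "((\<lambda>x. arctan (x / sqrt s)) \<longlongrightarrow> pi / 2) at_top"
    by (rule filterlim_compose[OF tendsto_arctan_at_top ft])
  have a2: "((\<lambda>x. arctan (x / sqrt s)) \<longlongrightarrow> - (pi / 2)) at_bot"
    unfolding filterlim_at_bot_mirror using tendsto_minus[OF a1] by (simp add: arctan_minus)
  have l: "(?F \<longlongrightarrow> (2 / s) * 0 + (2 / (s * sqrt s)) * (- (pi / 2))) at_bot"
    "(?F \<longlongrightarrow> (2 / s) * 0 + (2 / (s * sqrt s)) * (pi / 2)) at_top"
    by (intro tendsto_add tendsto_mult tendsto_const z1 z2 a1 a2)+
  show ?thesis
    using FTC_line_nonneg(2)[OF d c p l] by simp
qed

text \<open>Both measures give a box the product of its side lengths. The identification makes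
  Fubini's theorem available on the complex plane.\<close>

lemma lborel_complex: "(lborel :: complex measure) = distr (lborel \<Otimes>\<^sub>M lborel) borel (\<lambda>(x, y). Complex x y)"
proof (rule lborel_eqI)
  have m: "(\<lambda>(x, y). Complex x y) \<in> borel_measurable (lborel \<Otimes>\<^sub>M lborel)"
  proof -
    have "continuous_on UNIV (\<lambda>(x, y). Complex x y)"
      unfolding split_beta Complex_eq by (intro continuous_intros)
    then show ?thesis unfolding lborel_prod by (simp add: borel_measurable_continuous_onI)
  qed
  fix l u :: complex
  assume lu: "\<And>b. b \<in> Basis \<Longrightarrow> l \<bullet> b \<le> u \<bullet> b"
  have "Re l \<le> Re u" "Im l \<le> Im u"
    using lu[of 1] lu[of \<i>] by (simp_all add: Basis_complex_def inner_complex_def)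
  moreover have "(\<lambda>(x, y). Complex x y) -` box l u \<inter> space (lborel \<Otimes>\<^sub>M lborel) = box (Re l) (Re u) \<times> box (Im l) (Im u)"
    by (auto simp: space_pair_measure box_def Basis_complex_def inner_complex_def)
  ultimately show "emeasure (distr (lborel \<Otimes>\<^sub>M lborel) borel (\<lambda>(x, y). Complex x y)) (box l u) = ennreal (\<Prod>b\<in>Basis. (u - l) \<bullet> b)"
    using m by (simp add: emeasure_distr lborel.emeasure_pair_measure_Times Basis_complex_def inner_complex_def
        ennreal_mult[symmetric])
qed simp

lemma complex_integral:
  fixes g :: "complex \<Rightarrow> real"
  assumes "continuous_on UNIV g"
  shows "integrable lborel g \<longleftrightarrow> integrable (lborel \<Otimes>\<^sub>M lborel) (\<lambda>(x, y). g (Complex x y))"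
    "(LINT z|lborel. g z) = integral\<^sup>L (lborel \<Otimes>\<^sub>M lborel) (\<lambda>(x, y). g (Complex x y))"
    "(\<lambda>(x, y). g (Complex x y)) \<in> borel_measurable (lborel \<Otimes>\<^sub>M lborel)"
proof -
  have c: "continuous_on UNIV (\<lambda>(x, y). Complex x y)"
    unfolding split_beta Complex_eq by (intro continuous_intros)
  have m: "(\<lambda>(x, y). Complex x y) \<in> measurable (lborel \<Otimes>\<^sub>M lborel) borel"
    unfolding lborel_prod using c by (simp add: borel_measurable_continuous_onI)
  have g: "g \<in> borel_measurable borel" by (rule borel_measurable_continuous_onI[OF assms])
  show "integrable lborel g \<longleftrightarrow> integrable (lborel \<Otimes>\<^sub>M lborel) (\<lambda>(x, y). g (Complex x y))"
    unfolding lborel_complex using integrable_distr_eq[OF m g] by (simp only: case_prod_unfold)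
  show "(LINT z|lborel. g z) = integral\<^sup>L (lborel \<Otimes>\<^sub>M lborel) (\<lambda>(x, y). g (Complex x y))"
    unfolding lborel_complex using integral_distr[OF m g] by (simp only: case_prod_unfold)
  show "(\<lambda>(x, y). g (Complex x y)) \<in> borel_measurable (lborel \<Otimes>\<^sub>M lborel)"
    using measurable_compose[OF m g] by (simp only: case_prod_unfold)
qed

text \<open>The power -3/2 of \<open>1 + |z|^2\<close>. Second derivatives, in the affine
  coordinate, of a smooth function on the sphere decay like \<open>|z|^-3\<close>, which is still
  integrable over the plane.\<close>

definition decay :: "complex \<Rightarrow> real" where
  "decay z = 1 / ((1 + (norm z)\<^sup>2) * sqrt (1 + (norm z)\<^sup>2))"

lemma decay_Complex: "decay (Complex x y) = 1 / (((1 + y\<^sup>2) + x\<^sup>2) * sqrt ((1 + y\<^sup>2) + x\<^sup>2))"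
  by (simp add: decay_def cmod_def add_ac)

lemma one_plus_pos: "0 < 1 + (y::real)\<^sup>2" by (simp add: add_pos_nonneg)

lemma one_plus_norm_pos: "0 < 1 + (norm z)\<^sup>2" by (simp add: add_pos_nonneg)

lemma decay_pos: "0 < decay z" using one_plus_norm_pos[of z] by (simp add: decay_def)

lemma decay_continuous: "continuous_on UNIV decay"
proof -
  have "(1 + (norm z)\<^sup>2) * sqrt (1 + (norm z)\<^sup>2) \<noteq> 0" for z :: complex
    using one_plus_norm_pos[of z] by simp
  then show ?thesis unfolding decay_def[abs_def] by (intro continuous_intros) auto
qed

lemma decay_integrable: "integrable lborel decay"
  unfolding complex_integral(1)[OF decay_continuous]
proof -
  note m = complex_integral(3)[OF decay_continuous]
  have "integrable (lborel \<Otimes>\<^sub>M lborel) (\<lambda>(y, x). decay (Complex x y))"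
  proof (rule lborel_pair.Fubini_integrable)
    show "(\<lambda>(y, x). decay (Complex x y)) \<in> borel_measurable (lborel \<Otimes>\<^sub>M lborel)"
      using measurable_pair_swap[OF m] by (simp add: split_beta)
    have "(LINT x|lborel. norm (case (y, x) of (y, x) \<Rightarrow> decay (Complex x y))) = 2 / (1 + y\<^sup>2)" for y
    proof -
      have "norm (decay z) = decay z" for z using decay_pos[of z] by simp
      then show ?thesis
        using line_integral_32(2)[OF one_plus_pos[of y]] by (simp add: decay_Complex)
    qed
    moreover have "integrable lborel (\<lambda>y::real. 2 / (1 + y\<^sup>2))"
    proof (rule FTC_line_nonneg(1))
      show "((\<lambda>y. 2 * arctan y) has_real_derivative 2 / (1 + y\<^sup>2)) (at y)" for y
        by (auto intro!: derivative_eq_intros simp: divide_inverse)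
      show "isCont (\<lambda>y::real. 2 / (1 + y\<^sup>2)) y" for y
        using one_plus_pos[of y] by (intro continuous_intros) auto
      show "((\<lambda>y. 2 * arctan y) \<longlongrightarrow> 2 * - (pi / 2)) at_bot" "((\<lambda>y. 2 * arctan y) \<longlongrightarrow> 2 * (pi / 2)) at_top"
        by (intro tendsto_mult tendsto_const tendsto_arctan_at_top tendsto_arctan_at_bot)+
    qed simp
    ultimately show "integrable lborel (\<lambda>y. LINT x|lborel. norm (case (y, x) of (y, x) \<Rightarrow> decay (Complex x y)))"
      by simp
    show "AE y in lborel. integrable lborel (\<lambda>x. case (y, x) of (y, x) \<Rightarrow> decay (Complex x y))"
      using line_integral_32(1)[OF one_plus_pos] by (simp add: decay_Complex)
  qed
  then show "integrable (lborel \<Otimes>\<^sub>M lborel) (\<lambda>(x, y). decay (Complex x y))"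
    using lborel_pair.integrable_product_swap_iff[of "\<lambda>(x, y). decay (Complex x y)"] by (simp add: split_beta)
qed

lemma decay_dominated:
  fixes g :: "complex \<Rightarrow> real"
  assumes "continuous_on UNIV g" "\<And>z. \<bar>g z\<bar> \<le> C * decay z"
  shows "integrable lborel g"
proof (rule Bochner_Integration.integrable_bound[of _ "\<lambda>z. C * decay z"])
  show "g \<in> borel_measurable lborel" using borel_measurable_continuous_onI[OF assms(1)] by simp
  show "AE z in lborel. norm (g z) \<le> norm (C * decay z)" using order_trans[OF assms(2) abs_ge_self] by (simp only: real_norm_def AE_I2)
qed (intro integrable_mult_right decay_integrable)

lemma sphere_area: "(LINT z::complex|lborel. 4 / (1 + (norm z)\<^sup>2)\<^sup>2) = 4 * pi"
  and sphere_integrable: "integrable lborel (\<lambda>z::complex. 4 / (1 + (norm z)\<^sup>2)\<^sup>2)"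
proof -
  let ?g = "\<lambda>z::complex. 4 / (1 + (norm z)\<^sup>2)\<^sup>2"
  have nz: "(1 + (norm z)\<^sup>2)\<^sup>2 \<noteq> 0" for z :: complex using one_plus_norm_pos[of z] by simp
  have c: "continuous_on UNIV ?g" using nz by (intro continuous_intros) auto
  show i: "integrable lborel ?g"
  proof (rule decay_dominated[OF c, of 4])
    fix z :: complex
    let ?r = "1 + (norm z)\<^sup>2"
    have "1 \<le> ?r" by simp
    then have "sqrt ?r \<le> ?r" by (intro real_sqrt_le_iff'[THEN iffD2]) (auto simp: power2_eq_square mult_le_cancel_left1)
    then have "?r * sqrt ?r \<le> ?r\<^sup>2" unfolding power2_eq_square[of ?r] using \<open>1 \<le> ?r\<close> by (intro mult_left_mono) auto
    moreover have "0 < ?r * sqrt ?r" using one_plus_norm_pos[of z] by simp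
    moreover have "0 < ?r\<^sup>2" using one_plus_norm_pos[of z] by simp
    ultimately have "4 / ?r\<^sup>2 \<le> 4 / (?r * sqrt ?r)" by (intro divide_left_mono mult_pos_pos) (auto simp: one_plus_norm_pos)
    then show "\<bar>?g z\<bar> \<le> 4 * decay z" by (simp add: decay_def)
  qed
  have "(LINT z|lborel. ?g z) = integral\<^sup>L (lborel \<Otimes>\<^sub>M lborel) (\<lambda>(x, y). ?g (Complex x y))"
    by (rule complex_integral(2)[OF c])
  also have "\<dots> = (LINT y|lborel. LINT x|lborel. ?g (Complex x y))"
    using lborel_pair.integral_snd[of "\<lambda>x y. ?g (Complex x y)"] i[unfolded complex_integral(1)[OF c]] by simp
  also have "\<dots> = (LINT y|lborel. 2 * pi * (1 / ((1 + y\<^sup>2) * sqrt (1 + y\<^sup>2))))"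
  proof -
    have "(LINT x|lborel. ?g (Complex x y)) = 2 * pi * (1 / ((1 + y\<^sup>2) * sqrt (1 + y\<^sup>2)))" for y
      using line_integral_sphere[OF one_plus_pos[of y]] by (simp add: cmod_def add_ac)
    then show ?thesis by simp
  qed
  also have "\<dots> = 2 * pi * (LINT y|lborel. 1 / ((1 + y\<^sup>2) * sqrt (1 + y\<^sup>2)))"
    by (rule integral_mult_right_zero)
  also have "\<dots> = 4 * pi" using line_integral_32(2)[of 1] by simp
  finally show "(LINT z|lborel. ?g z) = 4 * pi" .
qed

text \<open>On each line parallel to \<open>u\<close> the integrand is the derivative of a function
  tending to 0 at both ends. Fubini's theorem reduces the plane to these lines; on almost all of
  them the integrand is integrable because of the bound by \<open>decay\<close>.\<close>

lemma divergence_zero: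
  fixes X :: "complex \<Rightarrow> real"
  assumes X: "\<And>z. (X has_derivative X' z) (at z)" and c: "continuous_on UNIV (\<lambda>z. X' z u)"
    and u: "u = 1 \<or> u = \<i>"
    and b: "\<And>z. \<bar>X z\<bar> \<le> K / (1 + (norm z)\<^sup>2)" and b': "\<And>z. \<bar>X' z u\<bar> \<le> C * decay z"
  shows "integrable lborel (\<lambda>z. X' z u)" "(LINT z|lborel. X' z u) = 0"
proof -
  show i: "integrable lborel (\<lambda>z. X' z u)" by (rule decay_dominated[OF c b'])
  have line: "(LINT t|lborel. X' (a + t *\<^sub>R u) u) = 0"
    if a: "a \<bullet> u = 0" and int: "integrable lborel (\<lambda>t. X' (a + t *\<^sub>R u) u)" for a
  proof (rule FTC_line_zero[where F = "\<lambda>t. X (a + t *\<^sub>R u)"])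
    show "((\<lambda>t. X (a + t *\<^sub>R u)) has_real_derivative X' (a + t *\<^sub>R u) u) (at t)" for t
      using has_vector_derivative_line[OF X] by (simp add: has_real_derivative_iff_has_vector_derivative)
    have "continuous_on UNIV (\<lambda>t. X' (a + t *\<^sub>R u) u)"
      by (intro continuous_on_compose2[OF c] continuous_intros) auto
    then show "isCont (\<lambda>t. X' (a + t *\<^sub>R u) u) t" for t by (simp add: continuous_on_eq_continuous_at)
    have "\<bar>X (a + t *\<^sub>R u)\<bar> \<le> \<bar>K\<bar> / (1 + t\<^sup>2)" for t
    proof -
      have "(norm (a + t *\<^sub>R u))\<^sup>2 = (norm a)\<^sup>2 + t\<^sup>2"
        using a u by (auto simp: cmod_power2 inner_complex_def)
      then have "1 + t\<^sup>2 \<le> 1 + (norm (a + t *\<^sub>R u))\<^sup>2" by simp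
      then have "\<bar>K\<bar> / (1 + (norm (a + t *\<^sub>R u))\<^sup>2) \<le> \<bar>K\<bar> / (1 + t\<^sup>2)"
        using one_plus_pos[of t] by (intro divide_left_mono mult_pos_pos) auto
      moreover have "K / (1 + (norm (a + t *\<^sub>R u))\<^sup>2) \<le> \<bar>K\<bar> / (1 + (norm (a + t *\<^sub>R u))\<^sup>2)"
        by (intro divide_right_mono) auto
      ultimately show ?thesis using b[of "a + t *\<^sub>R u"] by linarith
    qed
    then have le: "norm (X (a + t *\<^sub>R u)) \<le> \<bar>K\<bar> / (1 + t\<^sup>2)" for t by simp
    have top: "((\<lambda>t::real. \<bar>K\<bar> / (1 + t\<^sup>2)) \<longlongrightarrow> 0) at_top"
      by (intro tendsto_divide_0[OF tendsto_const] filterlim_at_top_imp_at_infinity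
          filterlim_tendsto_add_at_top[OF tendsto_const] filterlim_pow_at_top filterlim_ident) auto
    then have bot: "((\<lambda>t::real. \<bar>K\<bar> / (1 + t\<^sup>2)) \<longlongrightarrow> 0) at_bot"
      unfolding filterlim_at_bot_mirror by simp
    show "((\<lambda>t. X (a + t *\<^sub>R u)) \<longlongrightarrow> 0) at_bot"
      by (rule Lim_null_comparison[OF always_eventually bot]) (use le in blast)
    show "((\<lambda>t. X (a + t *\<^sub>R u)) \<longlongrightarrow> 0) at_top"
      by (rule Lim_null_comparison[OF always_eventually top]) (use le in blast)
  qed (rule int)
  note i2 = i[unfolded complex_integral(1)[OF c]]
  show "(LINT z|lborel. X' z u) = 0"
    using u
  proof
    assume u: "u = 1"
    have "(LINT z|lborel. X' z u) = (LINT y|lborel. LINT x|lborel. X' (Complex x y) u)"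
      using lborel_pair.integral_snd[of "\<lambda>x y. X' (Complex x y) u"] i2 complex_integral(2)[OF c] by simp
    also have "\<dots> = 0"
    proof (rule integral_eq_zero_AE)
      have e: "(\<lambda>x. X' (Complex x y) u) = (\<lambda>x. X' (Complex 0 y + x *\<^sub>R u) u)" for y
      proof
        have c: "Complex x y = Complex 0 y + x *\<^sub>R u" for x by (simp add: u complex_eq_iff)
        show "X' (Complex x y) u = X' (Complex 0 y + x *\<^sub>R u) u" for x
          by (rule arg_cong[OF c, of "\<lambda>z. X' z u"])
      qed
      show "AE y in lborel. (LINT x|lborel. X' (Complex x y) u) = 0"
        using lborel_pair.AE_integrable_snd[of "\<lambda>x y. X' (Complex x y) u"] i2
      proof (simp, elim eventually_mono)
        fix y assume "integrable lborel (\<lambda>x. X' (Complex x y) u)"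
        then show "(LINT x|lborel. X' (Complex x y) u) = 0"
          unfolding e[of y] by (intro line) (simp_all add: u inner_complex_def)
      qed
    qed
    finally show ?thesis .
  next
    assume u: "u = \<i>"
    have "(LINT z|lborel. X' z u) = (LINT x|lborel. LINT y|lborel. X' (Complex x y) u)"
      using lborel_pair.integral_fst[of "\<lambda>x y. X' (Complex x y) u"] i2 complex_integral(2)[OF c] by simp
    also have "\<dots> = 0"
    proof (rule integral_eq_zero_AE)
      have e: "(\<lambda>y. X' (Complex x y) u) = (\<lambda>y. X' (Complex x 0 + y *\<^sub>R u) u)" for x
      proof
        have c: "Complex x y = Complex x 0 + y *\<^sub>R u" for y by (simp add: u complex_eq_iff)
        show "X' (Complex x y) u = X' (Complex x 0 + y *\<^sub>R u) u" for y
          by (rule arg_cong[OF c, of "\<lambda>z. X' z u"])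
      qed
      show "AE x in lborel. (LINT y|lborel. X' (Complex x y) u) = 0"
        using lborel_pair.AE_integrable_fst[of "\<lambda>x y. X' (Complex x y) u"] i2
      proof (simp, elim eventually_mono)
        fix x assume "integrable lborel (\<lambda>y. X' (Complex x y) u)"
        then show "(LINT y|lborel. X' (Complex x y) u) = 0"
          unfolding e[of x] by (intro line) (simp_all add: u inner_complex_def)
      qed
    qed
    finally show ?thesis .
  qed
qed

section \<open>Decay at infinity of derivatives of functions on the sphere\<close>

lemma unit_disc_bound:
  fixes g :: "complex \<Rightarrow> 'b::real_normed_vector"
  assumes "continuous_on UNIV g"
  obtains C where "0 \<le> C" "\<And>w. norm w \<le> 1 \<Longrightarrow> norm (g w) \<le> C"
proof -
  have "compact (g ` cball 0 1)"
    by (rule compact_continuous_image[OF continuous_on_subset[OF assms]]) auto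
  then obtain C where C: "\<And>x. x \<in> g ` cball 0 1 \<Longrightarrow> norm x \<le> C"
    using compact_imp_bounded bounded_iff by metis
  have "norm (g w) \<le> C" if "norm w \<le> 1" for w using C[of "g w"] that by simp
  moreover from this[of 0] have "0 \<le> C" by (simp add: order_trans[OF norm_ge_zero])
  ultimately show ?thesis using that by blast
qed

lemma linear_complex_bound:
  fixes L :: "complex \<Rightarrow> 'b::real_normed_vector"
  assumes "linear L" "norm (L 1) \<le> A" "norm (L \<i>) \<le> B"
  shows "norm (L v) \<le> (A + B) * norm v"
proof -
  have "norm (L v) \<le> \<bar>Re v\<bar> * norm (L 1) + \<bar>Im v\<bar> * norm (L \<i>)"
    using norm_triangle_ineq[of "Re v *\<^sub>R L 1" "Im v *\<^sub>R L \<i>"] by (simp add: linear_complex[OF assms(1), of v])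
  also have "\<dots> \<le> norm v * A + norm v * B"
    by (intro add_mono mult_mono abs_Re_le_cmod abs_Im_le_cmod assms) auto
  finally show ?thesis by (simp add: algebra_simps)
qed

lemma derivative_disc_bound:
  fixes g :: "complex \<Rightarrow> 'b::real_normed_vector"
  assumes g: "smooth_on UNIV g"
  obtains C where "0 \<le> C" "\<And>w v. norm w \<le> 1 \<Longrightarrow> norm (frechet_derivative g (at w) v) \<le> C * norm v"
proof -
  have c: "continuous_on UNIV (\<lambda>w. frechet_derivative g (at w) v)" for v
    by (rule smooth_on_imp_continuous_on[OF smooth_on_derivative[OF open_UNIV g]])
  obtain A where A: "0 \<le> A" "\<And>w. norm w \<le> 1 \<Longrightarrow> norm (frechet_derivative g (at w) 1) \<le> A"
    using unit_disc_bound[OF c] by blast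
  obtain B where B: "0 \<le> B" "\<And>w. norm w \<le> 1 \<Longrightarrow> norm (frechet_derivative g (at w) \<i>) \<le> B"
    using unit_disc_bound[OF c] by blast
  show ?thesis
  proof (rule that[of "A + B"])
    show "norm (frechet_derivative g (at w) v) \<le> (A + B) * norm v" if "norm w \<le> 1" for w v
      by (rule linear_complex_bound[OF has_derivative_linear[OF smooth_on_has_derivative[OF open_UNIV g UNIV_I]]
            A(2)[OF that] B(2)[OF that]])
  qed (use A(1) B(1) in simp)
qed

lemma cdiff_Fin_eq:
  assumes "csmooth UNIV h"
  shows "cdiff h (Fin z) v = frechet_derivative (h \<circ> Fin) (at z) v"
    and "z \<noteq> 0 \<Longrightarrow> cdiff h (Fin z) v = frechet_derivative (h \<circ> par Infty) (at (1 / z)) (- v * (1 / z)\<^sup>2)"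
  using cdiff_par[OF open_UNIV assms, of "Fin 0" z v]
    cdiff_par[OF open_UNIV assms, of Infty "1 / z" "- v * (1 / z)\<^sup>2"]
  by (simp_all add: dpar_def par_Infty power_divide)

lemma cdiff_smooth:
  assumes "csmooth UNIV h" shows "smooth_on UNIV (\<lambda>z. cdiff h (Fin z) v)"
  using smooth_on_derivative[OF open_UNIV csmooth_par_UNIV[OF assms], of "Fin 0" v]
  by (simp add: cdiff_Fin_eq(1)[OF assms])

text \<open>The unit discs of the two charts cover the sphere, and by compactness derivatives are
  bounded on each. Outside the affine unit disc the change of coordinate contributes the factor
  \<open>1 / |z|^2\<close>.\<close>

lemma cdiff_bound:
  fixes h :: "cp1 \<Rightarrow> 'b::real_normed_vector"
  assumes h: "csmooth UNIV h"
  obtains C where "0 \<le> C" "\<And>z v. norm (cdiff h (Fin z) v) \<le> C * norm v / (1 + (norm z)\<^sup>2)"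
proof -
  obtain A where A: "0 \<le> A" "\<And>w v. norm w \<le> 1 \<Longrightarrow> norm (frechet_derivative (h \<circ> Fin) (at w) v) \<le> A * norm v"
    using derivative_disc_bound[OF csmooth_par_UNIV[OF h, of "Fin 0"]] by auto
  obtain B where B: "0 \<le> B" "\<And>w v. norm w \<le> 1 \<Longrightarrow> norm (frechet_derivative (h \<circ> par Infty) (at w) v) \<le> B * norm v"
    using derivative_disc_bound[OF csmooth_par_UNIV[OF h, of Infty]] by blast
  show ?thesis
  proof (rule that[of "2 * (A + B)"])
    fix z v :: complex
    note r = one_plus_norm_pos[of z]
    show "norm (cdiff h (Fin z) v) \<le> 2 * (A + B) * norm v / (1 + (norm z)\<^sup>2)"
    proof (cases "norm z \<le> 1")
      case True
      then have "1 + (norm z)\<^sup>2 \<le> 2" by (simp add: power_le_one)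
      have "norm (cdiff h (Fin z) v) * (1 + (norm z)\<^sup>2) \<le> (A * norm v) * 2"
        using A(2)[OF True, of v] \<open>1 + (norm z)\<^sup>2 \<le> 2\<close> A(1)
        by (intro mult_mono) (simp_all add: cdiff_Fin_eq(1)[OF h])
      also have "\<dots> \<le> 2 * (A + B) * norm v" using B(1) by (simp add: algebra_simps)
      finally show ?thesis using r by (simp add: pos_le_divide_eq)
    next
      case False
      then have z: "z \<noteq> 0" "1 < norm z" by auto
      have n1: "norm (1 / z) \<le> 1" using z by (simp add: norm_divide)
      have "norm (cdiff h (Fin z) v) \<le> B * norm (- v * (1 / z)\<^sup>2)"
        unfolding cdiff_Fin_eq(2)[OF h z(1)] by (rule B(2)[OF n1])
      also have "\<dots> = B * norm v / (norm z)\<^sup>2" by (simp add: norm_mult norm_divide norm_power power_divide)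
      finally have "norm (cdiff h (Fin z) v) * (norm z)\<^sup>2 \<le> B * norm v"
        using z by (simp add: pos_le_divide_eq)
      moreover have "norm (cdiff h (Fin z) v) * (1 + (norm z)\<^sup>2) \<le> norm (cdiff h (Fin z) v) * (2 * (norm z)\<^sup>2)"
        using z one_le_power[of "norm z" 2] by (intro mult_left_mono) auto
      ultimately have "norm (cdiff h (Fin z) v) * (1 + (norm z)\<^sup>2) \<le> 2 * (B * norm v)" by simp
      also have "\<dots> \<le> 2 * (A + B) * norm v" using A(1) by (simp add: algebra_simps)
      finally show ?thesis using r by (simp add: pos_le_divide_eq)
    qed
  qed (use A(1) B(1) in simp)
qed

text \<open>The constant 4 is 2 times 2, from \<open>1 + |z|^2\<close> and from its square root:
  these are at most 2 and 2 on the unit disc, and at most \<open>2 |z|^2\<close> and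
  \<open>2 |z|\<close> outside.\<close>

lemma decay_lower:
  assumes "0 \<le> x" "norm z \<le> 1 \<Longrightarrow> x \<le> C" "1 < norm z \<Longrightarrow> x \<le> C / norm z ^ 3" "0 \<le> C"
  shows "x \<le> (4 * C) * decay z"
proof -
  let ?r = "1 + (norm z)\<^sup>2"
  have pos: "0 < ?r * sqrt ?r" using one_plus_norm_pos[of z] by simp
  have "x * (?r * sqrt ?r) \<le> 4 * C"
  proof (cases "norm z \<le> 1")
    case True
    then have "?r \<le> 2" by (simp add: power_le_one)
    moreover have "sqrt ?r \<le> 2" using \<open>?r \<le> 2\<close> by (intro real_le_lsqrt) auto
    ultimately have "?r * sqrt ?r \<le> 2 * 2" by (intro mult_mono) auto
    then have "x * (?r * sqrt ?r) \<le> C * 4" using assms(1,2,4) True pos by (intro mult_mono) auto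
    then show ?thesis by simp
  next
    case False
    then have z: "1 < norm z" by simp
    then have z2: "1 \<le> (norm z)\<^sup>2" by (intro one_le_power) simp
    then have r: "?r \<le> 2 * (norm z)\<^sup>2" by simp
    moreover have "sqrt ?r \<le> 2 * norm z"
    proof (rule real_le_lsqrt)
      have "(2 * norm z)\<^sup>2 = 4 * (norm z)\<^sup>2" by (simp add: power_mult_distrib)
      then show "?r \<le> (2 * norm z)\<^sup>2" using z2 by linarith
    qed simp
    ultimately have "?r * sqrt ?r \<le> (2 * (norm z)\<^sup>2) * (2 * norm z)" using z by (intro mult_mono) auto
    then have "x * (?r * sqrt ?r) \<le> (C / norm z ^ 3) * ((2 * (norm z)\<^sup>2) * (2 * norm z))"
      by (rule mult_mono[OF assms(3)[OF z]]) (use assms(4) pos in simp_all)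
    also have "\<dots> = 4 * C" using z by (auto simp add: power2_eq_square power3_eq_cube)
    finally show ?thesis .
  qed
  then show ?thesis using pos unfolding decay_def by (simp add: pos_le_divide_eq)
qed

text \<open>With \<open>w = 1 / z\<close>, the first derivative is that of \<open>h\<close> in the
  chart at infinity applied to \<open>- v w^2\<close>. The second differentiation brings in a
  further \<open>w^2\<close>: combined with derivatives of \<open>A\<close> and \<open>B\<close> it
  gives order 4, and combined with the derivative of \<open>w^2\<close> order 3.\<close>

lemma second_derivative_bound:
  fixes h :: "cp1 \<Rightarrow> real"
  assumes h: "csmooth UNIV h" and u: "norm u \<le> 1" and v: "norm v \<le> 1"
  obtains C where "\<And>z. \<bar>frechet_derivative (\<lambda>z. cdiff h (Fin z) v) (at z) u\<bar> \<le> C * decay z"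
proof -
  let ?k = "\<lambda>z. cdiff h (Fin z) v"
  define A where "A w = frechet_derivative (h \<circ> par Infty) (at w) 1" for w
  define B where "B w = frechet_derivative (h \<circ> par Infty) (at w) \<i>" for w
  have sm: "smooth_on UNIV A" "smooth_on UNIV B"
    unfolding A_def[abs_def] B_def[abs_def]
    by (intro smooth_on_derivative open_UNIV csmooth_par_UNIV[OF h])+
  have dA: "(A has_derivative frechet_derivative A (at w)) (at w)"
    and dB: "(B has_derivative frechet_derivative B (at w)) (at w)" for w
    using sm by (auto intro: smooth_on_has_derivative[OF open_UNIV])
  obtain a where a: "0 \<le> a" "\<And>w. norm w \<le> 1 \<Longrightarrow> norm (A w) \<le> a"
    using unit_disc_bound[OF smooth_on_imp_continuous_on[OF sm(1)]] by blast
  obtain b where b: "0 \<le> b" "\<And>w. norm w \<le> 1 \<Longrightarrow> norm (B w) \<le> b"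
    using unit_disc_bound[OF smooth_on_imp_continuous_on[OF sm(2)]] by blast
  obtain a' where a': "0 \<le> a'" "\<And>w v. norm w \<le> 1 \<Longrightarrow> norm (frechet_derivative A (at w) v) \<le> a' * norm v"
    using derivative_disc_bound[OF sm(1)] by blast
  obtain b' where b': "0 \<le> b'" "\<And>w v. norm w \<le> 1 \<Longrightarrow> norm (frechet_derivative B (at w) v) \<le> b' * norm v"
    using derivative_disc_bound[OF sm(2)] by blast
  obtain c where c: "0 \<le> c" "\<And>w v. norm w \<le> 1 \<Longrightarrow> norm (frechet_derivative ?k (at w) v) \<le> c * norm v"
    using derivative_disc_bound[OF cdiff_smooth[OF h, of v]] by blast
  let ?C = "c + 2 * a + 2 * b + a' + b'"
  show ?thesis
  proof (rule that[of "4 * ?C"], rule decay_lower)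
    fix z :: complex
    show "\<bar>frechet_derivative ?k (at z) u\<bar> \<le> ?C" if "norm z \<le> 1"
    proof -
      have "\<bar>frechet_derivative ?k (at z) u\<bar> \<le> c * norm u" using c(2)[OF that, of u] by simp
      also have "\<dots> \<le> c * 1" by (rule mult_left_mono[OF u c(1)])
      finally show ?thesis using a(1) b(1) a'(1) b'(1) by simp
    qed
    show "\<bar>frechet_derivative ?k (at z) u\<bar> \<le> ?C / norm z ^ 3" if z: "1 < norm z"
    proof -
      define w where "w = 1 / z"
      have z0: "z \<noteq> 0" using z by auto
      have w: "norm w \<le> 1" "norm w = 1 / norm z" "w \<noteq> 0" using z z0 by (auto simp: w_def norm_divide)
      let ?K = "\<lambda>w. Re (- v * w\<^sup>2) * A w + Im (- v * w\<^sup>2) * B w"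
      let ?K' = "\<lambda>y. (Re (- v * w\<^sup>2) * frechet_derivative A (at w) y + Re (- v * (2 * w * y)) * A w) +
        (Im (- v * w\<^sup>2) * frechet_derivative B (at w) y + Im (- v * (2 * w * y)) * B w)"
      have k: "?k x = ?K (1 / x)" if "x \<noteq> 0" for x
      proof -
        have "linear (frechet_derivative (h \<circ> par Infty) (at (1 / x)))"
          by (rule has_derivative_linear[OF csmooth_has_derivative[OF open_UNIV h UNIV_I]])
        from linear_complex[OF this, of "- v * (1 / x)\<^sup>2"] show ?thesis
          unfolding cdiff_Fin_eq(2)[OF h that] A_def B_def by simp
      qed
      have sq: "((\<lambda>w. - v * w\<^sup>2) has_derivative (\<lambda>y. - v * (2 * w * y))) (at w)"
        by (auto intro!: derivative_eq_intros simp: fun_eq_iff)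
      have "(?K has_derivative ?K') (at w)"
        by (intro has_derivative_add has_derivative_mult dA dB has_derivative_Re has_derivative_Im sq)
      then have K: "(?K has_derivative ?K') (at (1 / z))" by (simp only: w_def)
      have i: "((\<lambda>x. 1 / x) has_derivative (\<lambda>y. - y * w\<^sup>2)) (at z)"
        using z0 by (auto intro!: derivative_eq_intros simp: w_def fun_eq_iff field_simps power2_eq_square)
      have dk: "(?k has_derivative (\<lambda>y. ?K' (- y * w\<^sup>2))) (at z)"
        by (rule has_derivative_transform_within_open[OF has_derivative_compose[OF i K], of "- {0}"])
          (use z0 k in \<open>auto simp: open_Compl\<close>)
      have eq: "frechet_derivative ?k (at z) u = ?K' (- u * w\<^sup>2)"
        by (rule fun_cong[OF frechet_derivative_at[OF dk], symmetric])
      have nu: "norm (- u * w\<^sup>2) \<le> norm w ^ 2" "norm (- v * w\<^sup>2) \<le> norm w ^ 2"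
        using mult_right_mono[OF u, of "norm w ^ 2"] mult_right_mono[OF v, of "norm w ^ 2"]
        by (simp_all add: norm_mult norm_power)
      have w23: "norm w ^ 2 * norm w ^ 2 \<le> norm w ^ 3"
        using w(1) by (simp add: power_add[symmetric] power_decreasing)
      have nv: "norm (- v * (2 * w * (- u * w\<^sup>2))) \<le> 2 * norm w ^ 3"
      proof -
        have "norm v * norm u \<le> 1" using mult_mono[OF v u] by simp
        from mult_right_mono[OF this, of "2 * norm w ^ 3"] show ?thesis
          by (simp add: norm_mult norm_power power2_eq_square power3_eq_cube mult_ac)
      qed
      have t: "\<bar>x * y\<bar> \<le> X * Y" if "\<bar>x\<bar> \<le> X" "\<bar>y\<bar> \<le> Y" "0 \<le> X" for x y X Y :: real
        using mult_mono[OF that(1,2,3)] by (simp add: abs_mult)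
      have nA: "\<bar>frechet_derivative A (at w) (- u * w\<^sup>2)\<bar> \<le> a' * norm w ^ 2"
        using a'(2)[OF w(1), of "- u * w\<^sup>2"] mult_left_mono[OF nu(1) a'(1)] by simp
      have nB: "\<bar>frechet_derivative B (at w) (- u * w\<^sup>2)\<bar> \<le> b' * norm w ^ 2"
        using b'(2)[OF w(1), of "- u * w\<^sup>2"] mult_left_mono[OF nu(1) b'(1)] by simp
      have 1: "\<bar>Re (- v * w\<^sup>2) * frechet_derivative A (at w) (- u * w\<^sup>2)\<bar> \<le> norm w ^ 2 * (a' * norm w ^ 2)"
        by (intro t order_trans[OF abs_Re_le_cmod nu(2)] nA) auto
      have 2: "\<bar>Im (- v * w\<^sup>2) * frechet_derivative B (at w) (- u * w\<^sup>2)\<bar> \<le> norm w ^ 2 * (b' * norm w ^ 2)"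
        by (intro t order_trans[OF abs_Im_le_cmod nu(2)] nB) auto
      have 3: "\<bar>Re (- v * (2 * w * (- u * w\<^sup>2))) * A w\<bar> \<le> (2 * norm w ^ 3) * a"
        using a(2)[OF w(1)] by (intro t order_trans[OF abs_Re_le_cmod nv]) auto
      have 4: "\<bar>Im (- v * (2 * w * (- u * w\<^sup>2))) * B w\<bar> \<le> (2 * norm w ^ 3) * b"
        using b(2)[OF w(1)] by (intro t order_trans[OF abs_Im_le_cmod nv]) auto
      have 5: "norm w ^ 2 * (a' * norm w ^ 2) \<le> a' * norm w ^ 3" "norm w ^ 2 * (b' * norm w ^ 2) \<le> b' * norm w ^ 3"
        using mult_left_mono[OF w23 a'(1)] mult_left_mono[OF w23 b'(1)] by (simp_all add: mult_ac)
      have 6: "0 \<le> c * norm w ^ 3" using c(1) by simp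
      have tri: "\<bar>x + y + (x' + y')\<bar> \<le> X + Y + (X' + Y')"
        if "\<bar>x\<bar> \<le> X" "\<bar>y\<bar> \<le> Y" "\<bar>x'\<bar> \<le> X'" "\<bar>y'\<bar> \<le> Y'" for x y x' y' X Y X' Y' :: real
        using that by linarith
      have "\<bar>frechet_derivative ?k (at z) u\<bar> \<le>
          a' * norm w ^ 3 + (2 * norm w ^ 3) * a + (b' * norm w ^ 3 + (2 * norm w ^ 3) * b)"
        unfolding eq by (rule tri[OF order_trans[OF 1 5(1)] 3 order_trans[OF 2 5(2)] 4])
      also have "\<dots> \<le> ?C * norm w ^ 3" using 6 by (simp add: algebra_simps)
      finally have "\<bar>frechet_derivative ?k (at z) u\<bar> \<le> ?C * norm w ^ 3" .
      then show ?thesis by (simp add: w(2) power_divide)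
    qed
  qed (use a(1) b(1) a'(1) b'(1) c(1) in auto)
qed

lemma laplacian_part_integral:
  fixes h :: "cp1 \<Rightarrow> real"
  assumes h: "csmooth UNIV h" and u: "u = 1 \<or> u = \<i>"
  shows "integrable lborel (\<lambda>z. frechet_derivative (\<lambda>z. cdiff h (Fin z) u) (at z) u)"
    "(LINT z|lborel. frechet_derivative (\<lambda>z. cdiff h (Fin z) u) (at z) u) = 0"
proof -
  let ?X = "\<lambda>z. cdiff h (Fin z) u"
  have sm: "smooth_on UNIV ?X" by (rule cdiff_smooth[OF h])
  have d: "(?X has_derivative frechet_derivative ?X (at z)) (at z)" for z
    by (rule smooth_on_has_derivative[OF open_UNIV sm UNIV_I])
  have c: "continuous_on UNIV (\<lambda>z. frechet_derivative ?X (at z) u)"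
    by (rule smooth_on_imp_continuous_on[OF smooth_on_derivative[OF open_UNIV sm]])
  have nu: "norm u = 1" using u by auto
  obtain K where "0 \<le> K" and K: "\<And>z v. norm (cdiff h (Fin z) v) \<le> K * norm v / (1 + (norm z)\<^sup>2)"
    by (rule cdiff_bound[OF h]) (rule that)
  obtain C where C: "\<And>z. \<bar>frechet_derivative ?X (at z) u\<bar> \<le> C * decay z"
    using second_derivative_bound[OF h, of u u] nu by auto
  have b: "\<bar>?X z\<bar> \<le> K / (1 + (norm z)\<^sup>2)" for z using K[of z u] nu by simp
  show "integrable lborel (\<lambda>z. frechet_derivative ?X (at z) u)"
    "(LINT z|lborel. frechet_derivative ?X (at z) u) = 0"
    by (rule divergence_zero[OF d c u b C])+
qed

context imaginary_conformal_immersion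
begin

text \<open>Both parts of the Laplacian of \<open>hlog\<close> integrate to 0, so minus the area of
  the unit sphere remains.\<close>

lemma gauss_bonnet:
  "integrable lborel (\<lambda>z. (N (Fin z) * cdiff N (Fin z) 1) \<bullet> cdiff N (Fin z) \<i>)"
  "(LINT z|lborel. (N (Fin z) * cdiff N (Fin z) 1) \<bullet> cdiff N (Fin z) \<i>) = - 4 * pi"
proof -
  note x = laplacian_part_integral[OF hlog_smooth, of 1, simplified]
  note y = laplacian_part_integral[OF hlog_smooth, of \<i>, simplified]
  have eq: "(\<lambda>z. (N (Fin z) * cdiff N (Fin z) 1) \<bullet> cdiff N (Fin z) \<i>) =
    (\<lambda>z. (frechet_derivative (\<lambda>z. cdiff hlog (Fin z) 1) (at z) 1 +
      frechet_derivative (\<lambda>z. cdiff hlog (Fin z) \<i>) (at z) \<i>) - 4 / (1 + (norm z)\<^sup>2)\<^sup>2)"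
    using hlog_laplacian by (simp add: fun_eq_iff)
  show "integrable lborel (\<lambda>z. (N (Fin z) * cdiff N (Fin z) 1) \<bullet> cdiff N (Fin z) \<i>)"
    unfolding eq by (intro Bochner_Integration.integrable_diff Bochner_Integration.integrable_add x y sphere_integrable)
  show "(LINT z|lborel. (N (Fin z) * cdiff N (Fin z) 1) \<bullet> cdiff N (Fin z) \<i>) = - 4 * pi"
    unfolding eq using x y sphere_integrable sphere_area by simp
qed

text \<open>The energy densities are \<open>|X - Y|^2\<close> and \<open>|X + Y|^2\<close>; they
  differ by \<open>4 (X \<bullet> Y)\<close>, and the factor 1/4 in \<open>willm\<close> leaves the
  Gauss-Bonnet integral. The bound on \<open>dN\<close> provides the integrability needed to split
  the integral of the sum.\<close>

lemma willm_uminus: "willm (\<lambda>p. - N p) = willm N - 4 * pi"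
proof -
  let ?X = "\<lambda>z. N (Fin z) * cdiff N (Fin z) 1" and ?Y = "\<lambda>z. cdiff N (Fin z) \<i>"
  have m: "cdiff (\<lambda>p. - N p) p v = - cdiff N p v" for p v
    by (rule cdiff_bounded_linear[OF bounded_linear_minus[OF bounded_linear_ident] open_UNIV N_smooth UNIV_I])
  obtain C where C: "0 \<le> C" "\<And>z v. norm (cdiff N (Fin z) v) \<le> C * norm v / (1 + (norm z)\<^sup>2)"
    using cdiff_bound[OF N_smooth] by blast
  have cont: "continuous_on UNIV (\<lambda>z. (norm (?X z - ?Y z))\<^sup>2)"
    by (intro continuous_intros smooth_on_imp_continuous_on[OF N_Fin_smooth]
        smooth_on_imp_continuous_on[OF cdiff_smooth[OF N_smooth]])
  have int: "integrable lborel (\<lambda>z. (norm (?X z - ?Y z))\<^sup>2)"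
  proof (rule Bochner_Integration.integrable_bound[of _ "\<lambda>z. C\<^sup>2 * (4 / (1 + (norm z)\<^sup>2)\<^sup>2)"])
    show "integrable lborel (\<lambda>z::complex. C\<^sup>2 * (4 / (1 + (norm z)\<^sup>2)\<^sup>2))"
      by (intro integrable_mult_right sphere_integrable)
    show "(\<lambda>z. (norm (?X z - ?Y z))\<^sup>2) \<in> borel_measurable lborel"
      using borel_measurable_continuous_onI[OF cont] by simp
    show "AE z in lborel. norm ((norm (?X z - ?Y z))\<^sup>2) \<le> norm (C\<^sup>2 * (4 / (1 + (norm z)\<^sup>2)\<^sup>2))"
    proof (rule AE_I2)
      fix z
      have "norm (?X z - ?Y z) \<le> norm (cdiff N (Fin z) 1) + norm (cdiff N (Fin z) \<i>)"
        using norm_triangle_ineq4[of "?X z" "?Y z"] by (simp add: norm_mult N_norm)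
      also have "\<dots> \<le> C * (2 / (1 + (norm z)\<^sup>2))" using C(2)[of z 1] C(2)[of z \<i>] by (simp add: mult_2_right add_divide_distrib)
      finally have "(norm (?X z - ?Y z))\<^sup>2 \<le> (C * (2 / (1 + (norm z)\<^sup>2)))\<^sup>2"
        by (rule power_mono) simp
      then show "norm ((norm (?X z - ?Y z))\<^sup>2) \<le> norm (C\<^sup>2 * (4 / (1 + (norm z)\<^sup>2)\<^sup>2))"
        by (simp add: power_mult_distrib power_divide)
    qed
  qed
  have "(norm (- N (Fin z) * cdiff (\<lambda>p. - N p) (Fin z) 1 - cdiff (\<lambda>p. - N p) (Fin z) \<i>))\<^sup>2 =
      (norm (?X z - ?Y z))\<^sup>2 + 4 * (?X z \<bullet> ?Y z)" for z
    by (simp add: m power2_norm_eq_inner inner_simps inner_commute)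
  then have "willm (\<lambda>p. - N p) = 1 / 4 * (LINT z|lborel. (norm (?X z - ?Y z))\<^sup>2 + 4 * (?X z \<bullet> ?Y z))"
    by (simp add: willm_def)
  also have "\<dots> = 1 / 4 * ((LINT z|lborel. (norm (?X z - ?Y z))\<^sup>2) + 4 * (- 4 * pi))"
    using int gauss_bonnet by simp
  finally show ?thesis by (simp add: willm_def)
qed

end

section \<open>The linear system of the dual bundle\<close>

context imaginary_conformal_immersion
begin

lemma Pluecker_equality_dual:
  fixes E :: "'v qbundle" and D :: "'v dop"
  assumes "euclidean_bundle f E D \<Phi>" and P: "Pluecker_equality E D (H0 E D)"
  shows "admits_Pluecker_equality (annihilator L) (dual_bundle L JL)"
proof -
  obtain \<theta> \<psi> where th: "trivialized_hol E \<theta> N D" and \<psi>: "\<psi> \<in> H0 E D" "\<And>p. \<theta> p (\<psi> p) = 1"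
    using euclidean_trivialization[OF assms(1)] by blast
  interpret T: trivialized_hol E \<theta> N D by (rule th)
  interpret DB: trivialized_bundle "dual_bundle L JL" "rep_val kD" "\<lambda>p. - N p" by (rule trivialized_dual)
  obtain D' where "trivialized_hol (dual_bundle L JL) (rep_val kD) (\<lambda>p. - N p) D'"
    using DB.ex_trivialized_hol by blast
  then interpret T': trivialized_hol "dual_bundle L JL" "rep_val kD" "\<lambda>p. - N p" D' .
  obtain n d a ord where ls: "linear_system E D n (H0 E D)" and dg: "has_degree E d"
    and ao: "\<And>p. strict_mono_on {..n} (a p) \<and> a p ` {..n} = vanishing_orders E (H0 E D) p \<and>
        ord p = (\<Sum>k\<le>n. int (a p k) - int k)"
    and fin: "finite {p. ord p \<noteq> 0}"
    and W: "willmore E D = 4 * pi * real_of_int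
       ((int n + 1) * (int n * (1 - 0) - d) + (\<Sum>p | ord p \<noteq> 0. ord p))"
    using P unfolding Pluecker_equality_def by blast
  have hd: "has_deg N d" using dg unfolding T.has_degree_iff .
  then have d: "d = - 1" by (rule has_deg_N)
  obtain b where b: "\<And>k. k \<le> n \<Longrightarrow> nhol N (b k)" and ind: "qindep b n"
    and H0: "H0 E D = {s. (\<forall>p. s p \<in> fib E p) \<and> (\<lambda>p. \<theta> p (s p)) \<in> qspan b n}"
    by (rule T.linear_systemD[OF ls]) (rule that; simp only:)
  have "\<exists>G. \<forall>k\<in>{..n}. csmooth UNIV (G k) \<and> (\<forall>p v. cdiff (G k) p v = cdiff f p v * b k p)"
  proof (rule bchoice, rule ballI)
    fix k assume "k \<in> {..n}"
    then have "nhol N (b k)" by (intro b) simp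
    then show "\<exists>G. csmooth UNIV G \<and> (\<forall>p v. cdiff G p v = cdiff f p v * b k p)"
      by (rule primitive) (intro exI conjI allI, assumption+)
  qed
  then obtain G where "\<forall>k\<in>{..n}. csmooth UNIV (G k) \<and> (\<forall>p v. cdiff (G k) p v = cdiff f p v * b k p)" ..
  then have G: "\<And>k. k \<le> n \<Longrightarrow> csmooth UNIV (G k)"
    "\<And>k p v. k \<le> n \<Longrightarrow> cdiff (G k) p v = cdiff f p v * b k p" by simp_all
  let ?B = "prims G"
  define H where "H = {s. (\<forall>p. s p \<in> fib (dual_bundle L JL) p) \<and> (\<lambda>p. rep_val kD p (s p)) \<in> qspan ?B (Suc n)}"
  have ls': "linear_system (dual_bundle L JL) D' (Suc n) H"
    unfolding H_def
  proof (rule T'.linear_systemI)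
    show "nhol (\<lambda>p. - N p) (?B k)" if "k \<le> Suc n" for k by (rule prims_nhol[OF b G that])
    show "qindep ?B (Suc n)" by (rule qindep_prims[OF b G ind])
  qed
  have dg': "has_degree (dual_bundle L JL) 1"
    unfolding DB.has_degree_iff using has_deg_uminus[OF hd] d by simp
  have V: "a p ` {..n} = {k. \<exists>l\<in>qspan b n. order_at (N p) (shifted l p) k}" for p
  proof -
    have "a p ` {..n} = {k. \<exists>s\<in>H0 E D. (\<exists>q. \<theta> q (s q) \<noteq> 0) \<and> order_at (N p) (shifted (\<lambda>q. \<theta> q (s q)) p) k}"
      using ao[of p] T.vanishing_orders_eq[of "H0 E D" p] H0 by auto
    also have "\<dots> = {k. \<exists>l\<in>qspan b n. order_at (N p) (shifted l p) k}"
    proof (intro set_eqI iffI)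
      fix k assume "k \<in> {k. \<exists>l\<in>qspan b n. order_at (N p) (shifted l p) k}"
      then obtain l where l: "l \<in> qspan b n" "order_at (N p) (shifted l p) k" by blast
      have "(\<lambda>q. T.unt q (l q)) \<in> H0 E D" using l(1) by (simp add: H0)
      moreover have "\<exists>q. \<theta> q (T.unt q (l q)) \<noteq> 0" using order_at_nonzero[OF N_sq l(2)] by simp
      moreover have "order_at (N p) (shifted (\<lambda>q. \<theta> q (T.unt q (l q))) p) k" using l(2) by simp
      ultimately show "k \<in> {k. \<exists>s\<in>H0 E D. (\<exists>q. \<theta> q (s q) \<noteq> 0) \<and> order_at (N p) (shifted (\<lambda>q. \<theta> q (s q)) p) k}"
        by (intro CollectI bexI[of _ "\<lambda>q. T.unt q (l q)"] conjI)
    next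
      fix k assume "k \<in> {k. \<exists>s\<in>H0 E D. (\<exists>q. \<theta> q (s q) \<noteq> 0) \<and> order_at (N p) (shifted (\<lambda>q. \<theta> q (s q)) p) k}"
      then obtain s where s: "s \<in> H0 E D" "order_at (N p) (shifted (\<lambda>q. \<theta> q (s q)) p) k" by blast
      then have "(\<lambda>q. \<theta> q (s q)) \<in> qspan b n" by (simp add: H0)
      with s(2) show "k \<in> {k. \<exists>l\<in>qspan b n. order_at (N p) (shifted l p) k}"
        by (intro CollectI bexI[of _ "\<lambda>q. \<theta> q (s q)"])
    qed
    finally show ?thesis .
  qed
  have V': "vanishing_orders (dual_bundle L JL) H p = insert 0 (Suc ` a p ` {..n})" for p
  proof -
    have "vanishing_orders (dual_bundle L JL) H p = {k. \<exists>s\<in>H. (\<exists>q. rep_val kD q (s q) \<noteq> 0) \<and>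
        order_at (- N p) (shifted (\<lambda>q. rep_val kD q (s q)) p) k}"
      by (rule DB.vanishing_orders_eq) (simp add: H_def)
    also have "\<dots> = {k. \<exists>l\<in>qspan ?B (Suc n). (\<exists>q. l q \<noteq> 0) \<and> order_at (- N p) (shifted l p) k}"
    proof (intro set_eqI iffI)
      fix k assume "k \<in> {k. \<exists>l\<in>qspan ?B (Suc n). (\<exists>q. l q \<noteq> 0) \<and> order_at (- N p) (shifted l p) k}"
      then obtain l where l: "l \<in> qspan ?B (Suc n)" "\<exists>q. l q \<noteq> 0" "order_at (- N p) (shifted l p) k" by blast
      then show "k \<in> {k. \<exists>s\<in>H. (\<exists>q. rep_val kD q (s q) \<noteq> 0) \<and>
          order_at (- N p) (shifted (\<lambda>q. rep_val kD q (s q)) p) k}"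
        by (intro CollectI bexI[of _ "\<lambda>q. DB.unt q (l q)"]) (simp_all add: H_def)
    next
      fix k assume "k \<in> {k. \<exists>s\<in>H. (\<exists>q. rep_val kD q (s q) \<noteq> 0) \<and>
          order_at (- N p) (shifted (\<lambda>q. rep_val kD q (s q)) p) k}"
      then obtain s where s: "s \<in> H" "\<exists>q. rep_val kD q (s q) \<noteq> 0"
        "order_at (- N p) (shifted (\<lambda>q. rep_val kD q (s q)) p) k" by blast
      then show "k \<in> {k. \<exists>l\<in>qspan ?B (Suc n). (\<exists>q. l q \<noteq> 0) \<and> order_at (- N p) (shifted l p) k}"
        by (intro CollectI bexI[of _ "\<lambda>q. rep_val kD q (s q)"]) (simp_all add: H_def)
    qed
    also have "\<dots> = insert 0 (Suc ` a p ` {..n})"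
      using ao[of p] by (intro orders_prims[OF b G _ V]) simp_all
    finally show ?thesis .
  qed
  \<comment> \<open>The old orders are raised by one and moved up one place, so their excess over
    the index stays the same; the new entry at place 0 contributes nothing.\<close>
  define a' where "a' p k = (case k of 0 \<Rightarrow> 0 | Suc j \<Rightarrow> Suc (a p j))" for p and k :: nat
  have ao': "strict_mono_on {..Suc n} (a' p) \<and> a' p ` {..Suc n} = vanishing_orders (dual_bundle L JL) H p \<and>
      ord p = (\<Sum>k\<le>Suc n. int (a' p k) - int k)" for p
  proof (intro conjI)
    have mono: "strict_mono_on {..n} (a p)" and op: "ord p = (\<Sum>k\<le>n. int (a p k) - int k)"
      using ao[of p] by auto
    show "strict_mono_on {..Suc n} (a' p)"
    proof (rule strict_mono_onI)
      fix r s assume "r \<in> {..Suc n}" "s \<in> {..Suc n}" "r < s"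
      then show "a' p r < a' p s"
        using strict_mono_onD[OF mono] by (cases r; cases s) (auto simp: a'_def)
    qed
    have "{..Suc n} = insert 0 (Suc ` {..n})" by (rule atMost_Suc_eq_insert_0)
    then have "a' p ` {..Suc n} = insert (a' p 0) (a' p ` Suc ` {..n})" by (simp only: image_insert)
    also have "\<dots> = insert 0 (Suc ` a p ` {..n})" by (simp add: a'_def image_image)
    finally show "a' p ` {..Suc n} = vanishing_orders (dual_bundle L JL) H p" by (simp only: V')
    show "ord p = (\<Sum>k\<le>Suc n. int (a' p k) - int k)"
      by (simp only: sum.atMost_Suc_shift op) (simp add: a'_def)
  qed
  have "willmore (dual_bundle L JL) D' = willmore E D - 4 * pi"
    by (simp only: T.willmore_eq T'.willmore_eq willm_uminus)
  \<comment> \<open>Apart from the total order, the old bracket with \<open>d = - 1\<close> is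
    \<open>(n + 1) (n + 1)\<close>, and the new one with degree 1 and one more dimension is
    \<open>(n + 2) n\<close>. It is smaller by one, which accounts for the
    \<open>- 4 pi\<close>.\<close>
  also have "\<dots> = 4 * pi * real_of_int ((int (Suc n) + 1) * (int (Suc n) * (1 - 0) - 1) + (\<Sum>p | ord p \<noteq> 0. ord p))"
    unfolding W d by (simp add: algebra_simps)
  finally have W': "willmore (dual_bundle L JL) D' = 4 * pi * real_of_int
      ((int (Suc n) + 1) * (int (Suc n) * (1 - 0) - 1) + (\<Sum>p | ord p \<noteq> 0. ord p))" .
  have PE: "Pluecker_equality (dual_bundle L JL) D' H"
    unfolding Pluecker_equality_def
    by (intro exI[of _ "Suc n"] exI[of _ 1] exI[of _ a'] exI[of _ ord] conjI allI ls' dg' fin W' ao'[THEN conjunct1]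
        ao'[THEN conjunct2, THEN conjunct1] ao'[THEN conjunct2, THEN conjunct2])
  \<comment> \<open>The trivialising section has coordinate 1 and lies in the full space
    \<open>H0 E D\<close>, so 1 is a combination of the \<open>b k\<close>. This puts
    \<open>f\<close> among the primitives.\<close>
  have one: "(\<lambda>p. 1) \<in> qspan b n" using \<psi> by (simp add: H0)
  then obtain e where "(\<lambda>p. 1) = (\<lambda>p. \<Sum>k\<le>n. b k p * e k)" unfolding qspan_def by blast
  from fun_cong[OF this] have e: "(\<Sum>k\<le>n. b k p * e k) = 1" for p by simp
  have can: "s \<in> H \<and> s \<in> H0 (dual_bundle L JL) D'" if s: "s \<in> canonical_system (annihilator L)" for s
  proof -
    obtain c c' where fib: "\<And>p. s p \<in> fib (dual_bundle L JL) p"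
      and val: "\<And>p. rep_val kD p (s p) = f p * c + c'" by (rule canonical_system_values[OF s]) (rule that)
    let ?l = "\<lambda>p. f p * c + c'"
    have sm: "csmooth UNIV ?l" by (intro csmooth_add csmooth_mult csmooth_const f_smooth)
    have dl: "cdiff ?l p v = cdiff f p v * c" for p v
      using cdiff_add[OF open_UNIV csmooth_mult[OF f_smooth csmooth_const] csmooth_const UNIV_I, of c c' p v]
        cdiff_mult[OF open_UNIV f_smooth csmooth_const UNIV_I, of c p v] by simp
    have hol: "nhol (\<lambda>p. - N p) ?l" by (rule primitive_nhol[OF sm dl])
    \<comment> \<open>With the coefficients \<open>e k\<close> of 1, this element has differential
      \<open>df\<close> times \<open>c\<close>, the same as \<open>f c + c'\<close>; the two then
      differ by the constant \<open>k\<close> found below.\<close>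
    let ?c = "\<lambda>k. case k of 0 \<Rightarrow> 0 | Suc k \<Rightarrow> e k * c"
    let ?m = "\<lambda>p. \<Sum>k\<le>Suc n. ?B k p * ?c k"
    have smB: "csmooth UNIV (?B k)" if "k \<le> Suc n" for k
      using prims_nhol[OF b G that] by (simp add: nhol_def)
    have sm': "csmooth UNIV ?m" using smB by (intro csmooth_sum csmooth_mult csmooth_const) simp
    have dm: "cdiff ?m p v = cdiff f p v * c" for p v
    proof -
      have "cdiff ?m p v = cdiff f p v * (\<Sum>k\<le>n. b k p * (e k * c))"
        by (subst cdiff_prims[OF b G]) simp_all
      also have "(\<Sum>k\<le>n. b k p * (e k * c)) = (\<Sum>k\<le>n. b k p * e k) * c"
        by (simp add: sum_distrib_right mult.assoc)
      finally show ?thesis by (simp only: e mult_1)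
    qed
    have "cdiff (\<lambda>p. ?l p - ?m p) p v = 0" for p v
      using cdiff_add[OF open_UNIV sm csmooth_minus[OF sm'] UNIV_I, of p v]
        cdiff_bounded_linear[OF bounded_linear_minus[OF bounded_linear_ident] open_UNIV sm' UNIV_I, of p v]
      by (simp only: dl dm diff_conv_add_uminus) simp
    from csmooth_constant[OF csmooth_diff[OF sm sm'] this] have "?l p - ?m p = ?l Infty - ?m Infty" for p .
    moreover define k where "k = ?l Infty - ?m Infty"
    ultimately have k: "?l p - ?m p = k" for p by simp
    have "?l = (\<lambda>p. \<Sum>j\<le>Suc n. ?B j p * (?c(0 := k)) j)"
    proof
      fix p
      show "?l p = (\<Sum>j\<le>Suc n. ?B j p * (?c(0 := k)) j)"
        using k[of p] unfolding prims_sum by (simp add: algebra_simps)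
    qed
    then have "?l \<in> qspan ?B (Suc n)" unfolding qspan_def by blast
    with fib hol show ?thesis by (simp add: H_def T'.H0_iff val)
  qed
  show ?thesis
    unfolding admits_Pluecker_equality_def
    using T'.hol_line PE can by blast
qed

end

theorem corollary5p4:
  fixes f :: "cp1 \<Rightarrow> quat" and E :: "'v qbundle" and D :: "'v dop"
  assumes "Taimanov_soliton_sphere E D f"
  shows "soliton_sphere (lift_HP1 f)"
proof -
  from assms obtain \<Phi> where f: "conformal_immersion f" "\<And>p. qre (f p) = 0"
    and E: "euclidean_bundle f E D \<Phi>" and P: "Pluecker_equality E D (H0 E D)"
    unfolding Taimanov_soliton_sphere_def by blast
  interpret imaginary_conformal_immersion f
    using f by unfold_locales (auto simp: conformal_immersion_def)
  \<comment> \<open>Of the two Moebius invariant bundles it is the dual one that carries the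
    required linear system.\<close>
  show ?thesis
    unfolding soliton_sphere_def
    using conformal_HP1 conformal_structures Pluecker_equality_dual[OF E P] by blast
qed

end
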